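(* Let $N\ge1$ and $1<p<\infty$. There is a constant $C$, depending only on $p$ and $N$, such that the following holds. Let $\Lambda\in M_p(\mathbb R^N)$ be supported in $[\frac14,\frac34]^N$, let $\phi\in M_p^{(w)}(\mathbb Z^N)$, and define $$W_{\phi,\Lambda}(\xi)=\sum_{n\in\mathbb Z^N}\phi(n)\Lambda(\xi-n),\qquad \xi\in\mathbb R^N.$$ Then $W_{\phi,\Lambda}\in M_p^{(w)}(\mathbb R^N)$ and $$N_p^{(w)}(W_{\phi,\Lambda})\le C\,N_p^{(w)}(\phi)\,\|\Lambda\|_{M_p(\mathbb R^N)}.$$
   Context: Let $G$ be a locally compact abelian group with Haar measure $\mu$ and dual group $\hat G$ (here $G=\mathbb R^N$, $\hat G=\mathbb R^N$, or $G=\mathbb T^N\cong[0,1)^N$, $\hat G=\mathbb Z^N$, with Lebesgue measure; on $\mathbb R^N$ the Fourier transform is $\hat f(\xi)=\int f(x)e^{-2\pi i\xi\cdot x}dx$). $M_p(\hat G)$ is the space of (strong) $L^p$ multipliers: those $\phi\in L^\infty(\hat G)$ for which there is a bounded operator $T_\phi:L^p(G)\to L^p(G)$ with $(T_\phi f)^\wedge=\phi\hat f$ for all $f\in L^2\cap L^p(G)$; $\|\phi\|_{M_p(\hat G)}$ is the operator norm of $T_\phi$. $M_p^{(w)}(\hat G)$ is the space of multipliers of weak type $(p,p)$: those $\phi\in L^\infty(\hat G)$ for which there is a translation-invariant operator $T_\phi:L^p(G)\to L^{p,\infty}(G)$ with $(T_\phi f)^\wedge=\phi\hat f$ for all $f\in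 L^2\cap L^p(G)$ and a constant $K$ with $\mu\{x\in G:|T_\phi f(x)|>t\}\le\frac{K^p}{t^p}\|f\|_p^p$ for all $f\in L^p(G)$, $t>0$; $N_p^{(w)}(\phi)$ is the smallest such $K$. *)

theory Defs
  imports "HOL-Analysis.Analysis"
begin

text \<open>
  Elements of $L^p$ are represented by functions; equality of classes is equality almost
  everywhere, and operators on $L^p$ are functions on representatives that respect it.
\<close>

definition Lp_space :: "'a measure \<Rightarrow> real \<Rightarrow> ('a \<Rightarrow> complex) set" where
  "Lp_space M p = {f \<in> borel_measurable M. integrable M (\<lambda>x. norm (f x) powr p)}"

definition Lp_norm :: "'a measure \<Rightarrow> real \<Rightarrow> ('a \<Rightarrow> complex) \<Rightarrow> real" where
  "Lp_norm M p f = (\<integral>x. norm (f x) powr p \<partial>M) powr (1 / p)"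

definition Linf_space :: "'a measure \<Rightarrow> ('a \<Rightarrow> complex) set" where
  "Linf_space M = {f \<in> borel_measurable M. \<exists>B. AE x in M. norm (f x) \<le> B}"

definition weak_Lp_space :: "'a measure \<Rightarrow> real \<Rightarrow> ('a \<Rightarrow> complex) set" where
  "weak_Lp_space M p = {f \<in> borel_measurable M. \<exists>A::real. \<forall>t>0.
     emeasure M {x \<in> space M. norm (f x) > t} \<le> ennreal (A / t powr p)}"

definition linear_on_Lp ::
  "'a measure \<Rightarrow> real \<Rightarrow> ('a \<Rightarrow> complex) set \<Rightarrow> (('a \<Rightarrow> complex) \<Rightarrow> 'a \<Rightarrow> complex) \<Rightarrow> bool" where
  "linear_on_Lp M p Y T \<longleftrightarrow>
     (\<forall>f\<in>Lp_space M p. T f \<in> Y) \<and>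
     (\<forall>f\<in>Lp_space M p. \<forall>g\<in>Lp_space M p.
        (AE x in M. f x = g x) \<longrightarrow> (AE x in M. T f x = T g x)) \<and>
     (\<forall>f\<in>Lp_space M p. \<forall>g\<in>Lp_space M p.
        AE x in M. T (\<lambda>y. f y + g y) x = T f x + T g x) \<and>
     (\<forall>c. \<forall>f\<in>Lp_space M p. AE x in M. T (\<lambda>y. c * f y) x = c * T f x)"

definition Lp_opnorm :: "'a measure \<Rightarrow> real \<Rightarrow> (('a \<Rightarrow> complex) \<Rightarrow> 'a \<Rightarrow> complex) \<Rightarrow> real" where
  "Lp_opnorm M p T =
     Inf {K. K \<ge> 0 \<and> (\<forall>f\<in>Lp_space M p. Lp_norm M p (T f) \<le> K * Lp_norm M p f)}"

text \<open>
  A locally compact abelian group on the carrier \<open>space (haar G)\<close>, given with its Haar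
  measure, a Haar measure on the dual group, the group operation, and the pairing
  between the group and its dual.
\<close>

record ('g, 'd) lca =
  haar :: "'g measure"
  dual_haar :: "'d measure"
  gadd :: "'g \<Rightarrow> 'g \<Rightarrow> 'g"
  pairing :: "'g \<Rightarrow> 'd \<Rightarrow> complex"

definition euclidean_lca :: "(real ^ 'n, real ^ 'n) lca" where
  "euclidean_lca = \<lparr>
     haar = lborel,
     dual_haar = lborel,
     gadd = (\<lambda>x y. x + y),
     pairing = (\<lambda>x \<xi>. cis (2 * pi * (\<xi> \<bullet> x)))\<rparr>"

text \<open>The torus is $[0,1)^N$ with coordinatewise addition modulo 1.\<close>

definition torus_lca :: "(real ^ 'n, int ^ 'n) lca" where
  "torus_lca = \<lparr>
     haar = restrict_space lborel {x. \<forall>i. 0 \<le> x $ i \<and> x $ i < 1},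
     dual_haar = count_space UNIV,
     gadd = (\<lambda>x y. \<chi> i. frac (x $ i + y $ i)),
     pairing = (\<lambda>x n. cis (2 * pi * (\<Sum>i\<in>UNIV. of_int (n $ i) * x $ i)))\<rparr>"

definition fourier_L1 :: "('g, 'd) lca \<Rightarrow> ('g \<Rightarrow> complex) \<Rightarrow> 'd \<Rightarrow> complex" where
  "fourier_L1 G f \<xi> = (\<integral>x. f x * cnj (pairing G x \<xi>) \<partial>haar G)"

text \<open>
  \<open>fourier_L2 G f g\<close> says that \<open>g\<close> represents the Fourier transform of \<open>f\<close> in $L^2$, where
  the transform is the continuous extension of the integral from $L^1 \cap L^2$ to $L^2$.
  The transforms of the approximants are explicitly required to lie in $L^2$, because the
  norm of a function outside $L^2$ would be 0 by the convention for Bochner integrals.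
\<close>

definition fourier_L2 :: "('g, 'd) lca \<Rightarrow> ('g \<Rightarrow> complex) \<Rightarrow> ('d \<Rightarrow> complex) \<Rightarrow> bool" where
  "fourier_L2 G f g \<longleftrightarrow>
     f \<in> Lp_space (haar G) 2 \<and> g \<in> Lp_space (dual_haar G) 2 \<and>
     (\<exists>F :: nat \<Rightarrow> 'g \<Rightarrow> complex.
        (\<forall>k. F k \<in> Lp_space (haar G) 1 \<inter> Lp_space (haar G) 2) \<and>
        (\<forall>k. fourier_L1 G (F k) \<in> Lp_space (dual_haar G) 2) \<and>
        (\<lambda>k. Lp_norm (haar G) 2 (\<lambda>x. F k x - f x)) \<longlonglongrightarrow> 0 \<and>
        (\<lambda>k. Lp_norm (dual_haar G) 2 (\<lambda>\<xi>. fourier_L1 G (F k) \<xi> - g \<xi>)) \<longlonglongrightarrow> 0)"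

definition has_symbol ::
  "('g, 'd) lca \<Rightarrow> real \<Rightarrow> ('d \<Rightarrow> complex) \<Rightarrow> (('g \<Rightarrow> complex) \<Rightarrow> 'g \<Rightarrow> complex) \<Rightarrow> bool" where
  "has_symbol G p \<phi> T \<longleftrightarrow>
     (\<forall>f \<in> Lp_space (haar G) 2 \<inter> Lp_space (haar G) p.
        \<exists>g. fourier_L2 G f g \<and> fourier_L2 G (T f) (\<lambda>\<xi>. \<phi> \<xi> * g \<xi>))"

definition translation_invariant ::
  "('g, 'd) lca \<Rightarrow> real \<Rightarrow> (('g \<Rightarrow> complex) \<Rightarrow> 'g \<Rightarrow> complex) \<Rightarrow> bool" where
  "translation_invariant G p T \<longleftrightarrow>
     (\<forall>h \<in> space (haar G). \<forall>f \<in> Lp_space (haar G) p.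
        AE x in haar G. T (\<lambda>y. f (gadd G y h)) x = T f (gadd G x h))"

definition multiplier_op ::
  "('g, 'd) lca \<Rightarrow> real \<Rightarrow> ('d \<Rightarrow> complex) \<Rightarrow> (('g \<Rightarrow> complex) \<Rightarrow> 'g \<Rightarrow> complex) \<Rightarrow> bool" where
  "multiplier_op G p \<phi> T \<longleftrightarrow>
     linear_on_Lp (haar G) p (Lp_space (haar G) p) T \<and>
     (\<exists>K. \<forall>f\<in>Lp_space (haar G) p. Lp_norm (haar G) p (T f) \<le> K * Lp_norm (haar G) p f) \<and>
     has_symbol G p \<phi> T"

definition multipliers :: "('g, 'd) lca \<Rightarrow> real \<Rightarrow> ('d \<Rightarrow> complex) set" where
  "multipliers G p = {\<phi> \<in> Linf_space (dual_haar G). \<exists>T. multiplier_op G p \<phi> T}"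

text \<open>
  Operators with the same symbol agree almost everywhere on $L^p$, by density of
  $L^2 \cap L^p$; hence the operator norm does not depend on the chosen \<open>T\<close>.
\<close>

definition multiplier_norm :: "('g, 'd) lca \<Rightarrow> real \<Rightarrow> ('d \<Rightarrow> complex) \<Rightarrow> real" where
  "multiplier_norm G p \<phi> = Lp_opnorm (haar G) p (SOME T. multiplier_op G p \<phi> T)"

definition weak_multiplier_op ::
  "('g, 'd) lca \<Rightarrow> real \<Rightarrow> ('d \<Rightarrow> complex) \<Rightarrow> (('g \<Rightarrow> complex) \<Rightarrow> 'g \<Rightarrow> complex) \<Rightarrow> real \<Rightarrow> bool"
  where
  "weak_multiplier_op G p \<phi> T K \<longleftrightarrow>
     linear_on_Lp (haar G) p (weak_Lp_space (haar G) p) T \<and>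
     translation_invariant G p T \<and>
     has_symbol G p \<phi> T \<and>
     K \<ge> 0 \<and>
     (\<forall>f\<in>Lp_space (haar G) p. \<forall>t>0.
        emeasure (haar G) {x \<in> space (haar G). norm (T f x) > t}
          \<le> ennreal (K powr p / t powr p * Lp_norm (haar G) p f powr p))"

definition weak_multipliers :: "('g, 'd) lca \<Rightarrow> real \<Rightarrow> ('d \<Rightarrow> complex) set" where
  "weak_multipliers G p =
     {\<phi> \<in> Linf_space (dual_haar G). \<exists>T K. weak_multiplier_op G p \<phi> T K}"

definition weak_multiplier_norm :: "('g, 'd) lca \<Rightarrow> real \<Rightarrow> ('d \<Rightarrow> complex) \<Rightarrow> real" where
  "weak_multiplier_norm G p \<phi> = Inf {K. \<exists>T. weak_multiplier_op G p \<phi> T K}"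

definition W_ext :: "(int ^ 'n \<Rightarrow> complex) \<Rightarrow> (real ^ 'n \<Rightarrow> complex) \<Rightarrow> real ^ 'n \<Rightarrow> complex" where
  "W_ext \<phi> \<Lambda> \<xi> = (\<Sum>\<^sub>\<infinity>n\<in>UNIV. \<phi> n * \<Lambda> (\<xi> - (\<chi> i. of_int (n $ i))))"

end

theory Submission
  imports Defs "HOL-Probability.Probability"
begin

text \<open>
  Write $e_n(x) = e^{2\pi i n\cdot x}$, let $T_\Lambda$ and $T_\phi$ be operators with symbols
  $\Lambda$ and $\phi$, and let $f$ be a function on $\mathbb R^N$. The operator with symbol
  $W_{\phi,\Lambda}$ is formally $\sum_n \phi(n)\, e_n\, T_\Lambda(e_{-n} f)$. Fix an integrable
  kernel $\eta$ whose Fourier transform is 1 on $[1/4,3/4]^N$ and 0 off the unit cube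
  (\<open>bump_kernel\<close> and its transform \<open>bump\<close>). The spectrum of $u_n = T_\Lambda(e_{-n}f)$ lies in
  $[1/4,3/4]^N$, so $u_n$ is recovered from its values at lattice points,
  $u_n(x) = \sum_m u_n(m)\,\eta(x-m)$. Moreover $u_n = T_\Lambda v_n$ with
  $v_n = \eta * (e_{-n}f)$, whose spectrum lies in the unit cube; multiplication of spectra
  on the cube is convolution over the lattice, $u_n(m) = \sum_k \lambda(m-k)\, v_n(k)$ with
  $\lambda(m) = \int \Lambda(\xi) e^{2\pi i m\cdot\xi}\,d\xi$. Finally $v_n(k)$ is the $n$-th Fourier
  coefficient of the periodization $P_k$ of $\eta(k-\cdot) f$. Summation over $n$ gives
  \[ x \mapsto \sum_m \eta(x-m)\,(T_\phi Q_m)(x \bmod 1), \qquad Q_m = \sum_k \lambda(m-k) P_k . \]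

  This formula separates the two multipliers, and it is the definition of the operator here
  (\<open>transferred\<close>), on all of $L^p$. Each step obeys an estimate. The map from $f$ to
  $(P_k)$ goes from $L^p$ to $\ell^p(L^p)$ by Young's inequality, because $\eta$ has a
  summable majorant over the lattice (\<open>bump_analysis_energy\<close>). Convolution by $\lambda$ is a
  compression of $T_\Lambda$, hence bounded on $\ell^p$ by a constant times the norm of $\Lambda$
  (\<open>sampled_convolution\<close>), and so on $\ell^p(L^p)$ pointwise. The weak type inequality for
  $T_\phi$ can be summed over $m$, because its right-hand side is the $p$-th power of a norm
  (\<open>images_weak_type\<close>). The last sum preserves weak type because $p > 1$
  (\<open>bump_synthesis_weak_type\<close>). The constants multiply to the bound of the theorem.

  It remains to see that the operator has the symbol $W_{\phi,\Lambda}$ on $L^2 \cap L^p$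
  (\<open>transferred_fourier\<close>). This is a computation with Parseval's identity on the torus, once
  for the space variable and once for the frequency variable modulo the lattice: the image of $f$
  and the product of $W_{\phi,\Lambda}$ with the transform of $f$ are given by the same double
  family of coefficients, whose finite truncations are explicit Fourier pairs. Translation
  invariance follows from the symbol on $L^2 \cap L^p$, and from there on $L^p$ by density
  and the weak type inequality.

  The harmonic analysis is developed from integration theory. Plancherel's theorem on
  $\mathbb R^N$ comes from Gaussian means and the continuity of translations
  (\<open>plancherel_L1_L2\<close>). Parseval's identity on the torus comes from Plancherel's
  theorem and Bessel's inequality by averaging over modulations (\<open>torus_parseval\<close>).
\<close>

section \<open>Lattice, unit cube and tiling\<close>

definition lattice_vec :: "int ^ 'n \<Rightarrow> real ^ 'n" where
  "lattice_vec n = (\<chi> i. of_int (n $ i))"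

definition unit_cube :: "(real ^ 'n) set" where
  "unit_cube = {x. \<forall>i. 0 \<le> x $ i \<and> x $ i < 1}"

definition cube_measure :: "(real ^ 'n) measure" where
  "cube_measure = restrict_space lborel unit_cube"

text \<open>
  Sums over the lattice are written as integrals for counting measure, so that the
  measurability, Fubini and convergence theorems of integration apply to them unchanged.
  A Bochner integral over the lattice is 0 when the sum is not absolutely convergent.
\<close>
abbreviation lattice :: "(int ^ 'n) measure" where
  "lattice \<equiv> count_space UNIV"

definition frac_vec :: "real ^ 'n \<Rightarrow> real ^ 'n" where
  "frac_vec x = (\<chi> i. frac (x $ i))"

definition floor_vec :: "real ^ 'n \<Rightarrow> int ^ 'n" where
  "floor_vec x = (\<chi> i. \<lfloor>x $ i\<rfloor>)"

lemma lattice_vec_simps [simp]: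
  "lattice_vec 0 = 0" "lattice_vec (a + b) = lattice_vec a + lattice_vec b"
  "lattice_vec (a - b) = lattice_vec a - lattice_vec b" "lattice_vec (- a) = - lattice_vec a"
  by (simp_all add: lattice_vec_def vec_eq_iff)

lemma lattice_vec_nth [simp]: "lattice_vec n $ i = of_int (n $ i)"
  by (simp add: lattice_vec_def)

lemma frac_plus_floor_vec: "frac_vec x + lattice_vec (floor_vec x) = x"
  by (simp add: frac_vec_def floor_vec_def vec_eq_iff frac_def)

lemma frac_vec_in_cube [simp]: "frac_vec x \<in> unit_cube"
  by (simp add: frac_vec_def unit_cube_def frac_lt_1)

lemma frac_vec_add_lattice [simp]: "y \<in> unit_cube \<Longrightarrow> frac_vec (y + lattice_vec k) = y"
  by (simp add: frac_vec_def unit_cube_def vec_eq_iff frac_eq)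

lemma floor_vec_add_lattice [simp]: "y \<in> unit_cube \<Longrightarrow> floor_vec (y + lattice_vec k) = k"
  by (auto simp: floor_vec_def unit_cube_def vec_eq_iff floor_eq_iff)

lemma unit_cube_sets [measurable, simp]: "unit_cube \<in> sets borel"
proof -
  have "unit_cube = (\<Inter>i. {x :: real^'n. 0 \<le> x $ i} \<inter> {x. x $ i < 1})"
    by (auto simp: unit_cube_def)
  also have "\<dots> \<in> sets borel"
    by (intro sets.countable_INT'' sets.Int borel_closed borel_open)
       (auto intro!: closed_Collect_le open_Collect_less continuous_intros)
  finally show ?thesis .
qed

lemma space_cube_measure [simp]: "space cube_measure = unit_cube"
  by (simp add: cube_measure_def space_restrict_space)

lemma sets_cube_measure: "sets cube_measure = sets (restrict_space borel unit_cube)"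
  by (simp add: cube_measure_def sets_restrict_space)

lemma measurable_cube_measureI [intro]:
  "f \<in> borel_measurable borel \<Longrightarrow> f \<in> borel_measurable cube_measure"
  by (simp add: cube_measure_def measurable_restrict_space1)

lemma borel_measurable_vec_lambda:
  assumes "\<And>i. f i \<in> borel_measurable M"
  shows "(\<lambda>x. (\<chi> i. f i x) :: real^'n) \<in> borel_measurable M"
  unfolding borel_measurable_euclidean_space[of "\<lambda>x. (\<chi> i. f i x) :: real^'n"]
  using assms by (auto simp: Basis_vec_def inner_axis)

lemma frac_vec_measurable [measurable]: "frac_vec \<in> borel_measurable borel"
  unfolding frac_vec_def frac_def by (intro borel_measurable_vec_lambda) measurable

lemma frac_vec_measurable_cube [measurable]: "frac_vec \<in> measurable borel cube_measure"
proof -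
  have "frac_vec \<in> measurable borel (restrict_space borel unit_cube)"
    by (intro measurable_restrict_space2) auto
  then show ?thesis
    using measurable_cong_sets[OF refl sets_cube_measure] by blast
qed

lemma floor_vec_measurable [measurable]: "floor_vec \<in> measurable borel lattice"
proof (subst measurable_count_space_eq2_countable, intro conjI ballI)
  show "floor_vec \<in> space borel \<rightarrow> UNIV" by simp
  fix k :: "int^'n" 
  have "floor_vec -` {k} \<inter> space borel = (\<Inter>i. {x::real^'n. \<lfloor>x $ i\<rfloor> = k $ i})"
    by (auto simp: floor_vec_def vec_eq_iff)
  also have "\<dots> \<in> sets borel"
    by (intro sets.countable_INT'') measurable
  finally show "floor_vec -` {k} \<inter> space borel \<in> sets borel" .
qed

lemma lborel_vec_translate: "distr lborel borel (\<lambda>x. x + h) = (lborel :: (real^'n) measure)"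
  using lborel_affine[of 1 "h::real^'n"] by (simp add: density_1 add.commute)

lemma lborel_vec_reflect: "distr lborel borel (\<lambda>x. h - x) = (lborel :: (real^'n) measure)"
  using lborel_affine[of "-1" "h::real^'n"] by (simp add: density_1)

lemma nn_integral_vec_translate:
  fixes f :: "real^'n \<Rightarrow> ennreal"
  assumes [measurable]: "f \<in> borel_measurable borel"
  shows "(\<integral>\<^sup>+x. f (x + h) \<partial>lborel) = (\<integral>\<^sup>+x. f x \<partial>lborel)"
  by (subst (2) lborel_vec_translate[of h, symmetric]) (simp add: nn_integral_distr)

lemma nn_integral_vec_reflect:
  fixes f :: "real^'n \<Rightarrow> ennreal"
  assumes [measurable]: "f \<in> borel_measurable borel"
  shows "(\<integral>\<^sup>+x. f (h - x) \<partial>lborel) = (\<integral>\<^sup>+x. f x \<partial>lborel)"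
  by (subst (2) lborel_vec_reflect[of h, symmetric]) (simp add: nn_integral_distr)

lemma integral_vec_translate:
  fixes f :: "real^'n \<Rightarrow> complex"
  assumes [measurable]: "f \<in> borel_measurable borel"
  shows "(\<integral>x. f (x + h) \<partial>lborel) = (\<integral>x. f x \<partial>lborel)"
  by (subst (2) lborel_vec_translate[of h, symmetric]) (simp add: integral_distr)

lemma integral_vec_reflect:
  fixes f :: "real^'n \<Rightarrow> complex"
  assumes [measurable]: "f \<in> borel_measurable borel"
  shows "(\<integral>x. f (h - x) \<partial>lborel) = (\<integral>x. f x \<partial>lborel)"
  by (subst (2) lborel_vec_reflect[of h, symmetric]) (simp add: integral_distr)

lemma integrable_vec_translate:
  fixes f :: "real^'n \<Rightarrow> complex"
  assumes "integrable lborel f"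
  shows "integrable lborel (\<lambda>x. f (x + h))"
proof -
  have [measurable]: "f \<in> borel_measurable borel" using assms by auto
  have "integrable (distr lborel borel (\<lambda>x. x + h)) f"
    using assms by (simp add: lborel_vec_translate)
  then show ?thesis by (subst (asm) integrable_distr_eq) auto
qed

lemma AE_vec_translate:
  assumes "AE x in (lborel :: (real^'n) measure). P x"
  shows "AE x in lborel. P (x + h)"
proof -
  obtain N where N: "{x. \<not> P x} \<subseteq> N" "N \<in> sets lborel" "emeasure lborel N = 0"
    using assms by (auto elim!: AE_E)
  have "AE x in distr lborel borel (\<lambda>x. x + h). x \<notin> N"
    using N by (subst lborel_vec_translate) (auto intro!: AE_not_in simp: null_sets_def)
  then have "AE x in lborel. x + h \<notin> N"
    by (subst (asm) AE_distr_iff) (use N in auto)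
  then show ?thesis by eventually_elim (use N in auto)
qed

interpretation lattice_sigma: sigma_finite_measure "lattice :: (int^'n) measure"
  by (rule sigma_finite_measure_count_space)

lemma cube_measure_prob: "prob_space (cube_measure :: (real^'n) measure)"
proof
  have box: "emeasure lborel (unit_cube :: (real^'n) set) = 1"
  proof -
    let ?o = "(\<chi> i. 1) :: real^'n"
    have a: "box 0 ?o \<subseteq> unit_cube" and b: "unit_cube \<subseteq> cbox 0 ?o"
      by (auto simp: unit_cube_def mem_box_cart less_imp_le)
    have "emeasure lborel (box 0 ?o) = 1" "emeasure lborel (cbox 0 ?o) = 1"
      by (auto simp: emeasure_lborel_box_eq emeasure_lborel_cbox_eq Basis_vec_def inner_axis
          intro!: prod.neutral)
    with emeasure_mono[OF a, of lborel] emeasure_mono[OF b, of lborel] show ?thesis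
      by (simp add: antisym)
  qed
  show "emeasure (cube_measure :: (real^'n) measure) (space cube_measure) = 1"
    by (simp add: cube_measure_def emeasure_restrict_space box)
qed

interpretation cube_prob: prob_space "cube_measure :: (real^'n) measure"
  by (rule cube_measure_prob)

interpretation lattice_cube: pair_sigma_finite "lattice :: (int^'n) measure" "cube_measure :: (real^'m) measure"
  by unfold_locales

interpretation cube_lattice: pair_sigma_finite "cube_measure :: (real^'m) measure" "lattice :: (int^'n) measure"
  by unfold_locales

interpretation lattice_lattice: pair_sigma_finite "lattice :: (int^'m) measure" "lattice :: (int^'n) measure"
  by unfold_locales

lemma measurable_lattice_pair1:
  assumes "\<And>k. (\<lambda>y. f (k, y)) \<in> measurable M N"
  shows "f \<in> measurable ((lattice :: (int^'n) measure) \<Otimes>\<^sub>M M) N"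
  by (rule measurable_pair_measure_countable1) (use assms in auto)

lemma measurable_lattice_pair2:
  assumes "\<And>k. (\<lambda>y. f (y, k)) \<in> measurable M N"
  shows "f \<in> measurable (M \<Otimes>\<^sub>M (lattice :: (int^'n) measure)) N"
proof -
  have "(\<lambda>z. f (snd z, fst z)) \<in> measurable ((lattice :: (int^'n) measure) \<Otimes>\<^sub>M M) N"
    by (rule measurable_lattice_pair1) (use assms in simp)
  from measurable_compose[OF measurable_pair_swap' this] show ?thesis
    by (simp add: split_def)
qed

text \<open>
  Every point of space is uniquely \<open>y + lattice_vec k\<close> with \<open>y\<close> in the unit cube, and
  Lebesgue measure is invariant under translation by lattice vectors.
\<close>
lemma nn_integral_tiling:
  fixes f :: "real^'n \<Rightarrow> ennreal"
  assumes [measurable]: "f \<in> borel_measurable borel"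
  shows "(\<integral>\<^sup>+x. f x \<partial>lborel) = (\<integral>\<^sup>+y. (\<integral>\<^sup>+k. f (y + lattice_vec k) \<partial>lattice) \<partial>cube_measure)"
proof -
  let ?c = "\<lambda>k x. indicator {x. floor_vec x = k} x :: ennreal"
  have m: "{x. floor_vec x = (k :: int^'n)} \<in> sets borel" for k
  proof -
    have "floor_vec -` {k} \<inter> space borel \<in> sets borel"
      by (rule measurable_sets[OF floor_vec_measurable]) auto
    then show ?thesis by (simp add: vimage_def)
  qed
  have one: "(\<integral>\<^sup>+k. ?c k x * f x \<partial>lattice) = f x" for x
  proof -
    have "(\<integral>\<^sup>+k. ?c k x * f x \<partial>lattice) = (\<integral>\<^sup>+k. f x * indicator {floor_vec x} k \<partial>lattice)"
      by (intro nn_integral_cong) (auto split: split_indicator)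
    also have "\<dots> = f x" by (simp add: nn_integral_cmult_indicator)
    finally show ?thesis .
  qed
  have "(\<integral>\<^sup>+x. f x \<partial>lborel) = (\<integral>\<^sup>+x. (\<integral>\<^sup>+k. ?c k x * f x \<partial>lattice) \<partial>lborel)"
    by (simp add: one)
  also have "\<dots> = (\<integral>\<^sup>+k. (\<integral>\<^sup>+x. ?c k x * f x \<partial>lborel) \<partial>lattice)"
  proof -
    interpret P: pair_sigma_finite "lborel :: (real^'n) measure" "lattice :: (int^'n) measure" ..
    show ?thesis
      by (rule P.Fubini'[symmetric], rule measurable_lattice_pair2) (use m in simp)
  qed
  also have "\<dots> = (\<integral>\<^sup>+k. (\<integral>\<^sup>+x. f (x + lattice_vec k) \<partial>cube_measure) \<partial>lattice)"
  proof (rule nn_integral_cong)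
    fix k :: "int^'n"
    have "(\<integral>\<^sup>+x. ?c k x * f x \<partial>lborel) = (\<integral>\<^sup>+x. ?c k (x + lattice_vec k) * f (x + lattice_vec k) \<partial>lborel)"
      using m by (subst nn_integral_vec_translate) auto
    also have "\<dots> = (\<integral>\<^sup>+x. f (x + lattice_vec k) * indicator unit_cube x \<partial>lborel)"
    proof (intro nn_integral_cong)
      fix x :: "real^'n"
      have "floor_vec (x + lattice_vec k) = k \<longleftrightarrow> x \<in> unit_cube"
        by (auto simp: floor_vec_def unit_cube_def vec_eq_iff floor_eq_iff) 
      then show "?c k (x + lattice_vec k) * f (x + lattice_vec k) = f (x + lattice_vec k) * indicator unit_cube x"
        by (auto split: split_indicator)
    qed
    also have "\<dots> = (\<integral>\<^sup>+x. f (x + lattice_vec k) \<partial>cube_measure)"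
      by (simp add: cube_measure_def nn_integral_restrict_space)
    finally show "(\<integral>\<^sup>+x. ?c k x * f x \<partial>lborel) = (\<integral>\<^sup>+x. f (x + lattice_vec k) \<partial>cube_measure)" .
  qed
  also have "\<dots> = (\<integral>\<^sup>+y. (\<integral>\<^sup>+k. f (y + lattice_vec k) \<partial>lattice) \<partial>cube_measure)"
    by (rule lattice_cube.Fubini'[symmetric], rule measurable_lattice_pair1) auto
  finally show ?thesis .
qed

lemma tile_measurable:
  "(\<lambda>(y, k). y + lattice_vec k) \<in> measurable (cube_measure \<Otimes>\<^sub>M (lattice :: (int^'n) measure)) borel"
  by (rule measurable_lattice_pair2) auto

lemma lborel_tiling:
  "(lborel :: (real^'n) measure) = distr (cube_measure \<Otimes>\<^sub>M lattice) borel (\<lambda>(y, k). y + lattice_vec k)"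
  (is "_ = ?R")
proof (rule measure_eqI)
  show "sets lborel = sets ?R" by simp
  fix A :: "(real^'n) set" assume A: "A \<in> sets lborel"
  note tile_measurable [measurable]
  have [measurable]: "A \<in> sets borel" using A by simp
  have "emeasure lborel A = (\<integral>\<^sup>+x. indicator A x \<partial>lborel)"
    using A by simp
  also have "\<dots> = (\<integral>\<^sup>+y. (\<integral>\<^sup>+k. indicator A (y + lattice_vec k) \<partial>lattice) \<partial>cube_measure)"
    by (rule nn_integral_tiling) simp
  also have "\<dots> = (\<integral>\<^sup>+z. indicator A (case z of (y, k) \<Rightarrow> y + lattice_vec k) \<partial>(cube_measure \<Otimes>\<^sub>M lattice))"
    using lattice_sigma.nn_integral_fst[of _ cube_measure, where f= "\<lambda>z. indicator A (case z of (y, k) \<Rightarrow> y + lattice_vec k)"]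
    by simp
  also have "\<dots> = emeasure ?R A"
    by (subst nn_integral_distr[symmetric, where M'="borel"]) auto
  finally show "emeasure lborel A = emeasure ?R A" .
qed

lemma AE_lborel_tiling:
  assumes "AE x in (lborel :: (real^'n) measure). P x"
  shows "AE y in cube_measure. \<forall>k. P (y + lattice_vec k)"
proof -
  obtain N where N: "{x. \<not> P x} \<subseteq> N" "N \<in> sets lborel" "emeasure lborel N = 0"
    using assms by (auto elim!: AE_E)
  have [measurable]: "N \<in> sets borel" using N by simp
  have *: "(\<integral>\<^sup>+y. (\<integral>\<^sup>+k. indicator N (y + lattice_vec k) \<partial>lattice) \<partial>cube_measure) = 0"
    using N nn_integral_tiling[of "indicator N"] by simp
  have "AE y in cube_measure. (\<integral>\<^sup>+k. indicator N (y + lattice_vec k) \<partial>(lattice::(int^'n) measure)) = (0::ennreal)"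
  proof (subst nn_integral_0_iff_AE[symmetric])
    show "(\<lambda>y. \<integral>\<^sup>+k. indicator N (y + lattice_vec k) \<partial>(lattice::(int^'n) measure)) \<in> borel_measurable cube_measure"
      by (rule lattice_sigma.borel_measurable_nn_integral, simp add: split_def, rule measurable_lattice_pair2) auto
  qed (rule *)
  then show ?thesis
  proof eventually_elim
    case (elim y)
    then have "indicator N (y + lattice_vec k) = (0::ennreal)" for k
      by (subst (asm) nn_integral_0_iff_AE) (auto simp: AE_count_space)
    then show ?case using N by (auto simp: indicator_eq_0_iff)
  qed
qed

lemma AE_cube_frac_vec:
  assumes "AE y in (cube_measure :: (real^'n) measure). P y"
  shows "AE x in lborel. P (frac_vec x)"
proof -
  obtain N where N: "{x\<in>space cube_measure. \<not> P x} \<subseteq> N" "N \<in> sets (cube_measure :: (real^'n) measure)"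
    "emeasure cube_measure N = 0"
    using assms by (auto elim!: AE_E)
  have Nc: "N \<subseteq> unit_cube" using sets.sets_into_space[OF N(2)] by simp
  have M: "frac_vec -` N \<inter> space borel \<in> sets borel"
    by (rule measurable_sets[OF frac_vec_measurable_cube N(2)])
  have "emeasure lborel (frac_vec -` N) = (\<integral>\<^sup>+y. (\<integral>\<^sup>+k. indicator (frac_vec -` N) (y + lattice_vec k) \<partial>(lattice::(int^'n) measure)) \<partial>cube_measure)"
    using M by (subst nn_integral_tiling[symmetric]) auto
  also have "\<dots> = (\<integral>\<^sup>+y. 0 \<partial>(cube_measure :: (real^'n) measure))"
  proof (intro nn_integral_cong_AE)
    have "AE y in cube_measure. y \<notin> N"
      using N by (intro AE_not_in) (auto simp: null_sets_def)
    moreover have "AE y :: real^'n in cube_measure. y \<in> unit_cube"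
      using AE_space[of "cube_measure :: (real^'n) measure"] by simp
    ultimately show "AE y in cube_measure.
        (\<integral>\<^sup>+k. indicator (frac_vec -` N) (y + lattice_vec k) \<partial>(lattice::(int^'n) measure)) = (0::ennreal)"
      by eventually_elim (simp add: indicator_def)
  qed
  finally have "frac_vec -` N \<in> null_sets lborel"
    using M by (auto simp: null_sets_def)
  then have "AE x in lborel. frac_vec x \<notin> N"
    by (auto dest: AE_not_in)
  moreover have "P (frac_vec x)" if "frac_vec x \<notin> N" for x
    using N(1) frac_vec_in_cube[of x] that by (auto simp del: frac_vec_in_cube)
  ultimately show ?thesis by auto
qed

text \<open>
  Characters, boxes and Gaussians are products of functions of one coordinate; this reduces
  their integrals to one variable.
\<close>
lemma integral_lborel_prod:
  fixes g :: "'n::finite \<Rightarrow> real \<Rightarrow> complex"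
  assumes int: "\<And>i. integrable lborel (g i)"
  shows "integrable lborel (\<lambda>x::real^'n. \<Prod>i\<in>UNIV. g i (x $ i))"
    and "(\<integral>x. (\<Prod>i\<in>UNIV. g i (x $ i)) \<partial>(lborel :: (real^'n) measure)) = (\<Prod>i\<in>UNIV. \<integral>t. g i t \<partial>lborel)"
proof -
  interpret P: product_sigma_finite "\<lambda>_::real^'n. lborel :: real measure" ..
  define idx where "idx = (\<lambda>b::real^'n. SOME i. b = axis i 1)"
  have idx: "idx (axis i 1) = i" for i
    unfolding idx_def by (rule some_equality) (auto simp: axis_eq_axis)
  have bij: "bij_betw (\<lambda>i::'n. axis i (1::real)) UNIV Basis"
    by (auto simp: bij_betw_def inj_on_def axis_eq_axis Basis_vec_def)
  have T: "(\<Prod>i\<in>UNIV. g i ((\<Sum>b\<in>Basis. f b *\<^sub>R b) $ i)) = (\<Prod>b\<in>Basis. g (idx b) (f b))" for f :: "real^'n \<Rightarrow> real"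
  proof -
    have "(\<Sum>b\<in>Basis. f b *\<^sub>R b) $ i = f (axis i 1)" for i :: 'n
    proof -
      have "(\<Sum>b\<in>Basis. f b *\<^sub>R b) $ i = (\<Sum>b\<in>Basis. f b *\<^sub>R b) \<bullet> axis i 1"
        by (simp add: inner_axis)
      also have "\<dots> = f (axis i 1)"
        by (subst inner_sum_left_Basis) (auto simp: Basis_vec_def)
      finally show ?thesis .
    qed
    then show ?thesis
      by (subst prod.reindex_bij_betw[OF bij, symmetric]) (simp add: idx)
  qed
  have [measurable]: "g i \<in> borel_measurable borel" for i using int[of i] by auto
  have mg: "(\<lambda>x::real^'n. \<Prod>i\<in>UNIV. g i (x $ i)) \<in> borel_measurable borel" by measurable
  have ms: "(\<lambda>f. \<Sum>b\<in>(Basis::(real^'n) set). f b *\<^sub>R b) \<in> measurable (\<Pi>\<^sub>M b\<in>(Basis::(real^'n) set). lborel) borel"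
    by measurable
  have "integrable (\<Pi>\<^sub>M b\<in>(Basis::(real^'n) set). lborel) (\<lambda>f. \<Prod>b\<in>Basis. g (idx b) (f b))"
    by (rule P.product_integrable_prod) (auto intro: int)
  then show "integrable lborel (\<lambda>x::real^'n. \<Prod>i\<in>UNIV. g i (x $ i))"
    by (subst lborel_eq, subst integrable_distr_eq[OF ms mg]) (unfold T)
  have "(\<integral>x. (\<Prod>i\<in>UNIV. g i (x $ i)) \<partial>(lborel :: (real^'n) measure)) = (\<integral>f. (\<Prod>b\<in>Basis. g (idx b) (f b)) \<partial>(\<Pi>\<^sub>M b\<in>(Basis::(real^'n) set). lborel))"
    by (subst lborel_eq, subst integral_distr[OF ms mg]) (unfold T, rule refl)
  also have "\<dots> = (\<Prod>b\<in>(Basis::(real^'n) set). \<integral>t. g (idx b) t \<partial>lborel)"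
    by (rule P.product_integral_prod) (auto intro: int)
  also have "\<dots> = (\<Prod>i\<in>UNIV. \<integral>t. g i t \<partial>lborel)"
    by (subst prod.reindex_bij_betw[OF bij, symmetric]) (simp add: idx)
  finally show "(\<integral>x. (\<Prod>i\<in>UNIV. g i (x $ i)) \<partial>(lborel :: (real^'n) measure)) = (\<Prod>i\<in>UNIV. \<integral>t. g i t \<partial>lborel)" .
qed

section \<open>Energies of $L^p$ functions\<close>

text \<open>
  The $p$-th power of the $L^p$ norm with values in the extended nonnegative reals.
  Being an integral, it is additive over tiles and obeys Fubini, and it makes sense for
  functions outside $L^p$.
\<close>
definition Lp_energy :: "'a measure \<Rightarrow> real \<Rightarrow> ('a \<Rightarrow> complex) \<Rightarrow> ennreal" where
  "Lp_energy M p f = (\<integral>\<^sup>+x. ennreal (norm (f x) powr p) \<partial>M)"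

lemma Lp_space_iff:
  "f \<in> Lp_space M p \<longleftrightarrow> f \<in> borel_measurable M \<and> Lp_energy M p f < \<infinity>"
  unfolding Lp_space_def Lp_energy_def
  by (auto simp: integrable_iff_bounded)

lemma Lp_space_measurable [measurable_dest]: "f \<in> Lp_space M p \<Longrightarrow> f \<in> borel_measurable M"
  by (simp add: Lp_space_def)

lemma Lp_norm_nonneg [simp]: "0 \<le> Lp_norm M p f"
  by (simp add: Lp_norm_def)

lemma Lp_energy_eq_norm:
  assumes "f \<in> Lp_space M p" "0 < p"
  shows "Lp_energy M p f = ennreal (Lp_norm M p f powr p)"
proof -
  have "0 \<le> (\<integral>x. norm (f x) powr p \<partial>M)" by simp
  then have "Lp_norm M p f powr p = (\<integral>x. norm (f x) powr p \<partial>M)"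
    using assms(2) by (simp add: Lp_norm_def powr_powr)
  then show ?thesis
    using assms unfolding Lp_energy_def Lp_space_def by (simp add: nn_integral_eq_integral)
qed

lemma Lp_energy_cong_AE:
  "AE x in M. f x = g x \<Longrightarrow> Lp_energy M p f = Lp_energy M p g"
  unfolding Lp_energy_def by (rule nn_integral_cong_AE) auto

lemma Lp_norm_cong_AE:
  assumes "AE x in M. f x = g x" "f \<in> borel_measurable M" "g \<in> borel_measurable M"
  shows "Lp_norm M p f = Lp_norm M p g"
proof -
  have "(\<integral>x. norm (f x) powr p \<partial>M) = (\<integral>x. norm (g x) powr p \<partial>M)"
    by (rule integral_cong_AE) (use assms in auto)
  then show ?thesis by (simp add: Lp_norm_def)
qed

lemma powr_add_le:
  fixes a b :: real
  assumes "0 \<le> a" "0 \<le> b" "0 \<le> p"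
  shows "(a + b) powr p \<le> 2 powr p * (a powr p + b powr p)"
proof -
  have "(a + b) powr p \<le> (2 * max a b) powr p"
    using assms by (intro powr_mono2) auto
  also have "\<dots> = 2 powr p * (max a b) powr p"
    using assms by (simp add: powr_mult)
  also have "\<dots> \<le> 2 powr p * (a powr p + b powr p)"
    by (intro mult_left_mono) (auto simp: max_def)
  finally show ?thesis .
qed

lemma Lp_energy_add:
  assumes [measurable]: "f \<in> borel_measurable M" "g \<in> borel_measurable M" and p: "0 \<le> p"
  shows "Lp_energy M p (\<lambda>x. f x + g x) \<le> ennreal (2 powr p) * (Lp_energy M p f + Lp_energy M p g)"
proof -
  have "norm (f x + g x) powr p \<le> 2 powr p * (norm (f x) powr p + norm (g x) powr p)" for x
    by (rule order_trans[OF powr_mono2[OF p _ norm_triangle_ineq] powr_add_le]) (use p in auto)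
  then have "Lp_energy M p (\<lambda>x. f x + g x)
      \<le> (\<integral>\<^sup>+x. ennreal (2 powr p) * (ennreal (norm (f x) powr p) + ennreal (norm (g x) powr p)) \<partial>M)"
    unfolding Lp_energy_def
    by (intro nn_integral_mono) (auto simp: ennreal_mult[symmetric] ennreal_plus[symmetric] simp del: ennreal_plus intro!: ennreal_leI)
  also have "\<dots> = ennreal (2 powr p) * (Lp_energy M p f + Lp_energy M p g)"
    unfolding Lp_energy_def by (simp add: nn_integral_cmult nn_integral_add)
  finally show ?thesis .
qed

lemma Lp_energy_cmult:
  assumes [measurable]: "f \<in> borel_measurable M"
  shows "Lp_energy M p (\<lambda>x. c * f x) = ennreal (norm c powr p) * Lp_energy M p f"
  unfolding Lp_energy_def
  by (simp add: norm_mult powr_mult ennreal_mult nn_integral_cmult)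

lemma Lp_energy_diff_commute: "Lp_energy M p (\<lambda>x. f x - g x) = Lp_energy M p (\<lambda>x. g x - f x)"
  unfolding Lp_energy_def by (simp add: norm_minus_commute)

lemma Lp_energy_mono:
  "(\<And>x. x \<in> space M \<Longrightarrow> norm (f x) \<le> norm (g x)) \<Longrightarrow> 0 \<le> p \<Longrightarrow> Lp_energy M p f \<le> Lp_energy M p g"
  unfolding Lp_energy_def by (intro nn_integral_mono ennreal_leI powr_mono2) auto

lemma Lp_space_add:
  assumes "f \<in> Lp_space M p" "g \<in> Lp_space M p" "0 \<le> p"
  shows "(\<lambda>x. f x + g x) \<in> Lp_space M p"
proof -
  have "Lp_energy M p (\<lambda>x. f x + g x) \<le> ennreal (2 powr p) * (Lp_energy M p f + Lp_energy M p g)"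
    using assms by (intro Lp_energy_add) (auto simp: Lp_space_iff)
  also have "\<dots> < \<infinity>" using assms by (auto simp: Lp_space_iff ennreal_mult_less_top)
  finally show ?thesis using assms by (auto simp: Lp_space_iff)
qed

lemma Lp_space_cmult:
  assumes "f \<in> Lp_space M p" shows "(\<lambda>x. c * f x) \<in> Lp_space M p"
  using assms by (auto simp: Lp_space_iff Lp_energy_cmult ennreal_mult_less_top)

lemma Lp_space_diff:
  assumes "f \<in> Lp_space M p" "g \<in> Lp_space M p" "0 \<le> p"
  shows "(\<lambda>x. f x - g x) \<in> Lp_space M p"
  using Lp_space_add[OF assms(1) Lp_space_cmult[OF assms(2), of "-1"] assms(3)] by simp

lemma Lp_space_zero [simp]: "(\<lambda>x. 0) \<in> Lp_space M p"
  by (simp add: Lp_space_iff Lp_energy_def)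

lemma Lp_space_sum:
  assumes "\<And>i. i \<in> S \<Longrightarrow> f i \<in> Lp_space M p" "0 \<le> p"
  shows "(\<lambda>x. \<Sum>i\<in>S. f i x) \<in> Lp_space M p"
  using assms(1)
proof (induction S rule: infinite_finite_induct)
  case (insert i S)
  then have "(\<lambda>x. f i x + (\<Sum>i\<in>S. f i x)) \<in> Lp_space M p"
    by (intro Lp_space_add assms(2)) auto
  then show ?case using insert by simp
qed auto

lemma Lp_space_cong_AE:
  assumes "f \<in> Lp_space M p" "AE x in M. f x = g x" "g \<in> borel_measurable M"
  shows "g \<in> Lp_space M p"
  using assms Lp_energy_cong_AE[OF assms(2), of p] by (auto simp: Lp_space_iff)

lemma Lp_energy_eq_0_iff:
  assumes [measurable]: "f \<in> borel_measurable M"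
  shows "Lp_energy M p f = 0 \<longleftrightarrow> (AE x in M. f x = 0)"
  unfolding Lp_energy_def by (subst nn_integral_0_iff_AE) auto

lemma Lp_norm_tendsto_0_iff:
  assumes "\<And>k. f k \<in> Lp_space M p" "0 < p"
  shows "(\<lambda>k. Lp_norm M p (f k)) \<longlonglongrightarrow> 0 \<longleftrightarrow> (\<lambda>k. Lp_energy M p (f k)) \<longlonglongrightarrow> 0"
proof -
  have *: "Lp_energy M p (f k) = ennreal (Lp_norm M p (f k) powr p)" for k
    by (rule Lp_energy_eq_norm) (use assms in auto)
  have "(\<lambda>k. Lp_norm M p (f k)) \<longlonglongrightarrow> 0 \<longleftrightarrow> (\<lambda>k. Lp_norm M p (f k) powr p) \<longlonglongrightarrow> 0"
  proof
    assume "(\<lambda>k. Lp_norm M p (f k)) \<longlonglongrightarrow> 0"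
    then show "(\<lambda>k. Lp_norm M p (f k) powr p) \<longlonglongrightarrow> 0"
      using tendsto_powr2[of "\<lambda>k. Lp_norm M p (f k)" 0 sequentially "\<lambda>_. p" p] assms(2) by auto
  next
    assume "(\<lambda>k. Lp_norm M p (f k) powr p) \<longlonglongrightarrow> 0"
    then have "(\<lambda>k. (Lp_norm M p (f k) powr p) powr (1/p)) \<longlonglongrightarrow> 0"
      using tendsto_powr2[of "\<lambda>k. Lp_norm M p (f k) powr p" 0 sequentially "\<lambda>_. 1/p" "1/p"] assms(2) by auto
    then show "(\<lambda>k. Lp_norm M p (f k)) \<longlonglongrightarrow> 0"
      using assms(2) by (simp add: powr_powr)
  qed
  also have "\<dots> \<longleftrightarrow> (\<lambda>k. ennreal (Lp_norm M p (f k) powr p)) \<longlonglongrightarrow> ennreal 0"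
    by (subst tendsto_ennreal_iff) auto
  finally show ?thesis by (simp add: *)
qed

lemma Lp_energy_tendsto_0_add:
  assumes "(\<lambda>k. Lp_energy M p (f k)) \<longlonglongrightarrow> 0" "(\<lambda>k. Lp_energy M p (g k)) \<longlonglongrightarrow> 0" "0 \<le> p"
    "\<And>k. f k \<in> borel_measurable M" "\<And>k. g k \<in> borel_measurable M"
  shows "(\<lambda>k. Lp_energy M p (\<lambda>x. f k x + g k x)) \<longlonglongrightarrow> 0"
proof (rule tendsto_sandwich[OF _ _ tendsto_const])
  have "(\<lambda>k. ennreal (2 powr p) * (Lp_energy M p (f k) + Lp_energy M p (g k))) \<longlonglongrightarrow> ennreal (2 powr p) * (0 + 0)"
    by (intro ennreal_tendsto_cmult tendsto_add assms) auto
  then show "(\<lambda>k. ennreal (2 powr p) * (Lp_energy M p (f k) + Lp_energy M p (g k))) \<longlonglongrightarrow> 0" by simp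
qed (use assms in \<open>auto intro!: Lp_energy_add always_eventually\<close>)

lemma norm_add_square_le:
  fixes a b :: complex assumes "0 < d"
  shows "norm (a + b) powr 2 \<le> (1 + d) * norm a powr 2 + (1 + 1 / d) * norm b powr 2"
proof -
  have "norm (a + b) ^ 2 \<le> (norm a + norm b) ^ 2"
    by (intro power_mono norm_triangle_ineq) auto
  also have "\<dots> = norm a ^ 2 + 2 * (sqrt d * norm a) * (norm b / sqrt d) + norm b ^ 2"
    using assms by (simp add: power2_sum)
  also have "\<dots> \<le> norm a ^ 2 + ((sqrt d * norm a)^2 + (norm b / sqrt d)^2) + norm b ^ 2"
    using sum_squares_bound[of "sqrt d * norm a" "norm b / sqrt d"] by simp
  also have "\<dots> = (1 + d) * norm a ^ 2 + (1 + 1 / d) * norm b ^ 2"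
    using assms by (simp add: power_mult_distrib power_divide algebra_simps)
  finally show ?thesis by (simp add: powr_numeral)
qed

lemma L2_energy_add_le:
  assumes [measurable]: "f \<in> borel_measurable M" "g \<in> borel_measurable M" and d: "0 < d"
  shows "Lp_energy M 2 (\<lambda>x. f x + g x)
    \<le> ennreal (1 + d) * Lp_energy M 2 f + ennreal (1 + 1 / d) * Lp_energy M 2 g"
proof -
  have "Lp_energy M 2 (\<lambda>x. f x + g x) \<le> (\<integral>\<^sup>+x. ennreal (1 + d) * ennreal (norm (f x) powr 2)
      + ennreal (1 + 1/d) * ennreal (norm (g x) powr 2) \<partial>M)"
    unfolding Lp_energy_def
  proof (intro nn_integral_mono)
    fix x
    show "ennreal (norm (f x + g x) powr 2) \<le> ennreal (1 + d) * ennreal (norm (f x) powr 2)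
      + ennreal (1 + 1/d) * ennreal (norm (g x) powr 2)"
      using ennreal_leI[OF norm_add_square_le[OF d, of "f x" "g x"]] d by (simp add: ennreal_mult)
  qed
  also have "\<dots> = ennreal (1 + d) * Lp_energy M 2 f + ennreal (1 + 1 / d) * Lp_energy M 2 g"
    unfolding Lp_energy_def by (simp add: nn_integral_cmult nn_integral_add)
  finally show ?thesis .
qed

section \<open>Power means and convolution on the lattice\<close>

text \<open>
  Jensen's inequality for the weight \<open>c\<close>. It follows from Young's inequality
  $s u^{p-1} \le s^p / p + u^p (1 - 1/p)$ for $s = b(x)$, with $u$ the mean value of \<open>b\<close>.
\<close>
lemma power_mean:
  fixes b c :: "'a \<Rightarrow> real"
  assumes p: "1 \<le> p" and c: "\<And>x. 0 \<le> c x" and b: "\<And>x. 0 \<le> b x"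
    and meas [measurable]: "b \<in> borel_measurable M"
    and ic: "integrable M c" and icb: "integrable M (\<lambda>x. c x * b x powr p)"
  shows "integrable M (\<lambda>x. c x * b x)"
    and "(\<integral>x. c x * b x \<partial>M) powr p \<le> (\<integral>x. c x \<partial>M) powr (p - 1) * (\<integral>x. c x * b x powr p \<partial>M)"
proof -
  have [measurable]: "c \<in> borel_measurable M" using ic by auto
  have young: "s * u powr (p - 1) \<le> s powr p / p + u powr p * (1 - 1 / p)" if "0 \<le> s" "0 < u" for s u
  proof (cases "p = 1")
    case False
    then have p1: "1 < p" using p by simp
    have "1 / p + 1 / (p / (p - 1)) = 1" using p1 by (simp add: field_simps)
    then have "s * u powr (p - 1) \<le> s powr p / p + (u powr (p - 1)) powr (p / (p - 1)) / (p / (p - 1))"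
      using Youngs_inequality[of p "p / (p - 1)" s "u powr (p - 1)"] p1 that by auto
    also have "(u powr (p - 1)) powr (p / (p - 1)) = u powr p"
      using p1 by (simp add: powr_powr)
    finally show ?thesis using p1 by (simp add: field_simps)
  qed (use that in simp)
  show int: "integrable M (\<lambda>x. c x * b x)"
  proof (rule Bochner_Integration.integrable_bound[of M "\<lambda>x. c x + c x * b x powr p"])
    show "AE x in M. norm (c x * b x) \<le> norm (c x + c x * b x powr p)"
    proof (intro always_eventually allI)
      fix x
      have "b x \<le> 1 + b x powr p"
      proof (cases "b x \<le> 1")
        case False
        then have "b x powr 1 \<le> b x powr p" using p by (intro powr_mono) auto
        then show ?thesis using False by simp
      qed (simp add: add_increasing2)
      from mult_left_mono[OF this c[of x]] show "norm (c x * b x) \<le> norm (c x + c x * b x powr p)"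
        using b[of x] c[of x] by (simp add: algebra_simps)
    qed
  qed (use ic icb in auto)
  define C B where "C = (\<integral>x. c x \<partial>M)" and "B = (\<integral>x. c x * b x \<partial>M)"
  have C0: "0 \<le> C" and B0: "0 \<le> B" unfolding C_def B_def using b c by auto
  show "(\<integral>x. c x * b x \<partial>M) powr p \<le> (\<integral>x. c x \<partial>M) powr (p - 1) * (\<integral>x. c x * b x powr p \<partial>M)"
  proof (cases "B = 0")
    case True
    then show ?thesis using b c unfolding B_def by (auto intro!: mult_nonneg_nonneg integral_nonneg)
  next
    case False
    then have Bp: "0 < B" using B0 by simp
    have "C \<noteq> 0"
    proof
      assume "C = 0"
      then have "AE x in M. c x = 0"
        unfolding C_def using ic c by (subst (asm) integral_nonneg_eq_0_iff_AE) auto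
      then have "B = 0" unfolding B_def by (subst integral_cong_AE[where g="\<lambda>_. 0"]) auto
      then show False using False by simp
    qed
    then have Cp: "0 < C" using C0 by simp
    \<comment> \<open>the mean value of \<open>b\<close>, the point at which Young's inequality is sharp\<close>
    define u where "u = B / C"
    have up: "0 < u" unfolding u_def using Bp Cp by simp
    have "u powr (p - 1) * B = (\<integral>x. c x * (b x * u powr (p - 1)) \<partial>M)"
      unfolding B_def by (simp flip: integral_mult_right_zero add: mult_ac)
    also have "\<dots> \<le> (\<integral>x. (c x * b x powr p) / p + c x * (u powr p * (1 - 1 / p)) \<partial>M)"
    proof (rule integral_mono)
      show "integrable M (\<lambda>x. c x * (b x * u powr (p - 1)))"
        unfolding mult.assoc[symmetric] using int by (intro integrable_mult_left)
      show "integrable M (\<lambda>x. (c x * b x powr p) / p + c x * (u powr p * (1 - 1 / p)))"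
        using ic icb by auto
      fix x
      show "c x * (b x * u powr (p - 1)) \<le> c x * b x powr p / p + c x * (u powr p * (1 - 1 / p))"
        using mult_left_mono[OF young[OF b up] c[of x], of x] by (simp add: algebra_simps)
    qed
    also have "\<dots> = (\<integral>x. c x * b x powr p \<partial>M) / p + C * (u powr p * (1 - 1/p))"
      using ic icb unfolding C_def by simp
    also have "C * u powr p = u powr (p - 1) * B"
    proof -
      have "u powr p = u powr (p - 1) * u" using up by (simp add: powr_diff)
      then show ?thesis using Cp unfolding u_def by (simp add: field_simps)
    qed
    then have "C * (u powr p * (1 - 1/p)) = u powr (p - 1) * B * (1 - 1/p)" by (simp add: algebra_simps)
    finally have "u powr (p - 1) * B \<le> (\<integral>x. c x * b x powr p \<partial>M)"
      using p by (simp add: field_simps)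
    then have "C powr (p - 1) * (u powr (p - 1) * B) \<le> C powr (p - 1) * (\<integral>x. c x * b x powr p \<partial>M)"
      by (intro mult_left_mono) auto
    moreover have "C powr (p - 1) * (u powr (p - 1) * B) = B powr p"
    proof -
      have "C powr (p - 1) * u powr (p - 1) = B powr (p - 1)"
        using Cp Bp by (simp add: u_def powr_divide)
      then have "C powr (p - 1) * (u powr (p - 1) * B) = B powr (p - 1) * B"
        by (simp add: algebra_simps)
      then show ?thesis using Bp by (simp add: powr_diff)
    qed
    ultimately show ?thesis unfolding B_def C_def by simp
  qed
qed

lemma lattice_shift_nn_integral:
  fixes f :: "int^'n \<Rightarrow> ennreal"
  shows "(\<integral>\<^sup>+m. f (m - k) \<partial>lattice) = (\<integral>\<^sup>+m. f m \<partial>lattice)"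
    and "(\<integral>\<^sup>+m. f (k - m) \<partial>lattice) = (\<integral>\<^sup>+m. f m \<partial>lattice)"
proof -
  have b1: "bij_betw (\<lambda>m. m - k) UNIV UNIV"
    by (rule bij_betw_byWitness[where f'="\<lambda>m. m + k"]) auto
  have b2: "bij_betw (\<lambda>m. k - m) UNIV UNIV"
    by (rule bij_betw_byWitness[where f'="\<lambda>m. k - m"]) auto
  show "(\<integral>\<^sup>+m. f (m - k) \<partial>lattice) = (\<integral>\<^sup>+m. f m \<partial>lattice)"
    by (rule nn_integral_bij_count_space[OF b1])
  show "(\<integral>\<^sup>+m. f (k - m) \<partial>lattice) = (\<integral>\<^sup>+m. f m \<partial>lattice)"
    by (rule nn_integral_bij_count_space[OF b2])
qed

lemma integrable_lattice_iff:
  fixes f :: "int^'n \<Rightarrow> 'b::{banach, second_countable_topology}"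
  shows "integrable lattice f \<longleftrightarrow> (\<integral>\<^sup>+m. norm (f m) \<partial>lattice) < \<infinity>"
  by (simp add: integrable_iff_bounded)

text \<open>
  Power mean with the weight \<open>\<lambda>k. c (m - k)\<close>, summed over \<open>m\<close>.
\<close>
lemma convolution_Young:
  fixes c a :: "int^'n \<Rightarrow> real"
  assumes p: "1 \<le> p" and c: "\<And>m. 0 \<le> c m" "integrable lattice c"
    and a: "\<And>m. 0 \<le> a m" "(\<integral>\<^sup>+k. ennreal (a k powr p) \<partial>lattice) < \<infinity>"
  shows "\<And>m. integrable lattice (\<lambda>k. c (m - k) * a k)"
    and "(\<integral>\<^sup>+m. ennreal ((\<integral>k. c (m - k) * a k \<partial>lattice) powr p) \<partial>lattice)
      \<le> ennreal ((\<integral>k. c k \<partial>lattice) powr p) * (\<integral>\<^sup>+k. ennreal (a k powr p) \<partial>lattice)"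
proof -
  let ?C = "\<integral>k. c k \<partial>lattice"
  have ia: "integrable lattice (\<lambda>k. a k powr p)"
    using a by (simp add: integrable_lattice_iff)
  have nc: "(\<integral>\<^sup>+k. ennreal (c k) \<partial>lattice) = ennreal ?C"
    by (rule nn_integral_eq_integral) (use c in auto)
  have icm: "integrable lattice (\<lambda>k. c (m - k))" for m
    using c lattice_shift_nn_integral(2)[of "\<lambda>k. ennreal (c k)" m] by (simp add: integrable_lattice_iff)
  have icC: "(\<integral>k. c (m - k) \<partial>lattice) = ?C" for m
    using lattice_shift_nn_integral(2)[of "\<lambda>k. ennreal (c k)" m] c
    by (simp add: integral_eq_nn_integral)
  have bd: "c m \<le> ?C" for m
  proof -
    have "(\<integral>\<^sup>+k. ennreal (c m) * indicator {m} k \<partial>lattice) \<le> (\<integral>\<^sup>+k. ennreal (c k) \<partial>lattice)"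
      by (intro nn_integral_mono) (auto split: split_indicator)
    then show ?thesis using c by (simp add: nn_integral_cmult_indicator nc integral_nonneg)
  qed
  have icap: "integrable lattice (\<lambda>k. c (m - k) * a k powr p)" for m
    by (rule Bochner_Integration.integrable_bound[of _ "\<lambda>k. ?C * a k powr p"])
       (use ia bd c in \<open>auto intro!: mult_right_mono simp: abs_mult integral_nonneg\<close>)
  note pm = power_mean[OF p, of "\<lambda>k. c (m - k)" a lattice for m]
  show "integrable lattice (\<lambda>k. c (m - k) * a k)" for m
    by (rule pm(1)) (use c a icm icap in auto)
  have "ennreal ((\<integral>k. c (m - k) * a k \<partial>lattice) powr p)
      \<le> ennreal (?C powr (p - 1)) * (\<integral>\<^sup>+k. ennreal (c (m - k)) * ennreal (a k powr p) \<partial>lattice)" for m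
  proof -
    have "(\<integral>\<^sup>+k. ennreal (c (m - k)) * ennreal (a k powr p) \<partial>lattice) = ennreal (\<integral>k. c (m - k) * a k powr p \<partial>lattice)"
      using c a by (subst nn_integral_eq_integral[symmetric, OF icap]) (auto simp: ennreal_mult)
    moreover have "(\<integral>k. c (m - k) * a k \<partial>lattice) powr p \<le> ?C powr (p - 1) * (\<integral>k. c (m - k) * a k powr p \<partial>lattice)"
      using pm(2)[of m] c a icm icap by (simp add: icC)
    ultimately show ?thesis
      using c a by (simp add: ennreal_mult[symmetric] integral_nonneg ennreal_leI)
  qed
  then have "(\<integral>\<^sup>+m. ennreal ((\<integral>k. c (m - k) * a k \<partial>lattice) powr p) \<partial>lattice)
      \<le> (\<integral>\<^sup>+m. ennreal (?C powr (p - 1)) * (\<integral>\<^sup>+k. ennreal (c (m - k)) * ennreal (a k powr p) \<partial>lattice) \<partial>lattice)"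
    by (intro nn_integral_mono) 
  also have "\<dots> = ennreal (?C powr (p - 1)) * (\<integral>\<^sup>+m. (\<integral>\<^sup>+k. ennreal (c (m - k)) * ennreal (a k powr p) \<partial>lattice) \<partial>lattice)"
    by (rule nn_integral_cmult) simp
  also have "(\<integral>\<^sup>+m. (\<integral>\<^sup>+k. ennreal (c (m - k)) * ennreal (a k powr p) \<partial>lattice) \<partial>lattice)
      = (\<integral>\<^sup>+k. (\<integral>\<^sup>+m. ennreal (c (m - k)) * ennreal (a k powr p) \<partial>lattice) \<partial>lattice)"
    by (rule lattice_lattice.Fubini'[symmetric], rule measurable_lattice_pair1) auto
  also have "\<dots> = (\<integral>\<^sup>+k. ennreal ?C * ennreal (a k powr p) \<partial>lattice)"
    using lattice_shift_nn_integral(1)[of "\<lambda>k. ennreal (c k)"] by (simp add: nn_integral_multc nc)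
  also have "\<dots> = ennreal ?C * (\<integral>\<^sup>+k. ennreal (a k powr p) \<partial>lattice)"
    by (rule nn_integral_cmult) simp
  also have "ennreal (?C powr (p - 1)) * (ennreal ?C * (\<integral>\<^sup>+k. ennreal (a k powr p) \<partial>lattice))
      = ennreal (?C powr p) * (\<integral>\<^sup>+k. ennreal (a k powr p) \<partial>lattice)"
  proof (cases "?C = 0")
    case False
    then have "?C powr (p - 1) * ?C = ?C powr p" using c by (simp add: powr_diff integral_nonneg)
    then have "ennreal (?C powr (p - 1)) * ennreal ?C = ennreal (?C powr p)"
      using c by (simp add: ennreal_mult[symmetric] integral_nonneg)
    then show ?thesis by (simp add: mult.assoc[symmetric])
  qed simp
  finally show "(\<integral>\<^sup>+m. ennreal ((\<integral>k. c (m - k) * a k \<partial>lattice) powr p) \<partial>lattice)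
      \<le> ennreal (?C powr p) * (\<integral>\<^sup>+k. ennreal (a k powr p) \<partial>lattice)" .
qed

section \<open>Characters and the Fourier integral\<close>

definition wave :: "real ^ 'n \<Rightarrow> real ^ 'n \<Rightarrow> complex" where
  "wave x \<xi> = cis (2 * pi * (\<xi> \<bullet> x))"

lemma cis_measurable [measurable]: "cis \<in> borel_measurable borel"
  by (intro borel_measurable_continuous_onI continuous_intros)

lemma wave_measurable [measurable (raw)]:
  assumes [measurable]: "f \<in> borel_measurable M" "g \<in> borel_measurable M"
  shows "(\<lambda>x. wave (f x) (g x)) \<in> borel_measurable M"
  unfolding wave_def by measurable

lemma cnj_measurable [measurable]: "cnj \<in> borel_measurable borel"
  by (intro borel_measurable_continuous_onI continuous_intros)

lemma norm_wave [simp]: "norm (wave x \<xi>) = 1"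
  by (simp add: wave_def)

lemma wave_commute: "wave x \<xi> = wave \<xi> x"
  by (simp add: wave_def inner_commute)

lemma wave_zero [simp]: "wave 0 \<xi> = 1" "wave x 0 = 1"
  by (simp_all add: wave_def)

lemma wave_add_left: "wave (x + y) \<xi> = wave x \<xi> * wave y \<xi>"
  by (simp add: wave_def cis_mult inner_add_right algebra_simps)

lemma wave_add_right: "wave x (\<xi> + \<zeta>) = wave x \<xi> * wave x \<zeta>"
  by (simp add: wave_def cis_mult inner_add_left algebra_simps)

lemma wave_minus_left: "wave (- x) \<xi> = cnj (wave x \<xi>)"
  by (simp add: wave_def cis_cnj)

lemma wave_minus_right: "wave x (- \<xi>) = cnj (wave x \<xi>)"
  by (simp add: wave_def cis_cnj)

lemma wave_diff_left: "wave (x - y) \<xi> = wave x \<xi> * cnj (wave y \<xi>)"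
  using wave_add_left[of x "- y" \<xi>] by (simp add: wave_minus_left)

lemma wave_diff_right: "wave x (\<xi> - \<zeta>) = wave x \<xi> * cnj (wave x \<zeta>)"
  using wave_add_right[of x \<xi> "- \<zeta>"] by (simp add: wave_minus_right)

lemma wave_cnj_cancel [simp]: "wave x \<xi> * cnj (wave x \<xi>) = 1" "cnj (wave x \<xi>) * wave x \<xi> = 1"
  by (simp_all add: complex_norm_square[symmetric] mult.commute[of "cnj _"])

lemma wave_eq_prod: "wave x \<xi> = (\<Prod>i\<in>UNIV. cis (2 * pi * (\<xi> $ i * x $ i)))"
proof -
  have "(\<Prod>i\<in>S. cis (2 * pi * (\<xi> $ i * x $ i))) = cis (2 * pi * (\<Sum>i\<in>S. \<xi> $ i * x $ i))" if "finite S" for S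
    using that by (induction S) (auto simp: cis_mult algebra_simps)
  then show ?thesis by (simp add: wave_def inner_vec_def)
qed

lemma euclidean_simps [simp]:
  "haar euclidean_lca = lborel" "dual_haar euclidean_lca = lborel"
  "gadd euclidean_lca x y = x + y" "pairing euclidean_lca x \<xi> = wave x \<xi>"
  by (simp_all add: euclidean_lca_def wave_def)

abbreviation fourier :: "(real ^ 'n \<Rightarrow> complex) \<Rightarrow> real ^ 'n \<Rightarrow> complex" where
  "fourier \<equiv> fourier_L1 euclidean_lca"

lemma fourier_eq: "fourier f \<xi> = (\<integral>x. f x * cnj (wave x \<xi>) \<partial>lborel)"
  by (simp add: fourier_L1_def)

lemma integrable_mult_unimodular:
  fixes f u :: "'a \<Rightarrow> complex"
  assumes "integrable M f" "u \<in> borel_measurable M" "\<And>x. norm (u x) \<le> 1"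
  shows "integrable M (\<lambda>x. f x * u x)"
  by (rule Bochner_Integration.integrable_bound[OF assms(1)])
     (use assms in \<open>auto simp: norm_mult intro!: mult_right_le_one_le\<close>)

lemma fourier_measurable [measurable]:
  assumes "f \<in> borel_measurable borel"
  shows "fourier f \<in> borel_measurable borel"
proof -
  note assms[measurable]
  have "(\<lambda>\<xi>. \<integral>x. f x * cnj (wave x \<xi>) \<partial>lborel) \<in> borel_measurable borel"
    by (rule lborel.borel_measurable_lebesgue_integral) measurable
  then show ?thesis by (simp add: fourier_eq[abs_def])
qed

lemma norm_fourier_le:
  assumes "integrable lborel f"
  shows "norm (fourier f \<xi>) \<le> (\<integral>x. norm (f x) \<partial>lborel)"
proof -
  have "norm (fourier f \<xi>) \<le> (\<integral>x. norm (f x * cnj (wave x \<xi>)) \<partial>lborel)"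
    unfolding fourier_eq by (rule integral_norm_bound)
  then show ?thesis by (simp add: norm_mult)
qed

lemma integrable_tensor:
  fixes f :: "'a::euclidean_space \<Rightarrow> complex" and g :: "'b::euclidean_space \<Rightarrow> complex"
  assumes f: "integrable lborel f" and g: "integrable lborel g"
  shows "integrable (lborel \<Otimes>\<^sub>M lborel) (\<lambda>z. f (fst z) * g (snd z))"
proof (rule lborel_pair.Fubini_integrable)
  have [measurable]: "f \<in> borel_measurable borel" "g \<in> borel_measurable borel" using f g by auto
  show "(\<lambda>z. f (fst z) * g (snd z)) \<in> borel_measurable (lborel \<Otimes>\<^sub>M lborel)" by measurable
  show "integrable lborel (\<lambda>x. \<integral>y. norm (f (fst (x, y)) * g (snd (x, y))) \<partial>lborel)"
    using f by (auto simp: norm_mult intro!: integrable_mult_left)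
qed (use g in \<open>auto intro!: integrable_mult_right\<close>)

text \<open>
  Both sides are the double integral of \<open>f x * g \<xi> * cnj (wave x \<xi>)\<close>.
\<close>
lemma fourier_multiplication_formula:
  fixes f g :: "real^'n \<Rightarrow> complex"
  assumes f: "integrable lborel f" and g: "integrable lborel g"
  shows "(\<integral>\<xi>. fourier f \<xi> * g \<xi> \<partial>lborel) = (\<integral>x. f x * fourier g x \<partial>lborel)"
proof -
  have [measurable]: "f \<in> borel_measurable borel" "g \<in> borel_measurable borel" using f g by auto
  have int: "integrable (lborel \<Otimes>\<^sub>M lborel) (\<lambda>(x, \<xi>). f x * g \<xi> * cnj (wave x \<xi>))"
    unfolding split_def
    by (rule integrable_mult_unimodular[OF integrable_tensor[OF f g]]) auto
  have "(\<integral>\<xi>. fourier f \<xi> * g \<xi> \<partial>lborel) = (\<integral>\<xi>. (\<integral>x. f x * g \<xi> * cnj (wave x \<xi>) \<partial>lborel) \<partial>lborel)"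
    unfolding fourier_eq by (simp flip: integral_mult_right_zero add: mult_ac)
  also have "\<dots> = (\<integral>x. (\<integral>\<xi>. f x * g \<xi> * cnj (wave x \<xi>) \<partial>lborel) \<partial>lborel)"
    by (rule lborel_pair.Fubini_integral[OF int])
  also have "\<dots> = (\<integral>x. f x * fourier g x \<partial>lborel)"
    unfolding fourier_eq by (simp flip: integral_mult_right_zero add: mult_ac wave_commute)
  finally show ?thesis .
qed


section \<open>Continuity of translations\<close>

text \<open>
  Continuity of translations passes to limits, because translating \<open>f - g\<close> does not change
  its energy.
\<close>
lemma translation_energy_approx:
  fixes f :: "real^'n \<Rightarrow> complex"
  assumes p: "0 \<le> p" and f: "f \<in> borel_measurable borel"
    and approx: "\<And>e::real. 0 < e \<Longrightarrow> \<exists>g. g \<in> borel_measurable borel \<and> Lp_energy lborel p (\<lambda>x. f x - g x) \<le> ennreal e \<and>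
      (\<lambda>k. Lp_energy lborel p (\<lambda>x. g (x + z k) - g x)) \<longlonglongrightarrow> 0"
  shows "(\<lambda>k. Lp_energy lborel p (\<lambda>x. f (x + z k) - f x)) \<longlonglongrightarrow> 0"
proof -
  note f[measurable]
  define C where "C = (2::real) powr p"
  have C: "C > 0" unfolding C_def by simp
  let ?E = "Lp_energy lborel p :: (real^'n \<Rightarrow> complex) \<Rightarrow> ennreal"
  have key: "limsup (\<lambda>k. ?E (\<lambda>x. f (x + z k) - f x)) \<le> 0 + ennreal e" if e: "0 < e" for e
  proof -
    define d where "d = e / (C * C + C)"
    have d: "d > 0" unfolding d_def using e C by (auto intro!: divide_pos_pos add_pos_pos)
    from approx[OF d] obtain g where [measurable]: "g \<in> borel_measurable borel"
      and g: "?E (\<lambda>x. f x - g x) \<le> ennreal d" "(\<lambda>k. ?E (\<lambda>x. g (x + z k) - g x)) \<longlonglongrightarrow> 0" by blast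
    have bd: "?E (\<lambda>x. f (x + z k) - f x) \<le> ennreal e + ennreal (C * C) * ?E (\<lambda>x. g (x + z k) - g x)" for k
    proof -
      have tr: "?E (\<lambda>x. f (x + z k) - g (x + z k)) = ?E (\<lambda>x. f x - g x)"
        unfolding Lp_energy_def
        by (rule nn_integral_vec_translate[of "\<lambda>x. ennreal (norm (f x - g x) powr p)"]) measurable
      have "?E (\<lambda>x. f (x + z k) - f x) = ?E (\<lambda>x. ((f (x + z k) - g (x + z k)) + (g (x + z k) - g x)) + (g x - f x))"
        by (simp add: algebra_simps)
      also have "\<dots> \<le> ennreal C * (?E (\<lambda>x. (f (x + z k) - g (x + z k)) + (g (x + z k) - g x)) + ?E (\<lambda>x. g x - f x))"
        unfolding C_def by (rule Lp_energy_add) (use p in auto)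
      also have "\<dots> \<le> ennreal C * (ennreal C * (?E (\<lambda>x. f (x + z k) - g (x + z k)) + ?E (\<lambda>x. g (x + z k) - g x)) + ?E (\<lambda>x. g x - f x))"
        unfolding C_def by (intro mult_left_mono add_right_mono Lp_energy_add) (use p in auto)
      also have "\<dots> \<le> ennreal C * (ennreal C * (ennreal d + ?E (\<lambda>x. g (x + z k) - g x)) + ennreal d)"
        using g(1) by (intro mult_left_mono add_mono) (auto simp: tr Lp_energy_diff_commute[of lborel p g f])
      also have "\<dots> = (ennreal C * ennreal C + ennreal C) * ennreal d + ennreal C * ennreal C * ?E (\<lambda>x. g (x + z k) - g x)"
        by (simp only: algebra_simps)
      also have "ennreal C * ennreal C = ennreal (C * C)"
        using C by (simp add: ennreal_mult)
      also have "(ennreal (C * C) + ennreal C) * ennreal d = ennreal ((C * C + C) * d)"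
        using C d by (simp add: ennreal_mult)
      also have "(C * C + C) * d = e"
        unfolding d_def using C by (simp add: add_pos_pos less_imp_neq[symmetric])
      finally show ?thesis .
    qed
    have lim: "(\<lambda>k. ennreal e + ennreal (C * C) * ?E (\<lambda>x. g (x + z k) - g x)) \<longlonglongrightarrow> ennreal e + ennreal (C * C) * 0"
      by (intro tendsto_add tendsto_const ennreal_tendsto_cmult g) auto
    have "limsup (\<lambda>k. ?E (\<lambda>x. f (x + z k) - f x)) \<le> limsup (\<lambda>k. ennreal e + ennreal (C * C) * ?E (\<lambda>x. g (x + z k) - g x))"
      by (rule Limsup_mono) (use bd in auto)
    also have "\<dots> = ennreal e" using lim_imp_Limsup[OF _ lim] by simp
    finally show ?thesis by simp
  qed
  have "limsup (\<lambda>k. ?E (\<lambda>x. f (x + z k) - f x)) \<le> 0"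
    by (rule ennreal_le_epsilon) (rule key)
  then show ?thesis
    by (intro tendsto_0_if_Limsup_eq_0_ennreal) (simp add: le_zero_eq)
qed

text \<open>
  If $x$ lies in the open set $U$ then so does $x + w_k$ for large $k$; hence the measure of
  $\{x \in U.\ x + w_k \notin U\}$ tends to 0 by dominated convergence. The other half of the
  symmetric difference is the same quantity for $-w_k$.
\<close>
lemma translation_indicator_open:
  fixes z :: "nat \<Rightarrow> real^'n"
  assumes U: "open U" "emeasure lborel U < \<infinity>" and z: "z \<longlonglongrightarrow> 0"
  shows "(\<lambda>k. Lp_energy lborel 1 (\<lambda>x. indicator U (x + z k) - indicator U x)) \<longlonglongrightarrow> 0"
proof -
  have [measurable]: "U \<in> sets borel" using U by auto
  \<comment> \<open>stated for every null sequence, because it is used for \<open>z\<close> and for \<open>- z\<close>\<close>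
  have half: "(\<lambda>k. \<integral>\<^sup>+x. indicator U x * indicator (- U) (x + w k) \<partial>lborel) \<longlonglongrightarrow> 0" if w: "w \<longlonglongrightarrow> 0" for w :: "nat \<Rightarrow> real^'n"
  proof -
    have "(\<lambda>k. \<integral>\<^sup>+x. indicator U x * indicator (- U) (x + w k) \<partial>lborel) \<longlonglongrightarrow> (\<integral>\<^sup>+x. 0 \<partial>(lborel :: (real^'n) measure))"
    proof (rule nn_integral_dominated_convergence[where w="indicator U"])
      show "AE x in lborel. (\<lambda>k. indicator U x * indicator (- U) (x + w k)) \<longlonglongrightarrow> (0::ennreal)"
      proof (intro always_eventually allI)
        fix x
        show "(\<lambda>k. indicator U x * indicator (- U) (x + w k)) \<longlonglongrightarrow> (0::ennreal)"
        proof (cases "x \<in> U")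
          case True
          have "(\<lambda>k. x + w k) \<longlonglongrightarrow> x + 0" by (intro tendsto_add tendsto_const w)
          then have "\<forall>\<^sub>F k in sequentially. x + w k \<in> U"
            using True U by (intro topological_tendstoD) auto
          then have "\<forall>\<^sub>F k in sequentially. indicator U x * indicator (- U) (x + w k) = (0::ennreal)"
            by eventually_elim simp
          then show ?thesis by (rule tendsto_eventually)
        qed simp
      qed
    qed (use U in \<open>auto split: split_indicator\<close>)
    then show ?thesis by simp
  qed
  have "Lp_energy lborel 1 (\<lambda>x. indicator U (x + z k) - indicator U x)
      = (\<integral>\<^sup>+x. indicator U x * indicator (- U) (x + z k) \<partial>lborel)
        + (\<integral>\<^sup>+x. indicator U x * indicator (- U) (x + - z k) \<partial>lborel)" for k
  proof -
    have "(\<integral>\<^sup>+x. indicator U x * indicator (- U) (x + - z k) \<partial>lborel)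
        = (\<integral>\<^sup>+x. indicator U (x + z k) * indicator (- U) (x + z k + - z k) \<partial>lborel)"
      by (rule nn_integral_vec_translate[symmetric, of "\<lambda>x. indicator U x * indicator (- U) (x + - z k)"]) measurable
    moreover have "Lp_energy lborel 1 (\<lambda>x. indicator U (x + z k) - indicator U x)
      = (\<integral>\<^sup>+x. indicator U x * indicator (- U) (x + z k) + indicator U (x + z k) * indicator (- U) x \<partial>lborel)"
      unfolding Lp_energy_def by (intro nn_integral_cong) (auto split: split_indicator)
    ultimately show ?thesis by (simp add: nn_integral_add)
  qed
  moreover have "(\<lambda>k. (\<integral>\<^sup>+x. indicator U x * indicator (- U) (x + z k) \<partial>lborel)
        + (\<integral>\<^sup>+x. indicator U x * indicator (- U) (x + - z k) \<partial>lborel)) \<longlonglongrightarrow> 0 + 0"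
    using z tendsto_minus[OF z] by (intro tendsto_add half) auto
  ultimately show ?thesis by simp
qed

text \<open>
  Sets of finite measure are approximated from outside by open sets, integrable functions by
  simple ones.
\<close>
lemma L1_translation_continuous:
  fixes f :: "real^'n \<Rightarrow> complex"
  assumes f: "integrable lborel f" and z: "z \<longlonglongrightarrow> 0"
  shows "(\<lambda>k. Lp_energy lborel 1 (\<lambda>x. f (x + z k) - f x)) \<longlonglongrightarrow> 0"
  using f
proof (induction f rule: integrable_induct)
  case (base A c)
  have [measurable]: "A \<in> sets borel" using base by simp
  have "(\<lambda>k. Lp_energy lborel 1 (\<lambda>x. indicator A (x + z k) - indicator A x)) \<longlonglongrightarrow> 0"
  proof (rule translation_energy_approx)
    fix e :: real assume e: "0 < e"
    obtain U where U: "open U" "A \<subseteq> U" "emeasure lborel (U - A) < e"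
      using outer_regular_lborel[OF \<open>A \<in> sets borel\<close> e] by blast
    have [measurable]: "U \<in> sets borel" using U by auto
    have "emeasure lborel U \<le> emeasure lborel A + emeasure lborel (U - A)"
      using emeasure_subadditive[of A lborel "U - A"] U by (simp add: Un_absorb1)
    also have "\<dots> < \<infinity>" using base U by (auto intro: less_trans simp: less_top)
    finally have fin: "emeasure lborel U < \<infinity>" .
    have "Lp_energy lborel 1 (\<lambda>x. indicator A x - indicator U x) = (\<integral>\<^sup>+x. indicator (U - A) x \<partial>lborel)"
      unfolding Lp_energy_def using U by (intro nn_integral_cong) (auto split: split_indicator)
    also have "\<dots> \<le> ennreal e" using U by simp
    finally show "\<exists>g. g \<in> borel_measurable borel \<and> Lp_energy lborel 1 (\<lambda>x. indicator A x - g x) \<le> ennreal e \<and>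
      (\<lambda>k. Lp_energy lborel 1 (\<lambda>x. g (x + z k) - g x)) \<longlonglongrightarrow> 0"
      using translation_indicator_open[OF U(1) fin z]
      by (intro exI[of _ "indicator U"]) simp
  qed auto
  then have "(\<lambda>k. ennreal (norm c powr 1) * Lp_energy lborel 1 (\<lambda>x. indicator A (x + z k) - indicator A x)) \<longlonglongrightarrow> ennreal (norm c powr 1) * 0"
    by (intro ennreal_tendsto_cmult) auto
  then show ?case
    by (subst (asm) Lp_energy_cmult[symmetric]) (auto simp: scaleR_conv_of_real algebra_simps of_real_indicator)
next
  case (add f g)
  have [measurable]: "f \<in> borel_measurable borel" "g \<in> borel_measurable borel" using add by auto
  have "(\<lambda>k. Lp_energy lborel 1 (\<lambda>x. (f (x + z k) - f x) + (g (x + z k) - g x))) \<longlonglongrightarrow> 0"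
    by (rule Lp_energy_tendsto_0_add) (use add in auto)
  then show ?case by (simp add: algebra_simps)
next
  case (lim f s)
  have [measurable]: "f \<in> borel_measurable borel" "s i \<in> borel_measurable borel" for i using lim by auto
  show ?case
  proof (rule translation_energy_approx)
    fix e :: real assume e: "0 < e"
    have "(\<lambda>i. \<integral>\<^sup>+x. norm (f x - s i x) \<partial>lborel) \<longlonglongrightarrow> (\<integral>\<^sup>+x. 0 \<partial>(lborel :: (real^'n) measure))"
    proof (rule nn_integral_dominated_convergence[where w="\<lambda>x. ennreal (3 * norm (f x))"])
      show "AE x in lborel. ennreal (norm (f x - s i x)) \<le> ennreal (3 * norm (f x))" for i
      proof (intro always_eventually allI ennreal_leI)
        fix x show "norm (f x - s i x) \<le> 3 * norm (f x)"
          using norm_triangle_ineq4[of "f x" "s i x"] lim.hyps(3)[of x i] by simp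
      qed
      show "AE x in lborel. (\<lambda>i. ennreal (norm (f x - s i x))) \<longlonglongrightarrow> 0"
      proof (intro always_eventually allI)
        fix x
        have "(\<lambda>i. ennreal (norm (f x - s i x))) \<longlonglongrightarrow> ennreal (norm (f x - f x))"
          by (intro tendsto_intros lim.hyps(2)) auto
        then show "(\<lambda>i. ennreal (norm (f x - s i x))) \<longlonglongrightarrow> 0" by simp
      qed
      have "integrable lborel (\<lambda>x. 3 * norm (f x))" using lim by auto
      then show "(\<integral>\<^sup>+x. ennreal (3 * norm (f x)) \<partial>lborel) < \<infinity>"
        by (subst nn_integral_eq_integral) auto
    qed auto
    then have "\<forall>\<^sub>F i in sequentially. (\<integral>\<^sup>+x. norm (f x - s i x) \<partial>lborel) < ennreal e"
      using e by (intro order_tendstoD(2)[where y=0]) auto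
    then obtain i where "(\<integral>\<^sup>+x. norm (f x - s i x) \<partial>lborel) < ennreal e"
      by (auto simp: eventually_sequentially)
    then show "\<exists>g. g \<in> borel_measurable borel \<and> Lp_energy lborel 1 (\<lambda>x. f x - g x) \<le> ennreal e \<and>
      (\<lambda>k. Lp_energy lborel 1 (\<lambda>x. g (x + z k) - g x)) \<longlonglongrightarrow> 0"
      using lim.IH by (intro exI[of _ "s i"]) (auto simp: Lp_energy_def)
  qed auto
qed

section \<open>Gaussians\<close>

text \<open>
  This is the characteristic function of the standard normal distribution, rescaled.
\<close>
lemma gaussian_integral_1d:
  fixes a z :: real
  assumes a: "0 < a"
  shows "integrable lborel (\<lambda>t. complex_of_real (exp (- (a * t)\<^sup>2 / 2)) * cis (2 * pi * (t * z)))"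
    and "(\<integral>t. complex_of_real (exp (- (a * t)\<^sup>2 / 2)) * cis (2 * pi * (t * z)) \<partial>lborel)
      = of_real (sqrt (2 * pi) / a * exp (- (2 * pi * z / a)\<^sup>2 / 2))"
proof -
  define s where "s = 2 * pi * z / a"
  define F where "F = (\<lambda>x. complex_of_real (exp (- x\<^sup>2 / 2)) * cis (s * x))"
  have [measurable]: "F \<in> borel_measurable borel" unfolding F_def by measurable
  have nd: "std_normal_density x *\<^sub>R iexp (s * x) = of_real (1 / sqrt (2 * pi)) * F x" for x
    by (simp add: std_normal_density_def F_def scaleR_conv_of_real cis_conv_exp)
  have "integrable lborel (\<lambda>x. std_normal_density x *\<^sub>R iexp (s * x))"
  proof (rule Bochner_Integration.integrable_bound[of lborel std_normal_density])
    show "integrable lborel std_normal_density" by simp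
    show "(\<lambda>x. std_normal_density x *\<^sub>R iexp (s * x)) \<in> borel_measurable lborel"
      unfolding nd by measurable
  qed simp
  then have "integrable lborel (\<lambda>x. of_real (sqrt (2 * pi)) * (of_real (1 / sqrt (2 * pi)) * F x))"
    unfolding nd by (rule integrable_mult_right)
  then have iF: "integrable lborel F"
    by (simp add: mult.assoc[symmetric] flip: of_real_mult)
  have "of_real (exp (- s\<^sup>2 / 2)) = char std_normal_distribution s"
    by (simp add: char_std_normal_distribution)
  also have "\<dots> = (\<integral>x. std_normal_density x *\<^sub>R iexp (s * x) \<partial>lborel)"
    unfolding char_def by (subst integral_density) auto
  also have "\<dots> = of_real (1 / sqrt (2 * pi)) * (\<integral>x. F x \<partial>lborel)"
    unfolding nd by simp
  finally have "of_real (sqrt (2 * pi)) * complex_of_real (exp (- s\<^sup>2 / 2))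
      = of_real (sqrt (2 * pi)) * (of_real (1 / sqrt (2 * pi)) * (\<integral>x. F x \<partial>lborel))" by (rule arg_cong)
  then have vF: "(\<integral>x. F x \<partial>lborel) = of_real (sqrt (2 * pi) * exp (- s\<^sup>2 / 2))"
    by (simp add: mult.assoc[symmetric] flip: of_real_mult)
  have Fa: "F (0 + a * t) = complex_of_real (exp (- (a * t)\<^sup>2 / 2)) * cis (2 * pi * (t * z))" for t
    using a by (simp add: F_def s_def mult_ac)
  show "integrable lborel (\<lambda>t. complex_of_real (exp (- (a * t)\<^sup>2 / 2)) * cis (2 * pi * (t * z)))"
    unfolding Fa[symmetric] using iF a by (subst lborel_integrable_real_affine_iff) auto
  have "(\<integral>x. F x \<partial>lborel) = \<bar>a\<bar> *\<^sub>R (\<integral>t. F (0 + a * t) \<partial>lborel)"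
    by (rule lborel_integral_real_affine) (use a in simp)
  then show "(\<integral>t. complex_of_real (exp (- (a * t)\<^sup>2 / 2)) * cis (2 * pi * (t * z)) \<partial>lborel)
      = of_real (sqrt (2 * pi) / a * exp (- (2 * pi * z / a)\<^sup>2 / 2))"
    unfolding Fa vF using a by (simp add: scaleR_conv_of_real s_def field_simps)
qed

definition gauss :: "real \<Rightarrow> real ^ 'n \<Rightarrow> real" where
  "gauss a x = (\<Prod>i\<in>UNIV. exp (- (a * x $ i)\<^sup>2 / 2))"

text \<open>
  The Fourier transform of \<open>gauss a\<close>, itself a probability density that concentrates at the
  origin as \<open>a\<close> tends to 0.
\<close>
definition gauss_hat :: "real \<Rightarrow> real ^ 'n \<Rightarrow> real" where
  "gauss_hat a z = (\<Prod>i\<in>UNIV. sqrt (2 * pi) / a * exp (- (2 * pi * z $ i / a)\<^sup>2 / 2))"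

lemma gauss_measurable [measurable]: "gauss a \<in> borel_measurable borel" "gauss_hat a \<in> borel_measurable borel"
  unfolding gauss_def gauss_hat_def by measurable

lemma gauss_bounds: "0 \<le> gauss a x" "gauss a x \<le> 1"
  unfolding gauss_def by (auto intro!: prod_nonneg prod_le_1)

lemma gauss_fourier:
  fixes z :: "real^'n"
  assumes a: "0 < a"
  shows "integrable lborel (\<lambda>\<xi>. of_real (gauss a \<xi>) * wave z \<xi>)"
    and "(\<integral>\<xi>. of_real (gauss a \<xi>) * wave z \<xi> \<partial>lborel) = of_real (gauss_hat a z)"
proof -
  have *: "of_real (gauss a \<xi>) * wave z \<xi>
      = (\<Prod>i\<in>UNIV. complex_of_real (exp (- (a * \<xi> $ i)\<^sup>2 / 2)) * cis (2 * pi * (\<xi> $ i * z $ i)))" for \<xi> :: "real^'n"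
    by (simp add: gauss_def wave_eq_prod prod.distrib)
  note g = gaussian_integral_1d[OF a]
  show "integrable lborel (\<lambda>\<xi>. of_real (gauss a \<xi>) * wave z \<xi>)"
    unfolding * by (rule integral_lborel_prod(1)[of "\<lambda>i t. complex_of_real (exp (- (a * t)\<^sup>2 / 2)) * cis (2 * pi * (t * z $ i))"]) (rule g)
  show "(\<integral>\<xi>. of_real (gauss a \<xi>) * wave z \<xi> \<partial>lborel) = of_real (gauss_hat a z)"
    unfolding * by (subst integral_lborel_prod(2)[of "\<lambda>i t. complex_of_real (exp (- (a * t)\<^sup>2 / 2)) * cis (2 * pi * (t * z $ i))"])
      (simp_all only: g gauss_hat_def of_real_prod)
qed

lemma gauss_hat_integral:
  assumes a: "0 < a"
  shows "integrable lborel (\<lambda>z::real^'n. complex_of_real (gauss_hat a z))"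
    and "(\<integral>z. complex_of_real (gauss_hat a z) \<partial>(lborel :: (real^'n) measure)) = 1"
proof -
  let ?g = "\<lambda>t. complex_of_real (sqrt (2 * pi) / a) * (complex_of_real (exp (- (2 * pi / a * t)\<^sup>2 / 2)) * cis (2 * pi * (t * 0)))"
  have *: "complex_of_real (gauss_hat a z) = (\<Prod>i\<in>UNIV. ?g (z $ i))" for z :: "real^'n"
    by (simp add: gauss_hat_def)
  have b: "0 < 2 * pi / a" using a by simp
  have i1: "integrable lborel ?g"
    using gaussian_integral_1d(1)[OF b, of 0] by (intro integrable_mult_right)
  have "(\<integral>t. ?g t \<partial>lborel) = complex_of_real (sqrt (2 * pi) / a) * of_real (sqrt (2 * pi) / (2 * pi / a) * exp (- (2 * pi * 0 / (2 * pi / a))\<^sup>2 / 2))"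
    by (simp only: integral_mult_right_zero gaussian_integral_1d(2)[OF b, of 0])
  also have "\<dots> = of_real (sqrt (2 * pi) / a * (sqrt (2 * pi) / (2 * pi / a)))"
    by (simp only: of_real_mult mult_zero_right div_0 power_zero_numeral minus_zero exp_zero mult_1_right)
  also have "sqrt (2 * pi) / a * (sqrt (2 * pi) / (2 * pi / a)) = 1"
    using a by (simp add: field_simps)
  also have "complex_of_real 1 = 1" by simp
  finally have v: "(\<integral>t. ?g t \<partial>lborel) = 1" .
  show "integrable lborel (\<lambda>z::real^'n. complex_of_real (gauss_hat a z))"
    unfolding * by (rule integral_lborel_prod(1)) (rule i1)
  show "(\<integral>z. complex_of_real (gauss_hat a z) \<partial>(lborel :: (real^'n) measure)) = 1"
    unfolding * by (subst integral_lborel_prod(2)) (auto intro: i1 simp only: v prod.neutral_const)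
qed

lemma gauss_hat_nonneg: "0 < a \<Longrightarrow> 0 \<le> gauss_hat a z"
  unfolding gauss_hat_def by (intro prod_nonneg) auto

lemma gauss_hat_le:
  assumes "0 < a"
  shows "gauss_hat a (z :: real^'n) \<le> (sqrt (2 * pi) / a) ^ CARD('n)"
proof -
  have "gauss_hat a z \<le> (\<Prod>i\<in>(UNIV::'n set). sqrt (2 * pi) / a)"
    unfolding gauss_hat_def using assms by (intro prod_mono) (auto intro!: divide_right_mono mult_left_le)
  then show ?thesis by simp
qed

lemma integral_vec_scale:
  fixes f :: "real^'n \<Rightarrow> complex"
  assumes [measurable]: "f \<in> borel_measurable borel" and a: "0 < a"
  shows "(\<integral>x. f x \<partial>lborel) = (\<integral>x. of_real (a ^ CARD('n)) * f (a *\<^sub>R x) \<partial>lborel)"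
proof -
  have "(\<integral>x. f x \<partial>lborel) = (\<integral>x. f x \<partial>density (distr lborel borel (\<lambda>x. 0 + a *\<^sub>R x)) (\<lambda>_. ennreal (\<bar>a\<bar> ^ CARD('n))))"
    using a by (subst lborel_affine[of a "0::real^'n"]) simp_all
  also have "\<dots> = (\<integral>x. a ^ CARD('n) *\<^sub>R f x \<partial>(distr lborel borel (\<lambda>x. 0 + a *\<^sub>R x)))"
    using a by (subst integral_density) auto
  also have "\<dots> = (\<integral>x. a ^ CARD('n) *\<^sub>R f (0 + a *\<^sub>R x) \<partial>lborel)"
    by (subst integral_distr) auto
  finally show ?thesis by (simp add: scaleR_conv_of_real)
qed

lemma gauss_hat_scale:
  assumes "0 < a"
  shows "a ^ CARD('n) * gauss_hat a (a *\<^sub>R (z :: real^'n)) = gauss_hat 1 z"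
proof -
  have "a ^ CARD('n) * gauss_hat a (a *\<^sub>R z) = (\<Prod>i\<in>UNIV. a * (sqrt (2 * pi) / a * exp (- (2 * pi * (a *\<^sub>R z) $ i / a)\<^sup>2 / 2)))"
    by (simp only: gauss_hat_def prod.distrib prod_constant)
  also have "\<dots> = gauss_hat 1 z"
    unfolding gauss_hat_def using assms by (intro prod.cong) (auto simp: power_mult_distrib)
  finally show ?thesis .
qed

section \<open>Translations and products in $L^2$\<close>

lemma ennreal_tendsto_0_mono:
  fixes f g :: "nat \<Rightarrow> ennreal"
  assumes "g \<longlonglongrightarrow> 0" "\<And>k. f k \<le> g k"
  shows "f \<longlonglongrightarrow> 0"
  by (rule tendsto_sandwich[OF _ _ tendsto_const assms(1)]) (simp_all add: assms(2))

text \<open>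
  Cut \<open>f\<close> off where it is large. For a function bounded by $j$ the $L^2$ energy of
  a difference of translates is at most $2j$ times its $L^1$ norm.
\<close>
lemma L2_translation_continuous:
  fixes f :: "real^'n \<Rightarrow> complex"
  assumes f: "integrable lborel f" "f \<in> Lp_space lborel 2" and z: "z \<longlonglongrightarrow> 0"
  shows "(\<lambda>k. Lp_energy lborel 2 (\<lambda>x. f (x + z k) - f x)) \<longlonglongrightarrow> 0"
proof (rule translation_energy_approx)
  show [measurable]: "f \<in> borel_measurable borel" using f by auto
  fix e :: real assume e: "0 < e"
  define g where "g = (\<lambda>(j::nat) x. if norm (f x) \<le> real j then f x else 0)"
  have [measurable]: "g j \<in> borel_measurable borel" for j unfolding g_def by measurable
  have "(\<lambda>j. Lp_energy lborel 2 (\<lambda>x. f x - g j x)) \<longlonglongrightarrow> (\<integral>\<^sup>+x. 0 \<partial>(lborel :: (real^'n) measure))"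
    unfolding Lp_energy_def
  proof (rule nn_integral_dominated_convergence[where w="\<lambda>x. ennreal (norm (f x) powr 2)"])
    show "AE x in lborel. (\<lambda>j. ennreal (norm (f x - g j x) powr 2)) \<longlonglongrightarrow> 0"
    proof (intro always_eventually allI)
      fix x
      have "\<forall>\<^sub>F j in sequentially. norm (f x) \<le> real j"
        using eventually_ge_at_top[of "nat \<lceil>norm (f x)\<rceil>"] by eventually_elim linarith
      then have "\<forall>\<^sub>F j in sequentially. ennreal (norm (f x - g j x) powr 2) = 0"
        by eventually_elim (simp add: g_def)
      then show "(\<lambda>j. ennreal (norm (f x - g j x) powr 2)) \<longlonglongrightarrow> 0" by (rule tendsto_eventually)
    qed
    show "(\<integral>\<^sup>+x. ennreal (norm (f x) powr 2) \<partial>lborel) < \<infinity>"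
      using f(2) by (simp add: Lp_space_iff Lp_energy_def)
  qed (auto simp: g_def)
  then have "\<forall>\<^sub>F j in sequentially. Lp_energy lborel 2 (\<lambda>x. f x - g j x) < ennreal e"
    using e by (intro order_tendstoD(2)[where y=0]) auto
  then obtain j where j: "Lp_energy lborel 2 (\<lambda>x. f x - g j x) < ennreal e"
    by (auto simp: eventually_sequentially)
  have ig: "integrable lborel (g j)"
    by (rule Bochner_Integration.integrable_bound[OF f(1)]) (auto simp: g_def)
  have le: "Lp_energy lborel 2 (\<lambda>x. g j (x + z k) - g j x) \<le> ennreal (2 * real j) * Lp_energy lborel 1 (\<lambda>x. g j (x + z k) - g j x)" for k
  proof -
    have "Lp_energy lborel 2 (\<lambda>x. g j (x + z k) - g j x) \<le> (\<integral>\<^sup>+x. ennreal (2 * real j) * ennreal (norm (g j (x + z k) - g j x) powr 1) \<partial>lborel)"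
      unfolding Lp_energy_def
    proof (intro nn_integral_mono)
      fix x
      have "norm (g j (x + z k)) \<le> real j" "norm (g j x) \<le> real j" by (auto simp: g_def)
      then have "norm (g j (x + z k) - g j x) \<le> 2 * real j"
        using norm_triangle_ineq4[of "g j (x + z k)" "g j x"] by linarith
      then have "norm (g j (x + z k) - g j x) * norm (g j (x + z k) - g j x) \<le> 2 * real j * norm (g j (x + z k) - g j x)"
        by (intro mult_right_mono) auto
      then show "ennreal (norm (g j (x + z k) - g j x) powr 2) \<le> ennreal (2 * real j) * ennreal (norm (g j (x + z k) - g j x) powr 1)"
        by (subst ennreal_mult[symmetric]) (auto simp: powr_numeral power2_eq_square intro!: ennreal_leI)
    qed
    also have "\<dots> = ennreal (2 * real j) * Lp_energy lborel 1 (\<lambda>x. g j (x + z k) - g j x)"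
      unfolding Lp_energy_def by (rule nn_integral_cmult) measurable
    finally show ?thesis .
  qed
  have "(\<lambda>k. ennreal (2 * real j) * Lp_energy lborel 1 (\<lambda>x. g j (x + z k) - g j x)) \<longlonglongrightarrow> ennreal (2 * real j) * 0"
    by (intro ennreal_tendsto_cmult L1_translation_continuous ig z) auto
  then have "(\<lambda>k. Lp_energy lborel 2 (\<lambda>x. g j (x + z k) - g j x)) \<longlonglongrightarrow> 0"
    by (intro ennreal_tendsto_0_mono[OF _ le]) simp
  then show "\<exists>g. g \<in> borel_measurable borel \<and> Lp_energy lborel 2 (\<lambda>x. f x - g x) \<le> ennreal e \<and>
      (\<lambda>k. Lp_energy lborel 2 (\<lambda>x. g (x + z k) - g x)) \<longlonglongrightarrow> 0"
    using j by (intro exI[of _ "g j"]) auto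
qed auto

lemma L2_product_bound:
  fixes f g :: "'a \<Rightarrow> complex"
  assumes "f \<in> borel_measurable M" "g \<in> borel_measurable M"
  shows "(\<integral>\<^sup>+x. ennreal (norm (f x) * norm (g x)) \<partial>M)\<^sup>2 \<le> Lp_energy M 2 f * Lp_energy M 2 g"
  using Cauchy_Schwarz_nn_integral[of "\<lambda>x. ennreal (norm (f x))" M "\<lambda>x. ennreal (norm (g x))"] assms
  by (simp add: Lp_energy_def ennreal_mult[symmetric] ennreal_power powr_numeral)

lemma integrable_L2_product:
  fixes f g :: "'a \<Rightarrow> complex"
  assumes f: "f \<in> Lp_space M 2" and g: "g \<in> Lp_space M 2"
  shows "integrable M (\<lambda>x. f x * g x)" "integrable M (\<lambda>x. f x * cnj (g x))"
proof -
  have [measurable]: "f \<in> borel_measurable M" "g \<in> borel_measurable M" using f g by auto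
  have "(\<integral>\<^sup>+x. ennreal (norm (f x) * norm (g x)) \<partial>M)\<^sup>2 \<le> Lp_energy M 2 f * Lp_energy M 2 g"
    by (rule L2_product_bound) auto
  also have "\<dots> < \<infinity>" using f g by (simp add: Lp_space_iff ennreal_mult_less_top)
  finally have fin: "(\<integral>\<^sup>+x. ennreal (norm (f x) * norm (g x)) \<partial>M) < \<infinity>"
    by (cases "(\<integral>\<^sup>+x. ennreal (norm (f x) * norm (g x)) \<partial>M) = \<top>") (auto simp: power2_eq_square less_top)
  show "integrable M (\<lambda>x. f x * g x)" "integrable M (\<lambda>x. f x * cnj (g x))"
    using fin by (auto simp: integrable_iff_bounded norm_mult)
qed

section \<open>Plancherel's theorem on Euclidean space\<close>

definition autocorrelation :: "(real ^ 'n \<Rightarrow> complex) \<Rightarrow> real ^ 'n \<Rightarrow> complex" where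
  "autocorrelation f z = (\<integral>x. f x * cnj (f (x - z)) \<partial>lborel)"

lemma L2_energy_eq_square: "Lp_energy M 2 f = (\<integral>\<^sup>+x. ennreal ((norm (f x))\<^sup>2) \<partial>M)"
  by (simp add: Lp_energy_def powr_numeral)

lemma Lp_space_2_iff:
  "f \<in> Lp_space M 2 \<longleftrightarrow> f \<in> borel_measurable M \<and> integrable M (\<lambda>x. (norm (f x))\<^sup>2)"
  by (auto simp: Lp_space_def powr_numeral)

lemma L2_energy_eq_integral:
  assumes "f \<in> Lp_space M 2"
  shows "Lp_energy M 2 f = ennreal (\<integral>x. (norm (f x))\<^sup>2 \<partial>M)"
  unfolding L2_energy_eq_square using assms by (subst nn_integral_eq_integral) (auto simp: Lp_space_2_iff)

lemma Lp_energy_translate: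
  fixes f :: "real^'n \<Rightarrow> complex"
  assumes [measurable]: "f \<in> borel_measurable borel"
  shows "Lp_energy lborel p (\<lambda>x. f (x + h)) = Lp_energy lborel p f"
  unfolding Lp_energy_def
  by (rule nn_integral_vec_translate[of "\<lambda>x. ennreal (norm (f x) powr p)"]) measurable

lemma Lp_space_translate:
  fixes f :: "real^'n \<Rightarrow> complex"
  assumes "f \<in> Lp_space lborel p"
  shows "(\<lambda>x. f (x + h)) \<in> Lp_space lborel p"
proof -
  have [measurable]: "f \<in> borel_measurable borel" using assms by (simp add: Lp_space_def)
  show ?thesis using assms by (simp add: Lp_space_iff Lp_energy_translate)
qed

lemma Lp_energy_reflect:
  fixes f :: "real^'n \<Rightarrow> complex"
  assumes [measurable]: "f \<in> borel_measurable borel"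
  shows "Lp_energy lborel p (\<lambda>x. f (h - x)) = Lp_energy lborel p f"
  unfolding Lp_energy_def
  by (rule nn_integral_vec_reflect[of "\<lambda>x. ennreal (norm (f x) powr p)"]) measurable

lemma Lp_space_reflect:
  fixes f :: "real^'n \<Rightarrow> complex"
  assumes "f \<in> Lp_space lborel p"
  shows "(\<lambda>x. f (h - x)) \<in> Lp_space lborel p"
proof -
  have [measurable]: "f \<in> borel_measurable borel" using assms by (simp add: Lp_space_def)
  show ?thesis using assms by (simp add: Lp_space_iff Lp_energy_reflect)
qed

lemma autocorrelation_measurable [measurable]:
  assumes [measurable]: "f \<in> borel_measurable borel"
  shows "autocorrelation f \<in> borel_measurable borel"
  unfolding autocorrelation_def[abs_def]
  by (rule lborel.borel_measurable_lebesgue_integral) measurable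

lemma norm_integral_product_square_le:
  fixes f g :: "'a \<Rightarrow> complex"
  assumes f: "f \<in> Lp_space M 2" and g: "g \<in> Lp_space M 2"
  shows "ennreal ((norm (\<integral>x. f x * g x \<partial>M))\<^sup>2) \<le> Lp_energy M 2 f * Lp_energy M 2 g"
proof -
  have "ennreal (norm (\<integral>x. f x * g x \<partial>M)) \<le> (\<integral>\<^sup>+x. ennreal (norm (f x) * norm (g x)) \<partial>M)"
    using integral_norm_bound_ennreal[OF integrable_L2_product(1)[OF f g]] by (simp add: norm_mult)
  then have "(ennreal (norm (\<integral>x. f x * g x \<partial>M)))\<^sup>2 \<le> (\<integral>\<^sup>+x. ennreal (norm (f x) * norm (g x)) \<partial>M)\<^sup>2"
    by (rule power_mono) simp
  also have "\<dots> \<le> Lp_energy M 2 f * Lp_energy M 2 g"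
    by (rule L2_product_bound) (use f g in auto)
  finally show ?thesis by (simp add: ennreal_power)
qed

lemma Lp_space_cnj: "(\<lambda>x. cnj (f x)) \<in> Lp_space M p" if "f \<in> Lp_space M p"
proof -
  have [measurable]: "f \<in> borel_measurable M" using that by (simp add: Lp_space_def)
  have "(\<lambda>x. cnj (f x)) \<in> borel_measurable M" by measurable
  then show ?thesis using that by (simp add: Lp_space_iff Lp_energy_def)
qed

lemma autocorrelation_continuous_0:
  fixes f :: "real^'n \<Rightarrow> complex"
  assumes f: "integrable lborel f" "f \<in> Lp_space lborel 2" and z: "z \<longlonglongrightarrow> 0"
  shows "(\<lambda>k. autocorrelation f (z k)) \<longlonglongrightarrow> autocorrelation f 0"
proof -
  have fz: "(\<lambda>x. f (x - z k)) \<in> Lp_space lborel 2" for k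
    using Lp_space_translate[OF f(2), of "- z k"] by simp
  have dz: "(\<lambda>x. f (x - z k) - f x) \<in> Lp_space lborel 2" for k
    by (rule Lp_space_diff[OF fz f(2)]) simp
  have eq: "autocorrelation f (z k) - autocorrelation f 0 = (\<integral>x. f x * cnj (f (x - z k) - f x) \<partial>lborel)" for k
    unfolding autocorrelation_def
    by (subst Bochner_Integration.integral_diff[symmetric])
       (use integrable_L2_product(2)[OF f(2) fz[of k]] integrable_L2_product(2)[OF f(2) f(2)] in
         \<open>auto simp: algebra_simps\<close>)
  have le: "ennreal ((norm (autocorrelation f (z k) - autocorrelation f 0))\<^sup>2)
      \<le> Lp_energy lborel 2 f * Lp_energy lborel 2 (\<lambda>x. f (x + - z k) - f x)" for k
  proof -
    have "Lp_energy lborel 2 (\<lambda>x. cnj (f (x - z k) - f x)) = Lp_energy lborel 2 (\<lambda>x. f (x + - z k) - f x)"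
      by (simp add: Lp_energy_def flip: complex_cnj_diff)
    with norm_integral_product_square_le[OF f(2) Lp_space_cnj[OF dz[of k]]] show ?thesis
      unfolding eq by simp
  qed
  have "(\<lambda>k. Lp_energy lborel 2 f * Lp_energy lborel 2 (\<lambda>x. f (x + - z k) - f x)) \<longlonglongrightarrow> Lp_energy lborel 2 f * 0"
    using f tendsto_minus[OF z] by (intro ennreal_tendsto_cmult L2_translation_continuous) (auto simp: Lp_space_iff)
  then have "(\<lambda>k. ennreal ((norm (autocorrelation f (z k) - autocorrelation f 0))\<^sup>2)) \<longlonglongrightarrow> ennreal 0"
    using ennreal_tendsto_0_mono[OF _ le] by simp
  then have "(\<lambda>k. (norm (autocorrelation f (z k) - autocorrelation f 0))\<^sup>2) \<longlonglongrightarrow> 0"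
    by (subst (asm) tendsto_ennreal_iff) auto
  then have "(\<lambda>k. norm (autocorrelation f (z k) - autocorrelation f 0)) \<longlonglongrightarrow> 0"
    using tendsto_real_sqrt by fastforce
  then show ?thesis
    using LIM_zero_iff tendsto_norm_zero_iff by blast
qed

text \<open>
  Two applications of the multiplication formula turn the Gaussian mean of $|\hat f|^2$ into a
  mean of the autocorrelation against the transformed Gaussian; rescaling the variable moves
  \<open>a\<close> into the argument of the autocorrelation.
\<close>
lemma gaussian_mean_fourier_square:
  fixes f :: "real^'n \<Rightarrow> complex"
  assumes f: "integrable lborel f" and a: "0 < a"
  shows "(\<integral>\<xi>. fourier f \<xi> * (cnj (fourier f \<xi>) * of_real (gauss a \<xi>)) \<partial>lborel)
    = (\<integral>z. of_real (gauss_hat 1 z) * autocorrelation f (a *\<^sub>R z) \<partial>lborel)"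
proof -
  have [measurable]: "f \<in> borel_measurable borel" using f by auto
  have ig: "integrable lborel (\<lambda>\<xi>::real^'n. complex_of_real (gauss a \<xi>))"
    using gauss_fourier(1)[OF a, of 0] by simp
  define B where "B = (\<integral>x. norm (f x) \<partial>lborel)"
  have B: "norm (fourier f \<xi>) \<le> B" for \<xi> unfolding B_def by (rule norm_fourier_le[OF f])
  have iH: "integrable lborel (\<lambda>\<xi>. cnj (fourier f \<xi>) * of_real (gauss a \<xi>))"
  proof (rule Bochner_Integration.integrable_bound[of _ "\<lambda>\<xi>. of_real B * complex_of_real (gauss a \<xi>)"])
    show "AE \<xi> in lborel. norm (cnj (fourier f \<xi>) * of_real (gauss a \<xi>)) \<le> norm (complex_of_real B * complex_of_real (gauss a \<xi>))"
      using B order_trans[OF norm_ge_zero B] by (auto simp: norm_mult gauss_bounds intro!: mult_right_mono)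
  qed (use ig in \<open>auto intro!: integrable_mult_right\<close>)
  have Fg: "fourier (\<lambda>\<xi>. complex_of_real (gauss a \<xi>) * wave x \<xi>) y = of_real (gauss_hat a (x - y))" for x y :: "real^'n"
  proof -
    have "fourier (\<lambda>\<xi>. complex_of_real (gauss a \<xi>) * wave x \<xi>) y = (\<integral>\<xi>. of_real (gauss a \<xi>) * wave (x - y) \<xi> \<partial>lborel)"
      unfolding fourier_eq by (simp add: wave_diff_left wave_commute[of _ y] mult.assoc)
    then show ?thesis by (simp add: gauss_fourier(2)[OF a])
  qed
  have FH: "fourier (\<lambda>\<xi>. cnj (fourier f \<xi>) * of_real (gauss a \<xi>)) x = (\<integral>z. cnj (f (x - z)) * of_real (gauss_hat a z) \<partial>lborel)" for x
  proof -
    have "fourier (\<lambda>\<xi>. cnj (fourier f \<xi>) * of_real (gauss a \<xi>)) x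
        = (\<integral>\<xi>. cnj (fourier f \<xi> * (of_real (gauss a \<xi>) * wave x \<xi>)) \<partial>lborel)"
      unfolding fourier_eq[of "\<lambda>\<xi>. cnj (fourier f \<xi>) * of_real (gauss a \<xi>)"] by (simp add: wave_commute[of x] mult.assoc)
    also have "\<dots> = cnj (\<integral>\<xi>. fourier f \<xi> * (of_real (gauss a \<xi>) * wave x \<xi>) \<partial>lborel)"
      by (rule Bochner_Integration.integral_cnj)
    also have "\<dots> = cnj (\<integral>y. f y * of_real (gauss_hat a (x - y)) \<partial>lborel)"
      by (subst fourier_multiplication_formula[OF f gauss_fourier(1)[OF a]]) (simp add: Fg)
    also have "\<dots> = (\<integral>y. cnj (f y) * of_real (gauss_hat a (x - y)) \<partial>lborel)"
      by (subst Bochner_Integration.integral_cnj[symmetric]) simp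
    also have "\<dots> = (\<integral>z. cnj (f (x - z)) * of_real (gauss_hat a (x - (x - z))) \<partial>lborel)"
      by (rule integral_vec_reflect[symmetric]) measurable
    finally show ?thesis by simp
  qed
  have int: "integrable (lborel \<Otimes>\<^sub>M lborel) (\<lambda>(x, z). f x * (cnj (f (x - z)) * complex_of_real (gauss_hat a z)))"
  proof (rule Bochner_Integration.integrable_bound)
    define G where "G = (sqrt (2 * pi) / a) ^ CARD('n)"
    have G: "0 \<le> G" unfolding G_def using a by simp
    have im: "integrable (lborel \<Otimes>\<^sub>M lborel) (\<lambda>z. f (fst z) * f (fst z - snd z))"
    proof (rule lborel_pair.Fubini_integrable)
      have "(\<integral>z. norm (f (x - z)) \<partial>lborel) = B" for x
      proof -
        have "complex_of_real (\<integral>z. norm (f (x - z)) \<partial>lborel) = (\<integral>z. of_real (norm (f (x - z))) \<partial>lborel)" by simp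
        also have "\<dots> = (\<integral>z. of_real (norm (f z)) \<partial>lborel)"
          by (rule integral_vec_reflect[of "\<lambda>z. of_real (norm (f z))"]) measurable
        also have "\<dots> = complex_of_real B" by (simp add: B_def)
        finally show ?thesis by (simp only: of_real_eq_iff)
      qed
      then show "integrable lborel (\<lambda>x. \<integral>y. norm (f (fst (x, y)) * f (fst (x, y) - snd (x, y))) \<partial>lborel)"
        using f by (auto simp: norm_mult)
      have "integrable lborel (\<lambda>z. f (x - z))" for x
      proof -
        have "integrable (distr lborel borel (\<lambda>z. x - z)) f"
          using f by (simp add: lborel_vec_reflect)
        then show ?thesis by (subst (asm) integrable_distr_eq) auto
      qed
      then show "AE x in lborel. integrable lborel (\<lambda>y. f (fst (x, y)) * f (fst (x, y) - snd (x, y)))"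
        by auto
    qed measurable
    then show "integrable (lborel \<Otimes>\<^sub>M lborel) (\<lambda>z. of_real G * (f (fst z) * f (fst z - snd z)))"
      by (intro integrable_mult_right)
    show "AE z in lborel \<Otimes>\<^sub>M lborel. norm (case z of (x, z) \<Rightarrow> f x * (cnj (f (x - z)) * complex_of_real (gauss_hat a z)))
      \<le> norm (complex_of_real G * (f (fst z) * f (fst z - snd z)))"
    proof (intro always_eventually allI)
      fix w :: "(real^'n) \<times> (real^'n)"
      have "\<bar>gauss_hat a (snd w)\<bar> \<le> G"
        using gauss_hat_le[OF a, of "snd w"] gauss_hat_nonneg[OF a, of "snd w"] by (simp add: G_def)
      from mult_left_mono[OF this, of "norm (f (fst w)) * norm (f (fst w - snd w))"]
      show "norm (case w of (x, z) \<Rightarrow> f x * (cnj (f (x - z)) * complex_of_real (gauss_hat a z)))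
      \<le> norm (complex_of_real G * (f (fst w) * f (fst w - snd w)))"
        using G by (simp add: split_def norm_mult mult_ac)
    qed
  qed (simp add: split_def)
  have "(\<integral>\<xi>. fourier f \<xi> * (cnj (fourier f \<xi>) * of_real (gauss a \<xi>)) \<partial>lborel)
      = (\<integral>x. f x * (\<integral>z. cnj (f (x - z)) * of_real (gauss_hat a z) \<partial>lborel) \<partial>lborel)"
    by (subst fourier_multiplication_formula[OF f iH]) (simp add: FH)
  also have "\<dots> = (\<integral>x. (\<integral>z. f x * (cnj (f (x - z)) * of_real (gauss_hat a z)) \<partial>lborel) \<partial>lborel)"
    by simp
  also have "\<dots> = (\<integral>z. (\<integral>x. f x * (cnj (f (x - z)) * of_real (gauss_hat a z)) \<partial>lborel) \<partial>lborel)"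
    by (rule lborel_pair.Fubini_integral[OF int, symmetric])
  also have "\<dots> = (\<integral>z. of_real (gauss_hat a z) * autocorrelation f z \<partial>lborel)"
    unfolding autocorrelation_def by (simp flip: integral_mult_right_zero add: mult_ac)
  also have "\<dots> = (\<integral>z. of_real (a ^ CARD('n)) * (of_real (gauss_hat a (a *\<^sub>R z)) * autocorrelation f (a *\<^sub>R z)) \<partial>lborel)"
    by (rule integral_vec_scale[OF _ a]) measurable
  also have "\<dots> = (\<integral>z. of_real (gauss_hat 1 z) * autocorrelation f (a *\<^sub>R z) \<partial>lborel)"
    unfolding mult.assoc[symmetric] of_real_mult[symmetric] gauss_hat_scale[OF a] ..
  finally show ?thesis .
qed

text \<open>
  Let the Gaussian in \<open>gaussian_mean_fourier_square\<close> widen to 1. The mean of $|\hat f|^2$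
  increases to $\|\hat f\|_2^2$ by monotone convergence, and the other side tends to the
  autocorrelation at 0, which is $\|f\|_2^2$, because the autocorrelation is bounded and
  continuous at 0.
\<close>
theorem plancherel_L1_L2:
  fixes f :: "real^'n \<Rightarrow> complex"
  assumes f: "integrable lborel f" "f \<in> Lp_space lborel 2"
  shows "Lp_energy lborel 2 (fourier f) = Lp_energy lborel 2 f"
proof -
  have [measurable]: "f \<in> borel_measurable borel" using f by auto
  define a where "a = (\<lambda>k. 1 / real (Suc k))"
  have a: "0 < a k" for k by (simp add: a_def)
  have a0: "a \<longlonglongrightarrow> 0" unfolding a_def by (intro LIMSEQ_Suc lim_1_over_n)
  define F where "F = (\<lambda>k \<xi>. ennreal ((norm (fourier f \<xi>))\<^sup>2 * gauss (a k) \<xi>))"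
  have [measurable]: "F k \<in> borel_measurable borel" for k unfolding F_def by measurable
  have A0: "autocorrelation f 0 = of_real (\<integral>x. (norm (f x))\<^sup>2 \<partial>lborel)"
    unfolding autocorrelation_def by (simp add: complex_norm_square[symmetric] del: of_real_power)
  have Abd: "norm (autocorrelation f z) \<le> (\<integral>x. (norm (f x))\<^sup>2 \<partial>lborel)" for z
  proof -
    let ?I = "\<integral>x. (norm (f x))\<^sup>2 \<partial>lborel"
    have fz: "(\<lambda>x. f (x - z)) \<in> Lp_space lborel 2"
      using Lp_space_translate[OF f(2), of "- z"] by simp
    have e: "Lp_energy lborel 2 (\<lambda>x. cnj (f (x - z))) = Lp_energy lborel 2 f"
      using Lp_energy_translate[of f 2 "- z"] by (simp add: Lp_energy_def)
    have "ennreal ((norm (autocorrelation f z))\<^sup>2) \<le> Lp_energy lborel 2 f * Lp_energy lborel 2 f"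
      using norm_integral_product_square_le[OF f(2) Lp_space_cnj[OF fz]] unfolding e autocorrelation_def .
    also have "\<dots> = ennreal (?I\<^sup>2)"
      by (simp add: L2_energy_eq_integral[OF f(2)] ennreal_mult[symmetric] power2_eq_square)
    finally show ?thesis by (simp add: ennreal_le_iff power2_le_iff_abs_le)
  qed
  have FI: "(\<integral>\<^sup>+\<xi>. F k \<xi> \<partial>lborel) = ennreal (Re (\<integral>z. of_real (gauss_hat 1 z) * autocorrelation f (a k *\<^sub>R z) \<partial>lborel))" for k
  proof -
    let ?h = "\<lambda>\<xi>. (norm (fourier f \<xi>))\<^sup>2 * gauss (a k) \<xi>"
    define B where "B = (\<integral>x. norm (f x) \<partial>lborel)"
    have B: "norm (fourier f \<xi>) \<le> B" for \<xi> unfolding B_def by (rule norm_fourier_le[OF f(1)])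
    have ih: "integrable lborel ?h"
    proof (rule Bochner_Integration.integrable_bound[of _ "\<lambda>\<xi>. of_real (B\<^sup>2) * complex_of_real (gauss (a k) \<xi>)"])
      show "integrable lborel (\<lambda>\<xi>. of_real (B\<^sup>2) * complex_of_real (gauss (a k) \<xi>))"
        using gauss_fourier(1)[OF a, of k 0] by (intro integrable_mult_right) simp
      show "AE \<xi> in lborel. norm (?h \<xi>) \<le> norm (of_real (B\<^sup>2) * complex_of_real (gauss (a k) \<xi>))"
      proof (intro always_eventually allI)
        fix \<xi>
        have "(norm (fourier f \<xi>))\<^sup>2 \<le> B\<^sup>2" by (intro power_mono B) auto
        then show "norm (?h \<xi>) \<le> norm (of_real (B\<^sup>2) * complex_of_real (gauss (a k) \<xi>))"
          using gauss_bounds[of "a k" \<xi>] by (simp add: norm_mult norm_power abs_mult mult_right_mono)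
      qed
    qed measurable
    have "complex_of_real (\<integral>\<xi>. ?h \<xi> \<partial>lborel) = (\<integral>\<xi>. complex_of_real (?h \<xi>) \<partial>lborel)"
      by (rule integral_complex_of_real[symmetric])
    also have "\<dots> = (\<integral>\<xi>. fourier f \<xi> * (cnj (fourier f \<xi>) * of_real (gauss (a k) \<xi>)) \<partial>lborel)"
      unfolding of_real_mult complex_norm_square mult.assoc ..
    also have "\<dots> = (\<integral>z. of_real (gauss_hat 1 z) * autocorrelation f (a k *\<^sub>R z) \<partial>lborel)"
      by (rule gaussian_mean_fourier_square[OF f(1) a])
    finally have "Re (complex_of_real (\<integral>\<xi>. ?h \<xi> \<partial>lborel))
        = Re (\<integral>z. of_real (gauss_hat 1 z) * autocorrelation f (a k *\<^sub>R z) \<partial>lborel)" by (rule arg_cong)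
    then have hv: "(\<integral>\<xi>. ?h \<xi> \<partial>lborel) = Re (\<integral>z. of_real (gauss_hat 1 z) * autocorrelation f (a k *\<^sub>R z) \<partial>lborel)"
      by (simp only: Re_complex_of_real)
    have "AE \<xi> in lborel. 0 \<le> ?h \<xi>" by (simp add: gauss_bounds)
    then show ?thesis
      unfolding F_def hv[symmetric] by (rule nn_integral_eq_integral[OF ih])
  qed
  have "(\<lambda>k. \<integral>z. of_real (gauss_hat 1 z) * autocorrelation f (a k *\<^sub>R z) \<partial>lborel)
      \<longlonglongrightarrow> (\<integral>z. of_real (gauss_hat 1 z) * autocorrelation f 0 \<partial>(lborel :: (real^'n) measure))"
  proof (rule integral_dominated_convergence[where w="\<lambda>z. gauss_hat 1 z * (\<integral>x. (norm (f x))\<^sup>2 \<partial>lborel)"])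
    have "integrable lborel (\<lambda>z::real^'n. Re (complex_of_real (gauss_hat 1 z)))"
      by (intro integrable_Re gauss_hat_integral) simp
    then show "integrable lborel (\<lambda>z::real^'n. gauss_hat 1 z * (\<integral>x. (norm (f x))\<^sup>2 \<partial>lborel))"
      by (intro integrable_mult_left) simp
    show "AE z in lborel. (\<lambda>k. of_real (gauss_hat 1 z) * autocorrelation f (a k *\<^sub>R z)) \<longlonglongrightarrow> of_real (gauss_hat 1 z) * autocorrelation f 0"
    proof (intro always_eventually allI tendsto_mult tendsto_const autocorrelation_continuous_0 f)
      fix z :: "real^'n"
      have "(\<lambda>k. a k *\<^sub>R z) \<longlonglongrightarrow> 0 *\<^sub>R z" by (intro tendsto_intros a0)
      then show "(\<lambda>k. a k *\<^sub>R z) \<longlonglongrightarrow> 0" by simp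
    qed
    show "AE z in lborel. norm (of_real (gauss_hat 1 z) * autocorrelation f (a k *\<^sub>R z)) \<le> gauss_hat 1 z * (\<integral>x. (norm (f x))\<^sup>2 \<partial>lborel)" for k
    proof (intro always_eventually allI)
      fix z :: "real^'n"
      show "norm (of_real (gauss_hat 1 z) * autocorrelation f (a k *\<^sub>R z)) \<le> gauss_hat 1 z * (\<integral>x. (norm (f x))\<^sup>2 \<partial>lborel)"
        using mult_left_mono[OF Abd[of "a k *\<^sub>R z"] gauss_hat_nonneg[of 1 z]] gauss_hat_nonneg[of 1 z]
        by (simp add: norm_mult)
    qed
  qed measurable
  also have "(\<integral>z. of_real (gauss_hat 1 z) * autocorrelation f 0 \<partial>(lborel :: (real^'n) measure)) = autocorrelation f 0"
    using gauss_hat_integral(2)[of 1, where 'n='n] by simp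
  finally have "(\<lambda>k. \<integral>\<^sup>+\<xi>. F k \<xi> \<partial>lborel) \<longlonglongrightarrow> ennreal (Re (autocorrelation f 0))"
    unfolding FI by (intro tendsto_ennrealI tendsto_Re)
  then have lim1: "(\<lambda>k. \<integral>\<^sup>+\<xi>. F k \<xi> \<partial>lborel) \<longlonglongrightarrow> Lp_energy lborel 2 f"
    by (simp add: A0 L2_energy_eq_integral[OF f(2)])
  have inc: "incseq F"
  proof (intro incseq_SucI le_funI)
    fix k and \<xi> :: "real^'n"
    have "gauss (a k) \<xi> \<le> gauss (a (Suc k)) \<xi>"
      unfolding gauss_def
    proof (intro prod_mono conjI)
      fix i
      have "a (Suc k) \<le> a k" by (simp add: a_def frac_le)
      then have "\<bar>a (Suc k) * \<xi> $ i\<bar> \<le> \<bar>a k * \<xi> $ i\<bar>"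
        using a[of k] a[of "Suc k"] by (simp add: abs_mult mult_right_mono)
      then have "(a (Suc k) * \<xi> $ i)\<^sup>2 \<le> (a k * \<xi> $ i)\<^sup>2" by (simp only: abs_le_square_iff)
      then show "exp (- (a k * \<xi> $ i)\<^sup>2 / 2) \<le> exp (- (a (Suc k) * \<xi> $ i)\<^sup>2 / 2)" by simp
    qed simp
    then show "F k \<xi> \<le> F (Suc k) \<xi>"
      unfolding F_def by (intro ennreal_leI mult_left_mono) auto
  qed
  have "(\<lambda>k. F k \<xi>) \<longlonglongrightarrow> ennreal ((norm (fourier f \<xi>))\<^sup>2)" for \<xi>
  proof -
    have "(\<lambda>k. (norm (fourier f \<xi>))\<^sup>2 * gauss (a k) \<xi>) \<longlonglongrightarrow> (norm (fourier f \<xi>))\<^sup>2 * (\<Prod>i\<in>UNIV. exp (- (0 * \<xi> $ i)\<^sup>2 / 2))"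
      unfolding gauss_def by (intro tendsto_intros a0) auto
    then show ?thesis unfolding F_def by (intro tendsto_ennrealI) simp
  qed
  then have "(\<lambda>k. \<integral>\<^sup>+\<xi>. F k \<xi> \<partial>lborel) \<longlonglongrightarrow> (\<integral>\<^sup>+\<xi>. ennreal ((norm (fourier f \<xi>))\<^sup>2) \<partial>lborel)"
    by (intro nn_integral_LIMSEQ inc) auto
  with lim1 show ?thesis
    unfolding L2_energy_eq_square by (rule LIMSEQ_unique[rotated])
qed

section \<open>The Fourier transform on $L^2$\<close>

lemma Lp_space_1_iff: "f \<in> Lp_space M 1 \<longleftrightarrow> integrable M f"
  by (auto simp: Lp_space_def integrable_norm_iff)

lemma L2_norm_square: "f \<in> Lp_space M 2 \<Longrightarrow> (Lp_norm M 2 f)\<^sup>2 = (\<integral>x. (norm (f x))\<^sup>2 \<partial>M)"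
  by (simp add: Lp_norm_def powr_numeral powr_half_sqrt integral_nonneg)

lemma L2_energy_eq_norm: "f \<in> Lp_space M 2 \<Longrightarrow> Lp_energy M 2 f = ennreal ((Lp_norm M 2 f)\<^sup>2)"
  by (simp add: L2_energy_eq_integral L2_norm_square)

lemma L2_norm_eq_iff:
  assumes "f \<in> Lp_space M 2" "g \<in> Lp_space N 2"
  shows "Lp_norm M 2 f = Lp_norm N 2 g \<longleftrightarrow> Lp_energy M 2 f = Lp_energy N 2 g"
  using assms by (simp add: L2_energy_eq_norm power2_eq_iff_nonneg)

lemma L2_norm_le_iff:
  assumes "f \<in> Lp_space M 2" "g \<in> Lp_space N 2"
  shows "Lp_norm M 2 f \<le> Lp_norm N 2 g \<longleftrightarrow> Lp_energy M 2 f \<le> Lp_energy N 2 g"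
  using assms by (simp add: L2_energy_eq_norm ennreal_le_iff)

text \<open>
  Take $d = \|g\| / \|f\|$ in $\|f+g\|^2 \le (1+d)\|f\|^2 + (1+1/d)\|g\|^2$.
\<close>
lemma L2_norm_triangle:
  assumes f: "f \<in> Lp_space M 2" and g: "g \<in> Lp_space M 2"
  shows "Lp_norm M 2 (\<lambda>x. f x + g x) \<le> Lp_norm M 2 f + Lp_norm M 2 g"
proof -
  have [measurable]: "f \<in> borel_measurable M" "g \<in> borel_measurable M" using f g by (auto simp: Lp_space_def)
  have fg: "(\<lambda>x. f x + g x) \<in> Lp_space M 2" by (rule Lp_space_add[OF f g]) simp
  define a b where "a = Lp_norm M 2 f" and "b = Lp_norm M 2 g"
  have z: "AE x in M. u x = 0" if "u \<in> Lp_space M 2" "Lp_norm M 2 u = 0" for u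
  proof -
    have "Lp_energy M 2 u = 0" using that by (simp add: L2_energy_eq_norm)
    then show ?thesis using that by (subst (asm) Lp_energy_eq_0_iff) auto
  qed
  consider "a = 0" | "b = 0" | "a > 0" "b > 0"
    using Lp_norm_nonneg[of M 2 f] Lp_norm_nonneg[of M 2 g] unfolding a_def b_def by linarith
  then show ?thesis
  proof cases
    case 1
    have "Lp_norm M 2 (\<lambda>x. f x + g x) = Lp_norm M 2 g"
      by (rule Lp_norm_cong_AE) (use z[OF f] 1 in \<open>auto simp: a_def\<close>)
    then show ?thesis by simp
  next
    case 2
    have "Lp_norm M 2 (\<lambda>x. f x + g x) = Lp_norm M 2 f"
      by (rule Lp_norm_cong_AE) (use z[OF g] 2 in \<open>auto simp: b_def\<close>)
    then show ?thesis by simp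
  next
    case 3
    have "ennreal ((Lp_norm M 2 (\<lambda>x. f x + g x))\<^sup>2) \<le> ennreal (1 + b / a) * ennreal (a\<^sup>2) + ennreal (1 + 1 / (b / a)) * ennreal (b\<^sup>2)"
      using L2_energy_add_le[of f M g "b / a"] 3 f g fg by (simp add: L2_energy_eq_norm a_def b_def)
    also have "\<dots> = ennreal ((1 + b / a) * a\<^sup>2 + (1 + 1 / (b / a)) * b\<^sup>2)"
      using 3 by (simp add: ennreal_mult)
    also have "(1 + b / a) * a\<^sup>2 + (1 + 1 / (b / a)) * b\<^sup>2 = (a + b)\<^sup>2"
      using 3 by (simp add: field_simps power2_eq_square)
    finally have "(Lp_norm M 2 (\<lambda>x. f x + g x))\<^sup>2 \<le> (a + b)\<^sup>2" by (simp add: ennreal_le_iff)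
    then show ?thesis
      unfolding a_def b_def by (rule power2_le_imp_le) simp
  qed
qed

lemma L2_norm_tendsto:
  assumes F: "\<And>k. F k \<in> Lp_space M 2" and f: "f \<in> Lp_space M 2"
    and lim: "(\<lambda>k. Lp_norm M 2 (\<lambda>x. F k x - f x)) \<longlonglongrightarrow> 0"
  shows "(\<lambda>k. Lp_norm M 2 (F k)) \<longlonglongrightarrow> Lp_norm M 2 f"
proof (rule LIM_zero_cancel, rule Lim_null_comparison[OF _ lim], intro always_eventually allI)
  fix k
  have d: "(\<lambda>x. F k x - f x) \<in> Lp_space M 2" "(\<lambda>x. f x - F k x) \<in> Lp_space M 2" for k
    by (rule Lp_space_diff[OF F f], simp, rule Lp_space_diff[OF f F], simp)
  show "norm (Lp_norm M 2 (F k) - Lp_norm M 2 f) \<le> Lp_norm M 2 (\<lambda>x. F k x - f x)"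
  proof -
    have "Lp_norm M 2 (F k) \<le> Lp_norm M 2 f + Lp_norm M 2 (\<lambda>x. F k x - f x)"
      using L2_norm_triangle[OF f d(1)[of k]] by simp
    moreover have "Lp_norm M 2 f \<le> Lp_norm M 2 (F k) + Lp_norm M 2 (\<lambda>x. f x - F k x)"
      using L2_norm_triangle[OF F[of k] d(2)[of k]] by simp
    moreover have "Lp_norm M 2 (\<lambda>x. f x - F k x) = Lp_norm M 2 (\<lambda>x. F k x - f x)"
      by (simp add: Lp_norm_def norm_minus_commute)
    ultimately show ?thesis by (simp add: abs_le_iff)
  qed
qed

lemma L2_inner_expand:
  assumes f: "f \<in> Lp_space M 2" and g: "g \<in> Lp_space M 2"
  shows "(\<integral>x. (norm (f x + c * g x))\<^sup>2 \<partial>M)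
    = (\<integral>x. (norm (f x))\<^sup>2 \<partial>M) + (norm c)\<^sup>2 * (\<integral>x. (norm (g x))\<^sup>2 \<partial>M)
      + 2 * Re (cnj c * (\<integral>x. f x * cnj (g x) \<partial>M))"
proof -
  have pt: "(norm (f x + c * g x))\<^sup>2 = (norm (f x))\<^sup>2 + (norm c)\<^sup>2 * (norm (g x))\<^sup>2 + 2 * Re (cnj c * (f x * cnj (g x)))" for x
    unfolding cmod_power2 by (simp add: power2_eq_square algebra_simps)
  have i: "integrable M (\<lambda>x. (norm (f x))\<^sup>2)" "integrable M (\<lambda>x. (norm (g x))\<^sup>2)"
    using f g by (auto simp: Lp_space_2_iff)
  have j: "integrable M (\<lambda>x. cnj c * (f x * cnj (g x)))"
    using integrable_L2_product(2)[OF f g] by (rule integrable_mult_right)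
  have "(\<integral>x. 2 * Re (cnj c * (f x * cnj (g x))) \<partial>M) = 2 * Re (cnj c * (\<integral>x. f x * cnj (g x) \<partial>M))"
  proof -
    have "(\<integral>x. 2 * Re (cnj c * (f x * cnj (g x))) \<partial>M) = 2 * (\<integral>x. Re (cnj c * (f x * cnj (g x))) \<partial>M)"
      by (rule integral_mult_right_zero)
    also have "(\<integral>x. Re (cnj c * (f x * cnj (g x))) \<partial>M) = Re (\<integral>x. cnj c * (f x * cnj (g x)) \<partial>M)"
      by (rule integral_Re[OF j])
    also have "(\<integral>x. cnj c * (f x * cnj (g x)) \<partial>M) = cnj c * (\<integral>x. f x * cnj (g x) \<partial>M)"
      by (rule integral_mult_right_zero)
    finally show ?thesis .
  qed
  moreover have "integrable M (\<lambda>x. 2 * Re (cnj c * (f x * cnj (g x))))"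
    using integrable_Re[OF j] by (rule integrable_mult_right)
  ultimately show ?thesis
    unfolding pt using i by simp
qed

text \<open>
  What is used of a group: the Plancherel identity on $L^1 \cap L^2$. It gives the
  properties of the $L^2$ transform for Euclidean space and for the torus at once.
\<close>
locale plancherel_group =
  fixes G :: "('g, 'd) lca"
  assumes pairing_measurable: "\<And>\<xi>. (\<lambda>x. pairing G x \<xi>) \<in> borel_measurable (haar G)"
    and norm_pairing: "\<And>x \<xi>. norm (pairing G x \<xi>) = 1"
    and fourier_L1_measurable: "\<And>f. integrable (haar G) f \<Longrightarrow> fourier_L1 G f \<in> borel_measurable (dual_haar G)"
    and plancherel_dense: "\<And>f. integrable (haar G) f \<Longrightarrow> f \<in> Lp_space (haar G) 2 \<Longrightarrow>
      Lp_energy (dual_haar G) 2 (fourier_L1 G f) = Lp_energy (haar G) 2 f"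
begin

lemma fourier_L1_integrable:
  assumes "integrable (haar G) f"
  shows "integrable (haar G) (\<lambda>x. f x * cnj (pairing G x \<xi>))"
proof (rule integrable_mult_unimodular[OF assms])
  note pairing_measurable[measurable]
  show "(\<lambda>x. cnj (pairing G x \<xi>)) \<in> borel_measurable (haar G)" by measurable
qed (simp add: norm_pairing)

lemma fourier_L1_add_cmult:
  assumes f: "integrable (haar G) f" and g: "integrable (haar G) g"
  shows "fourier_L1 G (\<lambda>x. f x + c * g x) \<xi> = fourier_L1 G f \<xi> + c * fourier_L1 G g \<xi>"
proof -
  have "fourier_L1 G (\<lambda>x. f x + c * g x) \<xi>
      = (\<integral>x. f x * cnj (pairing G x \<xi>) + c * (g x * cnj (pairing G x \<xi>)) \<partial>haar G)"
    unfolding fourier_L1_def by (simp add: algebra_simps)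
  also have "\<dots> = fourier_L1 G f \<xi> + c * fourier_L1 G g \<xi>"
    unfolding fourier_L1_def
    by (subst Bochner_Integration.integral_add)
       (auto intro!: fourier_L1_integrable f g integrable_mult_right)
  finally show ?thesis .
qed

lemma fourier_L1_in_L2:
  assumes "integrable (haar G) f" "f \<in> Lp_space (haar G) 2"
  shows "fourier_L1 G f \<in> Lp_space (dual_haar G) 2"
  using assms plancherel_dense[OF assms] fourier_L1_measurable[OF assms(1)] by (simp add: Lp_space_iff)

lemma fourier_L2_of_L1:
  assumes "integrable (haar G) f" "f \<in> Lp_space (haar G) 2"
  shows "fourier_L2 G f (fourier_L1 G f)"
  unfolding fourier_L2_def
  by (intro conjI exI[of _ "\<lambda>_. f"] fourier_L1_in_L2 assms)
     (use assms fourier_L1_in_L2[OF assms] in \<open>auto simp: Lp_space_1_iff Lp_norm_def\<close>)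

lemma fourier_L2_spaces:
  assumes "fourier_L2 G f g"
  shows "f \<in> Lp_space (haar G) 2" "g \<in> Lp_space (dual_haar G) 2"
  using assms by (auto simp: fourier_L2_def)

lemma fourier_L2_norm:
  assumes "fourier_L2 G f g"
  shows "Lp_norm (dual_haar G) 2 g = Lp_norm (haar G) 2 f"
proof -
  from assms obtain F where F: "\<And>k. F k \<in> Lp_space (haar G) 1 \<inter> Lp_space (haar G) 2"
      "\<And>k. fourier_L1 G (F k) \<in> Lp_space (dual_haar G) 2"
      "(\<lambda>k. Lp_norm (haar G) 2 (\<lambda>x. F k x - f x)) \<longlonglongrightarrow> 0"
      "(\<lambda>k. Lp_norm (dual_haar G) 2 (\<lambda>\<xi>. fourier_L1 G (F k) \<xi> - g \<xi>)) \<longlonglongrightarrow> 0"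
    unfolding fourier_L2_def by blast
  have 1: "(\<lambda>k. Lp_norm (haar G) 2 (F k)) \<longlonglongrightarrow> Lp_norm (haar G) 2 f"
    by (rule L2_norm_tendsto) (use F fourier_L2_spaces[OF assms] in auto)
  have 2: "(\<lambda>k. Lp_norm (dual_haar G) 2 (fourier_L1 G (F k))) \<longlonglongrightarrow> Lp_norm (dual_haar G) 2 g"
    by (rule L2_norm_tendsto) (use F fourier_L2_spaces[OF assms] in auto)
  have "Lp_norm (dual_haar G) 2 (fourier_L1 G (F k)) = Lp_norm (haar G) 2 (F k)" for k
    using F(1)[of k] F(2)[of k] by (subst L2_norm_eq_iff) (auto simp: Lp_space_1_iff plancherel_dense)
  with 1 2 show ?thesis by (auto intro: LIMSEQ_unique)
qed

lemma fourier_L2_energy: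
  assumes "fourier_L2 G f g"
  shows "Lp_energy (dual_haar G) 2 g = Lp_energy (haar G) 2 f"
  using fourier_L2_norm[OF assms] fourier_L2_spaces[OF assms] by (simp add: L2_energy_eq_norm)

lemma fourier_L2_add_cmult:
  assumes 1: "fourier_L2 G f g" and 2: "fourier_L2 G f' g'"
  shows "fourier_L2 G (\<lambda>x. f x + c * f' x) (\<lambda>\<xi>. g \<xi> + c * g' \<xi>)"
proof -
  let ?H = "Lp_space (haar G) 2" and ?D = "Lp_space (dual_haar G) 2"
  from 1 obtain F where F: "\<And>k. F k \<in> Lp_space (haar G) 1 \<inter> ?H" "\<And>k. fourier_L1 G (F k) \<in> ?D"
      "(\<lambda>k. Lp_norm (haar G) 2 (\<lambda>x. F k x - f x)) \<longlonglongrightarrow> 0"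
      "(\<lambda>k. Lp_norm (dual_haar G) 2 (\<lambda>\<xi>. fourier_L1 G (F k) \<xi> - g \<xi>)) \<longlonglongrightarrow> 0"
    unfolding fourier_L2_def by blast
  from 2 obtain F' where F': "\<And>k. F' k \<in> Lp_space (haar G) 1 \<inter> ?H" "\<And>k. fourier_L1 G (F' k) \<in> ?D"
      "(\<lambda>k. Lp_norm (haar G) 2 (\<lambda>x. F' k x - f' x)) \<longlonglongrightarrow> 0"
      "(\<lambda>k. Lp_norm (dual_haar G) 2 (\<lambda>\<xi>. fourier_L1 G (F' k) \<xi> - g' \<xi>)) \<longlonglongrightarrow> 0"
    unfolding fourier_L2_def by blast
  note sp = fourier_L2_spaces[OF 1] fourier_L2_spaces[OF 2]
  have i: "integrable (haar G) (F k)" "integrable (haar G) (F' k)" for k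
    using F(1) F'(1) by (auto simp: Lp_space_1_iff)
  have lim: "(\<lambda>k. Lp_norm M 2 (\<lambda>x. (U k x + c * U' k x) - (u x + c * u' x))) \<longlonglongrightarrow> 0"
    if U: "\<And>k. U k \<in> Lp_space M 2" "\<And>k. U' k \<in> Lp_space M 2" "u \<in> Lp_space M 2" "u' \<in> Lp_space M 2"
      and l: "(\<lambda>k. Lp_norm M 2 (\<lambda>x. U k x - u x)) \<longlonglongrightarrow> 0" "(\<lambda>k. Lp_norm M 2 (\<lambda>x. U' k x - u' x)) \<longlonglongrightarrow> 0"
    for M :: "'m measure" and U U' u u'
  proof -
    have d: "(\<lambda>x. U k x - u x) \<in> Lp_space M 2" "(\<lambda>x. U' k x - u' x) \<in> Lp_space M 2" for k
      by (rule Lp_space_diff[OF U(1) U(3)], simp, rule Lp_space_diff[OF U(2) U(4)], simp)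
    have d': "(\<lambda>x. c * (U' k x - u' x)) \<in> Lp_space M 2" for k by (rule Lp_space_cmult[OF d(2)])
    have s: "(\<lambda>x. (U k x - u x) + c * (U' k x - u' x)) \<in> Lp_space M 2" for k
      by (rule Lp_space_add[OF d(1) d']) simp
    have "(\<lambda>k. Lp_energy M 2 (\<lambda>x. U' k x - u' x)) \<longlonglongrightarrow> 0"
      using l(2) by (subst (asm) Lp_norm_tendsto_0_iff[OF d(2)]) auto
    then have "(\<lambda>k. ennreal (norm c powr 2) * Lp_energy M 2 (\<lambda>x. U' k x - u' x)) \<longlonglongrightarrow> ennreal (norm c powr 2) * 0"
      by (rule ennreal_tendsto_cmult[rotated]) simp
    then have "(\<lambda>k. Lp_energy M 2 (\<lambda>x. c * (U' k x - u' x))) \<longlonglongrightarrow> 0"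
      using d(2) by (subst Lp_energy_cmult) (auto simp: Lp_space_def)
    then have "(\<lambda>k. Lp_energy M 2 (\<lambda>x. (U k x - u x) + c * (U' k x - u' x))) \<longlonglongrightarrow> 0"
      using l(1) d d' by (intro Lp_energy_tendsto_0_add) (auto simp: Lp_norm_tendsto_0_iff Lp_space_def)
    then have "(\<lambda>k. Lp_norm M 2 (\<lambda>x. (U k x - u x) + c * (U' k x - u' x))) \<longlonglongrightarrow> 0"
      by (subst Lp_norm_tendsto_0_iff[OF s]) auto
    then show ?thesis by (simp add: algebra_simps)
  qed
  have eq: "fourier_L1 G (\<lambda>x. F k x + c * F' k x) = (\<lambda>\<xi>. fourier_L1 G (F k) \<xi> + c * fourier_L1 G (F' k) \<xi>)" for k
    by (rule ext) (rule fourier_L1_add_cmult[OF i])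
  show ?thesis
    unfolding fourier_L2_def
  proof (intro conjI exI[of _ "\<lambda>k x. F k x + c * F' k x"] allI)
    show "(\<lambda>k. Lp_norm (haar G) 2 (\<lambda>x. F k x + c * F' k x - (f x + c * f' x))) \<longlonglongrightarrow> 0"
      by (rule lim) (use F F' sp in auto)
    show "(\<lambda>k. Lp_norm (dual_haar G) 2 (\<lambda>\<xi>. fourier_L1 G (\<lambda>x. F k x + c * F' k x) \<xi> - (g \<xi> + c * g' \<xi>))) \<longlonglongrightarrow> 0"
      unfolding eq by (rule lim) (use F F' sp in auto)
  qed (use F F' sp in \<open>auto simp: eq intro!: Lp_space_add Lp_space_cmult\<close>)
qed

lemma fourier_L2_unique:
  assumes "fourier_L2 G f g" "fourier_L2 G f' g'" "AE x in haar G. f x = f' x"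
  shows "AE \<xi> in dual_haar G. g \<xi> = g' \<xi>"
proof -
  from fourier_L2_energy[OF fourier_L2_add_cmult[OF assms(1,2), of "-1"]]
  have "Lp_energy (dual_haar G) 2 (\<lambda>\<xi>. g \<xi> - g' \<xi>) = Lp_energy (haar G) 2 (\<lambda>x. f x - f' x)" by simp
  also have "\<dots> = Lp_energy (haar G) 2 (\<lambda>x. 0)"
    by (rule Lp_energy_cong_AE) (use assms(3) in auto)
  finally have "Lp_energy (dual_haar G) 2 (\<lambda>\<xi>. g \<xi> - g' \<xi>) = 0" by (simp add: Lp_energy_def)
  then show ?thesis
    using fourier_L2_spaces[OF assms(1)] fourier_L2_spaces[OF assms(2)]
    by (subst (asm) Lp_energy_eq_0_iff) (auto simp: Lp_space_def)
qed

lemma fourier_L2_injective: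
  assumes "fourier_L2 G f g" "fourier_L2 G f' g'" "AE \<xi> in dual_haar G. g \<xi> = g' \<xi>"
  shows "AE x in haar G. f x = f' x"
proof -
  from fourier_L2_energy[OF fourier_L2_add_cmult[OF assms(1,2), of "-1"]]
  have "Lp_energy (haar G) 2 (\<lambda>x. f x - f' x) = Lp_energy (dual_haar G) 2 (\<lambda>\<xi>. g \<xi> - g' \<xi>)" by simp
  also have "\<dots> = Lp_energy (dual_haar G) 2 (\<lambda>x. 0)"
    by (rule Lp_energy_cong_AE) (use assms(3) in auto)
  finally have "Lp_energy (haar G) 2 (\<lambda>x. f x - f' x) = 0" by (simp add: Lp_energy_def)
  then show ?thesis
    using fourier_L2_spaces[OF assms(1)] fourier_L2_spaces[OF assms(2)]
    by (subst (asm) Lp_energy_eq_0_iff) (auto simp: Lp_space_def)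
qed

lemma fourier_L2_cong_AE:
  assumes "fourier_L2 G f g" "AE \<xi> in dual_haar G. g \<xi> = g' \<xi>" "g' \<in> borel_measurable (dual_haar G)"
  shows "fourier_L2 G f g'"
proof -
  have eq: "Lp_norm (dual_haar G) 2 (\<lambda>\<xi>. u \<xi> - g \<xi>) = Lp_norm (dual_haar G) 2 (\<lambda>\<xi>. u \<xi> - g' \<xi>)"
    if "u \<in> Lp_space (dual_haar G) 2" for u
    by (rule Lp_norm_cong_AE) (use that assms fourier_L2_spaces[OF assms(1)] in \<open>auto simp: Lp_space_def\<close>)
  from assms(1) obtain F where F: "\<And>k. F k \<in> Lp_space (haar G) 1 \<inter> Lp_space (haar G) 2"
      "\<And>k. fourier_L1 G (F k) \<in> Lp_space (dual_haar G) 2"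
      "(\<lambda>k. Lp_norm (haar G) 2 (\<lambda>x. F k x - f x)) \<longlonglongrightarrow> 0"
      "(\<lambda>k. Lp_norm (dual_haar G) 2 (\<lambda>\<xi>. fourier_L1 G (F k) \<xi> - g \<xi>)) \<longlonglongrightarrow> 0"
    unfolding fourier_L2_def by blast
  show ?thesis
    unfolding fourier_L2_def
  proof (intro conjI exI[of _ F] allI F)
    show "(\<lambda>k. Lp_norm (dual_haar G) 2 (\<lambda>\<xi>. fourier_L1 G (F k) \<xi> - g' \<xi>)) \<longlonglongrightarrow> 0"
      using F(4) by (simp only: eq[OF F(2)])
    show "g' \<in> Lp_space (dual_haar G) 2"
      by (rule Lp_space_cong_AE[OF fourier_L2_spaces(2)[OF assms(1)] assms(2,3)])
  qed (rule fourier_L2_spaces[OF assms(1)])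
qed

theorem parseval:
  assumes 1: "fourier_L2 G f g" and 2: "fourier_L2 G f' g'"
  shows "(\<integral>x. f x * cnj (f' x) \<partial>haar G) = (\<integral>\<xi>. g \<xi> * cnj (g' \<xi>) \<partial>dual_haar G)"
proof -
  note sp = fourier_L2_spaces[OF 1] fourier_L2_spaces[OF 2]
  have sq: "(\<integral>x. (norm (u x))\<^sup>2 \<partial>haar G) = (\<integral>\<xi>. (norm (v \<xi>))\<^sup>2 \<partial>dual_haar G)" if "fourier_L2 G u v" for u v
    using fourier_L2_norm[OF that] fourier_L2_spaces[OF that] by (simp flip: L2_norm_square)
  have "Re (cnj c * (\<integral>x. f x * cnj (f' x) \<partial>haar G)) = Re (cnj c * (\<integral>\<xi>. g \<xi> * cnj (g' \<xi>) \<partial>dual_haar G))" for c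
    using L2_inner_expand[OF sp(1,3), of c] L2_inner_expand[OF sp(2,4), of c]
      sq[OF fourier_L2_add_cmult[OF 1 2, of c]] sq[OF 1] sq[OF 2] by simp
  from this[of 1] this[of \<i>] show ?thesis by (simp add: complex_eq_iff)
qed

end

interpretation euclid: plancherel_group "euclidean_lca :: (real^'n, real^'n) lca"
  by unfold_locales (auto simp: plancherel_L1_L2 intro!: fourier_measurable)

lemma fourier_translate:
  fixes f :: "real^'n \<Rightarrow> complex"
  assumes [measurable]: "f \<in> borel_measurable borel"
  shows "fourier (\<lambda>x. f (x + h)) \<xi> = wave h \<xi> * fourier f \<xi>"
proof -
  have "fourier (\<lambda>x. f (x + h)) \<xi> = (\<integral>x. wave h \<xi> * (f (x + h) * cnj (wave (x + h) \<xi>)) \<partial>lborel)"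
  proof -
    have "wave h \<xi> * (f (x + h) * cnj (wave (x + h) \<xi>))
        = f (x + h) * cnj (wave x \<xi>) * (wave h \<xi> * cnj (wave h \<xi>))" for x
      unfolding wave_add_left complex_cnj_mult by (simp only: mult_ac)
    then show ?thesis unfolding fourier_eq by (simp only: wave_cnj_cancel mult_1_right)
  qed
  also have "\<dots> = wave h \<xi> * (\<integral>x. f (x + h) * cnj (wave (x + h) \<xi>) \<partial>lborel)" by simp
  also have "(\<integral>x. f (x + h) * cnj (wave (x + h) \<xi>) \<partial>lborel) = (\<integral>x. f x * cnj (wave x \<xi>) \<partial>lborel)"
    by (rule integral_vec_translate) measurable
  finally show ?thesis by (simp add: fourier_eq)
qed

lemma fourier_L2_translate:
  fixes f :: "real^'n \<Rightarrow> complex"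
  assumes "fourier_L2 euclidean_lca f g"
  shows "fourier_L2 euclidean_lca (\<lambda>x. f (x + h)) (\<lambda>\<xi>. wave h \<xi> * g \<xi>)"
proof -
  from assms obtain F where F: "\<And>k. F k \<in> Lp_space lborel 1 \<inter> Lp_space lborel 2" "\<And>k. fourier (F k) \<in> Lp_space lborel 2"
      "(\<lambda>k. Lp_norm lborel 2 (\<lambda>x. F k x - f x)) \<longlonglongrightarrow> 0"
      "(\<lambda>k. Lp_norm lborel 2 (\<lambda>\<xi>. fourier (F k) \<xi> - g \<xi>)) \<longlonglongrightarrow> 0"
    unfolding fourier_L2_def by auto
  have sp: "f \<in> Lp_space lborel 2" "g \<in> Lp_space lborel 2" using euclid.fourier_L2_spaces[OF assms] by auto
  have [measurable]: "F k \<in> borel_measurable borel" "f \<in> borel_measurable borel" "g \<in> borel_measurable borel" for k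
    using F(1)[of k] sp by (auto simp: Lp_space_def)
  have mw: "(\<lambda>\<xi>. wave h \<xi> * u \<xi>) \<in> Lp_space lborel 2" if "u \<in> Lp_space lborel 2" for u :: "real^'n \<Rightarrow> complex"
  proof -
    have [measurable]: "u \<in> borel_measurable borel" using that by (simp add: Lp_space_def)
    show ?thesis using that by (simp add: Lp_space_iff Lp_energy_def norm_mult)
  qed
  have F1: "fourier (\<lambda>x. F k (x + h)) = (\<lambda>\<xi>. wave h \<xi> * fourier (F k) \<xi>)" for k
    by (rule ext, rule fourier_translate) measurable
  show ?thesis
    unfolding fourier_L2_def
  proof (intro conjI exI[of _ "\<lambda>k x. F k (x + h)"] allI)
    have "Lp_norm lborel 2 (\<lambda>x. F k (x + h) - f (x + h)) = Lp_norm lborel 2 (\<lambda>x. F k x - f x)" for k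
    proof (subst L2_norm_eq_iff)
      show d: "(\<lambda>x. F k x - f x) \<in> Lp_space lborel 2" using F(1)[of k] sp by (intro Lp_space_diff) auto
      show "(\<lambda>x. F k (x + h) - f (x + h)) \<in> Lp_space lborel 2" by (rule Lp_space_translate[OF d])
      show "Lp_energy lborel 2 (\<lambda>x. F k (x + h) - f (x + h)) = Lp_energy lborel 2 (\<lambda>x. F k x - f x)"
        by (rule Lp_energy_translate[of "\<lambda>x. F k x - f x"]) measurable
    qed
    then show "(\<lambda>k. Lp_norm (haar euclidean_lca) 2 (\<lambda>x. F k (x + h) - f (x + h))) \<longlonglongrightarrow> 0"
      using F(3) by simp
    have "Lp_norm lborel 2 (\<lambda>\<xi>. wave h \<xi> * fourier (F k) \<xi> - wave h \<xi> * g \<xi>) = Lp_norm lborel 2 (\<lambda>\<xi>. fourier (F k) \<xi> - g \<xi>)" for k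
      unfolding right_diff_distrib[symmetric] by (simp add: Lp_norm_def norm_mult)
    then show "(\<lambda>k. Lp_norm (dual_haar euclidean_lca) 2 (\<lambda>\<xi>. fourier (\<lambda>x. F k (x + h)) \<xi> - wave h \<xi> * g \<xi>)) \<longlonglongrightarrow> 0"
      using F(4) by (simp add: F1)
  qed (use F sp in \<open>auto simp: F1 intro!: Lp_space_translate mw\<close>)
qed

section \<open>Parseval's identity on the torus\<close>

lemma torus_simps [simp]:
  "haar torus_lca = cube_measure" "dual_haar torus_lca = lattice"
  "pairing torus_lca x n = wave x (lattice_vec n)"
  by (simp_all add: torus_lca_def cube_measure_def unit_cube_def wave_def inner_vec_def)

lemma emeasure_unit_cube [simp]: "emeasure cube_measure unit_cube = 1"
  using cube_prob.emeasure_space_1 by simp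

abbreviation fourier_coeff :: "(real ^ 'n \<Rightarrow> complex) \<Rightarrow> int ^ 'n \<Rightarrow> complex" where
  "fourier_coeff \<equiv> fourier_L1 torus_lca"

lemma fourier_coeff_eq: "fourier_coeff f n = (\<integral>x. f x * cnj (wave x (lattice_vec n)) \<partial>cube_measure)"
  by (simp add: fourier_L1_def)

definition zero_ext :: "(real ^ 'n \<Rightarrow> complex) \<Rightarrow> real ^ 'n \<Rightarrow> complex" where
  "zero_ext f x = indicator unit_cube x *\<^sub>R f x"

lemma zero_ext_measurable [measurable]:
  "f \<in> borel_measurable cube_measure \<Longrightarrow> zero_ext f \<in> borel_measurable borel"
  unfolding zero_ext_def[abs_def] cube_measure_def
  by (subst (asm) borel_measurable_restrict_space_iff) auto

lemma integral_cube_eq: "(\<integral>x. f x \<partial>cube_measure) = (\<integral>x. zero_ext f x \<partial>lborel)"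
  unfolding cube_measure_def zero_ext_def by (rule integral_restrict_space) simp

lemma integrable_cube_iff: "integrable cube_measure f \<longleftrightarrow> integrable lborel (zero_ext f)"
  unfolding cube_measure_def zero_ext_def by (subst integrable_restrict_space) simp_all

lemma Lp_energy_zero_ext: "Lp_energy lborel p (zero_ext f) = Lp_energy cube_measure p f"
  unfolding Lp_energy_def cube_measure_def
  by (subst nn_integral_restrict_space)
     (auto intro!: nn_integral_cong simp: zero_ext_def split: split_indicator)

lemma measurable_cube_wave [measurable]:
  "(\<lambda>x. wave x \<xi>) \<in> borel_measurable cube_measure"
  by (rule measurable_cube_measureI) measurable

lemma L2_cube_integrable:
  assumes "f \<in> Lp_space cube_measure 2"
  shows "integrable cube_measure f"
proof (rule Bochner_Integration.integrable_bound[of _ "\<lambda>x. 1 + (norm (f x))\<^sup>2"])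
  show "AE x in cube_measure. norm (f x) \<le> norm (1 + (norm (f x))\<^sup>2)"
  proof (intro always_eventually allI)
    fix x
    have "0 \<le> (norm (f x) - 1)\<^sup>2" by simp
    then have "2 * norm (f x) \<le> 1 + (norm (f x))\<^sup>2" by (simp add: power2_diff)
    then show "norm (f x) \<le> norm (1 + (norm (f x))\<^sup>2)" using norm_ge_zero[of "f x"] unfolding real_norm_def by linarith
  qed
qed (use assms in \<open>auto simp: Lp_space_2_iff\<close>)

lemma integral_indicator_cis:
  fixes a b s :: real
  assumes "a \<le> b" "s \<noteq> 0"
  shows "(\<integral>t. indicator {a..b} t *\<^sub>R cis (2 * pi * (s * t)) \<partial>lborel) = (cis (2 * pi * (s * b)) - cis (2 * pi * (s * a))) / (\<i> * of_real (2 * pi * s))"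
proof -
  let ?F = "\<lambda>t. cis (2 * pi * (s * t)) / (\<i> * of_real (2 * pi * s))"
  have "(\<integral>t. indicator {a..b} t *\<^sub>R cis (2 * pi * (s * t)) \<partial>lborel) = ?F b - ?F a"
  proof (rule integral_FTC_Icc[OF assms(1)])
    fix t assume "a \<le> t" "t \<le> b"
    have "((\<lambda>t. exp (\<i> * of_real (2 * pi * s) * of_real t)) has_vector_derivative
        (exp (\<i> * of_real (2 * pi * s) * of_real t) * (\<i> * of_real (2 * pi * s)))) (at t within {a..b})"
      by (rule has_vector_derivative_real_field) (auto intro!: derivative_eq_intros)
    from has_vector_derivative_divide[OF this, of "\<i> * of_real (2 * pi * s)"]
    show "(?F has_vector_derivative cis (2 * pi * (s * t))) (at t within {a..b})"
      using assms(2) by (simp add: cis_conv_exp mult_ac)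
  qed (auto intro!: continuous_intros)
  then show ?thesis by (simp add: diff_divide_distrib)
qed

lemma integrable_indicator_cis:
  "integrable lborel (\<lambda>t. indicator {a..b::real} t *\<^sub>R cis (2 * pi * (s * t)))"
  using borel_integrable_atLeastAtMost'[of a b "\<lambda>t. cis (2 * pi * (s * t))"]
  by (simp add: set_integrable_def continuous_intros)

lemma integral_cube_wave:
  fixes k :: "int^'n"
  shows "(\<integral>x. wave x (lattice_vec k) \<partial>cube_measure) = (if k = 0 then 1 else 0)"
proof -
  let ?g = "\<lambda>i t. indicator {0..1::real} t *\<^sub>R cis (2 * pi * (of_int (k $ i) * t))"
  have "AE x in (lborel :: (real^'n) measure). \<forall>i. x $ i \<noteq> 1"
  proof -
    have "AE x in (lborel :: (real^'n) measure). x $ i \<noteq> 1" for i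
    proof (rule AE_I')
      have "{x :: real^'n. axis i 1 \<bullet> x = 1} \<in> null_sets lebesgue"
        using negligible_hyperplane[of "axis i (1::real)" 1] by (auto simp: negligible_iff_null_sets axis_eq_0_iff)
      moreover have "{x :: real^'n. axis i 1 \<bullet> x = 1} = {x. x $ i = 1}" by (simp add: inner_axis')
      moreover have "{x :: real^'n. x $ i = 1} \<in> sets borel" by measurable
      ultimately show "{x :: real^'n. x $ i = 1} \<in> null_sets lborel"
        by (auto simp: null_sets_def)
    qed auto
    then show ?thesis by (simp add: AE_all_countable)
  qed
  then have ae: "AE x in lborel. zero_ext (\<lambda>x. wave x (lattice_vec k)) x = (\<Prod>i\<in>UNIV. ?g i (x $ i))"
  proof eventually_elim
    case (elim x)
    show ?case
    proof (cases "x \<in> unit_cube")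
      case True
      then have "indicator {0..1} (x $ i) = (1::real)" for i by (auto simp: unit_cube_def less_imp_le)
      then show ?thesis using True by (simp add: zero_ext_def wave_eq_prod)
    next
      case False
      then obtain i where "\<not> (0 \<le> x $ i \<and> x $ i < 1)" by (auto simp: unit_cube_def)
      then have "?g i (x $ i) = 0" using elim by (auto simp: indicator_def less_le)
      then have "(\<Prod>i\<in>UNIV. ?g i (x $ i)) = 0" by (meson UNIV_I finite prod_zero)
      then show ?thesis using False by (simp add: zero_ext_def)
    qed
  qed
  have "(\<integral>x. wave x (lattice_vec k) \<partial>cube_measure) = (\<integral>x. (\<Prod>i\<in>UNIV. ?g i (x $ i)) \<partial>lborel)"
    unfolding integral_cube_eq by (rule integral_cong_AE) (use ae in auto)
  also have "\<dots> = (\<Prod>i\<in>UNIV. \<integral>t. ?g i t \<partial>lborel)"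
    by (rule integral_lborel_prod(2)) (rule integrable_indicator_cis)
  also have "\<dots> = (\<Prod>i\<in>UNIV. if k $ i = 0 then 1 else 0)"
  proof (intro prod.cong refl)
    fix i
    show "(\<integral>t. ?g i t \<partial>lborel) = (if k $ i = 0 then 1 else 0)"
    proof (cases "k $ i = 0")
      case False
      have "cis (2 * pi * of_int (k $ i)) = 1" by (rule cis_multiple_2pi) simp
      then show ?thesis using False integral_indicator_cis[of 0 1 "of_int (k $ i)"] by simp
    qed simp
  qed
  also have "\<dots> = (if k = 0 then 1 else 0)"
  proof (cases "k = 0")
    case False
    then obtain i where "k $ i \<noteq> 0" by (auto simp: vec_eq_iff)
    then have "(\<Prod>i\<in>UNIV. if k $ i = 0 then 1 else 0) = (0::complex)"
      by (intro prod_zero) auto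
    then show ?thesis using False by simp
  qed simp
  finally show ?thesis .
qed

lemma wave_L2_cube: "(\<lambda>x. wave x \<xi>) \<in> Lp_space cube_measure 2"
  by (auto simp: Lp_space_2_iff)

lemma fourier_coeff_wave: "fourier_coeff (\<lambda>x. wave x (lattice_vec n)) m = (if m = n then 1 else 0)"
  unfolding fourier_coeff_eq
  using integral_cube_wave[of "n - m"] by (auto simp: wave_diff_right)

lemma fourier_coeff_sum_waves:
  assumes "finite S"
  shows "fourier_coeff (\<lambda>x. \<Sum>n\<in>S. a n * wave x (lattice_vec n)) m = (if m \<in> S then a m else 0)"
proof -
  have i: "integrable cube_measure (\<lambda>x. a n * (wave x (lattice_vec n) * cnj (wave x (lattice_vec m))))" for n
    using integrable_L2_product(2)[OF wave_L2_cube wave_L2_cube] by (rule integrable_mult_right)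
  have "fourier_coeff (\<lambda>x. \<Sum>n\<in>S. a n * wave x (lattice_vec n)) m
      = (\<integral>x. (\<Sum>n\<in>S. a n * (wave x (lattice_vec n) * cnj (wave x (lattice_vec m)))) \<partial>cube_measure)"
    unfolding fourier_coeff_eq by (simp add: sum_distrib_right mult.assoc)
  also have "\<dots> = (\<Sum>n\<in>S. a n * fourier_coeff (\<lambda>x. wave x (lattice_vec n)) m)"
    unfolding fourier_coeff_eq using i by (subst Bochner_Integration.integral_sum) auto
  also have "\<dots> = (\<Sum>n\<in>S. if n = m then a n else 0)"
    by (intro sum.cong) (auto simp: fourier_coeff_wave)
  also have "\<dots> = (if m \<in> S then a m else 0)" using assms by simp
  finally show ?thesis .
qed

lemma sum_waves_L2: "(\<lambda>x. \<Sum>n\<in>S. a n * wave x (lattice_vec n)) \<in> Lp_space cube_measure 2"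
  by (intro Lp_space_sum Lp_space_cmult wave_L2_cube) simp

text \<open>
  Expand $\int |f - s|^2 \ge 0$, where \<open>s\<close> is the partial Fourier sum of \<open>f\<close> over \<open>S\<close>.
\<close>
lemma Bessel_finite:
  assumes f: "f \<in> Lp_space cube_measure 2" and S: "finite S"
  shows "(\<Sum>n\<in>S. (norm (fourier_coeff f n))\<^sup>2) \<le> (\<integral>x. (norm (f x))\<^sup>2 \<partial>cube_measure)"
proof -
  let ?a = "fourier_coeff f"
  define s where "s = (\<lambda>x. \<Sum>n\<in>S. ?a n * wave x (lattice_vec n))"
  have s: "s \<in> Lp_space cube_measure 2" unfolding s_def by (rule sum_waves_L2)
  have ip: "(\<integral>x. g x * cnj (s x) \<partial>cube_measure) = (\<Sum>n\<in>S. cnj (?a n) * fourier_coeff g n)"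
    if "g \<in> Lp_space cube_measure 2" for g
  proof -
    have "(\<integral>x. g x * cnj (s x) \<partial>cube_measure) = (\<integral>x. (\<Sum>n\<in>S. cnj (?a n) * (g x * cnj (wave x (lattice_vec n)))) \<partial>cube_measure)"
      by (simp add: s_def sum_distrib_left mult_ac)
    also have "\<dots> = (\<Sum>n\<in>S. cnj (?a n) * fourier_coeff g n)"
      unfolding fourier_coeff_eq using integrable_L2_product(2)[OF that wave_L2_cube]
      by (subst Bochner_Integration.integral_sum) (auto intro!: integrable_mult_right)
    finally show ?thesis .
  qed
  define T where "T = (\<Sum>n\<in>S. (norm (?a n))\<^sup>2)"
  have fs: "(\<integral>x. f x * cnj (s x) \<partial>cube_measure) = of_real T"
    unfolding ip[OF f] T_def of_real_sum complex_norm_square by (simp add: mult.commute)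
  have ss: "(\<integral>x. s x * cnj (s x) \<partial>cube_measure) = of_real T"
    unfolding ip[OF s] T_def of_real_sum complex_norm_square
    by (intro sum.cong refl) (simp add: s_def fourier_coeff_sum_waves[OF S] mult.commute)
  have "complex_of_real (\<integral>x. (norm (s x))\<^sup>2 \<partial>cube_measure) = of_real T"
    unfolding ss[symmetric] complex_norm_square[symmetric] by (simp del: of_real_power)
  then have s2: "(\<integral>x. (norm (s x))\<^sup>2 \<partial>cube_measure) = T" by (simp only: of_real_eq_iff)
  have "0 \<le> (\<integral>x. (norm (f x + (-1) * s x))\<^sup>2 \<partial>cube_measure)" by simp
  also have "\<dots> = (\<integral>x. (norm (f x))\<^sup>2 \<partial>cube_measure) - T"
    unfolding L2_inner_expand[OF f s] fs s2 by simp
  finally show ?thesis unfolding T_def by simp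
qed

text \<open>
  An increasing sequence of finite sets that exhausts the lattice, cut out by an arbitrary
  enumeration.
\<close>
definition lattice_ball :: "nat \<Rightarrow> (int ^ 'n) set" where
  "lattice_ball j = {n. to_nat n \<le> j}"

lemma finite_lattice_ball [simp]: "finite (lattice_ball j)"
  unfolding lattice_ball_def by (rule finite_imageD[where f=to_nat]) (auto simp: inj_on_def intro: finite_subset[of _ "{..j}"])

lemma eventually_in_lattice_ball: "\<forall>\<^sub>F j in sequentially. n \<in> lattice_ball j"
  unfolding lattice_ball_def using eventually_ge_at_top[of "to_nat n"] by simp

lemma nn_integral_lattice_le:
  fixes f :: "int^'n \<Rightarrow> ennreal"
  assumes "\<And>S. finite S \<Longrightarrow> (\<Sum>n\<in>S. f n) \<le> B"
  shows "(\<integral>\<^sup>+n. f n \<partial>lattice) \<le> B"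
proof -
  have lim: "(\<lambda>j. \<integral>\<^sup>+n. f n * indicator (lattice_ball j) n \<partial>lattice) \<longlonglongrightarrow> (\<integral>\<^sup>+n. f n \<partial>lattice)"
  proof (rule nn_integral_LIMSEQ)
    show "incseq (\<lambda>j n. f n * indicator (lattice_ball j) n)"
      by (auto simp: incseq_def le_fun_def lattice_ball_def split: split_indicator)
    show "(\<lambda>j. f n * indicator (lattice_ball j) n) \<longlonglongrightarrow> f n" for n
      by (rule tendsto_eventually, use eventually_in_lattice_ball[of n] in eventually_elim) simp
  qed simp
  have "(\<integral>\<^sup>+n. f n * indicator (lattice_ball j) n \<partial>lattice) \<le> B" for j
  proof -
    have "(\<integral>\<^sup>+n. f n * indicator (lattice_ball j) n \<partial>lattice) = (\<Sum>n\<in>lattice_ball j. f n)"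
      by (subst nn_integral_indicator_finite) auto
    then show ?thesis using assms[OF finite_lattice_ball] by simp
  qed
  then show ?thesis by (intro LIMSEQ_le_const2[OF lim]) auto
qed

lemma Bessel:
  fixes f :: "real^'n \<Rightarrow> complex"
  assumes f: "f \<in> Lp_space cube_measure 2"
  shows "Lp_energy lattice 2 (fourier_coeff f) \<le> Lp_energy cube_measure 2 f"
  unfolding L2_energy_eq_square[of lattice] L2_energy_eq_integral[OF f]
proof (rule nn_integral_lattice_le)
  fix S :: "(int^'n) set" assume "finite S"
  then show "(\<Sum>n\<in>S. ennreal ((norm (fourier_coeff f n))\<^sup>2)) \<le> ennreal (\<integral>x. (norm (f x))\<^sup>2 \<partial>cube_measure)"
    using Bessel_finite[OF f] by (simp add: ennreal_leI)
qed

lemma fourier_zero_ext: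
  "fourier (zero_ext f) (\<theta> + lattice_vec n) = fourier_coeff (\<lambda>x. f x * cnj (wave x \<theta>)) n"
  unfolding fourier_eq fourier_coeff_eq integral_cube_eq zero_ext_def[abs_def]
  by (simp add: wave_add_right mult_ac)

text \<open>
  A property that holds almost everywhere in the cube holds at points arbitrarily close to
  the corner 0.
\<close>
lemma cube_corner_positive:
  assumes "0 < e" "e \<le> 1" and AE: "AE x in (cube_measure :: (real^'n) measure). P x"
  shows "\<exists>x. P x \<and> (\<forall>i. 0 < x $ i \<and> x $ i < e)"
proof (rule ccontr)
  assume no: "\<not> ?thesis"
  let ?B = "box 0 ((\<chi> i. e) :: real^'n)"
  have sub: "?B \<subseteq> unit_cube"
    by (auto simp: mem_box_cart unit_cube_def intro: less_imp_le less_le_trans[OF _ assms(2)])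
  have "AE x in (cube_measure :: (real^'n) measure). x \<notin> ?B"
    using AE by eventually_elim (use no in \<open>auto simp: mem_box_cart\<close>)
  moreover have Bs: "?B \<in> sets cube_measure"
    using sub by (auto simp: sets_cube_measure sets_restrict_space image_iff intro!: bexI[of _ "?B"])
  ultimately have "emeasure cube_measure ?B = 0"
    by (subst (asm) AE_iff_measurable[OF _ refl]) (use sub in \<open>auto simp: Int_absorb1 Collect_conj_eq\<close>)
  then have "emeasure lborel ?B = 0"
    using sub by (simp add: cube_measure_def emeasure_restrict_space)
  moreover have "emeasure lborel ?B = ennreal (e ^ CARD('n))"
    using assms by (subst emeasure_lborel_box_eq) (auto simp: Basis_vec_def inner_axis prod.UNION_disjoint axis_eq_axis)
  ultimately show False using assms by simp
qed

text \<open>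
  Extend $f$ by 0 from the cube to all of space. By Plancherel, the average over $\theta$ in
  the cube of $\sum_n |\hat f(\theta + n)|^2$ is $\|f\|_2^2$. For each $\theta$ the sum is the
  Bessel sum of $f$ modulated by $\theta$, hence at most $\|f\|_2^2$, so that equality holds for
  almost every $\theta$. Choose such $\theta_j$ tending to 0; then the modulated functions tend
  to $f$ in $L^2$, and equality at $\theta = 0$ follows from Bessel's inequality.
\<close>
theorem torus_parseval:
  fixes f :: "real^'n \<Rightarrow> complex"
  assumes f: "f \<in> Lp_space cube_measure 2"
  shows "Lp_energy lattice 2 (fourier_coeff f) = Lp_energy cube_measure 2 f"
proof -
  have [measurable]: "f \<in> borel_measurable cube_measure" using f by (simp add: Lp_space_def)
  define E where "E = Lp_energy cube_measure 2 f"
  have Efin: "E < \<infinity>" using f by (simp add: E_def Lp_space_iff)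
  \<comment> \<open>modulation by \<open>\<theta>\<close> shifts the Fourier coefficients of \<open>f\<close> off the lattice\<close>
  define ft where "ft = (\<lambda>\<theta> x. f x * cnj (wave x \<theta>))"
  have [measurable]: "ft \<theta> \<in> borel_measurable cube_measure" for \<theta> unfolding ft_def by measurable
  have Eft: "Lp_energy cube_measure 2 (ft \<theta>) = E" for \<theta>
    by (simp add: ft_def E_def Lp_energy_def norm_mult)
  have ft: "ft \<theta> \<in> Lp_space cube_measure 2" for \<theta>
    using Efin by (simp add: Lp_space_iff Eft)
  define D where "D = (\<lambda>\<theta>. Lp_energy lattice 2 (fourier_coeff (ft \<theta>)))"
  have DE: "D \<theta> \<le> E" for \<theta> unfolding D_def using Bessel[OF ft] by (simp add: Eft)
  have z1: "integrable lborel (zero_ext f)" using L2_cube_integrable[OF f] by (simp add: integrable_cube_iff)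
  have z2: "zero_ext f \<in> Lp_space lborel 2" using f by (simp add: Lp_space_iff Lp_energy_zero_ext)
  have Deq: "D \<theta> = (\<integral>\<^sup>+n. ennreal ((norm (fourier (zero_ext f) (\<theta> + lattice_vec n)))\<^sup>2) \<partial>lattice)" for \<theta>
    unfolding D_def L2_energy_eq_square fourier_zero_ext ft_def ..
  have Dm [measurable]: "D \<in> borel_measurable cube_measure"
    unfolding Deq[abs_def]
    by (rule lattice_sigma.borel_measurable_nn_integral, simp add: split_def, rule measurable_lattice_pair2)
       (auto intro!: measurable_cube_measureI)
  have "E = Lp_energy lborel 2 (fourier (zero_ext f))"
    unfolding plancherel_L1_L2[OF z1 z2] Lp_energy_zero_ext E_def ..
  also have "\<dots> = (\<integral>\<^sup>+\<theta>. D \<theta> \<partial>cube_measure)"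
    unfolding L2_energy_eq_square Deq by (rule nn_integral_tiling) measurable
  finally have ID: "(\<integral>\<^sup>+\<theta>. D \<theta> \<partial>cube_measure) = E" ..
  have "AE \<theta> in cube_measure. E - D \<theta> = 0"
  proof -
    have "(\<integral>\<^sup>+\<theta>. (E - D \<theta>) \<partial>cube_measure) = (\<integral>\<^sup>+\<theta>. E \<partial>(cube_measure :: (real^'n) measure)) - (\<integral>\<^sup>+\<theta>. D \<theta> \<partial>cube_measure)"
      by (rule nn_integral_diff) (use ID Efin DE in auto)
    also have "\<dots> = 0" unfolding ID using Efin by simp
    finally show ?thesis by (subst (asm) nn_integral_0_iff_AE) auto
  qed
  then have AED: "AE \<theta> in cube_measure. D \<theta> = E"
    by eventually_elim (use DE Efin in \<open>auto simp: diff_eq_0_iff_ennreal intro: antisym\<close>)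
  have "\<exists>\<theta>. D \<theta> = E \<and> (\<forall>i. 0 < \<theta> $ i \<and> \<theta> $ i < 1 / real (Suc j))" for j
    by (rule cube_corner_positive[OF _ _ AED]) auto
  then obtain \<theta> where \<theta>: "\<And>j. D (\<theta> j) = E" "\<And>j i. 0 < \<theta> j $ i \<and> \<theta> j $ i < 1 / real (Suc j)" by metis
  have \<theta>0: "\<theta> \<longlonglongrightarrow> 0"
  proof (rule vec_tendstoI)
    fix i
    have L: "(\<lambda>j. 1 / real (Suc j)) \<longlonglongrightarrow> 0" by (rule LIMSEQ_Suc[OF lim_1_over_n])
    have "(\<lambda>j. \<theta> j $ i) \<longlonglongrightarrow> 0"
    proof (rule Lim_null_comparison[OF _ L], rule always_eventually, rule allI)
      fix j
      show "norm (\<theta> j $ i) \<le> 1 / real (Suc j)" using \<theta>(2)[of j i] by simp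
    qed
    then show "(\<lambda>j. \<theta> j $ i) \<longlonglongrightarrow> 0 $ i" by simp
  qed
  have dft: "(\<lambda>x. ft (\<theta> j) x - f x) \<in> Lp_space cube_measure 2" for j
    by (rule Lp_space_diff[OF ft f]) simp
  have "(\<lambda>j. Lp_energy cube_measure 2 (\<lambda>x. ft (\<theta> j) x - f x)) \<longlonglongrightarrow> (\<integral>\<^sup>+x. 0 \<partial>(cube_measure :: (real^'n) measure))"
    unfolding L2_energy_eq_square
  proof (rule nn_integral_dominated_convergence[where w="\<lambda>x. ennreal (4 * (norm (f x))\<^sup>2)"])
    show "AE x in cube_measure. ennreal ((norm (ft (\<theta> j) x - f x))\<^sup>2) \<le> ennreal (4 * (norm (f x))\<^sup>2)" for j
    proof (intro always_eventually allI ennreal_leI)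
      fix x
      have "norm (ft (\<theta> j) x - f x) \<le> 2 * norm (f x)"
        using norm_triangle_ineq4[of "ft (\<theta> j) x" "f x"] by (simp add: ft_def norm_mult)
      then have "(norm (ft (\<theta> j) x - f x))\<^sup>2 \<le> (2 * norm (f x))\<^sup>2" by (rule power_mono) simp
      then show "(norm (ft (\<theta> j) x - f x))\<^sup>2 \<le> 4 * (norm (f x))\<^sup>2" by (simp add: power_mult_distrib)
    qed
    show "AE x in cube_measure. (\<lambda>j. ennreal ((norm (ft (\<theta> j) x - f x))\<^sup>2)) \<longlonglongrightarrow> 0"
    proof (intro always_eventually allI)
      fix x
      have "(\<lambda>j. ennreal ((norm (f x * cnj (cis (2 * pi * (\<theta> j \<bullet> x))) - f x))\<^sup>2))
          \<longlonglongrightarrow> ennreal ((norm (f x * cnj (cis (2 * pi * (0 \<bullet> x))) - f x))\<^sup>2)"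
        by (intro tendsto_intros tendsto_cis \<theta>0)
      then show "(\<lambda>j. ennreal ((norm (ft (\<theta> j) x - f x))\<^sup>2)) \<longlonglongrightarrow> 0" by (simp add: ft_def wave_def)
    qed
    have "(\<integral>\<^sup>+x. ennreal (4 * (norm (f x))\<^sup>2) \<partial>cube_measure) = ennreal 4 * E"
      unfolding E_def L2_energy_eq_square by (simp add: ennreal_mult nn_integral_cmult)
    also have "\<dots> < \<infinity>" using Efin by (simp add: ennreal_mult_less_top)
    finally show "(\<integral>\<^sup>+x. ennreal (4 * (norm (f x))\<^sup>2) \<partial>cube_measure) < \<infinity>" .
  qed auto
  then have lim: "(\<lambda>j. Lp_norm cube_measure 2 (\<lambda>x. ft (\<theta> j) x - f x)) \<longlonglongrightarrow> 0"
    by (subst Lp_norm_tendsto_0_iff[OF dft]) auto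
  have cL2: "fourier_coeff u \<in> Lp_space lattice 2" if "u \<in> Lp_space cube_measure 2" for u
    using Bessel[OF that] that by (auto simp: Lp_space_iff)
  have "Lp_norm cube_measure 2 f \<le> Lp_norm lattice 2 (fourier_coeff f) + Lp_norm cube_measure 2 (\<lambda>x. ft (\<theta> j) x - f x)" for j
  proof -
    have "Lp_norm cube_measure 2 f = Lp_norm lattice 2 (fourier_coeff (ft (\<theta> j)))"
      using \<theta>(1)[of j] by (subst L2_norm_eq_iff) (auto simp: f cL2 ft D_def E_def)
    also have "fourier_coeff (ft (\<theta> j)) = (\<lambda>n. fourier_coeff f n + fourier_coeff (\<lambda>x. ft (\<theta> j) x - f x) n)"
    proof
      fix n :: "int^'n"
      have i: "integrable cube_measure (\<lambda>x. u x * cnj (wave x (lattice_vec n)))" if "u \<in> Lp_space cube_measure 2" for u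
        by (rule integrable_mult_unimodular[OF L2_cube_integrable[OF that]]) auto
      show "fourier_coeff (ft (\<theta> j)) n = fourier_coeff f n + fourier_coeff (\<lambda>x. ft (\<theta> j) x - f x) n"
        unfolding fourier_coeff_eq
        by (subst Bochner_Integration.integral_add[symmetric, OF i[OF f] i[OF dft]]) (simp add: algebra_simps)
    qed
    also have "Lp_norm lattice 2 \<dots> \<le> Lp_norm lattice 2 (fourier_coeff f) + Lp_norm lattice 2 (fourier_coeff (\<lambda>x. ft (\<theta> j) x - f x))"
      by (rule L2_norm_triangle) (auto intro: cL2 f dft)
    also have "Lp_norm lattice 2 (fourier_coeff (\<lambda>x. ft (\<theta> j) x - f x)) \<le> Lp_norm cube_measure 2 (\<lambda>x. ft (\<theta> j) x - f x)"
      using Bessel[OF dft] by (subst L2_norm_le_iff) (auto intro: cL2 dft)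
    finally show ?thesis by simp
  qed
  moreover have "(\<lambda>j. Lp_norm lattice 2 (fourier_coeff f) + Lp_norm cube_measure 2 (\<lambda>x. ft (\<theta> j) x - f x)) \<longlonglongrightarrow> Lp_norm lattice 2 (fourier_coeff f) + 0"
    by (intro tendsto_add tendsto_const lim)
  ultimately have "Lp_norm cube_measure 2 f \<le> Lp_norm lattice 2 (fourier_coeff f)"
    using LIMSEQ_le_const by fastforce
  then have "Lp_energy cube_measure 2 f \<le> Lp_energy lattice 2 (fourier_coeff f)"
    by (subst (asm) L2_norm_le_iff) (auto intro: f cL2)
  with Bessel[OF f] show ?thesis by (rule antisym)
qed

interpretation torus: plancherel_group "torus_lca :: (real^'n, int^'n) lca"
  by unfold_locales (auto simp: torus_parseval)

lemma torus_fourier_L2_coeff: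
  assumes "fourier_L2 torus_lca f g"
  shows "g n = fourier_coeff f n"
proof -
  have f: "f \<in> Lp_space cube_measure 2" using torus.fourier_L2_spaces[OF assms] by simp
  have "fourier_L2 torus_lca f (fourier_coeff f)"
    by (rule torus.fourier_L2_of_L1) (use f L2_cube_integrable[OF f] in auto)
  from torus.fourier_L2_unique[OF assms this] show ?thesis
    unfolding torus_simps by (auto simp: AE_count_space)
qed

section \<open>A band-limiting kernel with summable decay\<close>

lemmas fourier_in_L2 = euclid.fourier_L1_in_L2[unfolded euclidean_simps]

lemmas fourier_L2_fourier = euclid.fourier_L2_of_L1[unfolded euclidean_simps]

lemmas parseval_euclidean = euclid.parseval[unfolded euclidean_simps]

definition interval_wave :: "real \<Rightarrow> real \<Rightarrow> real \<Rightarrow> complex" where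
  "interval_wave a b t = (\<integral>s. indicator {a..b} s *\<^sub>R cis (2 * pi * (t * s)) \<partial>lborel)"

lemma norm_interval_wave_le:
  assumes "a \<le> b"
  shows "norm (interval_wave a b t) \<le> b - a"
proof -
  have "norm (interval_wave a b t) \<le> (\<integral>s. norm (indicator {a..b} s *\<^sub>R cis (2 * pi * (t * s))) \<partial>lborel)"
    unfolding interval_wave_def by (rule integral_norm_bound)
  also have "\<dots> = (\<integral>s. indicator {a..b} s \<partial>lborel)" by (simp add: norm_scaleR)
  also have "\<dots> = b - a" using assms by simp
  finally show ?thesis .
qed

lemma norm_interval_wave_decay:
  assumes "a \<le> b" "t \<noteq> 0"
  shows "norm (interval_wave a b t) \<le> 1 / (pi * \<bar>t\<bar>)"
proof -
  have "norm (cis (2 * pi * (t * b)) - cis (2 * pi * (t * a))) \<le> 2"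
    using norm_triangle_ineq4[of "cis (2 * pi * (t * b))" "cis (2 * pi * (t * a))"] by simp
  moreover have "norm (\<i> * complex_of_real (2 * pi * t)) = 2 * pi * \<bar>t\<bar>"
    by (simp add: norm_mult abs_mult)
  ultimately have "norm (interval_wave a b t) \<le> 2 / (2 * pi * \<bar>t\<bar>)"
    unfolding interval_wave_def integral_indicator_cis[OF assms] norm_divide
    by (simp only:) (intro divide_right_mono, auto)
  then show ?thesis by simp
qed

definition box_fun :: "real \<Rightarrow> real \<Rightarrow> real ^ 'n \<Rightarrow> complex" where
  "box_fun a b x = (\<Prod>i\<in>UNIV. indicator {a..b} (x $ i))"

lemma box_fun_measurable [measurable]: "box_fun a b \<in> borel_measurable borel"
  unfolding box_fun_def by measurable

lemma box_fun_eq: "box_fun a b x = (if \<forall>i. a \<le> x $ i \<and> x $ i \<le> b then 1 else 0)"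
proof (cases "\<forall>i. a \<le> x $ i \<and> x $ i \<le> b")
  case False
  then obtain i where "indicator {a..b} (x $ i) = (0::complex)" by (auto simp: indicator_def)
  then have "(\<Prod>i\<in>UNIV. indicator {a..b} (x $ i)) = (0::complex)" by (intro prod_zero) auto
  then show ?thesis using False by (simp add: box_fun_def)
qed (simp add: box_fun_def)

lemma box_fun_0: "\<not> (a \<le> x $ i \<and> x $ i \<le> b) \<Longrightarrow> box_fun a b x = 0"
  by (auto simp: box_fun_eq)

lemma box_fun_wave:
  fixes x :: "real^'n"
  shows "integrable lborel (\<lambda>\<zeta>. box_fun a b \<zeta> * wave x \<zeta>)"
    and "(\<integral>\<zeta>. box_fun a b \<zeta> * wave x \<zeta> \<partial>lborel) = (\<Prod>i\<in>UNIV. interval_wave a b (x $ i))"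
proof -
  let ?g = "\<lambda>i t. indicator {a..b} t *\<^sub>R cis (2 * pi * (x $ i * t))"
  have eq: "box_fun a b \<zeta> * wave x \<zeta> = (\<Prod>i\<in>UNIV. ?g i (\<zeta> $ i))" for \<zeta> :: "real^'n"
    unfolding box_fun_def wave_commute[of x] wave_eq_prod prod.distrib[symmetric]
    by (intro prod.cong refl) (simp add: scaleR_conv_of_real of_real_indicator mult.commute)
  show "integrable lborel (\<lambda>\<zeta>. box_fun a b \<zeta> * wave x \<zeta>)"
    unfolding eq by (rule integral_lborel_prod(1)) (rule integrable_indicator_cis)
  show "(\<integral>\<zeta>. box_fun a b \<zeta> * wave x \<zeta> \<partial>lborel) = (\<Prod>i\<in>UNIV. interval_wave a b (x $ i))"
    unfolding eq interval_wave_def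
    by (rule integral_lborel_prod(2)) (rule integrable_indicator_cis)
qed

lemma box_fun_integrable: "integrable lborel (box_fun a b :: real^'n \<Rightarrow> complex)"
  using box_fun_wave(1)[of a b 0] by simp

lemma box_fun_integral:
  assumes "a \<le> b"
  shows "(\<integral>x. box_fun a b x \<partial>(lborel :: (real^'n) measure)) = of_real ((b - a) ^ CARD('n))"
proof -
  have "interval_wave a b 0 = (\<integral>s. of_real (indicator {a..b} s) \<partial>lborel)"
    unfolding interval_wave_def by (simp add: scaleR_conv_of_real)
  also have "\<dots> = of_real (b - a)"
    unfolding integral_complex_of_real using assms by simp
  finally show ?thesis using box_fun_wave(2)[of a b "0 :: real^'n"] by simp
qed

lemma box_fun_L2: "(box_fun a b :: real^'n \<Rightarrow> complex) \<in> Lp_space lborel 2"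
proof -
  have "integrable lborel (\<lambda>x :: real^'n. norm (box_fun a b x :: complex))"
    using box_fun_integrable by (rule integrable_norm)
  moreover have "norm (box_fun a b x :: complex) = (norm (box_fun a b x :: complex))\<^sup>2" for x :: "real^'n"
    by (simp add: box_fun_eq)
  ultimately show ?thesis by (simp add: Lp_space_2_iff)
qed

lemma fourier_box_fun:
  "fourier (box_fun a b) x = cnj (\<Prod>i\<in>UNIV. interval_wave a b (x $ i))" for x :: "real^'n"
proof -
  have "fourier (box_fun a b) x = (\<integral>\<zeta>. cnj (box_fun a b \<zeta> * wave x \<zeta>) \<partial>lborel)"
    unfolding fourier_eq wave_commute[of _ x] by (intro Bochner_Integration.integral_cong) (auto simp: box_fun_eq)
  then show ?thesis by (simp add: box_fun_wave(2) del: cnj_prod complex_cnj_mult)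
qed

text \<open>
  The product of the transforms of the indicators of two centred boxes. Its Fourier
  transform \<open>bump\<close> is the normalised convolution of the two indicators, which is 1 where the
  small box, moved to \<open>\<xi>\<close>, lies inside the large one, and 0 where the two are disjoint. In each
  coordinate both factors decay like $1/|t|$, so the kernel decays like $1/t^2$ and is summable
  over the lattice.
\<close>
definition bump_kernel :: "real ^ 'n \<Rightarrow> complex" where
  "bump_kernel x = of_real (8 ^ CARD('n)) *
     (cnj (fourier (box_fun (3/16) (13/16)) x) * cnj (fourier (box_fun (-1/16) (1/16)) x))"

definition bump :: "real ^ 'n \<Rightarrow> complex" where
  "bump \<xi> = of_real (8 ^ CARD('n)) *
     (\<integral>\<zeta>. box_fun (-1/16) (1/16) (\<xi> - \<zeta>) * cnj (box_fun (3/16) (13/16) \<zeta>) \<partial>lborel)"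

lemma bump_kernel_measurable [measurable]: "bump_kernel \<in> borel_measurable borel"
  unfolding bump_kernel_def[abs_def] by measurable

lemma bump_kernel_eq_prod:
  "bump_kernel x = (\<Prod>i\<in>UNIV. 8 * (interval_wave (3/16) (13/16) (x $ i) * interval_wave (-1/16) (1/16) (x $ i)))"
  by (simp add: bump_kernel_def fourier_box_fun prod.distrib)

lemma bump_kernel_integrable: "integrable lborel (bump_kernel :: real^'n \<Rightarrow> complex)"
  unfolding bump_kernel_def[abs_def]
  by (intro integrable_mult_right integrable_L2_product Lp_space_cnj)
     (use fourier_in_L2[OF box_fun_integrable box_fun_L2] in auto)

text \<open>
  By Parseval, since $\overline{\hat u(x)}$ is the inverse transform of the indicator $u$ and
  $\overline{\hat v(x)}\,e^{-2\pi i x\cdot\xi}$ is the transform of $v(\xi - \cdot)$.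
\<close>
lemma fourier_bump_kernel: "fourier bump_kernel \<xi> = bump \<xi>" for \<xi> :: "real^'n"
proof -
  let ?u = "box_fun (3/16) (13/16) :: real^'n \<Rightarrow> complex" and ?v = "box_fun (-1/16) (1/16) :: real^'n \<Rightarrow> complex"
  let ?w = "\<lambda>\<zeta>. ?v (\<xi> - \<zeta>)"
  have w1: "integrable lborel ?w"
  proof -
    have "integrable (distr lborel borel (\<lambda>\<zeta>. \<xi> - \<zeta>)) ?v"
      using box_fun_integrable by (simp add: lborel_vec_reflect)
    then show ?thesis by (subst (asm) integrable_distr_eq) auto
  qed
  have w2: "?w \<in> Lp_space lborel 2" by (rule Lp_space_reflect[OF box_fun_L2])
  have Fw: "fourier ?w x = cnj (fourier ?v x) * cnj (wave x \<xi>)" for x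
  proof -
    have "fourier ?w x = (\<integral>\<zeta>. ?v (\<xi> - \<zeta>) * cnj (wave (\<xi> - (\<xi> - \<zeta>)) x) \<partial>lborel)"
      unfolding fourier_eq by simp
    also have "\<dots> = (\<integral>\<zeta>. ?v \<zeta> * cnj (wave (\<xi> - \<zeta>) x) \<partial>lborel)"
      by (rule integral_vec_reflect[of "\<lambda>\<zeta>. ?v \<zeta> * cnj (wave (\<xi> - \<zeta>) x)"]) measurable
    also have "\<dots> = (\<integral>\<zeta>. cnj (?v \<zeta> * cnj (wave \<zeta> x)) * cnj (wave x \<xi>) \<partial>lborel)"
      by (intro Bochner_Integration.integral_cong) (auto simp: wave_diff_left wave_commute[of \<xi>] box_fun_eq)
    also have "\<dots> = cnj (fourier ?v x) * cnj (wave x \<xi>)"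
      unfolding fourier_eq by (simp del: complex_cnj_mult)
    finally show ?thesis .
  qed
  have "(\<integral>x. bump_kernel x * cnj (wave x \<xi>) \<partial>lborel)
      = of_real (8 ^ CARD('n)) * (\<integral>x. fourier ?w x * cnj (fourier ?u x) \<partial>lborel)"
    unfolding bump_kernel_def Fw by (simp flip: integral_mult_right_zero add: mult_ac)
  also have "(\<integral>x. fourier ?w x * cnj (fourier ?u x) \<partial>lborel) = (\<integral>x. ?w x * cnj (?u x) \<partial>lborel)"
    by (rule parseval_euclidean[OF fourier_L2_fourier[OF w1 w2] fourier_L2_fourier[OF box_fun_integrable box_fun_L2], symmetric])
  finally show ?thesis unfolding bump_def fourier_eq .
qed

lemma bump_measurable [measurable]: "bump \<in> borel_measurable borel"
proof -
  have "fourier bump_kernel \<in> borel_measurable borel" by measurable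
  then show ?thesis unfolding fourier_bump_kernel[abs_def, symmetric] by (simp add: fourier_bump_kernel[abs_def])
qed

lemma integral_small_box: "(\<integral>\<zeta>. box_fun (-1/16) (1/16) (\<xi> - \<zeta>) \<partial>lborel) = of_real ((1 / 8) ^ CARD('n))" for \<xi> :: "real^'n"
proof -
  have "(\<integral>\<zeta>. box_fun (-1/16) (1/16) (\<xi> - \<zeta>) \<partial>lborel) = (\<integral>\<zeta>. box_fun (-1/16) (1/16) \<zeta> \<partial>(lborel :: (real^'n) measure))"
    by (rule integral_vec_reflect) measurable
  then show ?thesis by (subst (asm) box_fun_integral) (simp_all del: of_real_power of_real_divide)
qed

lemma bump_eq_1:
  fixes \<xi> :: "real^'n"
  assumes "\<forall>i. 1/4 \<le> \<xi> $ i \<and> \<xi> $ i \<le> 3/4"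
  shows "bump \<xi> = 1"
proof -
  have "box_fun (-1/16) (1/16) (\<xi> - \<zeta>) * cnj (box_fun (3/16) (13/16) \<zeta>) = (box_fun (-1/16) (1/16) (\<xi> - \<zeta>) :: complex)" for \<zeta>
  proof (cases "\<forall>i. -1/16 \<le> (\<xi> - \<zeta>) $ i \<and> (\<xi> - \<zeta>) $ i \<le> 1/16")
    case True
    have "3/16 \<le> \<zeta> $ i \<and> \<zeta> $ i \<le> 13/16" for i
      using True[rule_format, of i] assms[rule_format, of i] by auto
    then show ?thesis by (simp add: box_fun_eq)
  qed (auto simp: box_fun_eq)
  then have "bump \<xi> = of_real (8 ^ CARD('n)) * of_real ((1 / 8) ^ CARD('n))"
    unfolding bump_def by (simp only: integral_small_box)
  also have "\<dots> = 1" by (simp add: power_one_over)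
  finally show ?thesis .
qed

lemma bump_eq_0:
  fixes \<xi> :: "real^'n"
  assumes "\<xi> \<notin> unit_cube"
  shows "bump \<xi> = 0"
proof -
  obtain i where i: "\<not> (0 \<le> \<xi> $ i \<and> \<xi> $ i < 1)" using assms by (auto simp: unit_cube_def)
  have z: "box_fun (-1/16) (1/16) (\<xi> - \<zeta>) * cnj (box_fun (3/16) (13/16) \<zeta>) = (0 :: complex)" for \<zeta>
  proof -
    have "\<not> (-1/16 \<le> (\<xi> - \<zeta>) $ i \<and> (\<xi> - \<zeta>) $ i \<le> 1/16) \<or> \<not> (3/16 \<le> \<zeta> $ i \<and> \<zeta> $ i \<le> 13/16)"
      using i by auto
    then show ?thesis
    proof
      assume "\<not> (-1/16 \<le> (\<xi> - \<zeta>) $ i \<and> (\<xi> - \<zeta>) $ i \<le> 1/16)"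
      then show ?thesis by (simp only: box_fun_0 mult_zero_left)
    next
      assume "\<not> (3/16 \<le> \<zeta> $ i \<and> \<zeta> $ i \<le> 13/16)"
      then show ?thesis by (simp only: box_fun_0 complex_cnj_zero mult_zero_right)
    qed
  qed
  show ?thesis unfolding bump_def z by simp
qed

lemma norm_bump_le: "norm (bump \<xi>) \<le> 1" for \<xi> :: "real^'n"
proof -
  let ?v = "\<lambda>\<zeta>. box_fun (-1/16) (1/16) (\<xi> - \<zeta>) :: complex"
  let ?u = "\<lambda>\<zeta>::real^'n. box_fun (3/16) (13/16) \<zeta> :: complex"
  have iv: "integrable lborel ?v"
  proof -
    have "integrable (distr lborel borel (\<lambda>\<zeta>. \<xi> - \<zeta>)) (box_fun (-1/16) (1/16) :: real^'n \<Rightarrow> complex)"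
      using box_fun_integrable by (simp add: lborel_vec_reflect)
    then show ?thesis by (subst (asm) integrable_distr_eq) auto
  qed
  have "norm (\<integral>\<zeta>. ?v \<zeta> * cnj (?u \<zeta>) \<partial>lborel) \<le> (\<integral>\<zeta>. norm (?v \<zeta> * cnj (?u \<zeta>)) \<partial>lborel)"
    by (rule integral_norm_bound)
  also have "\<dots> \<le> (\<integral>\<zeta>. norm (?v \<zeta>) \<partial>lborel)"
  proof (rule integral_mono)
    show "integrable lborel (\<lambda>\<zeta>. norm (?v \<zeta> * cnj (?u \<zeta>)))"
      by (intro integrable_norm integrable_mult_unimodular[OF iv]) (auto simp: box_fun_eq)
  qed (use iv in \<open>auto simp: box_fun_eq\<close>)
  also have "\<dots> = (1 / 8) ^ CARD('n)"
  proof -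
    have "complex_of_real (\<integral>\<zeta>. norm (?v \<zeta>) \<partial>lborel) = (\<integral>\<zeta>. complex_of_real (norm (?v \<zeta>)) \<partial>lborel)"
      by (rule integral_complex_of_real[symmetric])
    also have "\<dots> = (\<integral>\<zeta>. ?v \<zeta> \<partial>lborel)" by (intro Bochner_Integration.integral_cong) (auto simp: box_fun_eq)
    also have "\<dots> = of_real ((1 / 8) ^ CARD('n))" by (rule integral_small_box)
    finally show ?thesis by (simp only: of_real_eq_iff)
  qed
  finally have "norm (\<integral>\<zeta>. ?v \<zeta> * cnj (?u \<zeta>) \<partial>lborel) \<le> (1 / 8) ^ CARD('n)" .
  then have "8 ^ CARD('n) * norm (\<integral>\<zeta>. ?v \<zeta> * cnj (?u \<zeta>) \<partial>lborel) \<le> 8 ^ CARD('n) * (1 / 8) ^ CARD('n)"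
    by (intro mult_left_mono) auto
  also have "(8::real) ^ CARD('n) * (1 / 8) ^ CARD('n) = 1" by (simp add: power_one_over)
  finally show ?thesis unfolding bump_def by (simp add: norm_mult norm_power)
qed

lemma bump_kernel_L2: "(bump_kernel :: real^'n \<Rightarrow> complex) \<in> Lp_space lborel 2"
proof -
  have "norm (bump_kernel x) \<le> norm (fourier (box_fun (3/16) (13/16)) x)" for x :: "real^'n"
  proof -
    have "norm (fourier (box_fun (-1/16) (1/16)) x) = (\<Prod>i\<in>UNIV. norm (interval_wave (-1/16) (1/16) (x $ i)))"
      unfolding fourier_box_fun complex_mod_cnj by (rule prod_norm[symmetric])
    also have "\<dots> \<le> (\<Prod>i\<in>(UNIV :: 'n set). 1 / 8)"
      by (intro prod_mono conjI norm_ge_zero order_trans[OF norm_interval_wave_le]) auto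
    finally have "norm (fourier (box_fun (-1/16) (1/16)) x) \<le> (1 / 8) ^ CARD('n)" by simp
    then have "8 ^ CARD('n) * norm (fourier (box_fun (3/16) (13/16)) x) * norm (fourier (box_fun (-1/16) (1/16)) x)
      \<le> 8 ^ CARD('n) * norm (fourier (box_fun (3/16) (13/16)) x) * (1 / 8) ^ CARD('n)"
      by (intro mult_left_mono) auto
    also have "\<dots> = norm (fourier (box_fun (3/16) (13/16)) x)" by (simp add: power_one_over)
    finally show ?thesis by (simp add: bump_kernel_def norm_mult norm_power mult_ac)
  qed
  then have "Lp_energy lborel 2 (bump_kernel :: real^'n \<Rightarrow> complex) \<le> Lp_energy lborel 2 (fourier (box_fun (3/16) (13/16)) :: real^'n \<Rightarrow> complex)"
    by (intro Lp_energy_mono) auto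
  also have "\<dots> < \<infinity>"
    using fourier_in_L2[OF box_fun_integrable box_fun_L2] by (auto simp: Lp_space_iff)
  finally show ?thesis by (auto simp: Lp_space_iff)
qed

definition decay :: "int ^ 'n \<Rightarrow> real" where
  "decay l = (\<Prod>i\<in>UNIV. 6 / (1 + (of_int (l $ i))\<^sup>2))"

lemma decay_pos: "0 < decay l"
  unfolding decay_def by (intro prod_pos) (auto intro!: divide_pos_pos add_pos_nonneg)

lemma decay_nonneg [simp]: "0 \<le> decay l"
  using decay_pos[of l] by simp

text \<open>
  For $|t| \le 1$ the two interval integrals are bounded by the lengths $5/8$ and $1/8$; for
  larger $t$ each is at most $1/(\pi |t|)$, and $8 < 9 < \pi^2$.
\<close>
lemma norm_bump_factor_le:
  fixes t :: real
  shows "norm (8 * (interval_wave (3/16) (13/16) t * interval_wave (-1/16) (1/16) t)) \<le> 2 / (1 + t\<^sup>2)"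
proof -
  let ?U = "norm (interval_wave (3/16) (13/16) t)" and ?V = "norm (interval_wave (-1/16) (1/16) t)"
  have n: "norm (8 * (interval_wave (3/16) (13/16) t * interval_wave (-1/16) (1/16) t)) = 8 * (?U * ?V)"
    by (simp add: norm_mult)
  show ?thesis
  proof (cases "\<bar>t\<bar> \<le> 1")
    case True
    have "?U * ?V \<le> 10/16 * (2/16)"
      by (intro mult_mono order_trans[OF norm_interval_wave_le]) auto
    then have "8 * (?U * ?V) \<le> 1" by simp
    also have "1 \<le> 2 / (1 + t\<^sup>2)"
    proof -
      have "t\<^sup>2 \<le> 1" using True by (simp add: abs_square_le_1)
      moreover have "0 < 1 + t\<^sup>2" by (intro add_pos_nonneg) auto
      ultimately show ?thesis by (simp add: field_simps)
    qed
    finally show ?thesis unfolding n .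
  next
    case False
    then have t0: "t \<noteq> 0" by auto
    have "?U * ?V \<le> 1 / (pi * \<bar>t\<bar>) * (1 / (pi * \<bar>t\<bar>))"
      using t0 by (intro mult_mono norm_interval_wave_decay) auto
    also have "\<dots> = 1 / (pi\<^sup>2 * t\<^sup>2)" by (simp add: power2_eq_square)
    also have "\<dots> \<le> 1 / (9 * t\<^sup>2)"
    proof (intro divide_left_mono mult_right_mono mult_pos_pos)
      have "3\<^sup>2 \<le> pi\<^sup>2" using pi_gt3 by (intro power_mono) auto
      then show "9 \<le> pi\<^sup>2" by simp
    qed (use t0 in auto)
    finally have "8 * (?U * ?V) \<le> 8 * (1 / (9 * t\<^sup>2))" by (rule mult_left_mono) simp
    also have "\<dots> \<le> 1 / t\<^sup>2" using t0 by (simp add: field_simps)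
    also have "\<dots> \<le> 2 / (1 + t\<^sup>2)"
    proof -
      have "1 < \<bar>t\<bar>\<^sup>2" using False by (intro one_less_power) auto
      then have "1 < t\<^sup>2" by simp
      then show ?thesis using t0 by (simp add: field_simps)
    qed
    finally show ?thesis unfolding n .
  qed
qed

text \<open>
  Moving a point by at most 1 in each coordinate changes $1 + t^2$ by at most a factor 3.
\<close>
lemma norm_bump_kernel_le:
  fixes v :: "real^'n"
  assumes v: "\<And>i. \<bar>v $ i\<bar> \<le> 1"
  shows "norm (bump_kernel (lattice_vec l + v)) \<le> decay l"
proof -
  have "norm (bump_kernel (lattice_vec l + v)) =
      (\<Prod>i\<in>UNIV. norm (8 * (interval_wave (3/16) (13/16) ((lattice_vec l + v) $ i) * interval_wave (-1/16) (1/16) ((lattice_vec l + v) $ i))))"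
    unfolding bump_kernel_eq_prod by (rule prod_norm[symmetric])
  also have "\<dots> \<le> decay l"
    unfolding decay_def
  proof (intro prod_mono conjI norm_ge_zero order_trans[OF norm_bump_factor_le])
    fix i
    define t r where "t = (lattice_vec l + v) $ i" and "r = real_of_int (l $ i)"
    have rt: "r = t - v $ i" by (simp add: t_def r_def)
    have "r\<^sup>2 = 2 * t\<^sup>2 + 2 * (v $ i)\<^sup>2 - (t + v $ i)\<^sup>2"
      unfolding rt by (simp add: power2_eq_square algebra_simps)
    then have "r\<^sup>2 \<le> 2 * t\<^sup>2 + 2 * (v $ i)\<^sup>2" by simp
    moreover have "(v $ i)\<^sup>2 \<le> 1" using v[of i] by (simp add: abs_square_le_1)
    ultimately have "1 + r\<^sup>2 \<le> 3 + 3 * t\<^sup>2" using zero_le_power2[of t] by linarith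
    moreover have "0 < 1 + r\<^sup>2" "0 < 1 + t\<^sup>2" by (auto intro: add_pos_nonneg)
    ultimately have "2 / (1 + t\<^sup>2) \<le> 6 / (1 + r\<^sup>2)" by (simp add: field_simps)
    then show "2 / (1 + ((lattice_vec l + v) $ i)\<^sup>2) \<le> 6 / (1 + (real_of_int (l $ i))\<^sup>2)"
      unfolding t_def r_def .
  qed
  finally show ?thesis .
qed

lemma sum_int_inverse_square_bounded:
  "\<exists>B::real. \<forall>A::int set. finite A \<longrightarrow> (\<Sum>a\<in>A. 6 / (1 + (of_int a)\<^sup>2)) \<le> B"
proof -
  define h where "h = (\<lambda>n::nat. 6 / (1 + (real n)\<^sup>2))"
  have h0: "0 \<le> h n" for n unfolding h_def by simp
  have "summable h"
  proof (rule summable_comparison_test)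
    show "summable (\<lambda>n. 6 * (inverse ((real n)\<^sup>2)))"
      using inverse_power_summable[of 2, where 'a=real] by (intro summable_mult) simp
    show "\<exists>N. \<forall>n\<ge>N. norm (h n) \<le> 6 * inverse ((real n)\<^sup>2)"
    proof (intro exI[of _ 1] allI impI)
      fix n :: nat assume "1 \<le> n"
      then have "6 / (1 + (real n)\<^sup>2) \<le> 6 / (real n)\<^sup>2"
        by (intro divide_left_mono) (auto intro!: mult_pos_pos add_pos_nonneg)
      then show "norm (h n) \<le> 6 * inverse ((real n)\<^sup>2)"
        using h0[of n] by (simp add: h_def divide_inverse)
    qed
  qed
  have part: "(\<Sum>a\<in>A. 6 / (1 + (of_int a)\<^sup>2)) \<le> suminf h" if A: "finite A" "inj_on (\<lambda>a. nat \<bar>a\<bar>) A" for A :: "int set"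
  proof -
    have "(\<Sum>a\<in>A. 6 / (1 + (of_int a)\<^sup>2)) = (\<Sum>a\<in>A. h (nat \<bar>a\<bar>))" by (simp add: h_def)
    also have "\<dots> = (\<Sum>n\<in>(\<lambda>a. nat \<bar>a\<bar>) ` A. h n)" using A by (simp add: sum.reindex)
    also have "\<dots> \<le> suminf h" using A h0 \<open>summable h\<close> by (intro sum_le_suminf) auto
    finally show ?thesis .
  qed
  have "(\<Sum>a\<in>A. 6 / (1 + (of_int a)\<^sup>2)) \<le> suminf h + suminf h" if "finite A" for A :: "int set"
  proof -
    have "(\<Sum>a\<in>A. 6 / (1 + (of_int a)\<^sup>2)) = (\<Sum>a\<in>A \<inter> {0..}. 6 / (1 + (real_of_int a)\<^sup>2)) + (\<Sum>a\<in>A - {0..}. 6 / (1 + (of_int a)\<^sup>2))"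
      using sum.Int_Diff[OF that] by blast
    also have "\<dots> \<le> suminf h + suminf h"
      by (intro add_mono part) (use that in \<open>auto simp: inj_on_def\<close>)
    finally show ?thesis .
  qed
  then show ?thesis by blast
qed

text \<open>
  A finite set of lattice points lies in a product of finite sets of integers, over which the
  sum of the product factorises.
\<close>
lemma decay_integrable: "integrable lattice (decay :: int^'n \<Rightarrow> real)"
proof -
  obtain B :: real where B: "\<And>A::int set. finite A \<Longrightarrow> (\<Sum>a\<in>A. 6 / (1 + (of_int a)\<^sup>2)) \<le> B"
    using sum_int_inverse_square_bounded by blast
  have "(\<integral>\<^sup>+l. ennreal (decay l) \<partial>(lattice :: (int^'n) measure)) \<le> ennreal (B ^ CARD('n))"
  proof (rule nn_integral_lattice_le)
    fix S :: "(int^'n) set" assume S: "finite S"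
    define A where "A = (\<Union>l\<in>S. range (\<lambda>i. l $ i))"
    have A: "finite A" unfolding A_def using S by auto
    define g where "g = (\<lambda>a::int. 6 / (1 + (real_of_int a)\<^sup>2))"
    have g0: "0 \<le> g a" for a unfolding g_def by simp
    have "(\<Sum>l\<in>S. decay l) = (\<Sum>f\<in>vec_nth ` S. \<Prod>i\<in>UNIV. g (f i))"
      by (subst sum.reindex) (auto simp: inj_on_def vec_eq_iff decay_def g_def)
    also have "\<dots> \<le> (\<Sum>f\<in>Pi\<^sub>E (UNIV :: 'n set) (\<lambda>_. A). \<Prod>i\<in>UNIV. g (f i))"
    proof (rule sum_mono2)
      show "finite (Pi\<^sub>E (UNIV :: 'n set) (\<lambda>_. A))" using A by (intro finite_PiE) auto
      show "vec_nth ` S \<subseteq> Pi\<^sub>E UNIV (\<lambda>_. A)" by (auto simp: A_def)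
    qed (use g0 in \<open>auto intro: prod_nonneg\<close>)
    also have "\<dots> = (\<Prod>i\<in>(UNIV::'n set). \<Sum>a\<in>A. g a)"
      using A by (subst prod_sum_PiE) auto
    also have "\<dots> = (\<Sum>a\<in>A. g a) ^ CARD('n)" by simp
    also have "\<dots> \<le> B ^ CARD('n)"
      using B[OF A] g0 unfolding g_def by (intro power_mono sum_nonneg) auto
    finally show "(\<Sum>l\<in>S. ennreal (decay l)) \<le> ennreal (B ^ CARD('n))" by (simp add: ennreal_leI)
  qed
  also have "\<dots> < \<infinity>" by simp
  finally show ?thesis by (simp add: integrable_lattice_iff)
qed

definition decay_mass :: "'n::finite itself \<Rightarrow> real" where
  "decay_mass _ = (\<integral>l. decay l \<partial>(lattice :: (int^'n) measure))"

section \<open>Families of functions on the cube\<close>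

lemma integral_lattice_indicator:
  fixes f :: "int^'n \<Rightarrow> 'b::{banach, second_countable_topology}"
  assumes "finite S"
  shows "(\<integral>k. indicator S k *\<^sub>R f k \<partial>lattice) = (\<Sum>k\<in>S. f k)"
proof -
  have "finite {k \<in> UNIV. indicator S k *\<^sub>R f k \<noteq> 0}"
    by (rule finite_subset[OF _ assms]) (auto simp: indicator_def)
  then have "(\<integral>k. indicator S k *\<^sub>R f k \<partial>lattice) = (\<Sum>k | k \<in> UNIV \<and> indicator S k *\<^sub>R f k \<noteq> 0. indicator S k *\<^sub>R f k)"
    by (rule lebesgue_integral_count_space_finite_support)
  also have "\<dots> = (\<Sum>k\<in>S. indicator S k *\<^sub>R f k)"
    by (rule sum.mono_neutral_left) (use assms in \<open>auto simp: indicator_def\<close>)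
  also have "\<dots> = (\<Sum>k\<in>S. f k)" by (intro sum.cong) auto
  finally show ?thesis .
qed

lemma sum_le_integral_lattice:
  fixes f :: "int^'n \<Rightarrow> real"
  assumes "finite S" "integrable lattice f" "\<And>k. 0 \<le> f k"
  shows "(\<Sum>k\<in>S. f k) \<le> (\<integral>k. f k \<partial>lattice)"
proof -
  have i: "integrable lattice (\<lambda>k. indicator S k *\<^sub>R f k)"
    by (rule Bochner_Integration.integrable_bound[OF assms(2)]) (auto split: split_indicator)
  have "(\<Sum>k\<in>S. f k) = (\<integral>k. indicator S k *\<^sub>R f k \<partial>lattice)"
    by (rule integral_lattice_indicator[OF assms(1), symmetric])
  also have "\<dots> \<le> (\<integral>k. f k \<partial>lattice)"
    by (rule integral_mono[OF i assms(2)]) (use assms(3) in \<open>auto split: split_indicator\<close>)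
  finally show ?thesis .
qed

lemma integral_lattice_limit:
  fixes f :: "int^'n \<Rightarrow> 'b::{banach, second_countable_topology}"
  assumes "integrable lattice f"
  shows "(\<lambda>j. \<Sum>k\<in>lattice_ball j. f k) \<longlonglongrightarrow> (\<integral>k. f k \<partial>lattice)"
proof -
  have "(\<lambda>j. \<integral>k. indicator (lattice_ball j) k *\<^sub>R f k \<partial>lattice) \<longlonglongrightarrow> (\<integral>k. f k \<partial>lattice)"
  proof (rule integral_dominated_convergence[where w="\<lambda>k. norm (f k)"])
    show "AE k in lattice. (\<lambda>j. indicator (lattice_ball j) k *\<^sub>R f k) \<longlonglongrightarrow> f k"
    proof (intro always_eventually allI)
      fix k
      show "(\<lambda>j. indicator (lattice_ball j) k *\<^sub>R f k) \<longlonglongrightarrow> f k"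
        by (rule tendsto_eventually, use eventually_in_lattice_ball[of k] in eventually_elim) simp
    qed
  qed (use assms in \<open>auto split: split_indicator\<close>)
  then show ?thesis by (simp add: integral_lattice_indicator)
qed

text \<open>
  The $q$-th power of the norm of a family of functions on the cube in
  $\ell^q(L^q)$.
\<close>
definition family_energy :: "real \<Rightarrow> (int ^ 'n \<Rightarrow> real ^ 'n \<Rightarrow> 'b::real_normed_vector) \<Rightarrow> ennreal" where
  "family_energy q u = (\<integral>\<^sup>+y. (\<integral>\<^sup>+m. ennreal (norm (u m y) powr q) \<partial>lattice) \<partial>cube_measure)"

lemma family_inner_measurable:
  fixes u :: "int ^ 'n \<Rightarrow> real ^ 'n \<Rightarrow> 'b::{real_normed_vector, second_countable_topology}"
  assumes [measurable]: "\<And>m. u m \<in> borel_measurable cube_measure"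
  shows "(\<lambda>y. \<integral>\<^sup>+m. ennreal (norm (u m y) powr q) \<partial>lattice) \<in> borel_measurable cube_measure"
  by (rule lattice_sigma.borel_measurable_nn_integral, unfold split_def, rule measurable_lattice_pair2) simp

lemma family_integral_measurable:
  fixes u :: "int ^ 'n \<Rightarrow> real ^ 'n \<Rightarrow> 'b::{banach, second_countable_topology}"
  assumes "\<And>m. u m \<in> borel_measurable M"
  shows "(\<lambda>y. \<integral>m. u m y \<partial>lattice) \<in> borel_measurable M"
  by (rule lattice_sigma.borel_measurable_lebesgue_integral, unfold split_def, rule measurable_lattice_pair2)
     (use assms in simp)

lemma family_energy_eq_sum:
  fixes u :: "int ^ 'n \<Rightarrow> real ^ 'n \<Rightarrow> complex"
  assumes [measurable]: "\<And>m. u m \<in> borel_measurable cube_measure"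
  shows "family_energy q u = (\<integral>\<^sup>+m. Lp_energy cube_measure q (u m) \<partial>lattice)"
  unfolding family_energy_def Lp_energy_def
  by (rule lattice_cube.Fubini', rule measurable_lattice_pair1) simp

lemma family_energy_tiles:
  fixes f :: "real^'n \<Rightarrow> complex"
  assumes [measurable]: "f \<in> borel_measurable borel"
  shows "family_energy q (\<lambda>j y. f (y + lattice_vec j)) = Lp_energy lborel q f"
  unfolding family_energy_def Lp_energy_def
  by (rule nn_integral_tiling[symmetric]) measurable

lemma translate_lattice_measurable_cube [measurable]:
  fixes f :: "real^'n \<Rightarrow> 'b::topological_space"
  assumes [measurable]: "f \<in> borel_measurable borel"
  shows "(\<lambda>y. f (y + h)) \<in> borel_measurable cube_measure" "(\<lambda>y. f (h - y)) \<in> borel_measurable cube_measure"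
  by (rule measurable_cube_measureI, measurable)+

lemma family_energy_finite_AE:
  fixes u :: "int ^ 'n \<Rightarrow> real ^ 'n \<Rightarrow> 'b::{real_normed_vector, second_countable_topology}"
  assumes "\<And>m. u m \<in> borel_measurable cube_measure" "family_energy q u < \<infinity>"
  shows "AE y in cube_measure. (\<integral>\<^sup>+m. ennreal (norm (u m y) powr q) \<partial>lattice) < \<infinity>"
  using nn_integral_PInf_AE[OF family_inner_measurable[of u q]] assms
  by (auto simp: family_energy_def less_top)

text \<open>
  The common majorant of analysis and synthesis with the bump kernel. Young's inequality
  bounds it on $\ell^q(L^q)$ for $q \ge 1$.
\<close>
definition decay_conv :: "(int ^ 'n \<Rightarrow> real ^ 'n \<Rightarrow> complex) \<Rightarrow> int ^ 'n \<Rightarrow> real ^ 'n \<Rightarrow> real" where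
  "decay_conv u m y = (\<integral>j. decay (m - j) * norm (u j y) \<partial>lattice)"

lemma decay_mass_pos: "0 < decay_mass TYPE('n::finite)"
proof -
  have "decay (0 :: int^'n) \<le> (\<integral>l. decay l \<partial>(lattice :: (int^'n) measure))"
    using sum_le_integral_lattice[of "{0 :: int^'n}" decay, OF _ decay_integrable] by simp
  then show ?thesis using decay_pos[of "0 :: int^'n"] unfolding decay_mass_def by linarith
qed

lemma decay_conv_measurable [measurable]:
  assumes "\<And>m. u m \<in> borel_measurable cube_measure"
  shows "decay_conv u m \<in> borel_measurable cube_measure"
  unfolding decay_conv_def[abs_def] by (rule family_integral_measurable) (use assms in measurable)

lemma decay_conv_nonneg: "0 \<le> decay_conv u m y"
  unfolding decay_conv_def by (rule Bochner_Integration.integral_nonneg) simp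

lemma decay_conv_pointwise:
  fixes u :: "int ^ 'n \<Rightarrow> real ^ 'n \<Rightarrow> complex"
  assumes q: "1 \<le> q" and fin: "(\<integral>\<^sup>+j. ennreal (norm (u j y) powr q) \<partial>lattice) < \<infinity>"
  shows "integrable lattice (\<lambda>j. decay (m - j) * norm (u j y))"
    and "(\<integral>\<^sup>+m. ennreal (norm (decay_conv u m y) powr q) \<partial>lattice)
      \<le> ennreal (decay_mass TYPE('n) powr q) * (\<integral>\<^sup>+j. ennreal (norm (u j y) powr q) \<partial>lattice)"
  using convolution_Young[OF q, of decay "\<lambda>j. norm (u j y)"] fin decay_integrable
  by (auto simp: decay_conv_def decay_mass_def Bochner_Integration.integral_nonneg)

lemma decay_conv_energy:
  fixes u :: "int ^ 'n \<Rightarrow> real ^ 'n \<Rightarrow> complex"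
  assumes q: "1 \<le> q" and [measurable]: "\<And>m. u m \<in> borel_measurable cube_measure" and fin: "family_energy q u < \<infinity>"
  shows "family_energy q (decay_conv u) \<le> ennreal (decay_mass TYPE('n) powr q) * family_energy q u"
proof -
  have "family_energy q (decay_conv u) \<le> (\<integral>\<^sup>+y. ennreal (decay_mass TYPE('n) powr q) * (\<integral>\<^sup>+j. ennreal (norm (u j y) powr q) \<partial>lattice) \<partial>cube_measure)"
    unfolding family_energy_def
  proof (rule nn_integral_mono_AE)
    show "AE y in cube_measure. (\<integral>\<^sup>+m. ennreal (norm (decay_conv u m y) powr q) \<partial>lattice)
      \<le> ennreal (decay_mass TYPE('n) powr q) * (\<integral>\<^sup>+j. ennreal (norm (u j y) powr q) \<partial>lattice)"
      using family_energy_finite_AE[OF assms(2) fin] by eventually_elim (rule decay_conv_pointwise[OF q])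
  qed
  also have "\<dots> = ennreal (decay_mass TYPE('n) powr q) * family_energy q u"
    unfolding family_energy_def by (rule nn_integral_cmult) (rule family_inner_measurable, simp)
  finally show ?thesis .
qed

lemma norm_bump_kernel_cube_le:
  assumes "y \<in> unit_cube"
  shows "norm (bump_kernel (lattice_vec l - y)) \<le> decay l" "norm (bump_kernel (lattice_vec l + y)) \<le> decay l"
  using norm_bump_kernel_le[of "- y" l] norm_bump_kernel_le[of y l] assms
  by (auto simp: unit_cube_def less_imp_le)

lemma bump_synthesis_energy:
  fixes a :: "int^'n \<Rightarrow> complex"
  assumes q: "1 \<le> q" and S: "finite S"
  shows "Lp_energy lborel q (\<lambda>x. \<Sum>k\<in>S. a k * bump_kernel (x - lattice_vec k))
    \<le> ennreal (decay_mass TYPE('n) powr q) * ennreal (\<Sum>k\<in>S. norm (a k) powr q)"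
proof -
  let ?f = "\<lambda>x. \<Sum>k\<in>S. a k * bump_kernel (x - lattice_vec k)"
  define u where "u = (\<lambda>k (y::real^'n). if k \<in> S then a k else 0)"
  have [measurable]: "u m \<in> borel_measurable cube_measure" for m unfolding u_def by simp
  have inner: "(\<integral>\<^sup>+j. ennreal (norm (u j y) powr q) \<partial>lattice) = ennreal (\<Sum>k\<in>S. norm (a k) powr q)" for y
  proof -
    have "(\<integral>\<^sup>+j. ennreal (norm (u j y) powr q) \<partial>lattice) = (\<integral>\<^sup>+j. ennreal (norm (a j) powr q) * indicator S j \<partial>lattice)"
      by (intro nn_integral_cong) (auto simp: u_def split: split_indicator)
    also have "\<dots> = (\<Sum>k\<in>S. ennreal (norm (a k) powr q))"
      using S by (subst nn_integral_indicator_finite) auto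
    finally show ?thesis by simp
  qed
  have E: "family_energy q u = ennreal (\<Sum>k\<in>S. norm (a k) powr q)"
    unfolding family_energy_def inner by (simp add: cube_prob.emeasure_space_1)
  have "Lp_energy lborel q ?f = family_energy q (\<lambda>j y. ?f (y + lattice_vec j))"
    by (rule family_energy_tiles[symmetric]) measurable
  also have "\<dots> \<le> family_energy q (decay_conv u)"
    unfolding family_energy_def
  proof (intro nn_integral_mono ennreal_leI powr_mono2)
    fix y :: "real^'n" and l :: "int^'n" assume "y \<in> space cube_measure"
    then have y: "y \<in> unit_cube" by simp
    have i: "integrable lattice (\<lambda>j. decay (l - j) * norm (u j y))"
      by (rule decay_conv_pointwise(1)[OF q, of u y]) (simp add: inner)
    have "norm (?f (y + lattice_vec l)) \<le> (\<Sum>k\<in>S. norm (a k * bump_kernel (y + lattice_vec l - lattice_vec k)))"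
      by (rule norm_sum)
    also have "\<dots> \<le> (\<Sum>k\<in>S. decay (l - k) * norm (u k y))"
    proof (intro sum_mono)
      fix k assume "k \<in> S"
      have "y + lattice_vec l - lattice_vec k = lattice_vec (l - k) + y" by simp
      then have "norm (bump_kernel (y + lattice_vec l - lattice_vec k)) \<le> decay (l - k)"
        using norm_bump_kernel_cube_le(2)[OF y] by metis
      then show "norm (a k * bump_kernel (y + lattice_vec l - lattice_vec k)) \<le> decay (l - k) * norm (u k y)"
        using \<open>k \<in> S\<close> by (simp add: norm_mult u_def mult.commute mult_left_mono)
    qed
    also have "\<dots> \<le> decay_conv u l y"
      unfolding decay_conv_def by (rule sum_le_integral_lattice[OF S i]) simp
    finally show "norm (?f (y + lattice_vec l)) \<le> norm (decay_conv u l y)"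
      by (simp add: decay_conv_nonneg)
  qed (use q in auto)
  also have "\<dots> \<le> ennreal (decay_mass TYPE('n) powr q) * family_energy q u"
    by (rule decay_conv_energy[OF q]) (auto simp: E)
  finally show ?thesis by (simp add: E)
qed

text \<open>
  Tile space by cubes. On the tile of $j$ the kernel is at most \<open>decay (m - j)\<close>, so the
  integral is at most the mean over the cube of \<open>decay_conv\<close>; Jensen's inequality moves the
  power \<open>q\<close> under that mean.
\<close>
lemma bump_sampling_bound:
  fixes V :: "real^'n \<Rightarrow> complex"
  assumes q: "1 \<le> q" and V: "V \<in> Lp_space lborel q"
  shows "(\<integral>\<^sup>+m. ennreal (norm (\<integral>x. V x * bump_kernel (lattice_vec m - x) \<partial>lborel) powr q) \<partial>lattice)
    \<le> ennreal (decay_mass TYPE('n) powr q) * Lp_energy lborel q V"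
proof -
  have [measurable]: "V \<in> borel_measurable borel" using V by (simp add: Lp_space_def)
  define u where "u = (\<lambda>j (y::real^'n). V (y + lattice_vec j))"
  have [measurable]: "u m \<in> borel_measurable cube_measure" for m unfolding u_def by measurable
  have E: "family_energy q u = Lp_energy lborel q V" unfolding u_def by (rule family_energy_tiles) measurable
  have fin: "family_energy q u < \<infinity>" using V by (simp add: E Lp_space_iff)
  have DE: "family_energy q (decay_conv u) \<le> ennreal (decay_mass TYPE('n) powr q) * Lp_energy lborel q V"
    using decay_conv_energy[OF q _ fin] by (simp add: E)
  have ae: "AE y in cube_measure. (\<integral>\<^sup>+j. ennreal (norm (u j y) powr q) \<partial>lattice) < \<infinity>"
    by (rule family_energy_finite_AE[OF _ fin]) simp
  have each: "ennreal (norm (\<integral>x. V x * bump_kernel (lattice_vec m - x) \<partial>lborel) powr q)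
      \<le> (\<integral>\<^sup>+y. ennreal (norm (decay_conv u m y) powr q) \<partial>cube_measure)" (is "?L \<le> ?R") for m
  proof (cases "?R < \<infinity>")
    case True
    let ?I = "\<integral>x. V x * bump_kernel (lattice_vec m - x) \<partial>lborel"
    have ip: "integrable cube_measure (\<lambda>y. decay_conv u m y powr q)"
      using True by (simp add: integrable_iff_bounded decay_conv_nonneg)
    have ib: "integrable cube_measure (decay_conv u m)"
      and pm: "(\<integral>y. decay_conv u m y \<partial>cube_measure) powr q \<le> (\<integral>y. decay_conv u m y powr q \<partial>cube_measure)"
      using power_mean[OF q, of "\<lambda>_. 1" "decay_conv u m" cube_measure] ip
      by (simp_all add: decay_conv_nonneg cube_prob.prob_space[simplified])
    have "ennreal (norm ?I) \<le> (\<integral>\<^sup>+x. ennreal (norm (V x * bump_kernel (lattice_vec m - x))) \<partial>lborel)"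
    proof (cases "integrable lborel (\<lambda>x. V x * bump_kernel (lattice_vec m - x))")
      case True
      then show ?thesis by (rule integral_norm_bound_ennreal)
    qed (simp add: not_integrable_integral_eq)
    also have "\<dots> = (\<integral>\<^sup>+y. (\<integral>\<^sup>+j. ennreal (norm (V (y + lattice_vec j) * bump_kernel (lattice_vec m - (y + lattice_vec j)))) \<partial>lattice) \<partial>cube_measure)"
      by (rule nn_integral_tiling) measurable
    also have "\<dots> \<le> (\<integral>\<^sup>+y. ennreal (decay_conv u m y) \<partial>cube_measure)"
    proof (rule nn_integral_mono_AE)
      have "AE y in (cube_measure :: (real^'n) measure). y \<in> unit_cube"
        using AE_space[of "cube_measure :: (real^'n) measure"] by simp
      with ae show "AE y in cube_measure. (\<integral>\<^sup>+j. ennreal (norm (V (y + lattice_vec j) * bump_kernel (lattice_vec m - (y + lattice_vec j)))) \<partial>lattice)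
          \<le> ennreal (decay_conv u m y)"
      proof eventually_elim
        case (elim y)
        have i: "integrable lattice (\<lambda>j. decay (m - j) * norm (u j y))"
          by (rule decay_conv_pointwise(1)[OF q, of u y]) (rule elim(1))
        have "(\<integral>\<^sup>+j. ennreal (norm (V (y + lattice_vec j) * bump_kernel (lattice_vec m - (y + lattice_vec j)))) \<partial>lattice)
            \<le> (\<integral>\<^sup>+j. ennreal (decay (m - j) * norm (u j y)) \<partial>lattice)"
        proof (intro nn_integral_mono ennreal_leI)
          fix j
          have "lattice_vec m - (y + lattice_vec j) = lattice_vec (m - j) - y" by simp
          then have "norm (bump_kernel (lattice_vec m - (y + lattice_vec j))) \<le> decay (m - j)"
            using norm_bump_kernel_cube_le(1)[OF elim(2)] by metis
          then show "norm (V (y + lattice_vec j) * bump_kernel (lattice_vec m - (y + lattice_vec j))) \<le> decay (m - j) * norm (u j y)"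
            by (auto simp: norm_mult u_def mult.commute[of "decay _"] intro!: mult_left_mono)
        qed
        also have "\<dots> = ennreal (decay_conv u m y)"
          unfolding decay_conv_def by (rule nn_integral_eq_integral[OF i]) simp
        finally show ?case .
      qed
    qed
    also have "\<dots> = ennreal (\<integral>y. decay_conv u m y \<partial>cube_measure)"
      by (rule nn_integral_eq_integral[OF ib]) (simp add: decay_conv_nonneg)
    finally have "norm ?I \<le> (\<integral>y. decay_conv u m y \<partial>cube_measure)"
      by (subst (asm) ennreal_le_iff) (auto simp: decay_conv_nonneg Bochner_Integration.integral_nonneg)
    then have "norm ?I powr q \<le> (\<integral>y. decay_conv u m y powr q \<partial>cube_measure)"
      using q pm by (intro order_trans[OF powr_mono2 pm]) auto
    then have "?L \<le> ennreal (\<integral>y. decay_conv u m y powr q \<partial>cube_measure)" by (rule ennreal_leI)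
    also have "\<dots> = ?R"
      using ip by (subst nn_integral_eq_integral[symmetric]) (auto simp: decay_conv_nonneg)
    finally show ?thesis .
  qed (simp add: not_less top_unique)
  have "(\<integral>\<^sup>+m. ennreal (norm (\<integral>x. V x * bump_kernel (lattice_vec m - x) \<partial>lborel) powr q) \<partial>lattice)
      \<le> (\<integral>\<^sup>+m. (\<integral>\<^sup>+y. ennreal (norm (decay_conv u m y) powr q) \<partial>cube_measure) \<partial>lattice)"
    by (rule nn_integral_mono) (rule each)
  also have "\<dots> = family_energy q (decay_conv u)"
    unfolding family_energy_def
    by (rule lattice_cube.Fubini'[symmetric], rule measurable_lattice_pair1) simp
  also note DE
  finally show ?thesis .
qed

definition lattice_conv :: "(int ^ 'n \<Rightarrow> complex) \<Rightarrow> (int ^ 'n \<Rightarrow> real ^ 'n \<Rightarrow> complex) \<Rightarrow> int ^ 'n \<Rightarrow> real ^ 'n \<Rightarrow> complex" where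
  "lattice_conv lam u m y = (\<integral>k. u k y * lam (m - k) \<partial>lattice)"

lemma lattice_conv_measurable [measurable]:
  assumes [measurable]: "\<And>m. u m \<in> borel_measurable cube_measure"
  shows "lattice_conv lam u m \<in> borel_measurable cube_measure"
  unfolding lattice_conv_def[abs_def] by (rule family_integral_measurable) measurable

text \<open>
  The kernel may decay slowly, so the absolute convergence of its convolution with an infinite
  sequence has to be extracted from the bound for finite sequences.
\<close>
locale lq_convolution =
  fixes lam :: "int ^ 'n \<Rightarrow> complex" and q B :: real
  assumes q1: "1 \<le> q" and B0: "0 \<le> B"
    and finite_bound: "\<And>S a. finite S \<Longrightarrow>
      (\<integral>\<^sup>+m. ennreal (norm (\<Sum>k\<in>S. a k * lam (m - k)) powr q) \<partial>lattice)
        \<le> ennreal (B powr q) * ennreal (\<Sum>k\<in>S. norm (a k) powr q)"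
begin

text \<open>
  Choosing the phases of \<open>a\<close> such that all terms become nonnegative, the bound for a finite
  sequence controls the sum of the absolute values, uniformly in the finite set. The
  bound for infinite sequences is then Fatou's lemma.
\<close>
lemma
  fixes a :: "int ^ 'n \<Rightarrow> complex"
  assumes fin: "(\<integral>\<^sup>+k. ennreal (norm (a k) powr q) \<partial>lattice) < \<infinity>"
  shows integrable_conv: "\<And>m. integrable lattice (\<lambda>k. a k * lam (m - k))"
    and conv_bound: "(\<integral>\<^sup>+m. ennreal (norm (\<integral>k. a k * lam (m - k) \<partial>lattice) powr q) \<partial>lattice)
      \<le> ennreal (B powr q) * (\<integral>\<^sup>+k. ennreal (norm (a k) powr q) \<partial>lattice)"
proof -
  let ?A = "\<integral>\<^sup>+k. ennreal (norm (a k) powr q) \<partial>lattice"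
  have SA: "ennreal (\<Sum>k\<in>S. norm (a k) powr q) \<le> ?A" if "finite S" for S
  proof -
    have "ennreal (\<Sum>k\<in>S. norm (a k) powr q) = (\<integral>\<^sup>+k. ennreal (norm (a k) powr q) * indicator S k \<partial>lattice)"
      using that by (subst nn_integral_indicator_finite) auto
    also have "\<dots> \<le> ?A" by (intro nn_integral_mono) (auto split: split_indicator)
    finally show ?thesis .
  qed
  obtain A where A: "?A = ennreal A" "0 \<le> A" using fin by (cases ?A) auto
  show int: "integrable lattice (\<lambda>k. a k * lam (m - k))" for m
  proof -
    have "(\<integral>\<^sup>+k. ennreal (norm (a k * lam (m - k))) \<partial>lattice) \<le> ennreal ((B powr q * A) powr (1 / q))"
    proof (rule nn_integral_lattice_le)
      fix S :: "(int^'n) set" assume S: "finite S"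
      \<comment> \<open>the phases that make every summand nonnegative\<close>
      define b where "b = (\<lambda>k. of_real (norm (a k)) * cnj (sgn (lam (m - k))))"
      have bn: "norm (b k) \<le> norm (a k)" for k
        by (simp add: b_def norm_mult norm_sgn)
      have bl: "b k * lam (m - k) = of_real (norm (a k * lam (m - k)))" for k
      proof (cases "lam (m - k) = 0")
        case False
        have "cnj (sgn (lam (m - k))) * lam (m - k) = of_real (norm (lam (m - k)))"
        proof -
          have "cnj (sgn (lam (m - k))) * lam (m - k) = (lam (m - k) * cnj (lam (m - k))) / of_real (norm (lam (m - k)))"
            by (simp add: sgn_eq)
          also have "\<dots> = of_real ((norm (lam (m - k)))\<^sup>2) / of_real (norm (lam (m - k)))"
            by (simp only: complex_norm_square)
          also have "\<dots> = of_real (norm (lam (m - k)))"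
            using False by (simp add: power2_eq_square)
          finally show ?thesis .
        qed
        then show ?thesis by (simp add: b_def norm_mult mult.assoc)
      qed (simp add: b_def)
      define s where "s = (\<Sum>k\<in>S. norm (a k * lam (m - k)))"
      have s0: "0 \<le> s" unfolding s_def by (intro sum_nonneg) auto
      have "ennreal (s powr q) = ennreal (norm (\<Sum>k\<in>S. b k * lam (m - k)) powr q)"
        unfolding bl of_real_sum[symmetric] s_def[symmetric] using s0 by simp
      also have "\<dots> \<le> (\<integral>\<^sup>+m. ennreal (norm (\<Sum>k\<in>S. b k * lam (m - k)) powr q) \<partial>lattice)"
      proof -
        have "ennreal (norm (\<Sum>k\<in>S. b k * lam (m - k)) powr q)
            = (\<integral>\<^sup>+m'. ennreal (norm (\<Sum>k\<in>S. b k * lam (m - k)) powr q) * indicator {m} m' \<partial>lattice)"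
          by (simp add: nn_integral_cmult_indicator)
        also have "\<dots> \<le> (\<integral>\<^sup>+m. ennreal (norm (\<Sum>k\<in>S. b k * lam (m - k)) powr q) \<partial>lattice)"
          by (intro nn_integral_mono) (auto split: split_indicator)
        finally show ?thesis .
      qed
      also have "\<dots> \<le> ennreal (B powr q) * ennreal (\<Sum>k\<in>S. norm (b k) powr q)"
        by (rule finite_bound[OF S])
      also have "\<dots> \<le> ennreal (B powr q) * ennreal (\<Sum>k\<in>S. norm (a k) powr q)"
        using bn q1 by (intro mult_left_mono ennreal_leI sum_mono powr_mono2) auto
      also have "\<dots> \<le> ennreal (B powr q) * ennreal A"
        using SA[OF S] A by (intro mult_left_mono) auto
      finally have "s powr q \<le> B powr q * A"
        using A by (simp add: ennreal_mult[symmetric] ennreal_le_iff)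
      then have "(s powr q) powr (1 / q) \<le> (B powr q * A) powr (1 / q)"
        using q1 by (intro powr_mono2) auto
      then have "s \<le> (B powr q * A) powr (1 / q)"
        using s0 q1 by (simp add: powr_powr)
      then show "(\<Sum>k\<in>S. ennreal (norm (a k * lam (m - k)))) \<le> ennreal ((B powr q * A) powr (1 / q))"
        unfolding s_def by (simp add: ennreal_leI)
    qed
    also have "\<dots> < \<infinity>" by simp
    finally show ?thesis by (simp add: integrable_lattice_iff)
  qed
  let ?s = "\<lambda>j m. \<Sum>k\<in>lattice_ball j. a k * lam (m - k)"
  have "(\<integral>\<^sup>+m. ennreal (norm (\<integral>k. a k * lam (m - k) \<partial>lattice) powr q) \<partial>lattice)
      = (\<integral>\<^sup>+m. liminf (\<lambda>j. ennreal (norm (?s j m) powr q)) \<partial>lattice)"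
  proof (rule nn_integral_cong)
    fix m :: "int^'n"
    have "(\<lambda>j. ennreal (norm (?s j m) powr q)) \<longlonglongrightarrow> ennreal (norm (\<integral>k. a k * lam (m - k) \<partial>lattice) powr q)"
      using q1 by (intro tendsto_ennrealI tendsto_powr2 tendsto_norm tendsto_const integral_lattice_limit int) auto
    then show "ennreal (norm (\<integral>k. a k * lam (m - k) \<partial>lattice) powr q) = liminf (\<lambda>j. ennreal (norm (?s j m) powr q))"
      by (rule lim_imp_Liminf[symmetric, rotated]) simp
  qed
  also have "\<dots> \<le> liminf (\<lambda>j. \<integral>\<^sup>+m. ennreal (norm (?s j m) powr q) \<partial>lattice)"
    by (rule nn_integral_liminf) simp
  also have "\<dots> \<le> liminf (\<lambda>j::nat. ennreal (B powr q) * ?A)"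
    by (intro Liminf_mono always_eventually allI order_trans[OF finite_bound[OF finite_lattice_ball]] mult_left_mono SA) auto
  also have "\<dots> = ennreal (B powr q) * ?A" by (simp add: Liminf_const)
  finally show "(\<integral>\<^sup>+m. ennreal (norm (\<integral>k. a k * lam (m - k) \<partial>lattice) powr q) \<partial>lattice) \<le> ennreal (B powr q) * ?A" .
qed

lemma lattice_conv_energy:
  assumes [measurable]: "\<And>m. u m \<in> borel_measurable cube_measure" and fin: "family_energy q u < \<infinity>"
  shows "family_energy q (lattice_conv lam u) \<le> ennreal (B powr q) * family_energy q u"
proof -
  have "family_energy q (lattice_conv lam u)
      \<le> (\<integral>\<^sup>+y. ennreal (B powr q) * (\<integral>\<^sup>+j. ennreal (norm (u j y) powr q) \<partial>lattice) \<partial>cube_measure)"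
    unfolding family_energy_def
  proof (rule nn_integral_mono_AE)
    show "AE y in cube_measure. (\<integral>\<^sup>+m. ennreal (norm (lattice_conv lam u m y) powr q) \<partial>lattice)
      \<le> ennreal (B powr q) * (\<integral>\<^sup>+j. ennreal (norm (u j y) powr q) \<partial>lattice)"
      using family_energy_finite_AE[OF assms(1) fin]
      by eventually_elim (unfold lattice_conv_def, rule conv_bound)
  qed
  also have "\<dots> = ennreal (B powr q) * family_energy q u"
    unfolding family_energy_def by (rule nn_integral_cmult) (rule family_inner_measurable, simp)
  finally show ?thesis .
qed

end

section \<open>Synthesis and weak type\<close>

lemma integral_tiling:
  fixes f :: "real^'n \<Rightarrow> complex"
  assumes f: "integrable lborel f"
  shows "(\<integral>x. f x \<partial>lborel) = (\<integral>y. (\<integral>k. f (y + lattice_vec k) \<partial>lattice) \<partial>cube_measure)"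
proof -
  note tile_measurable [measurable]
  have [measurable]: "f \<in> borel_measurable borel" using f by auto
  have i: "integrable (cube_measure \<Otimes>\<^sub>M lattice) (\<lambda>z. f (case z of (y, k) \<Rightarrow> y + lattice_vec k))"
    using f by (subst (asm) lborel_tiling, subst (asm) integrable_distr_eq) auto
  have "(\<integral>x. f x \<partial>lborel) = (\<integral>z. f (case z of (y, k) \<Rightarrow> y + lattice_vec k) \<partial>(cube_measure \<Otimes>\<^sub>M lattice))"
    by (subst lborel_tiling, subst integral_distr) auto
  also have "\<dots> = (\<integral>y. (\<integral>k. f (y + lattice_vec k) \<partial>lattice) \<partial>cube_measure)"
    using cube_lattice.integral_fst'[OF i] by simp
  finally show ?thesis .
qed

text \<open>
  Reassembles a function on space from a family \<open>H\<close> of functions on the torus. The kernel is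
  sampled at the distance of \<open>x\<close> from the lattice point, while the functions of the family are
  evaluated at the position of \<open>x\<close> in its tile.
\<close>
definition bump_synthesis :: "(int ^ 'n \<Rightarrow> real ^ 'n \<Rightarrow> complex) \<Rightarrow> real ^ 'n \<Rightarrow> complex" where
  "bump_synthesis H x = (\<integral>m. bump_kernel (x - lattice_vec m) * H m (frac_vec x) \<partial>lattice)"

lemma bump_synthesis_measurable [measurable]:
  assumes [measurable]: "\<And>m. H m \<in> borel_measurable cube_measure"
  shows "bump_synthesis H \<in> borel_measurable borel"
  unfolding bump_synthesis_def[abs_def] by (rule family_integral_measurable) measurable

lemma bump_synthesis_tile:
  assumes "y \<in> unit_cube"
  shows "bump_synthesis H (y + lattice_vec l) = (\<integral>m. bump_kernel (lattice_vec (l - m) + y) * H m y \<partial>lattice)"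
proof -
  have "y + lattice_vec l - lattice_vec m = lattice_vec (l - m) + y" for m by simp
  then show ?thesis unfolding bump_synthesis_def by (simp only: frac_vec_add_lattice[OF assms])
qed

lemma AE_in_unit_cube: "AE y in (cube_measure :: (real^'n) measure). y \<in> unit_cube"
  using AE_space[of "cube_measure :: (real^'n) measure"] by simp

lemma bump_synthesis_lattice_energy:
  fixes H :: "int ^ 'n \<Rightarrow> real ^ 'n \<Rightarrow> complex"
  assumes q: "1 \<le> q" and [measurable]: "\<And>m. H m \<in> borel_measurable cube_measure" and fin: "family_energy q H < \<infinity>"
  shows "Lp_energy lborel q (bump_synthesis H) \<le> ennreal (decay_mass TYPE('n) powr q) * family_energy q H"
proof -
  have "Lp_energy lborel q (bump_synthesis H) = family_energy q (\<lambda>l y. bump_synthesis H (y + lattice_vec l))"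
    by (rule family_energy_tiles[symmetric]) measurable
  also have "\<dots> \<le> family_energy q (decay_conv H)"
    unfolding family_energy_def
  proof (rule nn_integral_mono_AE)
    have "AE y in cube_measure. (\<integral>\<^sup>+m. ennreal (norm (H m y) powr q) \<partial>lattice) < \<infinity>"
      by (rule family_energy_finite_AE[OF _ fin]) simp
    with AE_in_unit_cube show "AE y in cube_measure. (\<integral>\<^sup>+l. ennreal (norm (bump_synthesis H (y + lattice_vec l)) powr q) \<partial>lattice)
        \<le> (\<integral>\<^sup>+l. ennreal (norm (decay_conv H l y) powr q) \<partial>lattice)"
    proof eventually_elim
      case (elim y)
      show ?case
      proof (intro nn_integral_mono ennreal_leI powr_mono2)
        fix l
        have i: "integrable lattice (\<lambda>m. decay (l - m) * norm (H m y))"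
          by (rule decay_conv_pointwise(1)[OF q, of H y]) (rule elim(2))
        have le: "norm (bump_kernel (lattice_vec (l - m) + y) * H m y) \<le> decay (l - m) * norm (H m y)" for m
          unfolding norm_mult by (intro mult_right_mono norm_bump_kernel_cube_le elim(1)) auto
        have "norm (bump_synthesis H (y + lattice_vec l)) \<le> (\<integral>m. norm (bump_kernel (lattice_vec (l - m) + y) * H m y) \<partial>lattice)"
          unfolding bump_synthesis_tile[OF elim(1)] by (rule integral_norm_bound)
        also have "\<dots> \<le> decay_conv H l y"
          unfolding decay_conv_def
          by (rule integral_mono[OF _ i le], rule Bochner_Integration.integrable_bound[OF i]) (use le in \<open>auto intro: order_trans\<close>)
        finally show "norm (bump_synthesis H (y + lattice_vec l)) \<le> norm (decay_conv H l y)"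
          by (simp add: decay_conv_nonneg)
      qed (use q in auto)
    qed
  qed
  also have "\<dots> \<le> ennreal (decay_mass TYPE('n) powr q) * family_energy q H"
    by (rule decay_conv_energy[OF q _ fin]) simp
  finally show ?thesis .
qed

text \<open>
  The value of $2 \sum_j 2^{j(1-p)}$; the series converges because $p > 1$.
\<close>
definition dyadic_const :: "real \<Rightarrow> real" where
  "dyadic_const p = 2 / (1 - 2 powr (1 - p))"

lemma dyadic_const_pos: "1 < p \<Longrightarrow> 0 < dyadic_const p"
  using powr_less_mono[of "1 - p" 0 2] by (simp add: dyadic_const_def)

text \<open>
  The term with $2^j t < h \le 2^{j+1} t$ alone suffices.
\<close>
lemma dyadic_domination:
  fixes h t :: real
  assumes t: "0 < t" and h: "t < h"
  shows "ennreal h \<le> (\<Sum>j. ennreal (2 ^ Suc j * t) * indicator {s. 2 ^ j * t < s} h)"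
proof -
  have "\<exists>n. h \<le> 2 ^ n * t"
  proof -
    obtain n where "h / t < 2 ^ n" using real_arch_pow[of 2 "h / t"] by auto
    then show ?thesis using t by (intro exI[of _ n]) (simp add: field_simps)
  qed
  define n where "n = (LEAST n. h \<le> 2 ^ n * t)"
  have n: "h \<le> 2 ^ n * t" unfolding n_def by (rule LeastI_ex) fact
  have "n \<noteq> 0" using n h by (intro notI) simp
  then obtain j where j: "n = Suc j" by (cases n) auto
  have "\<not> h \<le> 2 ^ j * t" using not_less_Least[of j "\<lambda>n. h \<le> 2 ^ n * t"] unfolding n_def[symmetric] j by simp
  then have "ennreal h \<le> ennreal (2 ^ Suc j * t) * indicator {s. 2 ^ j * t < s} h"
    using n j by (simp add: ennreal_leI)
  also have "\<dots> \<le> (\<Sum>j. ennreal (2 ^ Suc j * t) * indicator {s. 2 ^ j * t < s} h)"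
  proof -
    define F where "F = (\<lambda>j. ennreal (2 ^ Suc j * t) * indicator {s. 2 ^ j * t < s} h)"
    have "F j \<le> suminf F" using sum_le_suminf[OF summableI, of "{j}" F] by simp
    then show ?thesis unfolding F_def .
  qed
  finally show ?thesis .
qed

context
  fixes H :: "int ^ 'n \<Rightarrow> real ^ 'n \<Rightarrow> complex" and p A :: real
  assumes p: "1 < p" and A: "0 \<le> A"
    and H_measurable: "\<And>m. H m \<in> borel_measurable cube_measure"
    and weak: "\<And>t. 0 < t \<Longrightarrow>
      (\<integral>\<^sup>+m. emeasure cube_measure {y \<in> space cube_measure. t < norm (H m y)} \<partial>lattice) \<le> ennreal (A / t powr p)"
begin

text \<open>
  By dyadic domination the integral is at most the sum of $2^{j+1} t$ times the measure of
  $\{|H| > 2^j t\}$, which the weak type hypothesis bounds by a geometric series.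
\<close>
lemma large_values_integral:
  assumes t: "0 < t"
  shows "(\<integral>\<^sup>+m. (\<integral>\<^sup>+y. ennreal (norm (H m y)) * indicator {s. t < s} (norm (H m y)) \<partial>cube_measure) \<partial>lattice)
    \<le> ennreal (dyadic_const p * A * t powr (1 - p))"
proof -
  note H_measurable[measurable]
  let ?r = "2 powr (1 - p)"
  have r: "0 < ?r" "?r < 1" using p powr_less_mono[of "1 - p" 0 2] by auto
  have "(\<integral>\<^sup>+m. (\<integral>\<^sup>+y. ennreal (norm (H m y)) * indicator {s. t < s} (norm (H m y)) \<partial>cube_measure) \<partial>lattice)
      \<le> (\<integral>\<^sup>+m. (\<integral>\<^sup>+y. (\<Sum>j. ennreal (2 ^ Suc j * t) * indicator {s. 2 ^ j * t < s} (norm (H m y))) \<partial>cube_measure) \<partial>lattice)"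
  proof (intro nn_integral_mono)
    fix m y
    show "ennreal (norm (H m y)) * indicator {s. t < s} (norm (H m y))
        \<le> (\<Sum>j. ennreal (2 ^ Suc j * t) * indicator {s. 2 ^ j * t < s} (norm (H m y)))"
      by (cases "t < norm (H m y)") (use dyadic_domination[OF t] in auto)
  qed
  also have "\<dots> = (\<integral>\<^sup>+m. (\<Sum>j. ennreal (2 ^ Suc j * t) * emeasure cube_measure {y \<in> space cube_measure. 2 ^ j * t < norm (H m y)}) \<partial>lattice)"
  proof (intro nn_integral_cong)
    fix m
    have "(\<integral>\<^sup>+y. (\<Sum>j. ennreal (2 ^ Suc j * t) * indicator {s. 2 ^ j * t < s} (norm (H m y))) \<partial>cube_measure)
        = (\<Sum>j. (\<integral>\<^sup>+y. ennreal (2 ^ Suc j * t) * indicator {s. 2 ^ j * t < s} (norm (H m y)) \<partial>cube_measure))"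
      by (rule nn_integral_suminf) measurable
    also have "\<dots> = (\<Sum>j. ennreal (2 ^ Suc j * t) * emeasure cube_measure {y \<in> space cube_measure. 2 ^ j * t < norm (H m y)})"
    proof (intro arg_cong[where f=suminf] ext)
      fix j
      have "(\<integral>\<^sup>+y. ennreal (2 ^ Suc j * t) * indicator {s. 2 ^ j * t < s} (norm (H m y)) \<partial>cube_measure)
          = (\<integral>\<^sup>+y. ennreal (2 ^ Suc j * t) * indicator {y \<in> space cube_measure. 2 ^ j * t < norm (H m y)} y \<partial>cube_measure)"
        by (intro nn_integral_cong) (auto split: split_indicator)
      also have "\<dots> = ennreal (2 ^ Suc j * t) * emeasure cube_measure {y \<in> space cube_measure. 2 ^ j * t < norm (H m y)}"
        by (rule nn_integral_cmult_indicator) measurable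
      finally show "(\<integral>\<^sup>+y. ennreal (2 ^ Suc j * t) * indicator {s. 2 ^ j * t < s} (norm (H m y)) \<partial>cube_measure)
          = ennreal (2 ^ Suc j * t) * emeasure cube_measure {y \<in> space cube_measure. 2 ^ j * t < norm (H m y)}" .
    qed
    finally show "(\<integral>\<^sup>+y. (\<Sum>j. ennreal (2 ^ Suc j * t) * indicator {s. 2 ^ j * t < s} (norm (H m y))) \<partial>cube_measure)
        = (\<Sum>j. ennreal (2 ^ Suc j * t) * emeasure cube_measure {y \<in> space cube_measure. 2 ^ j * t < norm (H m y)})" .
  qed
  also have "\<dots> = (\<Sum>j. (\<integral>\<^sup>+m. ennreal (2 ^ Suc j * t) * emeasure cube_measure {y \<in> space cube_measure. 2 ^ j * t < norm (H m y)} \<partial>lattice))"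
    by (rule nn_integral_suminf) simp
  also have "\<dots> \<le> (\<Sum>j. ennreal (2 * A * t powr (1 - p) * ?r ^ j))"
  proof (intro suminf_le summableI)
    fix j
    have "(\<integral>\<^sup>+m. ennreal (2 ^ Suc j * t) * emeasure cube_measure {y \<in> space cube_measure. 2 ^ j * t < norm (H m y)} \<partial>lattice)
        = ennreal (2 ^ Suc j * t) * (\<integral>\<^sup>+m. emeasure cube_measure {y \<in> space cube_measure. 2 ^ j * t < norm (H m y)} \<partial>lattice)"
      by (rule nn_integral_cmult) simp
    also have "\<dots> \<le> ennreal (2 ^ Suc j * t) * ennreal (A / (2 ^ j * t) powr p)"
      using t by (intro mult_left_mono weak) auto
    also have "\<dots> = ennreal (2 ^ Suc j * t * (A / (2 ^ j * t) powr p))"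
      using t A by (intro ennreal_mult[symmetric]) auto
    also have "2 ^ Suc j * t * (A / (2 ^ j * t) powr p) = 2 * A * t powr (1 - p) * ?r ^ j"
    proof -
      have "2 ^ Suc j * t * (A / (2 ^ j * t) powr p) = 2 * A * ((2 ^ j * t) / (2 ^ j * t) powr p)" by simp
      also have "(2 ^ j * t) / (2 ^ j * t) powr p = (2 ^ j * t) powr (1 - p)"
        using t by (subst powr_diff) simp
      also have "(2 ^ j * t) powr (1 - p) = ?r ^ j * t powr (1 - p)"
        using t by (simp add: powr_mult powr_powr mult.commute flip: powr_realpow)
      finally show ?thesis by (simp only: mult_ac)
    qed
    finally show "(\<integral>\<^sup>+m. ennreal (2 ^ Suc j * t) * emeasure cube_measure {y \<in> space cube_measure. 2 ^ j * t < norm (H m y)} \<partial>lattice)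
        \<le> ennreal (2 * A * t powr (1 - p) * ?r ^ j)" .
  qed
  also have "\<dots> = ennreal (2 * A * t powr (1 - p) * (1 / (1 - ?r)))"
  proof (rule suminf_ennreal_eq)
    show "(\<lambda>j. 2 * A * t powr (1 - p) * ?r ^ j) sums (2 * A * t powr (1 - p) * (1 / (1 - ?r)))"
      using r by (intro sums_mult geometric_sums) auto
  qed (use A r in auto)
  also have "2 * A * t powr (1 - p) * (1 / (1 - ?r)) = dyadic_const p * A * t powr (1 - p)"
    by (simp add: dyadic_const_def)
  finally show ?thesis .
qed

text \<open>
  Weak $L^p$ is normable for $p > 1$, and this is a direct form of it. Values of $|H|$ below
  the level $t$ contribute at most $t$ times the mass of the kernel to the convolution; where
  the convolution exceeds twice that amount, the part of $|H|$ above $t$ has to contribute, and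
  Chebyshev's inequality with \<open>large_values_integral\<close> bounds the measure of that set.
\<close>
lemma weak_decay_sum:
  assumes t: "0 < t"
  shows "(\<integral>\<^sup>+y. (\<integral>\<^sup>+l. indicator {s. ennreal (2 * decay_mass TYPE('n) * t) < s} (\<integral>\<^sup>+m. ennreal (decay (l - m) * norm (H m y)) \<partial>lattice) \<partial>lattice) \<partial>cube_measure)
    \<le> ennreal (dyadic_const p * A / t powr p)"
proof -
  note H_measurable[measurable]
  define C where "C = decay_mass TYPE('n)"
  have C: "0 < C" unfolding C_def by (rule decay_mass_pos)
  have nC: "(\<integral>\<^sup>+m. ennreal (decay (l - m)) \<partial>lattice) = ennreal C" for l :: "int^'n"
    using lattice_shift_nn_integral(2)[of "\<lambda>m. ennreal (decay m)" l] nn_integral_eq_integral[OF decay_integrable]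
    by (simp add: C_def decay_mass_def)
  have nC': "(\<integral>\<^sup>+l. ennreal (decay (l - m)) \<partial>lattice) = ennreal C" for m :: "int^'n"
    using lattice_shift_nn_integral(1)[of "\<lambda>m. ennreal (decay m)" m] nn_integral_eq_integral[OF decay_integrable]
    by (simp add: C_def decay_mass_def)
  define big where "big = (\<lambda>m y. ennreal (norm (H m y)) * indicator {s. t < s} (norm (H m y)))"
  have [measurable]: "big m \<in> borel_measurable cube_measure" for m unfolding big_def by measurable
  have pt: "indicator {s. ennreal (2 * C * t) < s} (\<integral>\<^sup>+m. ennreal (decay (l - m) * norm (H m y)) \<partial>lattice)
      \<le> ennreal (1 / (C * t)) * (\<integral>\<^sup>+m. ennreal (decay (l - m)) * big m y \<partial>lattice)" (is "indicator _ ?S \<le> _ * ?R") for l y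
  proof (cases "ennreal (2 * C * t) < ?S")
    case True
    have "?S \<le> (\<integral>\<^sup>+m. ennreal t * ennreal (decay (l - m)) + ennreal (decay (l - m)) * big m y \<partial>lattice)"
    proof (rule nn_integral_mono)
      fix m
      show "ennreal (decay (l - m) * norm (H m y)) \<le> ennreal t * ennreal (decay (l - m)) + ennreal (decay (l - m)) * big m y"
      proof (cases "t < norm (H m y)")
        case True
        then show ?thesis by (simp add: big_def ennreal_mult add_increasing)
      next
        case False
        then have "ennreal (decay (l - m) * norm (H m y)) \<le> ennreal (decay (l - m) * t)"
          by (intro ennreal_leI mult_left_mono) auto
        also have "\<dots> = ennreal t * ennreal (decay (l - m))" using t by (simp add: ennreal_mult mult.commute)
        finally show ?thesis by (simp add: add_increasing2)
      qed
    qed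
    also have "\<dots> = ennreal t * ennreal C + ?R"
      by (simp add: nn_integral_add nn_integral_cmult nC)
    finally have S: "?S \<le> ennreal (C * t) + ?R"
      using C t by (simp add: ennreal_mult mult.commute)
    have "ennreal (C * t) + ennreal (C * t) = ennreal (2 * C * t)"
      using C t by (simp flip: ennreal_plus)
    also have "\<dots> < ennreal (C * t) + ?R" using True S by (rule less_le_trans)
    finally have "ennreal (C * t) \<le> ?R"
      by (meson add_left_mono linorder_not_le nle_le)
    then have "ennreal (1 / (C * t)) * ennreal (C * t) \<le> ennreal (1 / (C * t)) * ?R" by (rule mult_left_mono) simp
    moreover have "ennreal (1 / (C * t)) * ennreal (C * t) = 1"
      using C t by (simp flip: ennreal_mult)
    ultimately show ?thesis using True by simp
  qed simp
  have "(\<integral>\<^sup>+y. (\<integral>\<^sup>+l. indicator {s. ennreal (2 * C * t) < s} (\<integral>\<^sup>+m. ennreal (decay (l - m) * norm (H m y)) \<partial>lattice) \<partial>lattice) \<partial>cube_measure)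
      \<le> (\<integral>\<^sup>+y. (\<integral>\<^sup>+l. ennreal (1 / (C * t)) * (\<integral>\<^sup>+m. ennreal (decay (l - m)) * big m y \<partial>lattice) \<partial>lattice) \<partial>cube_measure)"
    by (intro nn_integral_mono pt)
  also have "\<dots> = (\<integral>\<^sup>+y. ennreal (1 / t) * (\<integral>\<^sup>+m. big m y \<partial>lattice) \<partial>cube_measure)"
  proof (intro nn_integral_cong)
    fix y
    have "(\<integral>\<^sup>+l. ennreal (1 / (C * t)) * (\<integral>\<^sup>+m. ennreal (decay (l - m)) * big m y \<partial>lattice) \<partial>lattice)
        = ennreal (1 / (C * t)) * (\<integral>\<^sup>+l. (\<integral>\<^sup>+m. ennreal (decay (l - m)) * big m y \<partial>lattice) \<partial>lattice)"
      by (rule nn_integral_cmult) simp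
    also have "(\<integral>\<^sup>+l. (\<integral>\<^sup>+m. ennreal (decay (l - m)) * big m y \<partial>lattice) \<partial>lattice)
        = (\<integral>\<^sup>+m. (\<integral>\<^sup>+l. ennreal (decay (l - m)) * big m y \<partial>lattice) \<partial>lattice)"
      by (rule lattice_lattice.Fubini'[symmetric], rule measurable_lattice_pair1) auto
    also have "\<dots> = (\<integral>\<^sup>+m. ennreal C * big m y \<partial>lattice)"
      by (simp add: nn_integral_multc nC')
    also have "\<dots> = ennreal C * (\<integral>\<^sup>+m. big m y \<partial>lattice)"
      by (rule nn_integral_cmult) simp
    also have "ennreal (1 / (C * t)) * (ennreal C * (\<integral>\<^sup>+m. big m y \<partial>lattice)) = ennreal (1 / t) * (\<integral>\<^sup>+m. big m y \<partial>lattice)"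
    proof -
      have "ennreal (1 / (C * t)) * ennreal C = ennreal (1 / t)"
        using C t by (simp flip: ennreal_mult)
      then show ?thesis by (simp add: mult.assoc[symmetric])
    qed
    finally show "(\<integral>\<^sup>+l. ennreal (1 / (C * t)) * (\<integral>\<^sup>+m. ennreal (decay (l - m)) * big m y \<partial>lattice) \<partial>lattice)
        = ennreal (1 / t) * (\<integral>\<^sup>+m. big m y \<partial>lattice)" .
  qed
  also have "\<dots> = ennreal (1 / t) * (\<integral>\<^sup>+y. (\<integral>\<^sup>+m. big m y \<partial>lattice) \<partial>cube_measure)"
    by (rule nn_integral_cmult, rule lattice_sigma.borel_measurable_nn_integral, unfold split_def, rule measurable_lattice_pair2) simp
  also have "(\<integral>\<^sup>+y. (\<integral>\<^sup>+m. big m y \<partial>lattice) \<partial>cube_measure) = (\<integral>\<^sup>+m. (\<integral>\<^sup>+y. big m y \<partial>cube_measure) \<partial>lattice)"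
    by (rule lattice_cube.Fubini', rule measurable_lattice_pair1) simp
  also have "ennreal (1 / t) * \<dots> \<le> ennreal (1 / t) * ennreal (dyadic_const p * A * t powr (1 - p))"
    unfolding big_def by (intro mult_left_mono large_values_integral t) simp
  also have "\<dots> = ennreal (1 / t * (dyadic_const p * A * t powr (1 - p)))"
    using t A dyadic_const_pos[OF p] by (subst ennreal_mult) (auto intro!: mult_nonneg_nonneg)
  also have "1 / t * (dyadic_const p * A * t powr (1 - p)) = dyadic_const p * A / t powr p"
    using t by (simp add: powr_diff)
  finally show ?thesis unfolding C_def .
qed

lemma decay_sum_measurable:
  "(\<lambda>y. \<integral>\<^sup>+m. ennreal (decay (l - m) * norm (H m y)) \<partial>lattice) \<in> borel_measurable cube_measure"
  by (rule lattice_sigma.borel_measurable_nn_integral, unfold split_def, rule measurable_lattice_pair2)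
     (use H_measurable in measurable)

text \<open>
  The set where the sum is infinite has measure at most a constant over $t^p$ for every $t$.
\<close>
lemma weak_decay_sum_finite_AE:
  "AE y in cube_measure. \<forall>l. (\<integral>\<^sup>+m. ennreal (decay (l - m) * norm (H m y)) \<partial>lattice) < \<infinity>"
proof -
  define S where "S = (\<lambda>l y. \<integral>\<^sup>+m. ennreal (decay (l - m) * norm (H m y)) \<partial>lattice)"
  define C where "C = decay_mass TYPE('n)"
  have [measurable]: "S l \<in> borel_measurable cube_measure" for l
    unfolding S_def by (rule decay_sum_measurable)
  have mI: "(\<lambda>y. \<integral>\<^sup>+l. indicator {\<infinity>} (S l y) \<partial>lattice) \<in> borel_measurable cube_measure"
    by (rule lattice_sigma.borel_measurable_nn_integral, unfold split_def, rule measurable_lattice_pair2) simp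
  let ?I = "\<integral>\<^sup>+y. (\<integral>\<^sup>+l. indicator {\<infinity>} (S l y) \<partial>lattice) \<partial>cube_measure"
  have "?I \<le> ennreal (dyadic_const p * A / t powr p)" if t: "0 < t" for t
  proof -
    have "?I \<le> (\<integral>\<^sup>+y. (\<integral>\<^sup>+l. indicator {s. ennreal (2 * C * t) < s} (S l y) \<partial>lattice) \<partial>cube_measure)"
      by (intro nn_integral_mono) (auto split: split_indicator)
    also have "\<dots> \<le> ennreal (dyadic_const p * A / t powr p)"
      unfolding S_def C_def by (rule weak_decay_sum[OF t])
    finally show ?thesis .
  qed
  then have "?I \<le> ennreal (dyadic_const p * A / (real (Suc k)) powr p)" for k by simp
  moreover have "(\<lambda>k. ennreal (dyadic_const p * A / (real (Suc k)) powr p)) \<longlonglongrightarrow> ennreal 0"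
  proof (rule tendsto_ennrealI)
    have "filterlim (\<lambda>k. real (Suc k)) at_top sequentially"
      by (rule filterlim_compose[OF filterlim_real_sequentially filterlim_Suc])
    then have "(\<lambda>k. real (Suc k) powr (- p)) \<longlonglongrightarrow> 0"
      using p by (intro tendsto_neg_powr) auto
    then have "(\<lambda>k. dyadic_const p * A * real (Suc k) powr (- p)) \<longlonglongrightarrow> dyadic_const p * A * 0"
      by (intro tendsto_mult tendsto_const)
    then show "(\<lambda>k. dyadic_const p * A / (real (Suc k)) powr p) \<longlonglongrightarrow> 0"
      by (simp add: powr_minus_divide)
  qed
  ultimately have "?I \<le> ennreal 0" by (intro LIMSEQ_le_const[where x="ennreal 0"]) auto
  then have "AE y in cube_measure. (\<integral>\<^sup>+l. indicator {\<infinity>} (S l y) \<partial>lattice) = (0::ennreal)"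
    using mI by (subst nn_integral_0_iff_AE[symmetric]) auto
  then show ?thesis
  proof eventually_elim
    case (elim y)
    then have "indicator {\<infinity>} (S l y) = (0::ennreal)" for l
      by (subst (asm) nn_integral_0_iff_AE) (auto simp: AE_count_space)
    then show ?case by (auto simp: S_def indicator_def less_top split: if_splits)
  qed
qed

lemma bump_synthesis_AE_integrable:
  "AE x in lborel. integrable lattice (\<lambda>m. bump_kernel (x - lattice_vec m) * H m (frac_vec x))"
proof -
  have "AE x in lborel. \<forall>l. (\<integral>\<^sup>+m. ennreal (decay (l - m) * norm (H m (frac_vec x))) \<partial>lattice) < \<infinity>"
    by (rule AE_cube_frac_vec[OF weak_decay_sum_finite_AE])
  then show ?thesis
  proof eventually_elim
    case (elim x)
    have "(\<integral>\<^sup>+m. ennreal (norm (bump_kernel (x - lattice_vec m) * H m (frac_vec x))) \<partial>lattice)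
        \<le> (\<integral>\<^sup>+m. ennreal (decay (floor_vec x - m) * norm (H m (frac_vec x))) \<partial>lattice)"
    proof (intro nn_integral_mono ennreal_leI)
      fix m
      have "x - lattice_vec m = lattice_vec (floor_vec x - m) + frac_vec x"
        using frac_plus_floor_vec[of x] by (simp add: algebra_simps)
      then have "norm (bump_kernel (x - lattice_vec m)) \<le> decay (floor_vec x - m)"
        using norm_bump_kernel_cube_le(2)[OF frac_vec_in_cube] by metis
      then show "norm (bump_kernel (x - lattice_vec m) * H m (frac_vec x)) \<le> decay (floor_vec x - m) * norm (H m (frac_vec x))"
        unfolding norm_mult by (rule mult_right_mono) simp
    qed
    also have "\<dots> < \<infinity>" using elim by blast
    finally show ?case by (simp add: integrable_lattice_iff)
  qed
qed

lemma bump_synthesis_weak_type: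
  assumes t: "0 < t"
  shows "emeasure lborel {x. t < norm (bump_synthesis H x)}
    \<le> ennreal (dyadic_const p * (2 * decay_mass TYPE('n)) powr p * A / t powr p)"
proof -
  note H_measurable[measurable]
  define C where "C = decay_mass TYPE('n)"
  have C: "0 < C" unfolding C_def by (rule decay_mass_pos)
  \<comment> \<open>the level for which the threshold \<open>2 * C * s\<close> of \<open>weak_decay_sum\<close> is \<open>t\<close>\<close>
  define s where "s = t / (2 * C)"
  have s: "0 < s" "t = 2 * C * s" using t C by (auto simp: s_def)
  let ?S = "\<lambda>l y. \<integral>\<^sup>+m. ennreal (decay (l - m) * norm (H m y)) \<partial>lattice"
  have "emeasure lborel {x. t < norm (bump_synthesis H x)} = (\<integral>\<^sup>+x. indicator {x. t < norm (bump_synthesis H x)} x \<partial>lborel)"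
    by simp
  also have "\<dots> = (\<integral>\<^sup>+y. (\<integral>\<^sup>+l. indicator {x. t < norm (bump_synthesis H x)} (y + lattice_vec l) \<partial>lattice) \<partial>cube_measure)"
    by (rule nn_integral_tiling) measurable
  also have "\<dots> \<le> (\<integral>\<^sup>+y. (\<integral>\<^sup>+l. indicator {s. ennreal t < s} (?S l y) \<partial>lattice) \<partial>cube_measure)"
  proof (intro nn_integral_mono)
    fix y :: "real^'n" and l :: "int^'n" assume "y \<in> space cube_measure"
    then have y: "y \<in> unit_cube" by simp
    have le: "ennreal (norm (bump_synthesis H (y + lattice_vec l))) \<le> ?S l y"
    proof (cases "integrable lattice (\<lambda>m. bump_kernel (lattice_vec (l - m) + y) * H m y)")
      case True
      have "ennreal (norm (bump_synthesis H (y + lattice_vec l))) \<le> (\<integral>\<^sup>+m. ennreal (norm (bump_kernel (lattice_vec (l - m) + y) * H m y)) \<partial>lattice)"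
        unfolding bump_synthesis_tile[OF y] by (rule integral_norm_bound_ennreal[OF True])
      also have "\<dots> \<le> ?S l y"
        unfolding norm_mult by (intro nn_integral_mono ennreal_leI mult_right_mono norm_bump_kernel_cube_le y) auto
      finally show ?thesis .
    qed (simp add: bump_synthesis_tile[OF y] not_integrable_integral_eq)
    have "ennreal t < ?S l y" if "t < norm (bump_synthesis H (y + lattice_vec l))"
    proof -
      have "ennreal t < ennreal (norm (bump_synthesis H (y + lattice_vec l)))"
        using that t by (simp add: ennreal_less_iff)
      then show ?thesis using le by (rule less_le_trans)
    qed
    then show "indicator {x. t < norm (bump_synthesis H x)} (y + lattice_vec l) \<le> (indicator {s. ennreal t < s} (?S l y) :: ennreal)"
      by (auto split: split_indicator)
  qed
  also have "\<dots> \<le> ennreal (dyadic_const p * A / s powr p)"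
    unfolding s(2) C_def by (rule weak_decay_sum[OF s(1)])
  also have "dyadic_const p * A / s powr p = dyadic_const p * (2 * C) powr p * A / t powr p"
    using t C by (simp add: s_def powr_divide)
  finally show ?thesis unfolding C_def .
qed

end

section \<open>The convolution kernel of a band-limited multiplier\<close>

lemma emeasure_lborel_unit_cube [simp]: "emeasure lborel (unit_cube :: (real^'n) set) = 1"
  using emeasure_unit_cube[where 'a='n] by (simp add: cube_measure_def emeasure_restrict_space)

lemmas fourier_L2_unique_euclidean = euclid.fourier_L2_unique[unfolded euclidean_simps]

lemmas fourier_L2_injective_euclidean = euclid.fourier_L2_injective[unfolded euclidean_simps]

lemmas fourier_L2_cong_AE_euclidean = euclid.fourier_L2_cong_AE[unfolded euclidean_simps]

lemmas fourier_L2_spaces_euclidean = euclid.fourier_L2_spaces[unfolded euclidean_simps]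

lemma Lp_space_vec_wave:
  assumes "u \<in> Lp_space lborel p"
  shows "(\<lambda>x. u x * wave x h) \<in> Lp_space lborel p"
proof -
  have [measurable]: "u \<in> borel_measurable borel" using assms by (simp add: Lp_space_def)
  show ?thesis using assms by (simp add: Lp_space_iff Lp_energy_def norm_mult)
qed

lemma fourier_cnj_reflect:
  fixes f :: "real^'n \<Rightarrow> complex"
  assumes [measurable]: "f \<in> borel_measurable borel"
  shows "fourier (\<lambda>x. cnj (f (h - x))) \<xi> = cnj (wave h \<xi> * fourier f \<xi>)"
proof -
  have "fourier (\<lambda>x. cnj (f (h - x))) \<xi> = (\<integral>x. cnj (f (h - x)) * cnj (wave (h - (h - x)) \<xi>) \<partial>lborel)"
    unfolding fourier_eq by simp
  also have "\<dots> = (\<integral>z. cnj (f z) * cnj (wave (h - z) \<xi>) \<partial>lborel)"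
    by (rule integral_vec_reflect[of "\<lambda>z. cnj (f z) * cnj (wave (h - z) \<xi>)"]) measurable
  also have "\<dots> = (\<integral>z. cnj (wave h \<xi> * (f z * cnj (wave z \<xi>))) \<partial>lborel)"
    by (intro Bochner_Integration.integral_cong) (auto simp: wave_diff_left)
  also have "\<dots> = cnj (wave h \<xi> * fourier f \<xi>)"
    unfolding fourier_eq by (simp del: complex_cnj_mult)
  finally show ?thesis .
qed

lemma fourier_modulate:
  "fourier (\<lambda>x. f x * wave x h) \<xi> = fourier f (\<xi> - h)"
  unfolding fourier_eq wave_diff_right by (simp add: mult_ac)

text \<open>
  The final constant is proportional to the bound \<open>B\<close> for \<open>T\<close> on $L^p$; the bound \<open>M\<close> for \<open>\<Lambda>\<close>
  itself takes the place of \<open>B\<close> in the $L^2$ estimates.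
\<close>
locale jodeit_multiplier =
  fixes p :: real and \<Lambda> :: "real ^ 'n \<Rightarrow> complex" and T :: "(real ^ 'n \<Rightarrow> complex) \<Rightarrow> real ^ 'n \<Rightarrow> complex"
    and B M :: real
  assumes p1: "1 < p"
    and Lam_measurable [measurable]: "\<Lambda> \<in> borel_measurable borel"
    and Lam_bound: "AE \<xi> in lborel. norm (\<Lambda> \<xi>) \<le> M" and M0: "0 \<le> M"
    and Lam_support: "AE \<xi> in lborel. \<not> (\<forall>i. 1/4 \<le> \<xi> $ i \<and> \<xi> $ i \<le> 3/4) \<longrightarrow> \<Lambda> \<xi> = 0"
    and T_maps: "\<And>f. f \<in> Lp_space lborel p \<Longrightarrow> T f \<in> Lp_space lborel p"
    and T_symbol: "has_symbol euclidean_lca p \<Lambda> T"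
    and B0: "0 \<le> B"
    and T_bound: "\<And>f. f \<in> Lp_space lborel p \<Longrightarrow> Lp_norm lborel p (T f) \<le> B * Lp_norm lborel p f"
begin

lemma Lam_bump: "AE \<xi> in lborel. \<Lambda> \<xi> * bump \<xi> = \<Lambda> \<xi>"
  using Lam_support by eventually_elim (use bump_eq_1 in auto)

lemma Lam_outside: "AE \<xi> in lborel. \<xi> \<notin> unit_cube \<longrightarrow> \<Lambda> \<xi> = 0"
  using Lam_bump by eventually_elim (use bump_eq_0 in force)

lemma Lam_integrable: "integrable lborel \<Lambda>"
proof (rule Bochner_Integration.integrable_bound[of _ "\<lambda>\<xi>. M * indicator unit_cube \<xi>"])
  show "AE \<xi> in lborel. norm (\<Lambda> \<xi>) \<le> norm (M * indicator unit_cube \<xi>)"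
    using Lam_bound Lam_outside by eventually_elim (use M0 in \<open>auto split: split_indicator\<close>)
qed (auto intro!: integrable_mult_right)

lemma T_energy: 
  assumes f: "f \<in> Lp_space lborel p"
  shows "Lp_energy lborel p (T f) \<le> ennreal (B powr p) * Lp_energy lborel p f"
proof -
  have "Lp_norm lborel p (T f) powr p \<le> (B * Lp_norm lborel p f) powr p"
    using T_bound[OF f] p1 by (intro powr_mono2) auto
  also have "\<dots> = B powr p * Lp_norm lborel p f powr p" using B0 by (simp add: powr_mult)
  finally show ?thesis
    using p1 by (simp add: Lp_energy_eq_norm[OF f] Lp_energy_eq_norm[OF T_maps[OF f]] ennreal_leI flip: ennreal_mult)
qed

lemma symbolE:
  assumes "f \<in> Lp_space lborel 2" "f \<in> Lp_space lborel p"
  obtains g where "fourier_L2 euclidean_lca f g" "fourier_L2 euclidean_lca (T f) (\<lambda>\<xi>. \<Lambda> \<xi> * g \<xi>)"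
  using T_symbol assms unfolding has_symbol_def by auto

lemma T_energy_2:
  assumes f: "f \<in> Lp_space lborel 2" "f \<in> Lp_space lborel p"
  shows "T f \<in> Lp_space lborel 2" "Lp_energy lborel 2 (T f) \<le> ennreal (M powr 2) * Lp_energy lborel 2 f"
proof -
  from symbolE[OF f] obtain g where g: "fourier_L2 euclidean_lca f g" "fourier_L2 euclidean_lca (T f) (\<lambda>\<xi>. \<Lambda> \<xi> * g \<xi>)" .
  show "T f \<in> Lp_space lborel 2" using euclid.fourier_L2_spaces(1)[OF g(2)] by simp
  have [measurable]: "g \<in> borel_measurable borel"
    using euclid.fourier_L2_spaces(2)[OF g(1)] by (simp add: Lp_space_def)
  have "Lp_energy lborel 2 (T f) = Lp_energy lborel 2 (\<lambda>\<xi>. \<Lambda> \<xi> * g \<xi>)"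
    using euclid.fourier_L2_energy[OF g(2)] by simp
  also have "\<dots> \<le> (\<integral>\<^sup>+\<xi>. ennreal (M powr 2) * ennreal (norm (g \<xi>) powr 2) \<partial>lborel)"
    unfolding Lp_energy_def
  proof (rule nn_integral_mono_AE)
    show "AE \<xi> in lborel. ennreal (norm (\<Lambda> \<xi> * g \<xi>) powr 2) \<le> ennreal (M powr 2) * ennreal (norm (g \<xi>) powr 2)"
      using Lam_bound
    proof eventually_elim
      case (elim \<xi>)
      have "norm (\<Lambda> \<xi> * g \<xi>) powr 2 \<le> (M * norm (g \<xi>)) powr 2"
        using elim by (intro powr_mono2) (auto simp: norm_mult intro!: mult_right_mono)
      also have "\<dots> = M powr 2 * norm (g \<xi>) powr 2" by (rule powr_mult)
      finally show ?case by (simp add: ennreal_leI flip: ennreal_mult)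
    qed
  qed
  also have "\<dots> = ennreal (M powr 2) * Lp_energy lborel 2 g"
    unfolding Lp_energy_def by (rule nn_integral_cmult) measurable
  also have "Lp_energy lborel 2 g = Lp_energy lborel 2 f"
    using euclid.fourier_L2_energy[OF g(1)] by simp
  finally show "Lp_energy lborel 2 (T f) \<le> ennreal (M powr 2) * Lp_energy lborel 2 f" .
qed

text \<open>
  The inverse Fourier transform of \<open>\<Lambda>\<close> at the lattice points.
\<close>
definition lam :: "int ^ 'n \<Rightarrow> complex" where
  "lam m = (\<integral>\<xi>. \<Lambda> \<xi> * wave (lattice_vec m) \<xi> \<partial>lborel)"

context
  fixes S :: "(int ^ 'n) set" and a :: "int ^ 'n \<Rightarrow> complex"
  assumes S: "finite S"
begin

definition comb :: "real ^ 'n \<Rightarrow> complex" where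
  "comb x = (\<Sum>k\<in>S. a k * bump_kernel (x - lattice_vec k))"

lemma comb_measurable [measurable]: "comb \<in> borel_measurable borel"
  unfolding comb_def by measurable

lemma comb_energy: "1 \<le> q \<Longrightarrow> Lp_energy lborel q comb \<le> ennreal (decay_mass TYPE('n) powr q) * ennreal (\<Sum>k\<in>S. norm (a k) powr q)"
  unfolding comb_def[abs_def] by (rule bump_synthesis_energy[OF _ S])

lemma comb_Lp:
  assumes "1 \<le> q" shows "comb \<in> Lp_space lborel q"
proof -
  note comb_energy[OF assms]
  also have "ennreal (decay_mass TYPE('n) powr q) * ennreal (\<Sum>k\<in>S. norm (a k) powr q) < \<infinity>"
    by (simp add: ennreal_mult_less_top)
  finally show ?thesis by (simp add: Lp_space_iff)
qed

lemma fourier_comb: "fourier comb \<xi> = (\<Sum>k\<in>S. a k * (cnj (wave (lattice_vec k) \<xi>) * bump \<xi>))"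
proof -
  have i: "integrable lborel (\<lambda>x. a k * (bump_kernel (x - lattice_vec k) * cnj (wave x \<xi>)))" for k
    using integrable_vec_translate[OF bump_kernel_integrable, of "- lattice_vec k"]
    by (intro integrable_mult_right integrable_mult_unimodular) auto
  have "fourier comb \<xi> = (\<integral>x. (\<Sum>k\<in>S. a k * (bump_kernel (x - lattice_vec k) * cnj (wave x \<xi>))) \<partial>lborel)"
    unfolding fourier_eq comb_def by (simp add: sum_distrib_right mult.assoc)
  also have "\<dots> = (\<Sum>k\<in>S. a k * fourier (\<lambda>x. bump_kernel (x + - lattice_vec k)) \<xi>)"
    unfolding fourier_eq using i by (subst Bochner_Integration.integral_sum) auto
  also have "\<dots> = (\<Sum>k\<in>S. a k * (cnj (wave (lattice_vec k) \<xi>) * bump \<xi>))"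
    by (simp only: fourier_translate[OF bump_kernel_measurable] fourier_bump_kernel wave_minus_left)
  finally show ?thesis .
qed

text \<open>
  Convolution by \<open>lam\<close> is a compression of \<open>T\<close>: spread the sequence \<open>a\<close> out by the bump kernel,
  apply \<open>T\<close>, and sample with the bump kernel. On the Fourier side this multiplies by \<open>bump\<close> twice,
  which does not change \<open>\<Lambda>\<close>.
\<close>
lemma sampled_convolution:
  "(\<integral>x. T comb x * bump_kernel (lattice_vec m - x) \<partial>lborel) = (\<Sum>k\<in>S. a k * lam (m - k))"
proof -
  have c2: "comb \<in> Lp_space lborel 2" and cp: "comb \<in> Lp_space lborel p" and c1: "integrable lborel comb"
    using comb_Lp[of 2] comb_Lp[of p] comb_Lp[of 1] p1 by (auto simp: Lp_space_1_iff)
  from symbolE[OF c2 cp] obtain g where g: "fourier_L2 euclidean_lca comb g" "fourier_L2 euclidean_lca (T comb) (\<lambda>\<xi>. \<Lambda> \<xi> * g \<xi>)" .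
  have [measurable]: "g \<in> borel_measurable borel"
    using euclid.fourier_L2_spaces(2)[OF g(1)] by (simp add: Lp_space_def)
  have ge: "AE \<xi> in lborel. g \<xi> = fourier comb \<xi>"
    using fourier_L2_unique_euclidean[OF g(1) fourier_L2_fourier[OF c1 c2]] by simp
  let ?w = "\<lambda>x. cnj (bump_kernel (lattice_vec m - x))"
  have w1: "integrable lborel ?w"
  proof -
    have "integrable (distr lborel borel (\<lambda>x. lattice_vec m - x)) (\<lambda>z :: real^'n. cnj (bump_kernel z))"
      using bump_kernel_integrable by (simp add: lborel_vec_reflect)
    then show ?thesis by (subst (asm) integrable_distr_eq) auto
  qed
  have w2: "?w \<in> Lp_space lborel 2"
    by (rule Lp_space_cnj[OF Lp_space_reflect[OF bump_kernel_L2]])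
  have "(\<integral>x. T comb x * bump_kernel (lattice_vec m - x) \<partial>lborel) = (\<integral>x. T comb x * cnj (?w x) \<partial>lborel)" by simp
  also have "\<dots> = (\<integral>\<xi>. (\<Lambda> \<xi> * g \<xi>) * cnj (fourier ?w \<xi>) \<partial>lborel)"
    by (rule parseval_euclidean[OF g(2) fourier_L2_fourier[OF w1 w2]])
  also have "\<dots> = (\<integral>\<xi>. (\<Sum>k\<in>S. a k * (\<Lambda> \<xi> * wave (lattice_vec (m - k)) \<xi>)) \<partial>lborel)"
  proof (rule integral_cong_AE)
    show "AE \<xi> in lborel. (\<Lambda> \<xi> * g \<xi>) * cnj (fourier ?w \<xi>) = (\<Sum>k\<in>S. a k * (\<Lambda> \<xi> * wave (lattice_vec (m - k)) \<xi>))"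
      using ge Lam_bump
    proof eventually_elim
      case (elim \<xi>)
      have "(\<Lambda> \<xi> * g \<xi>) * cnj (fourier ?w \<xi>) = (\<Sum>k\<in>S. a k * (((\<Lambda> \<xi> * bump \<xi>) * bump \<xi>) * (wave (lattice_vec m) \<xi> * cnj (wave (lattice_vec k) \<xi>))))"
        unfolding elim(1) fourier_comb fourier_cnj_reflect[OF bump_kernel_measurable] fourier_bump_kernel complex_cnj_cnj
        by (simp add: sum_distrib_left sum_distrib_right mult_ac)
      then show ?case unfolding elim(2) lattice_vec_simps wave_diff_left .
    qed
  qed measurable
  also have "\<dots> = (\<Sum>k\<in>S. a k * lam (m - k))"
  proof -
    have "integrable lborel (\<lambda>\<xi>. a k * (\<Lambda> \<xi> * wave (lattice_vec (m - k)) \<xi>))" for k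
      by (intro integrable_mult_right integrable_mult_unimodular[OF Lam_integrable]) auto
    then show ?thesis unfolding lam_def by (subst Bochner_Integration.integral_sum) auto
  qed
  finally show ?thesis .
qed

lemma finite_convolution_bound:
  assumes q: "1 \<le> q" and D: "0 \<le> D"
    and bound: "T comb \<in> Lp_space lborel q" "Lp_energy lborel q (T comb) \<le> ennreal (D powr q) * Lp_energy lborel q comb"
  shows "(\<integral>\<^sup>+m. ennreal (norm (\<Sum>k\<in>S. a k * lam (m - k)) powr q) \<partial>lattice)
    \<le> ennreal ((D * decay_mass TYPE('n) ^ 2) powr q) * ennreal (\<Sum>k\<in>S. norm (a k) powr q)"
proof -
  define C where "C = decay_mass TYPE('n)"
  have C: "0 < C" unfolding C_def by (rule decay_mass_pos)
  have "(\<integral>\<^sup>+m. ennreal (norm (\<Sum>k\<in>S. a k * lam (m - k)) powr q) \<partial>lattice)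
      = (\<integral>\<^sup>+m. ennreal (norm (\<integral>x. T comb x * bump_kernel (lattice_vec m - x) \<partial>lborel) powr q) \<partial>lattice)"
    unfolding sampled_convolution ..
  also have "\<dots> \<le> ennreal (C powr q) * Lp_energy lborel q (T comb)"
    unfolding C_def by (rule bump_sampling_bound[OF q bound(1)])
  also have "\<dots> \<le> ennreal (C powr q) * (ennreal (D powr q) * (ennreal (C powr q) * ennreal (\<Sum>k\<in>S. norm (a k) powr q)))"
    unfolding C_def by (intro mult_left_mono order_trans[OF bound(2)] comb_energy[OF q]) auto
  also have "\<dots> = ennreal (C powr q * (D powr q * C powr q)) * ennreal (\<Sum>k\<in>S. norm (a k) powr q)"
    by (simp add: ennreal_mult mult.assoc)
  also have "C powr q * (D powr q * C powr q) = (D * C ^ 2) powr q"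
    using C D by (simp add: powr_mult power2_eq_square mult_ac)
  finally show ?thesis unfolding C_def .
qed

end

text \<open>
  Convolution by \<open>lam\<close> is needed on $\ell^p$ for the weak type estimate, and on $\ell^2$ for
  the computation of the symbol.
\<close>
sublocale Lp: lq_convolution lam p "B * decay_mass TYPE('n) ^ 2"
proof
  show "0 \<le> B * decay_mass TYPE('n) ^ 2" using B0 by simp
  fix S :: "(int^'n) set" and a assume S: "finite S"
  have c: "comb S a \<in> Lp_space lborel p" using comb_Lp[OF S] p1 by simp
  show "(\<integral>\<^sup>+m. ennreal (norm (\<Sum>k\<in>S. a k * lam (m - k)) powr p) \<partial>lattice)
    \<le> ennreal ((B * decay_mass TYPE('n) ^ 2) powr p) * ennreal (\<Sum>k\<in>S. norm (a k) powr p)"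
    by (rule finite_convolution_bound[OF S _ B0 T_maps[OF c] T_energy[OF c]]) (use p1 in simp)
qed (use p1 in simp)

sublocale L2: lq_convolution lam 2 "M * decay_mass TYPE('n) ^ 2"
proof
  show "0 \<le> M * decay_mass TYPE('n) ^ 2" using M0 by simp
  fix S :: "(int^'n) set" and a assume S: "finite S"
  have c: "comb S a \<in> Lp_space lborel 2" "comb S a \<in> Lp_space lborel p" using comb_Lp[OF S] p1 by auto
  show "(\<integral>\<^sup>+m. ennreal (norm (\<Sum>k\<in>S. a k * lam (m - k)) powr 2) \<partial>lattice)
    \<le> ennreal ((M * decay_mass TYPE('n) ^ 2) powr 2) * ennreal (\<Sum>k\<in>S. norm (a k) powr 2)"
    by (rule finite_convolution_bound[OF S _ M0 T_energy_2[OF c]]) simp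
qed simp

end

text \<open>
  The periodization of \<open>\<lambda>x. bump_kernel (lattice_vec k - x) * f x\<close>. Its \<open>n\<close>-th Fourier coefficient
  is the value at the lattice point \<open>k\<close> of the part of \<open>f\<close> with frequencies in the \<open>n\<close>-th cube.
\<close>
definition bump_analysis :: "(real ^ 'n \<Rightarrow> complex) \<Rightarrow> int ^ 'n \<Rightarrow> real ^ 'n \<Rightarrow> complex" where
  "bump_analysis f k y = (\<integral>j. bump_kernel (lattice_vec k - (y + lattice_vec j)) * f (y + lattice_vec j) \<partial>lattice)"

lemma bump_analysis_measurable [measurable]:
  assumes [measurable]: "f \<in> borel_measurable borel"
  shows "bump_analysis f k \<in> borel_measurable cube_measure"
proof -
  have "(\<lambda>y. bump_kernel (lattice_vec k - (y + lattice_vec j)) * f (y + lattice_vec j)) \<in> borel_measurable cube_measure" for j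
    by (rule measurable_cube_measureI) measurable
  then show ?thesis
    unfolding bump_analysis_def[abs_def] by (rule family_integral_measurable)
qed

lemma bump_analysis_term_le:
  assumes "y \<in> unit_cube"
  shows "norm (bump_kernel (lattice_vec k - (y + lattice_vec j)) * f (y + lattice_vec j)) \<le> decay (k - j) * norm (f (y + lattice_vec j))"
proof -
  have "lattice_vec k - (y + lattice_vec j) = lattice_vec (k - j) - y" by simp
  then have "norm (bump_kernel (lattice_vec k - (y + lattice_vec j))) \<le> decay (k - j)"
    using norm_bump_kernel_cube_le(1)[OF assms] by metis
  then show ?thesis unfolding norm_mult by (rule mult_right_mono) simp
qed

lemma
  fixes f :: "real^'n \<Rightarrow> complex"
  assumes q: "1 \<le> q" and f: "f \<in> Lp_space lborel q"
  shows bump_analysis_integrable: "AE y in cube_measure. \<forall>k. integrable lattice (\<lambda>j. bump_kernel (lattice_vec k - (y + lattice_vec j)) * f (y + lattice_vec j))"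
    and bump_analysis_energy: "family_energy q (bump_analysis f) \<le> ennreal (decay_mass TYPE('n) powr q) * Lp_energy lborel q f"
proof -
  have [measurable]: "f \<in> borel_measurable borel" using f by (simp add: Lp_space_def)
  define u where "u = (\<lambda>j (y::real^'n). f (y + lattice_vec j))"
  have [measurable]: "u m \<in> borel_measurable cube_measure" for m unfolding u_def by measurable
  have E: "family_energy q u = Lp_energy lborel q f" unfolding u_def by (rule family_energy_tiles) measurable
  have fin: "family_energy q u < \<infinity>" using f by (simp add: E Lp_space_iff)
  have ae: "AE y in cube_measure. (\<integral>\<^sup>+j. ennreal (norm (u j y) powr q) \<partial>lattice) < \<infinity>"
    by (rule family_energy_finite_AE[OF _ fin]) simp
  have int: "integrable lattice (\<lambda>j. bump_kernel (lattice_vec k - (y + lattice_vec j)) * f (y + lattice_vec j))"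
    if "y \<in> unit_cube" "(\<integral>\<^sup>+j. ennreal (norm (u j y) powr q) \<partial>lattice) < \<infinity>" for y k
    by (rule Bochner_Integration.integrable_bound[OF decay_conv_pointwise(1)[OF q, of u y k]])
       (use that(2) bump_analysis_term_le[OF that(1), of k] in \<open>auto simp: u_def\<close>)
  show "AE y in cube_measure. \<forall>k. integrable lattice (\<lambda>j. bump_kernel (lattice_vec k - (y + lattice_vec j)) * f (y + lattice_vec j))"
    using ae AE_in_unit_cube by eventually_elim (use int in blast)
  have "family_energy q (bump_analysis f) \<le> family_energy q (decay_conv u)"
    unfolding family_energy_def
  proof (rule nn_integral_mono_AE)
    show "AE y in cube_measure. (\<integral>\<^sup>+m. ennreal (norm (bump_analysis f m y) powr q) \<partial>lattice)
        \<le> (\<integral>\<^sup>+m. ennreal (norm (decay_conv u m y) powr q) \<partial>lattice)"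
      using ae AE_in_unit_cube
    proof eventually_elim
      case (elim y)
      show ?case
      proof (intro nn_integral_mono ennreal_leI powr_mono2)
        fix m
        have "norm (bump_analysis f m y) \<le> (\<integral>j. norm (bump_kernel (lattice_vec m - (y + lattice_vec j)) * f (y + lattice_vec j)) \<partial>lattice)"
          unfolding bump_analysis_def by (rule integral_norm_bound)
        also have "\<dots> \<le> decay_conv u m y"
          unfolding decay_conv_def
          by (rule integral_mono[OF integrable_norm[OF int[OF elim(2,1)]] decay_conv_pointwise(1)[OF q, of u y m]])
             (use elim(1) bump_analysis_term_le[OF elim(2), of m] in \<open>auto simp: u_def\<close>)
        finally show "norm (bump_analysis f m y) \<le> norm (decay_conv u m y)"
          by (simp add: decay_conv_nonneg)
      qed (use q in auto)
    qed
  qed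
  also have "\<dots> \<le> ennreal (decay_mass TYPE('n) powr q) * Lp_energy lborel q f"
    using decay_conv_energy[OF q _ fin] by (simp add: E)
  finally show "family_energy q (bump_analysis f) \<le> ennreal (decay_mass TYPE('n) powr q) * Lp_energy lborel q f" .
qed

section \<open>The transferred operator\<close>

lemma linear_on_LpD:
  assumes "linear_on_Lp M p Y S"
  shows "f \<in> Lp_space M p \<Longrightarrow> S f \<in> Y"
    and "f \<in> Lp_space M p \<Longrightarrow> g \<in> Lp_space M p \<Longrightarrow> AE x in M. f x = g x \<Longrightarrow> AE x in M. S f x = S g x"
    and "f \<in> Lp_space M p \<Longrightarrow> g \<in> Lp_space M p \<Longrightarrow> AE x in M. S (\<lambda>y. f y + g y) x = S f x + S g x"
    and "f \<in> Lp_space M p \<Longrightarrow> AE x in M. S (\<lambda>y. c * f y) x = c * S f x"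
  using assms by (simp_all add: linear_on_Lp_def)

text \<open>
  The final constant is proportional to the weak type constant \<open>K\<close> of \<open>U\<close>; the bound \<open>N\<close> for \<open>\<phi>\<close>
  is for the $L^2$ estimates.
\<close>
locale jodeit_transfer = jodeit_multiplier p \<Lambda> T B M
  for p and \<Lambda> :: "real ^ 'n \<Rightarrow> complex" and T B M +
  fixes \<phi> :: "int ^ 'n \<Rightarrow> complex" and U :: "(real ^ 'n \<Rightarrow> complex) \<Rightarrow> real ^ 'n \<Rightarrow> complex" and K N :: real
  assumes U_op: "weak_multiplier_op torus_lca p \<phi> U K"
    and phi_bound: "\<And>n. norm (\<phi> n) \<le> N"
begin

lemma U_linear: "linear_on_Lp cube_measure p (weak_Lp_space cube_measure p) U"
  and U_symbol: "has_symbol torus_lca p \<phi> U"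
  and K0: "0 \<le> K"
  using U_op by (auto simp: weak_multiplier_op_def)

lemma U_weak:
  assumes "f \<in> Lp_space cube_measure p" "0 < t"
  shows "emeasure cube_measure {x \<in> space cube_measure. t < norm (U f x)}
      \<le> ennreal (K powr p / t powr p) * Lp_energy cube_measure p f"
proof -
  have "emeasure cube_measure {x \<in> space cube_measure. t < norm (U f x)}
      \<le> ennreal (K powr p / t powr p * Lp_norm cube_measure p f powr p)"
    using U_op assms by (auto simp: weak_multiplier_op_def)
  also have "\<dots> = ennreal (K powr p / t powr p) * Lp_energy cube_measure p f"
  proof -
    have "0 < p" using p1 by simp
    from Lp_energy_eq_norm[OF assms(1) this] show ?thesis by (simp only:) (rule ennreal_mult, auto)
  qed
  finally show ?thesis .
qed

lemma U_measurable: "f \<in> Lp_space cube_measure p \<Longrightarrow> U f \<in> borel_measurable cube_measure"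
  using linear_on_LpD(1)[OF U_linear] by (auto simp: weak_Lp_space_def)

lemma U_cong:
  "f \<in> Lp_space cube_measure p \<Longrightarrow> g \<in> Lp_space cube_measure p \<Longrightarrow> AE x in cube_measure. f x = g x
    \<Longrightarrow> AE x in cube_measure. U f x = U g x"
  by (rule linear_on_LpD(2)[OF U_linear])

lemma U_add_cmult:
  assumes f: "f \<in> Lp_space cube_measure p" and g: "g \<in> Lp_space cube_measure p"
  shows "AE x in cube_measure. U (\<lambda>y. f y + c * g y) x = U f x + c * U g x"
proof -
  have cg: "(\<lambda>y. c * g y) \<in> Lp_space cube_measure p" by (rule Lp_space_cmult[OF g])
  have "AE x in cube_measure. U (\<lambda>y. f y + c * g y) x = U f x + U (\<lambda>y. c * g y) x"
    by (rule linear_on_LpD(3)[OF U_linear f cg])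
  moreover have "AE x in cube_measure. U (\<lambda>y. c * g y) x = c * U g x"
    by (rule linear_on_LpD(4)[OF U_linear g])
  ultimately show ?thesis by eventually_elim simp
qed

definition slices :: "(real ^ 'n \<Rightarrow> complex) \<Rightarrow> int ^ 'n \<Rightarrow> real ^ 'n \<Rightarrow> complex" where
  "slices f = lattice_conv lam (bump_analysis f)"

definition images :: "(real ^ 'n \<Rightarrow> complex) \<Rightarrow> int ^ 'n \<Rightarrow> real ^ 'n \<Rightarrow> complex" where
  "images f m = U (slices f m)"

text \<open>
  The operator on Euclidean space: analysis, convolution by \<open>lam\<close> over the lattice, \<open>U\<close> on each
  torus function, synthesis. For \<open>f\<close> in $L^p$ all sums converge absolutely almost everywhere.
\<close>
definition transferred :: "(real ^ 'n \<Rightarrow> complex) \<Rightarrow> real ^ 'n \<Rightarrow> complex" where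
  "transferred f = bump_synthesis (images f)"

lemma slices_measurable [measurable]: "f \<in> borel_measurable borel \<Longrightarrow> slices f m \<in> borel_measurable cube_measure"
  unfolding slices_def by measurable

text \<open>
  Stated for a general exponent, to be used with \<open>p\<close> for the weak type estimate and with 2 for the
  symbol.
\<close>
lemma slices_energy:
  assumes f: "f \<in> Lp_space lborel q" and q: "1 \<le> q" and lc: "lq_convolution lam q D"
  shows "family_energy q (slices f) \<le> ennreal ((D * decay_mass TYPE('n)) powr q) * Lp_energy lborel q f"
    and "family_energy q (slices f) < \<infinity>"
    and "slices f m \<in> Lp_space cube_measure q"
proof -
  have [measurable]: "f \<in> borel_measurable borel" using f by (simp add: Lp_space_def)
  have D: "0 \<le> D" using lc by (simp add: lq_convolution_def)
  note an = bump_analysis_energy[OF q f]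
  also have "ennreal (decay_mass TYPE('n) powr q) * Lp_energy lborel q f < \<infinity>"
    using f by (simp add: Lp_space_iff ennreal_mult_less_top)
  finally have fin: "family_energy q (bump_analysis f) < \<infinity>" .
  have "family_energy q (slices f) \<le> ennreal (D powr q) * family_energy q (bump_analysis f)"
    unfolding slices_def by (rule lq_convolution.lattice_conv_energy[OF lc _ fin]) measurable
  also have "\<dots> \<le> ennreal (D powr q) * (ennreal (decay_mass TYPE('n) powr q) * Lp_energy lborel q f)"
    by (intro mult_left_mono an) simp
  also have "\<dots> = ennreal ((D * decay_mass TYPE('n)) powr q) * Lp_energy lborel q f"
    using D decay_mass_pos[where 'n='n] by (simp add: powr_mult ennreal_mult mult.assoc)
  finally show e: "family_energy q (slices f) \<le> ennreal ((D * decay_mass TYPE('n)) powr q) * Lp_energy lborel q f" .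
  also have "\<dots> < \<infinity>" using f by (simp add: Lp_space_iff ennreal_mult_less_top)
  finally show fin2: "family_energy q (slices f) < \<infinity>" .
  have "Lp_energy cube_measure q (slices f m) = (\<integral>\<^sup>+k. Lp_energy cube_measure q (slices f m) * indicator {m} k \<partial>lattice)"
    by (simp add: nn_integral_cmult_indicator)
  also have "\<dots> \<le> (\<integral>\<^sup>+k. Lp_energy cube_measure q (slices f k) \<partial>lattice)"
    by (intro nn_integral_mono) (auto split: split_indicator)
  also have "\<dots> = family_energy q (slices f)"
    by (rule family_energy_eq_sum[symmetric]) measurable
  finally show "slices f m \<in> Lp_space cube_measure q" using fin2 by (auto simp: Lp_space_iff)
qed

lemma slices_Lp: "f \<in> Lp_space lborel p \<Longrightarrow> slices f m \<in> Lp_space cube_measure p"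
  using slices_energy(3)[OF _ _ Lp.lq_convolution_axioms] p1 by simp

lemma slices_L2: "f \<in> Lp_space lborel 2 \<Longrightarrow> slices f m \<in> Lp_space cube_measure 2"
  using slices_energy(3)[OF _ _ L2.lq_convolution_axioms] by simp

lemma images_measurable: "f \<in> Lp_space lborel p \<Longrightarrow> images f m \<in> borel_measurable cube_measure"
  unfolding images_def by (intro U_measurable slices_Lp)

lemma transferred_measurable: "f \<in> Lp_space lborel p \<Longrightarrow> transferred f \<in> borel_measurable borel"
  unfolding transferred_def by (intro bump_synthesis_measurable images_measurable)

definition slice_const :: real where
  "slice_const = B * decay_mass TYPE('n) ^ 3"

lemma slice_const_nonneg: "0 \<le> slice_const"
  unfolding slice_const_def using B0 decay_mass_pos[where 'n='n] by (simp add: less_imp_le)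

text \<open>
  Weak type estimates for single functions add up over \<open>m\<close>, because the right-hand side of each
  is the $p$-th power of a norm.
\<close>
lemma images_weak_type:
  assumes f: "f \<in> Lp_space lborel p" and t: "0 < t"
  shows "(\<integral>\<^sup>+m. emeasure cube_measure {y \<in> space cube_measure. t < norm (images f m y)} \<partial>lattice)
    \<le> ennreal ((K * slice_const * Lp_norm lborel p f) powr p / t powr p)"
proof -
  have [measurable]: "f \<in> borel_measurable borel" using f by (simp add: Lp_space_def)
  have "(\<integral>\<^sup>+m. emeasure cube_measure {y \<in> space cube_measure. t < norm (images f m y)} \<partial>lattice)
      \<le> (\<integral>\<^sup>+m. ennreal (K powr p / t powr p) * Lp_energy cube_measure p (slices f m) \<partial>lattice)"
    unfolding images_def by (intro nn_integral_mono U_weak slices_Lp f t)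
  also have "\<dots> = ennreal (K powr p / t powr p) * (\<integral>\<^sup>+m. Lp_energy cube_measure p (slices f m) \<partial>lattice)"
    by (rule nn_integral_cmult) simp
  also have "(\<integral>\<^sup>+m. Lp_energy cube_measure p (slices f m) \<partial>lattice) = family_energy p (slices f)"
    by (rule family_energy_eq_sum[symmetric]) measurable
  also have "\<dots> \<le> ennreal (slice_const powr p) * Lp_energy lborel p f"
    using slices_energy(1)[OF f _ Lp.lq_convolution_axioms] p1
    by (simp add: slice_const_def power3_eq_cube power2_eq_square mult.assoc)
  also have "ennreal (K powr p / t powr p) * (ennreal (slice_const powr p) * Lp_energy lborel p f)
      = ennreal (K powr p / t powr p * (slice_const powr p * Lp_norm lborel p f powr p))"
  proof -
    have "ennreal a * (ennreal b * ennreal c) = ennreal (a * (b * c))" if "0 \<le> a" "0 \<le> b" "0 \<le> c" for a b c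
      using that by (simp add: ennreal_mult)
    moreover have "Lp_energy lborel p f = ennreal (Lp_norm lborel p f powr p)"
      using p1 by (intro Lp_energy_eq_norm[OF f]) simp
    ultimately show ?thesis by simp
  qed
  also have "K powr p / t powr p * (slice_const powr p * Lp_norm lborel p f powr p)
      = (K * slice_const * Lp_norm lborel p f) powr p / t powr p"
    using K0 slice_const_nonneg by (simp add: powr_mult)
  finally show ?thesis by (simp add: mult_left_mono)
qed

definition transfer_const :: real where
  "transfer_const = dyadic_const p powr (1 / p) * (2 * decay_mass TYPE('n)) * (K * slice_const)"

lemma transfer_const_nonneg: "0 \<le> transfer_const"
  unfolding transfer_const_def using K0 slice_const_nonneg decay_mass_pos[where 'n='n]
  by (auto intro!: mult_nonneg_nonneg)

lemma transferred_weak_type: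
  assumes f: "f \<in> Lp_space lborel p" and t: "0 < t"
  shows "emeasure lborel {x. t < norm (transferred f x)}
    \<le> ennreal (transfer_const powr p / t powr p * Lp_norm lborel p f powr p)"
proof -
  have "emeasure lborel {x. t < norm (transferred f x)}
      \<le> ennreal (dyadic_const p * (2 * decay_mass TYPE('n)) powr p * (K * slice_const * Lp_norm lborel p f) powr p / t powr p)"
    unfolding transferred_def
    by (rule bump_synthesis_weak_type[OF p1 _ images_measurable[OF f] images_weak_type[OF f] t]) auto
  also have "dyadic_const p * (2 * decay_mass TYPE('n)) powr p * (K * slice_const * Lp_norm lborel p f) powr p / t powr p
      = transfer_const powr p / t powr p * Lp_norm lborel p f powr p"
    using K0 slice_const_nonneg decay_mass_pos[where 'n='n] dyadic_const_pos[OF p1] p1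
    by (simp add: transfer_const_def powr_mult powr_powr)
  finally show ?thesis .
qed

lemma images_AE_integrable:
  assumes f: "f \<in> Lp_space lborel p"
  shows "AE x in lborel. integrable lattice (\<lambda>m. bump_kernel (x - lattice_vec m) * images f m (frac_vec x))"
  by (rule bump_synthesis_AE_integrable[OF p1 _ images_measurable[OF f] images_weak_type[OF f]]) auto

lemma slices_add_cmult:
  assumes f: "f \<in> Lp_space lborel p" and g: "g \<in> Lp_space lborel p"
  shows "AE y in cube_measure. \<forall>m. slices (\<lambda>x. f x + c * g x) m y = slices f m y + c * slices g m y"
proof -
  have [measurable]: "f \<in> borel_measurable borel" "g \<in> borel_measurable borel" using f g by (auto simp: Lp_space_def)
  have p: "1 \<le> p" using p1 by simp
  have fin: "AE y in cube_measure. (\<integral>\<^sup>+k. ennreal (norm (bump_analysis u k y) powr p) \<partial>lattice) < \<infinity>"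
    if u: "u \<in> Lp_space lborel p" for u :: "real^'n \<Rightarrow> complex"
  proof (rule family_energy_finite_AE)
    have "u \<in> borel_measurable borel" using u by (simp add: Lp_space_def)
    then show "bump_analysis u m \<in> borel_measurable cube_measure" for m by measurable
    note bump_analysis_energy[OF p u]
    also have "ennreal (decay_mass TYPE('n) powr p) * Lp_energy lborel p u < \<infinity>"
      using u by (simp add: Lp_space_iff ennreal_mult_less_top)
    finally show "family_energy p (bump_analysis u) < \<infinity>" .
  qed
  show ?thesis
    using fin[OF f] fin[OF g] bump_analysis_integrable[OF p f] bump_analysis_integrable[OF p g]
  proof eventually_elim
    case (elim y)
    have an: "bump_analysis (\<lambda>x. f x + c * g x) k y = bump_analysis f k y + c * bump_analysis g k y" for k
    proof -
      have "bump_analysis (\<lambda>x. f x + c * g x) k y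
          = (\<integral>j. bump_kernel (lattice_vec k - (y + lattice_vec j)) * f (y + lattice_vec j)
              + c * (bump_kernel (lattice_vec k - (y + lattice_vec j)) * g (y + lattice_vec j)) \<partial>lattice)"
        unfolding bump_analysis_def by (simp add: algebra_simps)
      also have "\<dots> = bump_analysis f k y + c * bump_analysis g k y"
        unfolding bump_analysis_def using elim(3,4)
        by (subst Bochner_Integration.integral_add) (auto intro!: integrable_mult_right)
      finally show ?thesis .
    qed
    show ?case
    proof
      fix m
      have "slices (\<lambda>x. f x + c * g x) m y
          = (\<integral>k. bump_analysis f k y * lam (m - k) + c * (bump_analysis g k y * lam (m - k)) \<partial>lattice)"
        unfolding slices_def lattice_conv_def an by (simp add: algebra_simps)
      also have "\<dots> = slices f m y + c * slices g m y"
        unfolding slices_def lattice_conv_def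
        using Lp.integrable_conv[OF elim(1), of m] Lp.integrable_conv[OF elim(2), of m]
        by (subst Bochner_Integration.integral_add) (auto intro!: integrable_mult_right)
      finally show "slices (\<lambda>x. f x + c * g x) m y = slices f m y + c * slices g m y" .
    qed
  qed
qed

lemma transferred_add_cmult:
  assumes f: "f \<in> Lp_space lborel p" and g: "g \<in> Lp_space lborel p"
  shows "AE x in lborel. transferred (\<lambda>x. f x + c * g x) x = transferred f x + c * transferred g x"
proof -
  have p: "0 \<le> p" using p1 by simp
  have fg: "(\<lambda>x. f x + c * g x) \<in> Lp_space lborel p"
    by (rule Lp_space_add[OF f Lp_space_cmult[OF g] p])
  have "AE y in cube_measure. images (\<lambda>x. f x + c * g x) m y = images f m y + c * images g m y" for m
  proof -
    have s: "(\<lambda>y. slices f m y + c * slices g m y) \<in> Lp_space cube_measure p"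
      by (rule Lp_space_add[OF slices_Lp[OF f] Lp_space_cmult[OF slices_Lp[OF g]] p])
    have "AE y in cube_measure. slices (\<lambda>x. f x + c * g x) m y = slices f m y + c * slices g m y"
      using slices_add_cmult[OF f g, of c] by eventually_elim simp
    from U_cong[OF slices_Lp[OF fg] s this] U_add_cmult[OF slices_Lp[OF f] slices_Lp[OF g]]
    show ?thesis unfolding images_def by eventually_elim simp
  qed
  then have "AE y in cube_measure. \<forall>m. images (\<lambda>x. f x + c * g x) m y = images f m y + c * images g m y"
    by (simp add: AE_all_countable)
  from AE_cube_frac_vec[OF this] images_AE_integrable[OF f] images_AE_integrable[OF g]
  show ?thesis
  proof eventually_elim
    case (elim x)
    have "transferred (\<lambda>x. f x + c * g x) x
        = (\<integral>m. bump_kernel (x - lattice_vec m) * images f m (frac_vec x)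
            + c * (bump_kernel (x - lattice_vec m) * images g m (frac_vec x)) \<partial>lattice)"
      unfolding transferred_def bump_synthesis_def using elim(1) by (simp add: algebra_simps)
    also have "\<dots> = transferred f x + c * transferred g x"
      unfolding transferred_def bump_synthesis_def using elim(2,3)
      by (subst Bochner_Integration.integral_add) (auto intro!: integrable_mult_right)
    finally show ?case .
  qed
qed

lemma transferred_eq_0:
  assumes f: "f \<in> Lp_space lborel p" and 0: "AE x in lborel. f x = 0"
  shows "AE x in lborel. transferred f x = 0"
proof -
  note transferred_measurable[OF f, measurable]
  have "Lp_norm lborel p f = Lp_norm lborel p (\<lambda>x :: real^'n. 0)"
    by (rule Lp_norm_cong_AE) (use f 0 in \<open>auto simp: Lp_space_def\<close>)
  then have n0: "Lp_norm lborel p f = 0" by (simp add: Lp_norm_def)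
  have "AE x in lborel. \<not> 1 / real (Suc k) < norm (transferred f x)" for k
  proof (rule AE_I')
    have "emeasure lborel {x. 1 / real (Suc k) < norm (transferred f x)} \<le> 0"
      using transferred_weak_type[OF f, of "1 / real (Suc k)"] n0 by simp
    then show "{x. 1 / real (Suc k) < norm (transferred f x)} \<in> null_sets lborel"
      by (auto simp: null_sets_def)
  qed auto
  then have "AE x in lborel. \<forall>k. \<not> 1 / real (Suc k) < norm (transferred f x)"
    by (simp add: AE_all_countable)
  then show ?thesis
  proof eventually_elim
    case (elim x)
    show ?case
    proof (rule ccontr)
      assume "transferred f x \<noteq> 0"
      then obtain k where "1 / real (Suc k) < norm (transferred f x)"
        using nat_approx_posE[of "norm (transferred f x)"] by auto
      then show False using elim by blast
    qed
  qed
qed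

lemma transferred_linear: "linear_on_Lp lborel p (weak_Lp_space lborel p) transferred"
  unfolding linear_on_Lp_def
proof (intro conjI ballI impI allI)
  have p: "0 \<le> p" using p1 by simp
  fix f :: "real^'n \<Rightarrow> complex" assume f: "f \<in> Lp_space lborel p"
  have fm: "f \<in> borel_measurable borel" using f by (simp add: Lp_space_def)
  show "transferred f \<in> weak_Lp_space lborel p"
    unfolding weak_Lp_space_def
    using transferred_measurable[OF f] transferred_weak_type[OF f]
    by (auto intro!: exI[of _ "transfer_const powr p * Lp_norm lborel p f powr p"])
  show "AE x in lborel. transferred (\<lambda>y. c * f y) x = c * transferred f x" for c
  proof -
    have "AE x in lborel. transferred (\<lambda>x. 0 + c * f x) x = transferred (\<lambda>x. 0) x + c * transferred f x"
      by (rule transferred_add_cmult[OF Lp_space_zero f])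
    moreover have "AE x in lborel. transferred (\<lambda>x. 0) x = 0"
      by (rule transferred_eq_0[OF Lp_space_zero]) simp
    ultimately show ?thesis by eventually_elim simp
  qed
  fix g :: "real^'n \<Rightarrow> complex" assume g: "g \<in> Lp_space lborel p"
  have gm: "g \<in> borel_measurable borel" using g by (simp add: Lp_space_def)
  show "AE x in lborel. transferred (\<lambda>y. f y + g y) x = transferred f x + transferred g x"
    using transferred_add_cmult[OF f g, of 1] by simp
  assume eq: "AE x in lborel. f x = g x"
  have d: "(\<lambda>x. f x + (- 1) * g x) \<in> Lp_space lborel p"
    by (rule Lp_space_add[OF f Lp_space_cmult[OF g] p])
  have "AE x in lborel. transferred (\<lambda>x. f x + (- 1) * g x) x = 0"
    by (rule transferred_eq_0[OF d]) (use eq in auto)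
  with transferred_add_cmult[OF f g, of "-1"] show "AE x in lborel. transferred f x = transferred g x"
    by eventually_elim simp
qed

end

section \<open>The symbol of the transferred operator\<close>

lemma wave_lattice_lattice [simp]: "wave (lattice_vec j) (lattice_vec n) = 1"
proof -
  have "lattice_vec n \<bullet> lattice_vec j = of_int (\<Sum>i\<in>UNIV. n $ i * j $ i)"
    by (simp add: inner_vec_def)
  then show ?thesis
    unfolding wave_def by (simp only:) (rule cis_multiple_2pi, rule Ints_of_int)
qed

lemma wave_add_lattice [simp]: "wave (y + lattice_vec j) (lattice_vec n) = wave y (lattice_vec n)"
  by (simp add: wave_add_left)

lemma wave_frac_vec: "wave (frac_vec x) (lattice_vec n) = wave x (lattice_vec n)"
  using wave_add_lattice[of "frac_vec x" "floor_vec x" n] by (simp add: frac_plus_floor_vec)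

lemma integral_lattice_uminus:
  fixes f :: "int^'n \<Rightarrow> complex"
  shows "(\<integral>k. f (- k) \<partial>lattice) = (\<integral>k. f k \<partial>lattice)"
  by (rule integral_bij_count_space) (rule bij_uminus)

lemma nn_integral_lattice_uminus:
  fixes f :: "int^'n \<Rightarrow> ennreal"
  shows "(\<integral>\<^sup>+k. f (- k) \<partial>lattice) = (\<integral>\<^sup>+k. f k \<partial>lattice)"
  by (rule nn_integral_bij_count_space) (rule bij_uminus)

lemma AE_lborel_cube:
  assumes "AE x in (lborel :: (real^'n) measure). P x"
  shows "AE x in cube_measure. P x"
  using AE_lborel_tiling[OF assms] by eventually_elim (auto dest: spec[of _ 0])

lemma torus_parseval_product:
  fixes f g :: "real^'n \<Rightarrow> complex"
  assumes f: "f \<in> Lp_space cube_measure 2" and g: "g \<in> Lp_space cube_measure 2"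
  shows "(\<integral>x. f x * cnj (g x) \<partial>cube_measure) = (\<integral>n. fourier_coeff f n * cnj (fourier_coeff g n) \<partial>lattice)"
  using torus.parseval[OF torus.fourier_L2_of_L1 torus.fourier_L2_of_L1, of f g, unfolded torus_simps]
    f g L2_cube_integrable[OF f] L2_cube_integrable[OF g] by simp

lemma fourier_coeff_add_cmult:
  fixes f g :: "real^'n \<Rightarrow> complex"
  assumes f: "f \<in> Lp_space cube_measure 2" and g: "g \<in> Lp_space cube_measure 2"
  shows "fourier_coeff (\<lambda>x. f x + c * g x) n = fourier_coeff f n + c * fourier_coeff g n"
  by (rule torus.fourier_L1_add_cmult[unfolded torus_simps]) (intro L2_cube_integrable f g)+

lemma tile_energy_le:
  fixes u :: "real^'n \<Rightarrow> complex"
  assumes [measurable]: "u \<in> borel_measurable borel"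
  shows "(\<integral>\<^sup>+n. Lp_energy cube_measure q (\<lambda>\<xi>. u (\<xi> + lattice_vec n)) \<partial>lattice) = Lp_energy lborel q u"
  by (subst family_energy_eq_sum[symmetric]) (simp_all add: family_energy_tiles)

context jodeit_transfer
begin

lemma N0: "0 \<le> N"
  using phi_bound[of 0] norm_ge_zero[of "\<phi> 0"] by linarith

text \<open>
  Almost everywhere equal to \<open>W_ext \<phi> \<Lambda>\<close>: off the lattice translates of the null set where the
  support condition on \<open>\<Lambda>\<close> fails, only the term of the tile that contains \<open>\<xi>\<close> can be nonzero.
\<close>
definition symbol :: "real ^ 'n \<Rightarrow> complex" where
  "symbol \<xi> = \<phi> (floor_vec \<xi>) * \<Lambda> (frac_vec \<xi>)"

lemma symbol_measurable [measurable]: "symbol \<in> borel_measurable borel"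
proof -
  have "(\<lambda>\<xi>. \<phi> (floor_vec \<xi>)) \<in> borel_measurable borel"
    by (rule measurable_compose[OF floor_vec_measurable]) simp
  moreover have "(\<lambda>\<xi>. \<Lambda> (frac_vec \<xi>)) \<in> borel_measurable borel" by measurable
  ultimately show ?thesis unfolding symbol_def[abs_def] by measurable
qed

lemma symbol_bound: "AE \<xi> in lborel. norm (symbol \<xi>) \<le> N * M"
  using AE_cube_frac_vec[OF AE_lborel_cube[OF Lam_bound]]
  by eventually_elim (auto simp: symbol_def norm_mult intro!: mult_mono phi_bound N0)

lemma lam_L2: "(\<integral>\<^sup>+m. ennreal (norm (lam m) powr 2) \<partial>lattice) < \<infinity>"
proof -
  have "(\<integral>\<^sup>+m. ennreal (norm (\<Sum>k\<in>{0}. 1 * lam (m - k)) powr 2) \<partial>lattice) < \<infinity>"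
    by (rule le_less_trans[OF L2.finite_bound]) (auto simp flip: ennreal_mult)
  then show ?thesis by simp
qed

lemma lam_eq_cube: "lam m = (\<integral>\<xi>. \<Lambda> \<xi> * wave (lattice_vec m) \<xi> \<partial>cube_measure)"
  unfolding lam_def integral_cube_eq
proof (rule integral_cong_AE)
  show "AE \<xi> in lborel. \<Lambda> \<xi> * wave (lattice_vec m) \<xi> = zero_ext (\<lambda>\<xi>. \<Lambda> \<xi> * wave (lattice_vec m) \<xi>) \<xi>"
    using Lam_outside by eventually_elim (auto simp: zero_ext_def split: split_indicator)
  have "(\<lambda>\<xi>. \<Lambda> \<xi> * wave (lattice_vec m) \<xi>) \<in> borel_measurable cube_measure"
    by (rule measurable_cube_measureI) measurable
  then show "zero_ext (\<lambda>\<xi>. \<Lambda> \<xi> * wave (lattice_vec m) \<xi>) \<in> borel_measurable lborel" by measurable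
qed measurable

context
  fixes f g :: "real ^ 'n \<Rightarrow> complex"
  assumes f2: "f \<in> Lp_space lborel 2" and fp: "f \<in> Lp_space lborel p"
    and fg: "fourier_L2 euclidean_lca f g"
begin

lemma g_L2: "g \<in> Lp_space lborel 2"
  using fourier_L2_spaces_euclidean(2)[OF fg] .

lemma fg_measurable [measurable]: "f \<in> borel_measurable borel" "g \<in> borel_measurable borel"
  using f2 g_L2 by (auto simp: Lp_space_def)

text \<open>
  The integral over the cube of the periodization unfolds to an integral over space, to which
  Parseval applies.
\<close>
lemma bump_analysis_coeff:
  "fourier_coeff (bump_analysis f k) n = (\<integral>\<xi>. g \<xi> * (wave (lattice_vec k) (\<xi> - lattice_vec n) * bump (\<xi> - lattice_vec n)) \<partial>lborel)"
proof -
  define w where "w = (\<lambda>x. cnj (bump_kernel (lattice_vec k - x)) * wave x (lattice_vec n))"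
  have u1: "integrable lborel (\<lambda>x :: real^'n. cnj (bump_kernel (lattice_vec k - x)))"
  proof -
    have "integrable (distr lborel borel (\<lambda>x. lattice_vec k - x)) (\<lambda>z :: real^'n. cnj (bump_kernel z))"
      using bump_kernel_integrable by (simp add: lborel_vec_reflect)
    then show ?thesis by (subst (asm) integrable_distr_eq) auto
  qed
  have w1: "integrable lborel w" unfolding w_def by (rule integrable_mult_unimodular[OF u1]) auto
  have w2: "w \<in> Lp_space lborel 2"
    unfolding w_def by (rule Lp_space_vec_wave[OF Lp_space_cnj[OF Lp_space_reflect[OF bump_kernel_L2]]])
  have Fw: "fourier w \<xi> = cnj (wave (lattice_vec k) (\<xi> - lattice_vec n) * bump (\<xi> - lattice_vec n))" for \<xi>
    unfolding w_def fourier_modulate fourier_cnj_reflect[OF bump_kernel_measurable] fourier_bump_kernel ..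
  have "fourier_coeff (bump_analysis f k) n = (\<integral>y. (\<integral>j. f (y + lattice_vec j) * cnj (w (y + lattice_vec j)) \<partial>lattice) \<partial>cube_measure)"
    unfolding fourier_coeff_eq bump_analysis_def w_def
    by (simp flip: integral_mult_left_zero add: mult_ac)
  also have "\<dots> = (\<integral>x. f x * cnj (w x) \<partial>lborel)"
    by (rule integral_tiling[symmetric, OF integrable_L2_product(2)[OF f2 w2]])
  also have "\<dots> = (\<integral>\<xi>. g \<xi> * cnj (fourier w \<xi>) \<partial>lborel)"
    by (rule parseval_euclidean[OF fg fourier_L2_fourier[OF w1 w2]])
  finally show ?thesis unfolding Fw complex_cnj_cnj .
qed

text \<open>
  The part of the transform \<open>g\<close> in the \<open>n\<close>-th cube, moved to the unit cube, first cut off by \<open>bump\<close>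
  and then by \<open>\<Lambda>\<close>.
\<close>
definition block :: "int ^ 'n \<Rightarrow> real ^ 'n \<Rightarrow> complex" where
  "block n \<xi> = g (\<xi> + lattice_vec n) * bump \<xi>"

definition cut_block :: "int ^ 'n \<Rightarrow> real ^ 'n \<Rightarrow> complex" where
  "cut_block n \<xi> = \<Lambda> \<xi> * g (\<xi> + lattice_vec n)"

lemma block_measurable [measurable]:
  "block n \<in> borel_measurable borel" "cut_block n \<in> borel_measurable borel"
  unfolding block_def[abs_def] cut_block_def[abs_def] by measurable

lemma tile_L2: "(\<lambda>\<xi>. g (\<xi> + lattice_vec n)) \<in> Lp_space cube_measure 2"
proof -
  have "Lp_energy cube_measure 2 (\<lambda>\<xi>. g (\<xi> + lattice_vec n))
      = (\<integral>\<^sup>+k. Lp_energy cube_measure 2 (\<lambda>\<xi>. g (\<xi> + lattice_vec n)) * indicator {n} k \<partial>lattice)"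
    by (simp add: nn_integral_cmult_indicator)
  also have "\<dots> \<le> (\<integral>\<^sup>+k. Lp_energy cube_measure 2 (\<lambda>\<xi>. g (\<xi> + lattice_vec k)) \<partial>lattice)"
    by (intro nn_integral_mono) (auto split: split_indicator)
  also have "\<dots> < \<infinity>" using g_L2 by (simp add: tile_energy_le Lp_space_iff)
  finally show ?thesis by (simp add: Lp_space_iff translate_lattice_measurable_cube)
qed

lemma block_L2: "block n \<in> Lp_space cube_measure 2"
proof -
  have "Lp_energy cube_measure 2 (block n) \<le> Lp_energy cube_measure 2 (\<lambda>\<xi>. g (\<xi> + lattice_vec n))"
    unfolding block_def by (rule Lp_energy_mono) (auto simp: norm_mult norm_bump_le mult_right_le_one_le)
  also have "\<dots> < \<infinity>" using tile_L2 by (simp add: Lp_space_iff)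
  finally show ?thesis using block_measurable(1) by (auto simp: Lp_space_iff)
qed

lemma cut_block_energy: "Lp_energy cube_measure 2 (cut_block n) \<le> ennreal (M powr 2) * Lp_energy cube_measure 2 (\<lambda>\<xi>. g (\<xi> + lattice_vec n))"
proof -
  have "Lp_energy cube_measure 2 (cut_block n) \<le> (\<integral>\<^sup>+\<xi>. ennreal (M powr 2) * ennreal (norm (g (\<xi> + lattice_vec n)) powr 2) \<partial>cube_measure)"
    unfolding Lp_energy_def
  proof (rule nn_integral_mono_AE)
    show "AE \<xi> in cube_measure. ennreal (norm (cut_block n \<xi>) powr 2) \<le> ennreal (M powr 2) * ennreal (norm (g (\<xi> + lattice_vec n)) powr 2)"
      using AE_lborel_cube[OF Lam_bound]
    proof eventually_elim
      case (elim \<xi>)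
      have "norm (cut_block n \<xi>) powr 2 \<le> (M * norm (g (\<xi> + lattice_vec n))) powr 2"
        using elim by (intro powr_mono2) (auto simp: cut_block_def norm_mult intro!: mult_right_mono)
      then show ?case by (simp add: powr_mult ennreal_leI flip: ennreal_mult)
    qed
  qed
  also have "\<dots> = ennreal (M powr 2) * Lp_energy cube_measure 2 (\<lambda>\<xi>. g (\<xi> + lattice_vec n))"
    unfolding Lp_energy_def by (rule nn_integral_cmult) (use translate_lattice_measurable_cube(1)[OF fg_measurable(2)] in measurable)
  finally show ?thesis .
qed

lemma cut_block_L2: "cut_block n \<in> Lp_space cube_measure 2"
proof -
  note cut_block_energy[of n]
  also have "ennreal (M powr 2) * Lp_energy cube_measure 2 (\<lambda>\<xi>. g (\<xi> + lattice_vec n)) < \<infinity>"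
    using tile_L2 by (simp add: Lp_space_iff ennreal_mult_less_top)
  finally show ?thesis using block_measurable(2) by (auto simp: Lp_space_iff)
qed

lemma bump_analysis_coeff_block: "fourier_coeff (bump_analysis f k) n = fourier_coeff (block n) (- k)"
proof -
  have "fourier_coeff (bump_analysis f k) n
      = (\<integral>\<xi>. g (\<xi> + lattice_vec n) * (wave (lattice_vec k) (\<xi> + lattice_vec n - lattice_vec n) * bump (\<xi> + lattice_vec n - lattice_vec n)) \<partial>lborel)"
    unfolding bump_analysis_coeff by (rule integral_vec_translate[symmetric]) measurable
  also have "\<dots> = (\<integral>\<xi>. zero_ext (\<lambda>\<xi>. block n \<xi> * cnj (wave \<xi> (lattice_vec (- k)))) \<xi> \<partial>lborel)"
  proof (rule Bochner_Integration.integral_cong[OF refl])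
    fix \<xi> :: "real^'n"
    show "g (\<xi> + lattice_vec n) * (wave (lattice_vec k) (\<xi> + lattice_vec n - lattice_vec n) * bump (\<xi> + lattice_vec n - lattice_vec n))
        = zero_ext (\<lambda>\<xi>. block n \<xi> * cnj (wave \<xi> (lattice_vec (- k)))) \<xi>"
      by (cases "\<xi> \<in> unit_cube")
         (auto simp: zero_ext_def block_def wave_minus_right wave_commute[of \<xi>] bump_eq_0)
  qed
  finally show ?thesis unfolding fourier_coeff_eq integral_cube_eq .
qed

text \<open>
  Convolution over the lattice becomes multiplication on the frequency cube, by Parseval
  on that cube: the coefficients of \<open>block n\<close> are those of the analysis of \<open>f\<close>, the coefficients
  of \<open>\<Lambda>\<close> are the values of \<open>lam\<close>, and the product of the two functions is \<open>cut_block n\<close>.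
\<close>
lemma slices_coeff: "fourier_coeff (slices f m) n = fourier_coeff (cut_block n) (- m)"
proof -
  define P where "P = bump_analysis f"
  have [measurable]: "P k \<in> borel_measurable cube_measure" for k unfolding P_def by measurable
  define A where "A = (\<lambda>z. P (snd z) (fst z) * cnj (wave (fst z) (lattice_vec n)))"
  define L where "L = (\<lambda>z :: (real^'n) \<times> (int^'n). lam (m - snd z))"
  have Am: "A \<in> borel_measurable (cube_measure \<Otimes>\<^sub>M lattice)"
    unfolding A_def by (rule measurable_lattice_pair2) simp
  have Lm: "L \<in> borel_measurable (cube_measure \<Otimes>\<^sub>M lattice)"
    unfolding L_def by (rule measurable_lattice_pair2) simp
  have "Lp_energy (cube_measure \<Otimes>\<^sub>M lattice) 2 A = family_energy 2 P"
    unfolding Lp_energy_def family_energy_def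
    by (subst lattice_sigma.nn_integral_fst[symmetric]) (use Am in \<open>auto simp: A_def norm_mult\<close>)
  also have "\<dots> < \<infinity>"
  proof -
    have "family_energy 2 P \<le> ennreal (decay_mass TYPE('n) powr 2) * Lp_energy lborel 2 f"
      unfolding P_def by (rule bump_analysis_energy[OF _ f2]) simp
    also have "\<dots> < \<infinity>" using f2 by (simp add: Lp_space_iff ennreal_mult_less_top)
    finally show ?thesis .
  qed
  finally have A2: "A \<in> Lp_space (cube_measure \<Otimes>\<^sub>M lattice) 2" using Am by (simp add: Lp_space_iff)
  have "Lp_energy (cube_measure \<Otimes>\<^sub>M lattice) 2 L = (\<integral>\<^sup>+k. ennreal (norm (lam (m - k)) powr 2) \<partial>lattice)"
    unfolding Lp_energy_def
    by (subst lattice_sigma.nn_integral_fst[symmetric]) (use Lm in \<open>auto simp: L_def\<close>)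
  also have "\<dots> < \<infinity>"
    using lam_L2 lattice_shift_nn_integral(2)[of "\<lambda>k. ennreal (norm (lam k) powr 2)" m] by simp
  finally have L2': "L \<in> Lp_space (cube_measure \<Otimes>\<^sub>M lattice) 2" using Lm by (simp add: Lp_space_iff)
  have int: "integrable (cube_measure \<Otimes>\<^sub>M lattice) (\<lambda>(y, k). P k y * cnj (wave y (lattice_vec n)) * lam (m - k))"
    using integrable_L2_product(1)[OF A2 L2'] by (simp add: A_def L_def split_def)
  have "fourier_coeff (slices f m) n = (\<integral>y. (\<integral>k. P k y * cnj (wave y (lattice_vec n)) * lam (m - k) \<partial>lattice) \<partial>cube_measure)"
    unfolding fourier_coeff_eq slices_def lattice_conv_def P_def[symmetric]
    by (simp flip: integral_mult_right_zero add: mult_ac)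
  also have "\<dots> = (\<integral>k. (\<integral>y. P k y * cnj (wave y (lattice_vec n)) * lam (m - k) \<partial>cube_measure) \<partial>lattice)"
    by (rule cube_lattice.Fubini_integral[OF int, symmetric])
  also have "\<dots> = (\<integral>k. fourier_coeff (block n) (- k) * lam (m - k) \<partial>lattice)"
    by (simp add: fourier_coeff_eq[symmetric] P_def bump_analysis_coeff_block)
  also have "\<dots> = (\<integral>\<xi>. block n \<xi> * (\<Lambda> \<xi> * wave (lattice_vec m) \<xi>) \<partial>cube_measure)"
  proof -
    \<comment> \<open>conjugated, because Parseval conjugates its second factor\<close>
    define Lm where "Lm = (\<lambda>\<xi>. cnj (\<Lambda> \<xi> * wave (lattice_vec m) \<xi>))"
    have [measurable]: "Lm \<in> borel_measurable borel" unfolding Lm_def by measurable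
    have "Lp_energy cube_measure 2 Lm \<le> (\<integral>\<^sup>+\<xi>. ennreal (M powr 2) \<partial>(cube_measure :: (real^'n) measure))"
      unfolding Lp_energy_def
    proof (rule nn_integral_mono_AE)
      show "AE \<xi> in cube_measure. ennreal (norm (Lm \<xi>) powr 2) \<le> ennreal (M powr 2)"
        using AE_lborel_cube[OF Lam_bound]
      proof eventually_elim
        case (elim \<xi>)
        then have "norm (Lm \<xi>) \<le> M" by (simp add: Lm_def norm_mult)
        then show ?case by (intro ennreal_leI powr_mono2) simp_all
      qed
    qed
    also have "\<dots> < \<infinity>" by simp
    finally have Lm2: "Lm \<in> Lp_space cube_measure 2" by (auto simp: Lp_space_iff)
    have coeff: "fourier_coeff Lm (- k) = cnj (lam (m - k))" for k
    proof -
      have "fourier_coeff Lm (- k) = (\<integral>\<xi>. cnj (\<Lambda> \<xi> * wave (lattice_vec (m - k)) \<xi>) \<partial>cube_measure)"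
        unfolding fourier_coeff_eq Lm_def lattice_vec_simps wave_diff_left wave_minus_right
        by (simp add: wave_commute[of _ "lattice_vec k"] mult_ac)
      also have "\<dots> = cnj (lam (m - k))" unfolding lam_eq_cube by (rule Bochner_Integration.integral_cnj)
      finally show ?thesis .
    qed
    have "(\<integral>k. fourier_coeff (block n) (- k) * lam (m - k) \<partial>lattice)
        = (\<integral>k. fourier_coeff (block n) (- k) * cnj (fourier_coeff Lm (- k)) \<partial>lattice)"
      unfolding coeff by simp
    also have "\<dots> = (\<integral>k. fourier_coeff (block n) k * cnj (fourier_coeff Lm k) \<partial>lattice)"
      by (rule integral_lattice_uminus)
    also have "\<dots> = (\<integral>\<xi>. block n \<xi> * cnj (Lm \<xi>) \<partial>cube_measure)"
      by (rule torus_parseval_product[OF block_L2 Lm2, symmetric])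
    finally show ?thesis by (simp add: Lm_def)
  qed
  also have "\<dots> = fourier_coeff (cut_block n) (- m)"
    unfolding fourier_coeff_eq
  proof (rule integral_cong_AE)
    show "AE \<xi> in cube_measure. block n \<xi> * (\<Lambda> \<xi> * wave (lattice_vec m) \<xi>) = cut_block n \<xi> * cnj (wave \<xi> (lattice_vec (- m)))"
      using AE_lborel_cube[OF Lam_bump]
    proof eventually_elim
      case (elim \<xi>)
      have "block n \<xi> * (\<Lambda> \<xi> * wave (lattice_vec m) \<xi>) = (\<Lambda> \<xi> * bump \<xi>) * g (\<xi> + lattice_vec n) * wave (lattice_vec m) \<xi>"
        by (simp add: block_def mult_ac)
      then show ?case unfolding elim by (simp add: cut_block_def wave_minus_right wave_commute[of \<xi>])
    qed
  qed (rule measurable_cube_measureI, measurable)+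
  finally show ?thesis .
qed

text \<open>
  The \<open>n\<close>-th Fourier coefficient of the \<open>m\<close>-th torus function in the synthesis. The same numbers
  are, up to \<open>\<phi> n\<close>, the Fourier coefficients in the frequency variable of \<open>cut_block n\<close>.
\<close>
definition coeff :: "int ^ 'n \<Rightarrow> int ^ 'n \<Rightarrow> complex" where
  "coeff m n = \<phi> n * fourier_coeff (cut_block n) (- m)"

lemma
  shows images_L2: "images f m \<in> Lp_space cube_measure 2"
    and images_coeff: "fourier_coeff (images f m) n = coeff m n"
proof -
  have "slices f m \<in> Lp_space (haar torus_lca) 2 \<inter> Lp_space (haar torus_lca) p"
    using slices_L2[OF f2] slices_Lp[OF fp] by simp
  then obtain h where h: "fourier_L2 torus_lca (slices f m) h" "fourier_L2 torus_lca (images f m) (\<lambda>n. \<phi> n * h n)"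
    using U_symbol unfolding has_symbol_def images_def by blast
  show "images f m \<in> Lp_space cube_measure 2" using torus.fourier_L2_spaces(1)[OF h(2)] by simp
  show "fourier_coeff (images f m) n = coeff m n"
    using torus_fourier_L2_coeff[OF h(1), of n] torus_fourier_L2_coeff[OF h(2), of n]
    by (simp add: coeff_def slices_coeff)
qed

lemma coeff_square_sum: "(\<integral>\<^sup>+m. (\<integral>\<^sup>+n. ennreal ((norm (coeff m n))\<^sup>2) \<partial>lattice) \<partial>lattice) < \<infinity>"
proof -
  have "(\<integral>\<^sup>+m. (\<integral>\<^sup>+n. ennreal ((norm (coeff m n))\<^sup>2) \<partial>lattice) \<partial>lattice)
      = (\<integral>\<^sup>+n. (\<integral>\<^sup>+m. ennreal ((norm (coeff m n))\<^sup>2) \<partial>lattice) \<partial>lattice)"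
    by (rule lattice_lattice.Fubini'[symmetric], rule measurable_lattice_pair1) simp
  also have "\<dots> \<le> (\<integral>\<^sup>+n. ennreal (N\<^sup>2) * (ennreal (M powr 2) * Lp_energy cube_measure 2 (\<lambda>\<xi>. g (\<xi> + lattice_vec n))) \<partial>lattice)"
  proof (intro nn_integral_mono)
    fix n
    have "(\<integral>\<^sup>+m. ennreal ((norm (coeff m n))\<^sup>2) \<partial>lattice)
        \<le> (\<integral>\<^sup>+m. ennreal (N\<^sup>2) * ennreal ((norm (fourier_coeff (cut_block n) (- m)))\<^sup>2) \<partial>lattice)"
    proof (intro nn_integral_mono)
      fix m
      have "(norm (coeff m n))\<^sup>2 \<le> (N * norm (fourier_coeff (cut_block n) (- m)))\<^sup>2"
        unfolding coeff_def norm_mult by (intro power_mono mult_right_mono phi_bound) auto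
      then show "ennreal ((norm (coeff m n))\<^sup>2) \<le> ennreal (N\<^sup>2) * ennreal ((norm (fourier_coeff (cut_block n) (- m)))\<^sup>2)"
        by (simp add: power_mult_distrib ennreal_leI flip: ennreal_mult)
    qed
    also have "\<dots> = ennreal (N\<^sup>2) * (\<integral>\<^sup>+m. ennreal ((norm (fourier_coeff (cut_block n) (- m)))\<^sup>2) \<partial>lattice)"
      by (rule nn_integral_cmult) simp
    also have "(\<integral>\<^sup>+m. ennreal ((norm (fourier_coeff (cut_block n) (- m)))\<^sup>2) \<partial>lattice) = Lp_energy lattice 2 (fourier_coeff (cut_block n))"
      unfolding L2_energy_eq_square
      by (rule nn_integral_lattice_uminus[of "\<lambda>k. ennreal ((norm (fourier_coeff (cut_block n) k))\<^sup>2)"])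
    also have "\<dots> = Lp_energy cube_measure 2 (cut_block n)" by (rule torus_parseval[OF cut_block_L2])
    also have "\<dots> \<le> ennreal (M powr 2) * Lp_energy cube_measure 2 (\<lambda>\<xi>. g (\<xi> + lattice_vec n))"
      by (rule cut_block_energy)
    finally show "(\<integral>\<^sup>+m. ennreal ((norm (coeff m n))\<^sup>2) \<partial>lattice)
        \<le> ennreal (N\<^sup>2) * (ennreal (M powr 2) * Lp_energy cube_measure 2 (\<lambda>\<xi>. g (\<xi> + lattice_vec n)))"
      by (simp add: mult_left_mono)
  qed
  also have "\<dots> = ennreal (N\<^sup>2) * (ennreal (M powr 2) * Lp_energy lborel 2 g)"
    by (simp add: nn_integral_cmult tile_energy_le)
  also have "\<dots> < \<infinity>" using g_L2 by (simp add: Lp_space_iff ennreal_mult_less_top)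
  finally show ?thesis .
qed

definition tail :: "(int ^ 'n) set \<Rightarrow> ennreal" where
  "tail S = (\<integral>\<^sup>+m. (\<integral>\<^sup>+n. (if m \<in> S \<and> n \<in> S then 0 else ennreal ((norm (coeff m n))\<^sup>2)) \<partial>lattice) \<partial>lattice)"

lemma tail_tendsto_0: "(\<lambda>j. tail (lattice_ball j)) \<longlonglongrightarrow> 0"
proof -
  let ?P = "(lattice :: (int^'n) measure) \<Otimes>\<^sub>M (lattice :: (int^'n) measure)"
  have m: "h \<in> borel_measurable ?P" for h :: "(int^'n) \<times> (int^'n) \<Rightarrow> ennreal"
    by (rule measurable_lattice_pair1) simp
  let ?t = "\<lambda>j z. if fst z \<in> lattice_ball j \<and> snd z \<in> lattice_ball j then 0 else ennreal ((norm (coeff (fst z) (snd z)))\<^sup>2)"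
  have eq: "tail (lattice_ball j) = (\<integral>\<^sup>+z. ?t j z \<partial>?P)" for j
    unfolding tail_def by (subst lattice_sigma.nn_integral_fst[symmetric, OF m]) (simp only: fst_conv snd_conv)
  have "(\<lambda>j. \<integral>\<^sup>+z. ?t j z \<partial>?P) \<longlonglongrightarrow> (\<integral>\<^sup>+z. 0 \<partial>?P)"
  proof (rule nn_integral_dominated_convergence[where w="\<lambda>z. ennreal ((norm (coeff (fst z) (snd z)))\<^sup>2)"])
    show "(\<integral>\<^sup>+z. ennreal ((norm (coeff (fst z) (snd z)))\<^sup>2) \<partial>?P) < \<infinity>"
      using coeff_square_sum by (subst lattice_sigma.nn_integral_fst[symmetric, OF m]) simp
    show "AE z in ?P. (\<lambda>j. ?t j z) \<longlonglongrightarrow> 0"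
    proof (intro always_eventually allI)
      fix z :: "(int^'n) \<times> (int^'n)"
      have "\<forall>\<^sub>F j in sequentially. ?t j z = 0"
        using eventually_in_lattice_ball[of "fst z"] eventually_in_lattice_ball[of "snd z"]
        by eventually_elim simp
      then show "(\<lambda>j. ?t j z) \<longlonglongrightarrow> 0" by (rule tendsto_eventually)
    qed
  qed (auto intro: m)
  then show ?thesis by (simp add: eq)
qed

context
  fixes S :: "(int ^ 'n) set"
  assumes S: "finite S"
begin

text \<open>
  A finite part of the synthesis of the Fourier series of the torus functions. It is
  integrable, and its Fourier transform is explicit.
\<close>
definition truncated :: "real ^ 'n \<Rightarrow> complex" where
  "truncated x = (\<Sum>m\<in>S. \<Sum>n\<in>S. coeff m n * (bump_kernel (x - lattice_vec m) * wave x (lattice_vec n)))"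

lemma truncated_empty: "S = {} \<Longrightarrow> truncated x = 0"
  unfolding truncated_def by simp

definition truncated_images :: "int ^ 'n \<Rightarrow> real ^ 'n \<Rightarrow> complex" where
  "truncated_images m y = (if m \<in> S then \<Sum>n\<in>S. coeff m n * wave y (lattice_vec n) else 0)"

lemma shifted_bump_kernel:
  "integrable lborel (\<lambda>x. bump_kernel (x - lattice_vec m))" "(\<lambda>x. bump_kernel (x - lattice_vec m)) \<in> Lp_space lborel 2"
  using integrable_vec_translate[OF bump_kernel_integrable, of "- lattice_vec m"]
    Lp_space_translate[OF bump_kernel_L2, of "- lattice_vec m"] by simp_all

lemma truncated_term:
  "integrable lborel (\<lambda>x. coeff m n * (bump_kernel (x - lattice_vec m) * wave x (lattice_vec n)))"
  "(\<lambda>x. coeff m n * (bump_kernel (x - lattice_vec m) * wave x (lattice_vec n))) \<in> Lp_space lborel 2"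
  by (intro integrable_mult_right integrable_mult_unimodular shifted_bump_kernel, simp, simp)
     (intro Lp_space_cmult Lp_space_vec_wave shifted_bump_kernel)

lemma truncated_integrable: "integrable lborel truncated"
  unfolding truncated_def[abs_def] by (intro Bochner_Integration.integrable_sum truncated_term)

lemma truncated_L2: "truncated \<in> Lp_space lborel 2"
  unfolding truncated_def[abs_def] by (intro Lp_space_sum truncated_term) simp_all

lemma truncated_images_L2: "truncated_images m \<in> Lp_space cube_measure 2"
  unfolding truncated_images_def[abs_def] by (cases "m \<in> S") (simp_all add: sum_waves_L2)

lemma truncated_images_coeff: "fourier_coeff (truncated_images m) n = (if m \<in> S \<and> n \<in> S then coeff m n else 0)"
proof (cases "m \<in> S")
  case True
  then show ?thesis using fourier_coeff_sum_waves[OF S, of "coeff m" n] by (simp add: truncated_images_def[abs_def])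
next
  case False
  then show ?thesis by (simp add: truncated_images_def[abs_def] fourier_coeff_eq)
qed

lemma truncated_eq_synthesis: "truncated x = bump_synthesis truncated_images x"
proof -
  have "bump_synthesis truncated_images x
      = (\<integral>m. indicator S m *\<^sub>R (bump_kernel (x - lattice_vec m) * (\<Sum>n\<in>S. coeff m n * wave x (lattice_vec n))) \<partial>lattice)"
    unfolding bump_synthesis_def
    by (intro Bochner_Integration.integral_cong) (auto simp: truncated_images_def wave_frac_vec)
  also have "\<dots> = truncated x"
    unfolding integral_lattice_indicator[OF S] truncated_def by (simp add: sum_distrib_left mult_ac)
  finally show ?thesis ..
qed

text \<open>
  By Parseval on the torus, in the space variable, for each \<open>m\<close>.
\<close>
lemma synthesis_error:
  "Lp_energy lborel 2 (\<lambda>x. transferred f x - truncated x) \<le> ennreal (decay_mass TYPE('n) powr 2) * tail S"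
proof -
  define D where "D = (\<lambda>m y. images f m y + (- 1) * truncated_images m y)"
  have D2: "D m \<in> Lp_space cube_measure 2" for m
    unfolding D_def by (intro Lp_space_add Lp_space_cmult images_L2 truncated_images_L2) simp
  have Dm [measurable]: "D m \<in> borel_measurable cube_measure" for m
    using D2[of m] by (simp add: Lp_space_def)
  have Dc: "fourier_coeff (D m) n = (if m \<in> S \<and> n \<in> S then 0 else coeff m n)" for m n
    unfolding D_def fourier_coeff_add_cmult[OF images_L2 truncated_images_L2]
    by (simp add: images_coeff truncated_images_coeff)
  have DE: "family_energy 2 D = tail S"
    unfolding family_energy_eq_sum[of D, OF Dm] tail_def torus_parseval[OF D2, symmetric] L2_energy_eq_square[of lattice] Dc
    by (intro nn_integral_cong) simp
  have fin: "family_energy 2 D < \<infinity>"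
  proof -
    have "tail S \<le> (\<integral>\<^sup>+m. (\<integral>\<^sup>+n. ennreal ((norm (coeff m n))\<^sup>2) \<partial>lattice) \<partial>lattice)"
      unfolding tail_def by (intro nn_integral_mono) auto
    with coeff_square_sum show ?thesis unfolding DE by (rule le_less_trans[rotated])
  qed
  have "AE x in lborel. transferred f x - truncated x = bump_synthesis D x"
    using images_AE_integrable[OF fp]
  proof eventually_elim
    case (elim x)
    have fs: "integrable lattice (\<lambda>m. bump_kernel (x - lattice_vec m) * truncated_images m (frac_vec x))"
    proof -
      have "integrable (count_space S) (\<lambda>m. bump_kernel (x - lattice_vec m) * truncated_images m (frac_vec x))"
        using S by (rule integrable_count_space)
      then have "integrable lattice (\<lambda>m. indicator S m *\<^sub>R (bump_kernel (x - lattice_vec m) * truncated_images m (frac_vec x)))"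
        by (subst (asm) restrict_count_space_subset[symmetric, of S UNIV]) (auto simp: integrable_restrict_space)
      moreover have "(\<lambda>m. indicator S m *\<^sub>R (bump_kernel (x - lattice_vec m) * truncated_images m (frac_vec x)))
          = (\<lambda>m. bump_kernel (x - lattice_vec m) * truncated_images m (frac_vec x))"
        by (rule ext) (auto simp: truncated_images_def)
      ultimately show ?thesis by simp
    qed
    have "bump_synthesis D x = (\<integral>m. bump_kernel (x - lattice_vec m) * images f m (frac_vec x)
        - bump_kernel (x - lattice_vec m) * truncated_images m (frac_vec x) \<partial>lattice)"
      unfolding bump_synthesis_def D_def by (simp add: algebra_simps)
    also have "\<dots> = transferred f x - truncated x"
      unfolding transferred_def truncated_eq_synthesis bump_synthesis_def
      by (rule Bochner_Integration.integral_diff[OF elim fs])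
    finally show ?case ..
  qed
  then have "Lp_energy lborel 2 (\<lambda>x. transferred f x - truncated x) = Lp_energy lborel 2 (bump_synthesis D)"
    by (rule Lp_energy_cong_AE)
  also have "\<dots> \<le> ennreal (decay_mass TYPE('n) powr 2) * family_energy 2 D"
    by (rule bump_synthesis_lattice_energy[OF _ Dm fin]) simp
  finally show ?thesis unfolding DE .
qed

lemma fourier_truncated:
  "fourier truncated \<xi> = (\<Sum>n\<in>S. (\<Sum>m\<in>S. coeff m n * cnj (wave (lattice_vec m) (\<xi> - lattice_vec n))) * bump (\<xi> - lattice_vec n))"
proof -
  have i: "integrable lborel (\<lambda>x. coeff m n * ((bump_kernel (x - lattice_vec m) * wave x (lattice_vec n)) * cnj (wave x \<xi>)))" for m n
    by (intro integrable_mult_right integrable_mult_unimodular shifted_bump_kernel) simp_all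
  have t: "fourier (\<lambda>x. bump_kernel (x - lattice_vec m) * wave x (lattice_vec n)) \<xi>
      = cnj (wave (lattice_vec m) (\<xi> - lattice_vec n)) * bump (\<xi> - lattice_vec n)" for m n
    using fourier_translate[OF bump_kernel_measurable, of "- lattice_vec m" "\<xi> - lattice_vec n"]
    unfolding fourier_modulate by (simp add: fourier_bump_kernel wave_minus_left)
  have "fourier truncated \<xi> = (\<integral>x. (\<Sum>m\<in>S. \<Sum>n\<in>S. coeff m n * ((bump_kernel (x - lattice_vec m) * wave x (lattice_vec n)) * cnj (wave x \<xi>))) \<partial>lborel)"
    unfolding fourier_eq truncated_def by (simp add: sum_distrib_right mult.assoc)
  also have "\<dots> = (\<Sum>m\<in>S. \<Sum>n\<in>S. coeff m n * fourier (\<lambda>x. bump_kernel (x - lattice_vec m) * wave x (lattice_vec n)) \<xi>)"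
    unfolding fourier_eq using i
    by (subst Bochner_Integration.integral_sum)
       (auto intro!: Bochner_Integration.integrable_sum sum.cong simp: Bochner_Integration.integral_sum)
  also have "\<dots> = (\<Sum>n\<in>S. \<Sum>m\<in>S. coeff m n * (cnj (wave (lattice_vec m) (\<xi> - lattice_vec n)) * bump (\<xi> - lattice_vec n)))"
    unfolding t by (rule sum.swap)
  finally show ?thesis by (simp add: sum_distrib_right mult.assoc)
qed

definition truncated_block :: "int ^ 'n \<Rightarrow> real ^ 'n \<Rightarrow> complex" where
  "truncated_block n \<zeta> = (if n \<in> S then \<Sum>j\<in>uminus ` S. coeff (- j) n * wave \<zeta> (lattice_vec j) else 0)"

text \<open>
  The bump function vanishes off the unit cube, and so only the summand of the cube that
  contains the frequency survives.
\<close>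
lemma fourier_truncated_tile:
  assumes \<zeta>: "\<zeta> \<in> unit_cube"
  shows "fourier truncated (\<zeta> + lattice_vec k) = truncated_block k \<zeta> * bump \<zeta>"
proof -
  have "fourier truncated (\<zeta> + lattice_vec k)
      = (\<Sum>n\<in>S. if n = k then truncated_block k \<zeta> * bump \<zeta> else 0)"
    unfolding fourier_truncated
  proof (rule sum.cong[OF refl])
    fix n assume n: "n \<in> S"
    have e: "\<zeta> + lattice_vec k - lattice_vec n = \<zeta> + lattice_vec (k - n)" by simp
    show "(\<Sum>m\<in>S. coeff m n * cnj (wave (lattice_vec m) (\<zeta> + lattice_vec k - lattice_vec n))) * bump (\<zeta> + lattice_vec k - lattice_vec n)
        = (if n = k then truncated_block k \<zeta> * bump \<zeta> else 0)"
    proof (cases "n = k")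
      case True
      have "(\<Sum>j\<in>uminus ` S. coeff (- j) k * wave \<zeta> (lattice_vec j)) = (\<Sum>m\<in>S. coeff m k * cnj (wave (lattice_vec m) \<zeta>))"
        by (subst sum.reindex) (auto simp: inj_on_def wave_minus_left wave_commute[of \<zeta>])
      then show ?thesis using True n by (simp add: truncated_block_def)
    next
      case False
      have "\<zeta> + lattice_vec (k - n) \<notin> unit_cube"
      proof
        assume "\<zeta> + lattice_vec (k - n) \<in> unit_cube"
        then have "floor_vec (\<zeta> + lattice_vec (k - n) + lattice_vec 0) = 0" by (rule floor_vec_add_lattice)
        moreover have "floor_vec (\<zeta> + lattice_vec (k - n)) = k - n" by (rule floor_vec_add_lattice[OF \<zeta>])
        ultimately show False using False by simp
      qed
      then show ?thesis using False unfolding e by (simp add: bump_eq_0)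
    qed
  qed
  also have "\<dots> = truncated_block k \<zeta> * bump \<zeta>"
    using S by (simp add: truncated_block_def)
  finally show ?thesis .
qed

lemma truncated_block_L2: "truncated_block n \<in> Lp_space cube_measure 2"
  unfolding truncated_block_def[abs_def] by (cases "n \<in> S") (simp_all add: sum_waves_L2)

text \<open>
  By Parseval on the torus, in the frequency variable, for each \<open>n\<close>. The same coefficients
  remain as in \<open>synthesis_error\<close>.
\<close>
lemma frequency_error:
  "Lp_energy lborel 2 (\<lambda>\<xi>. fourier truncated \<xi> - symbol \<xi> * g \<xi>) \<le> tail S"
proof -
  have tm: "truncated \<in> borel_measurable borel" using truncated_integrable by auto
  note fourier_measurable[OF tm, measurable]
  define D where "D = (\<lambda>n \<zeta>. truncated_block n \<zeta> + (- \<phi> n) * cut_block n \<zeta>)"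
  have D2: "D n \<in> Lp_space cube_measure 2" for n
    unfolding D_def by (intro Lp_space_add Lp_space_cmult truncated_block_L2 cut_block_L2) simp
  have Dm: "D n \<in> borel_measurable cube_measure" for n
    using D2[of n] by (simp add: Lp_space_def)
  have Dc: "fourier_coeff (D n) (- m) = (if m \<in> S \<and> n \<in> S then 0 else - coeff m n)" for m n
  proof -
    have S': "finite (uminus ` S)" using S by simp
    have "fourier_coeff (truncated_block n) (- m) = (if m \<in> S \<and> n \<in> S then coeff m n else 0)"
    proof (cases "n \<in> S")
      case True
      then show ?thesis
        using fourier_coeff_sum_waves[OF S', of "\<lambda>j. coeff (- j) n" "- m"]
        by (auto simp: truncated_block_def[abs_def])
    next
      case False
      then show ?thesis by (simp add: truncated_block_def[abs_def] fourier_coeff_eq)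
    qed
    then show ?thesis
      unfolding D_def fourier_coeff_add_cmult[OF truncated_block_L2 cut_block_L2] by (simp add: coeff_def)
  qed
  have DE: "Lp_energy cube_measure 2 (D n) = (\<integral>\<^sup>+m. (if m \<in> S \<and> n \<in> S then 0 else ennreal ((norm (coeff m n))\<^sup>2)) \<partial>lattice)" for n
  proof -
    have "Lp_energy cube_measure 2 (D n) = (\<integral>\<^sup>+m. ennreal ((norm (fourier_coeff (D n) m))\<^sup>2) \<partial>lattice)"
      unfolding torus_parseval[OF D2, symmetric] L2_energy_eq_square[of lattice] ..
    also have "\<dots> = (\<integral>\<^sup>+m. ennreal ((norm (fourier_coeff (D n) (- m)))\<^sup>2) \<partial>lattice)"
      by (rule nn_integral_lattice_uminus[symmetric])
    also have "\<dots> = (\<integral>\<^sup>+m. (if m \<in> S \<and> n \<in> S then 0 else ennreal ((norm (coeff m n))\<^sup>2)) \<partial>lattice)"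
      unfolding Dc by (intro nn_integral_cong) simp
    finally show ?thesis .
  qed
  have "Lp_energy lborel 2 (\<lambda>\<xi>. fourier truncated \<xi> - symbol \<xi> * g \<xi>)
      = family_energy 2 (\<lambda>n \<zeta>. fourier truncated (\<zeta> + lattice_vec n) - symbol (\<zeta> + lattice_vec n) * g (\<zeta> + lattice_vec n))"
    by (rule family_energy_tiles[symmetric]) measurable
  also have "\<dots> \<le> family_energy 2 D"
    unfolding family_energy_def
  proof (rule nn_integral_mono_AE)
    show "AE \<zeta> in cube_measure. (\<integral>\<^sup>+n. ennreal (norm (fourier truncated (\<zeta> + lattice_vec n) - symbol (\<zeta> + lattice_vec n) * g (\<zeta> + lattice_vec n)) powr 2) \<partial>lattice)
        \<le> (\<integral>\<^sup>+n. ennreal (norm (D n \<zeta>) powr 2) \<partial>lattice)"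
      using AE_lborel_cube[OF Lam_bump] AE_in_unit_cube
    proof eventually_elim
      case (elim \<zeta>)
      show ?case
      proof (intro nn_integral_mono ennreal_leI powr_mono2)
        fix n
        have sy: "symbol (\<zeta> + lattice_vec n) * g (\<zeta> + lattice_vec n) = \<phi> n * (\<Lambda> \<zeta> * bump \<zeta>) * g (\<zeta> + lattice_vec n)"
          using elim by (simp add: symbol_def)
        have "fourier truncated (\<zeta> + lattice_vec n) - symbol (\<zeta> + lattice_vec n) * g (\<zeta> + lattice_vec n) = D n \<zeta> * bump \<zeta>"
          unfolding fourier_truncated_tile[OF elim(2)] sy by (simp add: D_def cut_block_def algebra_simps)
        then show "norm (fourier truncated (\<zeta> + lattice_vec n) - symbol (\<zeta> + lattice_vec n) * g (\<zeta> + lattice_vec n)) \<le> norm (D n \<zeta>)"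
          using norm_bump_le[of \<zeta>] by (simp add: norm_mult mult_right_le_one_le)
      qed simp_all
    qed
  qed
  also have "\<dots> = (\<integral>\<^sup>+n. (\<integral>\<^sup>+m. (if m \<in> S \<and> n \<in> S then 0 else ennreal ((norm (coeff m n))\<^sup>2)) \<partial>lattice) \<partial>lattice)"
    unfolding family_energy_eq_sum[of D, OF Dm] DE ..
  also have "\<dots> = tail S"
    unfolding tail_def by (rule lattice_lattice.Fubini', rule measurable_lattice_pair1) simp
  finally show ?thesis .
qed

end

text \<open>
  The truncated functions converge to the image of \<open>f\<close>, and their transforms to \<open>symbol\<close> times the
  transform of \<open>f\<close>: both errors are at most a constant times the same tail of a convergent double
  series.
\<close>
theorem transferred_fourier: "fourier_L2 euclidean_lca (transferred f) (\<lambda>\<xi>. symbol \<xi> * g \<xi>)"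
proof -
  let ?F = "\<lambda>j. truncated (lattice_ball j)"
  note fin = finite_lattice_ball
  have tm: "transferred f \<in> borel_measurable borel" by (rule transferred_measurable[OF fp])
  have t2: "transferred f \<in> Lp_space lborel 2"
  proof -
    have "Lp_energy lborel 2 (transferred f) \<le> ennreal (decay_mass TYPE('n) powr 2) * tail {}"
      using synthesis_error[of "{}"] by (simp add: truncated_empty)
    also have "\<dots> < \<infinity>"
      using coeff_square_sum by (simp add: tail_def ennreal_mult_less_top)
    finally show ?thesis using tm by (simp add: Lp_space_iff)
  qed
  have sg: "(\<lambda>\<xi>. symbol \<xi> * g \<xi>) \<in> Lp_space lborel 2"
  proof -
    have "Lp_energy lborel 2 (\<lambda>\<xi>. symbol \<xi> * g \<xi>) = Lp_energy lborel 2 (\<lambda>\<xi>. fourier (truncated {}) \<xi> - symbol \<xi> * g \<xi>)"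
      by (simp add: truncated_empty fourier_eq Lp_energy_def)
    also have "\<dots> \<le> tail {}" by (rule frequency_error) simp
    also have "\<dots> < \<infinity>" using coeff_square_sum by (simp add: tail_def)
    finally show ?thesis by (simp add: Lp_space_iff)
  qed
  have F1: "integrable lborel (?F j)" and F2: "?F j \<in> Lp_space lborel 2" for j
    by (rule truncated_integrable[OF fin], rule truncated_L2[OF fin])
  have F3: "fourier (?F j) \<in> Lp_space lborel 2" for j by (rule fourier_in_L2[OF F1 F2])
  have d1: "(\<lambda>x. ?F j x - transferred f x) \<in> Lp_space lborel 2" for j
    by (rule Lp_space_diff[OF F2 t2]) simp
  have d2: "(\<lambda>\<xi>. fourier (?F j) \<xi> - symbol \<xi> * g \<xi>) \<in> Lp_space lborel 2" for j
    by (rule Lp_space_diff[OF F3 sg]) simp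
  have "(\<lambda>j. ennreal (decay_mass TYPE('n) powr 2) * tail (lattice_ball j)) \<longlonglongrightarrow> ennreal (decay_mass TYPE('n) powr 2) * 0"
    by (rule ennreal_tendsto_cmult[OF _ tail_tendsto_0]) simp
  then have l: "(\<lambda>j. ennreal (decay_mass TYPE('n) powr 2) * tail (lattice_ball j)) \<longlonglongrightarrow> 0" by simp
  have l1: "(\<lambda>j. Lp_energy lborel 2 (\<lambda>x. ?F j x - transferred f x)) \<longlonglongrightarrow> 0"
    unfolding Lp_energy_diff_commute[of lborel 2 "?F _"]
    by (rule ennreal_tendsto_0_mono[OF l]) (rule synthesis_error[OF fin])
  have l2: "(\<lambda>j. Lp_energy lborel 2 (\<lambda>\<xi>. fourier (?F j) \<xi> - symbol \<xi> * g \<xi>)) \<longlonglongrightarrow> 0"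
    by (rule ennreal_tendsto_0_mono[OF tail_tendsto_0]) (rule frequency_error[OF fin])
  show ?thesis
    unfolding fourier_L2_def euclidean_simps
  proof (intro conjI exI[of _ ?F] allI)
    show "(\<lambda>k. Lp_norm lborel 2 (\<lambda>x. ?F k x - transferred f x)) \<longlonglongrightarrow> 0"
      using l1 Lp_norm_tendsto_0_iff[OF d1] by simp
    show "(\<lambda>k. Lp_norm lborel 2 (\<lambda>\<xi>. fourier (?F k) \<xi> - symbol \<xi> * g \<xi>)) \<longlonglongrightarrow> 0"
      using l2 Lp_norm_tendsto_0_iff[OF d2] by simp
  qed (use F1 F2 F3 t2 sg in \<open>auto simp: Lp_space_1_iff\<close>)
qed

end

text \<open>
  Outside the context the head of this rule is a variable, so that it would match every
  measurability goal.
\<close>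
declare fg_measurable [measurable del]

end

section \<open>The transferred operator as a multiplier of weak type\<close>

text \<open>
  Over the complex numbers unconditional and absolute summability agree, and both notions
  of sum are 0 where they fail.
\<close>
lemma infsum_eq_integral_lattice:
  fixes f :: "int^'n \<Rightarrow> complex"
  shows "infsum f UNIV = (\<integral>n. f n \<partial>lattice)"
proof (cases "f summable_on UNIV")
  case True
  then have "(\<lambda>n. norm (f n)) summable_on UNIV"
    by (simp add: summable_on_iff_abs_summable_on_complex)
  then have "Infinite_Set_Sum.abs_summable_on f UNIV"
    by (simp add: abs_summable_equivalent)
  from infsetsum_infsum[OF this] show ?thesis by (simp add: infsetsum_def)
next
  case False
  then have "\<not> Infinite_Set_Sum.abs_summable_on f UNIV"
    by (simp add: abs_summable_equivalent summable_on_iff_abs_summable_on_complex)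
  then have "\<not> integrable lattice f" by (simp add: Infinite_Set_Sum.abs_summable_on_def)
  then show ?thesis using False by (simp add: infsum_not_exists not_integrable_integral_eq)
qed

context jodeit_transfer
begin

lemma W_ext_eq: "W_ext \<phi> \<Lambda> \<xi> = (\<integral>n. \<phi> n * \<Lambda> (\<xi> - lattice_vec n) \<partial>lattice)"
  unfolding W_ext_def lattice_vec_def[symmetric] by (rule infsum_eq_integral_lattice)

lemma W_ext_measurable [measurable]: "W_ext \<phi> \<Lambda> \<in> borel_measurable borel"
  unfolding W_ext_eq[abs_def] by (rule family_integral_measurable) measurable

lemma W_ext_AE: "AE \<xi> in lborel. symbol \<xi> = W_ext \<phi> \<Lambda> \<xi>"
proof -
  have "AE \<xi> in lborel. \<xi> + - lattice_vec n \<notin> unit_cube \<longrightarrow> \<Lambda> (\<xi> + - lattice_vec n) = 0" for n :: "int^'n"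
    by (rule AE_vec_translate[OF Lam_outside])
  then have "AE \<xi> in lborel. \<forall>n. \<xi> + - lattice_vec n \<notin> unit_cube \<longrightarrow> \<Lambda> (\<xi> + - lattice_vec n) = 0"
    by (simp add: AE_all_countable)
  then show ?thesis
  proof eventually_elim
    case (elim \<xi>)
    let ?k = "floor_vec \<xi>"
    have fr: "\<xi> - lattice_vec ?k = frac_vec \<xi>" using frac_plus_floor_vec[of \<xi>] by (simp add: algebra_simps)
    have "\<phi> n * \<Lambda> (\<xi> - lattice_vec n) = indicator {?k} n *\<^sub>R (\<phi> n * \<Lambda> (\<xi> - lattice_vec n))" for n
    proof (cases "n = ?k")
      case False
      have "\<xi> - lattice_vec n \<notin> unit_cube"
      proof
        assume "\<xi> - lattice_vec n \<in> unit_cube"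
        then have "floor_vec (\<xi> - lattice_vec n + lattice_vec n) = n" by (rule floor_vec_add_lattice)
        then show False using False by simp
      qed
      then show ?thesis using False elim by simp
    qed simp
    then have "W_ext \<phi> \<Lambda> \<xi> = (\<integral>n. indicator {?k} n *\<^sub>R (\<phi> n * \<Lambda> (\<xi> - lattice_vec n)) \<partial>lattice)"
      unfolding W_ext_eq by (rule Bochner_Integration.integral_cong[OF refl])
    also have "\<dots> = \<phi> ?k * \<Lambda> (\<xi> - lattice_vec ?k)"
      by (subst integral_lattice_indicator) simp_all
    finally show ?case by (simp add: symbol_def fr)
  qed
qed

lemma W_ext_Linf: "W_ext \<phi> \<Lambda> \<in> Linf_space lborel"
proof -
  have "AE \<xi> in lborel. norm (W_ext \<phi> \<Lambda> \<xi>) \<le> N * M"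
    using symbol_bound W_ext_AE by eventually_elim simp
  then show ?thesis by (auto simp: Linf_space_def)
qed

lemma transferred_symbol: "has_symbol euclidean_lca p (W_ext \<phi> \<Lambda>) transferred"
  unfolding has_symbol_def euclidean_simps
proof
  fix f :: "real^'n \<Rightarrow> complex" assume "f \<in> Lp_space lborel 2 \<inter> Lp_space lborel p"
  then have f: "f \<in> Lp_space lborel 2" "f \<in> Lp_space lborel p" by auto
  from symbolE[OF f] obtain g where g: "fourier_L2 euclidean_lca f g" .
  have gm [measurable]: "g \<in> borel_measurable borel"
    using Lp_space_measurable[OF fourier_L2_spaces_euclidean(2)[OF g]] by simp
  have "fourier_L2 euclidean_lca (transferred f) (\<lambda>\<xi>. W_ext \<phi> \<Lambda> \<xi> * g \<xi>)"
  proof (rule fourier_L2_cong_AE_euclidean[OF transferred_fourier[OF f g]])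
    show "AE \<xi> in lborel. symbol \<xi> * g \<xi> = W_ext \<phi> \<Lambda> \<xi> * g \<xi>"
      using W_ext_AE by eventually_elim simp
  qed measurable
  with g show "\<exists>g. fourier_L2 euclidean_lca f g \<and> fourier_L2 euclidean_lca (transferred f) (\<lambda>\<xi>. W_ext \<phi> \<Lambda> \<xi> * g \<xi>)"
    by blast
qed

text \<open>
  Both sides have the same Fourier transform.
\<close>
lemma transferred_translate_L2:
  assumes f: "f \<in> Lp_space lborel 2" "f \<in> Lp_space lborel p"
  shows "AE x in lborel. transferred (\<lambda>y. f (y + h)) x = transferred f (x + h)"
proof -
  from symbolE[OF f] obtain g where g: "fourier_L2 euclidean_lca f g" .
  have 1: "fourier_L2 euclidean_lca (transferred (\<lambda>y. f (y + h))) (\<lambda>\<xi>. symbol \<xi> * (wave h \<xi> * g \<xi>))"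
    by (rule transferred_fourier[OF Lp_space_translate[OF f(1)] Lp_space_translate[OF f(2)] fourier_L2_translate[OF g]])
  have 2: "fourier_L2 euclidean_lca (\<lambda>x. transferred f (x + h)) (\<lambda>\<xi>. wave h \<xi> * (symbol \<xi> * g \<xi>))"
    by (rule fourier_L2_translate[OF transferred_fourier[OF f g]])
  show ?thesis
    by (rule fourier_L2_injective_euclidean[OF 1 2]) (simp add: mult_ac)
qed

text \<open>
  Cut \<open>f\<close> off where it is large and far from the origin.
\<close>
lemma truncation_approx:
  fixes f :: "real ^ 'n \<Rightarrow> complex"
  assumes f: "f \<in> Lp_space lborel p"
  obtains F where "\<And>j. F j \<in> Lp_space lborel 2" "\<And>j. F j \<in> Lp_space lborel p"
    "(\<lambda>j. Lp_energy lborel p (\<lambda>x. f x - F j x)) \<longlonglongrightarrow> 0"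
proof
  have [measurable]: "f \<in> borel_measurable borel" using Lp_space_measurable[OF f] by simp
  define F where "F = (\<lambda>(j::nat) x. if norm (f x) \<le> real j \<and> norm x \<le> real j then f x else 0)"
  have Fm [measurable]: "F j \<in> borel_measurable borel" for j unfolding F_def by measurable
  show "F j \<in> Lp_space lborel p" for j
  proof -
    have "Lp_energy lborel p (F j) \<le> Lp_energy lborel p f"
      by (rule Lp_energy_mono) (use p1 in \<open>auto simp: F_def\<close>)
    also have "\<dots> < \<infinity>" using f by (simp add: Lp_space_iff)
    finally show ?thesis by (simp add: Lp_space_iff)
  qed
  show "F j \<in> Lp_space lborel 2" for j
  proof -
    have "Lp_energy lborel 2 (F j) \<le> (\<integral>\<^sup>+x. ennreal ((real j)\<^sup>2) * indicator (cball 0 (real j)) x \<partial>(lborel :: (real^'n) measure))"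
      unfolding L2_energy_eq_square
      by (intro nn_integral_mono) (auto simp: F_def dist_norm split: split_indicator intro!: ennreal_leI power_mono)
    also have "\<dots> = ennreal ((real j)\<^sup>2) * emeasure lborel (cball (0::real^'n) (real j))"
      by (rule nn_integral_cmult_indicator) simp
    also have "\<dots> < \<infinity>"
      using emeasure_bounded_finite[OF bounded_cball, of "0 :: real^'n" "real j"] by (simp add: ennreal_mult_less_top)
    finally show ?thesis by (simp add: Lp_space_iff)
  qed
  have "(\<lambda>j. Lp_energy lborel p (\<lambda>x. f x - F j x)) \<longlonglongrightarrow> (\<integral>\<^sup>+x. 0 \<partial>(lborel :: (real^'n) measure))"
    unfolding Lp_energy_def
  proof (rule nn_integral_dominated_convergence[where w="\<lambda>x. ennreal (norm (f x) powr p)"])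
    show "AE x in lborel. (\<lambda>j. ennreal (norm (f x - F j x) powr p)) \<longlonglongrightarrow> 0"
    proof (intro always_eventually allI)
      fix x
      have "\<forall>\<^sub>F j in sequentially. max (norm (f x)) (norm x) \<le> real j"
        using eventually_ge_at_top[of "nat \<lceil>max (norm (f x)) (norm x)\<rceil>"] by eventually_elim linarith
      then have "\<forall>\<^sub>F j in sequentially. ennreal (norm (f x - F j x) powr p) = 0"
        by eventually_elim (simp add: F_def)
      then show "(\<lambda>j. ennreal (norm (f x - F j x) powr p)) \<longlonglongrightarrow> 0" by (rule tendsto_eventually)
    qed
    show "(\<integral>\<^sup>+x. ennreal (norm (f x) powr p) \<partial>lborel) < \<infinity>"
      using f by (simp add: Lp_space_iff Lp_energy_def)
  qed (auto simp: F_def)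
  then show "(\<lambda>j. Lp_energy lborel p (\<lambda>x. f x - F j x)) \<longlonglongrightarrow> 0" by simp
qed

lemma transferred_weak_energy:
  assumes f: "f \<in> Lp_space lborel p" and t: "0 < t"
  shows "emeasure lborel {x. t < norm (transferred f x)} \<le> ennreal (transfer_const powr p / t powr p) * Lp_energy lborel p f"
proof -
  have "Lp_energy lborel p f = ennreal (Lp_norm lborel p f powr p)"
    using p1 by (intro Lp_energy_eq_norm[OF f]) simp
  then have "ennreal (transfer_const powr p / t powr p) * Lp_energy lborel p f
      = ennreal (transfer_const powr p / t powr p * Lp_norm lborel p f powr p)"
    by (simp only:) (rule ennreal_mult[symmetric], auto)
  with transferred_weak_type[OF f t] show ?thesis by simp
qed

text \<open>
  Approximate \<open>f\<close> by functions in $L^2 \cap L^p$, for which the claim follows from the symbol. The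
  weak type estimate shows that the defect of a function exceeds any given level on a null set.
\<close>
lemma transferred_translation_invariant: "translation_invariant euclidean_lca p transferred"
  unfolding translation_invariant_def euclidean_simps
proof (intro ballI)
  fix h :: "real^'n" and f :: "real^'n \<Rightarrow> complex"
  assume f: "f \<in> Lp_space lborel p"
  have p0: "0 \<le> p" using p1 by simp
  from truncation_approx[OF f] obtain F where F: "\<And>j. F j \<in> Lp_space lborel 2" "\<And>j. F j \<in> Lp_space lborel p"
    "(\<lambda>j. Lp_energy lborel p (\<lambda>x. f x - F j x)) \<longlonglongrightarrow> 0" by blast
  define d where "d = (\<lambda>j x. f x - F j x)"
  have d: "d j \<in> Lp_space lborel p" for j unfolding d_def by (rule Lp_space_diff[OF f F(2) p0])
  define u where "u = (\<lambda>x. transferred (\<lambda>y. f (y + h)) x - transferred f (x + h))"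
  have tf: "(\<lambda>y. f (y + h)) \<in> Lp_space lborel p" by (rule Lp_space_translate[OF f])
  have td: "(\<lambda>y. d j (y + h)) \<in> Lp_space lborel p" for j by (rule Lp_space_translate[OF d])
  note tm = transferred_measurable
  have [measurable]: "transferred f \<in> borel_measurable borel" "transferred (\<lambda>y. f (y + h)) \<in> borel_measurable borel"
    "transferred (d j) \<in> borel_measurable borel" "transferred (\<lambda>y. d j (y + h)) \<in> borel_measurable borel" for j
    by (rule tm[OF f], rule tm[OF tf], rule tm[OF d], rule tm[OF td])
  have [measurable]: "u \<in> borel_measurable borel" unfolding u_def by measurable
  have ud: "AE x in lborel. u x = transferred (\<lambda>y. d j (y + h)) x - transferred (d j) (x + h)" for j
  proof -
    have "AE x in lborel. transferred (\<lambda>x. F j x + 1 * d j x) x = transferred (F j) x + 1 * transferred (d j) x"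
      by (rule transferred_add_cmult[OF F(2) d])
    then have "AE x in lborel. transferred f x = transferred (F j) x + transferred (d j) x"
      by (simp add: d_def)
    then have 1: "AE x in lborel. transferred f (x + h) = transferred (F j) (x + h) + transferred (d j) (x + h)"
      by (rule AE_vec_translate)
    have "AE x in lborel. transferred (\<lambda>x. F j (x + h) + 1 * d j (x + h)) x = transferred (\<lambda>y. F j (y + h)) x + 1 * transferred (\<lambda>y. d j (y + h)) x"
      by (rule transferred_add_cmult[OF Lp_space_translate[OF F(2)] td])
    then have 2: "AE x in lborel. transferred (\<lambda>y. f (y + h)) x = transferred (\<lambda>y. F j (y + h)) x + transferred (\<lambda>y. d j (y + h)) x"
      by (simp add: d_def)
    from 1 2 transferred_translate_L2[OF F(1,2)[of j], of h] show ?thesis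
      by eventually_elim (simp add: u_def)
  qed
  have null: "emeasure lborel {x. 2 * t < norm (u x)} = 0" if t: "0 < t" for t
  proof -
    let ?c = "ennreal (transfer_const powr p / t powr p)"
    have "emeasure lborel {x. 2 * t < norm (u x)} \<le> ?c * Lp_energy lborel p (d j) + ?c * Lp_energy lborel p (d j)" for j
    proof -
      let ?A = "{x. t < norm (transferred (\<lambda>y. d j (y + h)) x)}" and ?B = "{x. t < norm (transferred (d j) (x + h))}"
      have "emeasure lborel {x. 2 * t < norm (u x)} \<le> emeasure lborel (?A \<union> ?B)"
      proof (rule emeasure_mono_AE)
        show "AE x in lborel. x \<in> {x. 2 * t < norm (u x)} \<longrightarrow> x \<in> ?A \<union> ?B"
          using ud[of j]
        proof eventually_elim
          case (elim x)
          have "norm (u x) \<le> norm (transferred (\<lambda>y. d j (y + h)) x) + norm (transferred (d j) (x + h))"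
            unfolding elim by (rule norm_triangle_ineq4)
          then show ?case by auto
        qed
      qed measurable
      also have "\<dots> \<le> emeasure lborel ?A + emeasure lborel ?B"
        by (rule emeasure_subadditive) measurable
      also have "\<dots> \<le> ?c * Lp_energy lborel p (d j) + ?c * Lp_energy lborel p (d j)"
      proof (rule add_mono)
        have "Lp_energy lborel p (\<lambda>y. d j (y + h)) = Lp_energy lborel p (d j)"
          by (rule Lp_energy_translate) (use Lp_space_measurable[OF d[of j]] in simp)
        then show "emeasure lborel ?A \<le> ?c * Lp_energy lborel p (d j)"
          using transferred_weak_energy[OF td[of j] t] by simp
        have "?B \<in> sets lborel" by measurable
        then have "emeasure lborel ?B = (\<integral>\<^sup>+x. indicator ?B x \<partial>lborel)" by simp
        also have "\<dots> = (\<integral>\<^sup>+x. indicator {x. t < norm (transferred (d j) x)} (x + h) \<partial>lborel)"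
          by (simp add: indicator_def)
        also have "\<dots> = emeasure lborel {x. t < norm (transferred (d j) x)}"
          by (subst nn_integral_vec_translate) auto
        also have "\<dots> \<le> ?c * Lp_energy lborel p (d j)" by (rule transferred_weak_energy[OF d t])
        finally show "emeasure lborel ?B \<le> ?c * Lp_energy lborel p (d j)" .
      qed
      finally show ?thesis .
    qed
    moreover have "(\<lambda>j. ?c * Lp_energy lborel p (d j) + ?c * Lp_energy lborel p (d j)) \<longlonglongrightarrow> ?c * 0 + ?c * 0"
      unfolding d_def by (intro tendsto_add ennreal_tendsto_cmult F(3)) auto
    ultimately have "emeasure lborel {x. 2 * t < norm (u x)} \<le> ?c * 0 + ?c * 0"
      by (intro LIMSEQ_le_const[where x="?c * 0 + ?c * 0"]) auto
    then show ?thesis by simp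
  qed
  have "AE x in lborel. \<not> 2 * (1 / real (Suc k)) < norm (u x)" for k
    by (rule AE_I'[where N="{x. 2 * (1 / real (Suc k)) < norm (u x)}"])
       (use null[of "1 / real (Suc k)"] in \<open>auto simp: null_sets_def\<close>)
  then have "AE x in lborel. \<forall>k. \<not> 2 * (1 / real (Suc k)) < norm (u x)"
    by (simp add: AE_all_countable)
  then show "AE x in lborel. transferred (\<lambda>y. f (y + h)) x = transferred f (x + h)"
  proof eventually_elim
    case (elim x)
    have "u x = 0"
    proof (rule ccontr)
      assume "u x \<noteq> 0"
      then obtain k where "1 / real (Suc k) < norm (u x) / 2"
        using nat_approx_posE[of "norm (u x) / 2"] by auto
      then have "2 * (1 / real (Suc k)) < norm (u x)" by linarith
      then show False using elim by blast
    qed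
    then show ?case by (simp add: u_def)
  qed
qed

theorem transferred_weak_multiplier_op:
  "weak_multiplier_op euclidean_lca p (W_ext \<phi> \<Lambda>) transferred transfer_const"
  unfolding weak_multiplier_op_def
  using transferred_linear transferred_translation_invariant transferred_symbol transfer_const_nonneg transferred_weak_type
  by simp

end

section \<open>Transference of weak type multipliers\<close>

text \<open>
  The infimum in the definition of the operator norm is attained.
\<close>
lemma Lp_opnorm_properties:
  assumes ex: "\<exists>K. \<forall>f\<in>Lp_space M p. Lp_norm M p (T f) \<le> K * Lp_norm M p f"
  shows "0 \<le> Lp_opnorm M p T"
    and "f \<in> Lp_space M p \<Longrightarrow> Lp_norm M p (T f) \<le> Lp_opnorm M p T * Lp_norm M p f"
proof -
  define A where "A = {K. K \<ge> 0 \<and> (\<forall>f\<in>Lp_space M p. Lp_norm M p (T f) \<le> K * Lp_norm M p f)}"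
  have op: "Lp_opnorm M p T = Inf A" by (simp add: Lp_opnorm_def A_def)
  from ex obtain K where K: "\<forall>f\<in>Lp_space M p. Lp_norm M p (T f) \<le> K * Lp_norm M p f" by blast
  have "max K 0 \<in> A"
  proof -
    have "Lp_norm M p (T f) \<le> max K 0 * Lp_norm M p f" if "f \<in> Lp_space M p" for f
      by (rule order_trans[OF K[rule_format, OF that]]) (rule mult_right_mono, auto)
    then show ?thesis by (simp add: A_def)
  qed
  then have ne: "A \<noteq> {}" by blast
  show "0 \<le> Lp_opnorm M p T" unfolding op by (rule cInf_greatest[OF ne]) (simp add: A_def)
  assume f: "f \<in> Lp_space M p"
  show "Lp_norm M p (T f) \<le> Lp_opnorm M p T * Lp_norm M p f"
  proof (cases "Lp_norm M p f = 0")
    case True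
    then show ?thesis using K f by fastforce
  next
    case False
    then have pos: "0 < Lp_norm M p f" using Lp_norm_nonneg[of M p f] by linarith
    have "Lp_norm M p (T f) / Lp_norm M p f \<le> Inf A"
      by (rule cInf_greatest[OF ne]) (use f pos in \<open>auto simp: A_def divide_le_eq\<close>)
    then show ?thesis unfolding op using pos by (simp add: divide_le_eq)
  qed
qed

theorem theorem2p2:
  fixes p :: real
  assumes "1 < p"
  shows "\<exists>C::real. \<forall>(\<Lambda> :: real ^ 'n \<Rightarrow> complex) (\<phi> :: int ^ 'n \<Rightarrow> complex).
    \<Lambda> \<in> multipliers euclidean_lca p \<longrightarrow>
    (AE \<xi> in lborel. \<not> (\<forall>i. 1/4 \<le> \<xi> $ i \<and> \<xi> $ i \<le> 3/4) \<longrightarrow> \<Lambda> \<xi> = 0) \<longrightarrow>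
    \<phi> \<in> weak_multipliers torus_lca p \<longrightarrow>
      W_ext \<phi> \<Lambda> \<in> weak_multipliers euclidean_lca p \<and>
      weak_multiplier_norm euclidean_lca p (W_ext \<phi> \<Lambda>)
        \<le> C * weak_multiplier_norm torus_lca p \<phi> * multiplier_norm euclidean_lca p \<Lambda>"
proof -
  define D where "D = decay_mass TYPE('n)"
  define C where "C = dyadic_const p powr (1 / p) * (2 * D) * D ^ 3"
  have C0: "0 \<le> C"
    unfolding C_def D_def using decay_mass_pos[where 'n='n] by (auto intro!: mult_nonneg_nonneg)
  show ?thesis
  proof (intro exI[of _ C] allI impI)
    fix \<Lambda> :: "real ^ 'n \<Rightarrow> complex" and \<phi> :: "int ^ 'n \<Rightarrow> complex"
    assume Lam: "\<Lambda> \<in> multipliers euclidean_lca p"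
      and supp: "AE \<xi> in lborel. \<not> (\<forall>i. 1/4 \<le> \<xi> $ i \<and> \<xi> $ i \<le> 3/4) \<longrightarrow> \<Lambda> \<xi> = 0"
      and phi: "\<phi> \<in> weak_multipliers torus_lca p"
    define T where "T = (SOME T. multiplier_op euclidean_lca p \<Lambda> T)"
    define B where "B = multiplier_norm euclidean_lca p \<Lambda>"
    have T: "multiplier_op euclidean_lca p \<Lambda> T"
    proof -
      have "\<exists>T. multiplier_op euclidean_lca p \<Lambda> T" using Lam by (simp add: multipliers_def)
      then show ?thesis unfolding T_def by (rule someI_ex)
    qed
    have BT: "B = Lp_opnorm lborel p T" by (simp add: B_def multiplier_norm_def T_def)
    have Tb: "\<exists>K. \<forall>f\<in>Lp_space lborel p. Lp_norm lborel p (T f) \<le> K * Lp_norm lborel p f"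
      using T by (simp add: multiplier_op_def)
    obtain M0 where M0: "AE \<xi> in lborel. norm (\<Lambda> \<xi>) \<le> M0"
      using Lam by (auto simp: multipliers_def Linf_space_def)
    obtain N where N: "\<And>n. norm (\<phi> n) \<le> N"
      using phi by (auto simp: weak_multipliers_def Linf_space_def AE_count_space)
    have jm: "jodeit_multiplier p \<Lambda> T B (max M0 0)"
    proof
      show "AE \<xi> in lborel. norm (\<Lambda> \<xi>) \<le> max M0 0" using M0 by eventually_elim simp
      have "\<Lambda> \<in> Linf_space lborel" using Lam by (simp add: multipliers_def)
      then have "\<Lambda> \<in> borel_measurable lborel" unfolding Linf_space_def by blast
      then show "\<Lambda> \<in> borel_measurable borel" by simp
      show "T f \<in> Lp_space lborel p" if "f \<in> Lp_space lborel p" for f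
        using T that by (simp add: multiplier_op_def linear_on_Lp_def)
      show "has_symbol euclidean_lca p \<Lambda> T" using T by (simp add: multiplier_op_def)
      show "0 \<le> B" unfolding BT by (rule Lp_opnorm_properties[OF Tb])
      show "Lp_norm lborel p (T f) \<le> B * Lp_norm lborel p f" if "f \<in> Lp_space lborel p" for f
        unfolding BT by (rule Lp_opnorm_properties(2)[OF Tb that])
    qed (use assms supp in auto)
    \<comment> \<open>for every admissible pair, since the infimum defining the weak norm need not be attained\<close>
    have op: "\<exists>S. weak_multiplier_op euclidean_lca p (W_ext \<phi> \<Lambda>) S (C * K * B)"
      and Linf: "W_ext \<phi> \<Lambda> \<in> Linf_space lborel"
      if "weak_multiplier_op torus_lca p \<phi> U K" for U K
    proof -
      interpret jodeit_transfer p \<Lambda> T B "max M0 0" \<phi> U K N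
        by (intro jodeit_transfer.intro jm jodeit_transfer_axioms.intro that N)
      have "transfer_const = C * K * B"
        by (simp add: transfer_const_def slice_const_def C_def D_def)
      with transferred_weak_multiplier_op
      show "\<exists>S. weak_multiplier_op euclidean_lca p (W_ext \<phi> \<Lambda>) S (C * K * B)" by auto
      show "W_ext \<phi> \<Lambda> \<in> Linf_space lborel" by (rule W_ext_Linf)
    qed
    define A where "A = {K. \<exists>U. weak_multiplier_op torus_lca p \<phi> U K}"
    have ne: "A \<noteq> {}" using phi by (auto simp: A_def weak_multipliers_def)
    define E where "E = {K. \<exists>S. weak_multiplier_op euclidean_lca p (W_ext \<phi> \<Lambda>) S K}"
    have bdd: "bdd_below E"
      by (rule bdd_belowI[of _ 0]) (auto simp: E_def weak_multiplier_op_def)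
    have le: "Inf E \<le> C * B * K" if "K \<in> A" for K
    proof -
      have "C * K * B \<in> E" using op that by (auto simp: A_def E_def)
      then have "Inf E \<le> C * K * B" by (rule cInf_lower[OF _ bdd])
      then show ?thesis by (simp add: mult_ac)
    qed
    have "Inf E \<le> C * B * Inf A"
    proof (cases "C * B = 0")
      case True
      then show ?thesis using ne le by fastforce
    next
      case False
      have "0 \<le> B" unfolding BT by (rule Lp_opnorm_properties[OF Tb])
      then have pos: "0 < C * B" using False C0 by (simp add: less_le)
      have "Inf E / (C * B) \<le> Inf A"
        by (rule cInf_greatest[OF ne]) (use le pos in \<open>auto simp: divide_le_eq mult.commute\<close>)
      then show ?thesis using pos by (simp add: divide_le_eq mult.commute)
    qed
    moreover have "W_ext \<phi> \<Lambda> \<in> weak_multipliers euclidean_lca p"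
    proof -
      obtain U K where U: "weak_multiplier_op torus_lca p \<phi> U K" using phi by (auto simp: weak_multipliers_def)
      from op[OF U] Linf[OF U] show ?thesis by (auto simp: weak_multipliers_def)
    qed
    ultimately show "W_ext \<phi> \<Lambda> \<in> weak_multipliers euclidean_lca p \<and>
      weak_multiplier_norm euclidean_lca p (W_ext \<phi> \<Lambda>)
        \<le> C * weak_multiplier_norm torus_lca p \<phi> * multiplier_norm euclidean_lca p \<Lambda>"
      by (simp add: weak_multiplier_norm_def A_def E_def B_def mult_ac)
  qed
qed

end
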